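(* Let $\phi$ be a finite Blaschke product of order $4$. Then $\phi$ satisfies the hypothesis of one of the following cases, and in each case whose hypothesis is satisfied the stated conclusion holds. (i) If $\phi$ is equivalent to $z^4$, i.e. there are $\lambda\in\mathbb{D}$ and $|a|=1$ such that $\phi=a\,\varphi_\lambda(z^4)$, then $M_\phi$ has exactly four nontrivial minimal reducing subspaces on $D$. (ii) If $\phi=\psi_1\circ\psi_2$ is decomposable (with $\psi_1,\psi_2$ Blaschke products of orders greater than $1$) and $\psi_2$ is equivalent to $z^2$, and furthermore $\phi$ is not equivalent to $z^4$, then $M_\phi$ has exactly two nontrivial minimal reducing subspaces on $D$. (iii) If $\phi=\psi_1\circ\psi_2$ is decomposable (with $\psi_1,\psi_2$ as in the definition of decomposability) and $\phi$ is equivalent to $(z\varphi_\gamma)^2$ for some $\gamma\in\mathbb{D}\setminus\{0\}$, then $M_\phi$ has exactly two nontrivial minimal reducing subspaces on $D$. (iv) If $\phi=\psi_1\circ\psi_2$ is decomposable (with $\psi_1,\psi_2$ Blaschke products of orders greater than $1$), and furthermore $\psi_2$ is not equivalent to $z^2$ and $\phi$ is not equivalent to $(z\varphi_\gamma)^2$ for any $\gamma\in\mathbb{D}\setminus\{0\}$, then $M_\phi$ is irreducible on $D$. (v) If $\phi$ is not decomposable, then $M_\phi$ is irreducible on $D$.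
   Context: $\mathbb{D}=\{z\in\mathbb{C}:|z|<1\}$ and $dA$ is normalized Lebesgue area measure on $\mathbb{D}$. The Dirichlet space $D$ is the Hilbert space of holomorphic $f$ on $\mathbb{D}$ with $\int_{\mathbb{D}}|f'|^2dA<\infty$, with norm $\|f\|_D^2=\|f\|_{H^2}^2+\int_{\mathbb{D}}|f'|^2dA=\sum_{n\ge 0}(n+1)|\hat f(n)|^2$, where $\hat f(n)$ is the $n$-th Taylor coefficient and $H^2$ is the Hardy space. For $\lambda\in\mathbb{D}$, $\varphi_\lambda(z)=\frac{\lambda-z}{1-\overline{\lambda}z}$. A finite Blaschke product of order $n\ge1$ is a function $c\,\varphi_{\lambda_1}\cdots\varphi_{\lambda_n}$ with $\lambda_1,\dots,\lambda_n\in\mathbb{D}$ (not necessarily distinct) and $|c|=1$. $M_\phi f=\phi f$ is then a bounded operator on $D$. A closed subspace $\mathcal{M}$ of a Hilbert space is a reducing subspace of an operator $T$ if it is invariant under both $T$ and $T^*$; it is nontrivial if it is neither $\{0\}$ nor the whole space. A nontrivial reducing subspace $\mathcal{M}$ is minimal if the only reducing subspaces of $T$ contained in $\mathcal{M}$ are $\mathcal{M}$ and $\{0\}$. $T$ is reducible if it has a nontrivial reducing subspace, and irreducible otherwise. Two Blaschke products $\phi_1,\phi_2$ are equivalent if $\phi_2=a\,\varphi_\lambda\circ\phi_1$ for some $\lambda\in\mathbb{D}$, $|a|=1$. A finite Blaschke product $\phi$ is decomposable if there exist two Blaschke products $\psi_1,\psi_2$ with orders greater than $1$ such that $\phi(z)=\psi_1(\psi_2(z))$.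 *)

theory Defs
  imports "HOL-Complex_Analysis.Complex_Analysis"
begin

section \<open>Finite Blaschke products\<close>

definition disc_aut :: "complex \<Rightarrow> complex \<Rightarrow> complex" where
  "disc_aut l z = (l - z) / (1 - cnj l * z)"

text \<open>Blaschke products are functions on the open unit disc: for a function on the whole plane
  only the values on \<open>ball 0 1\<close> are constrained, here and in all the notions below.\<close>

definition finite_blaschke :: "nat \<Rightarrow> (complex \<Rightarrow> complex) \<Rightarrow> bool" where
  "finite_blaschke n \<phi> \<longleftrightarrow> n \<ge> 1 \<and>
     (\<exists>c ls. cmod c = 1 \<and> length ls = n \<and> set ls \<subseteq> ball 0 1 \<and>
        (\<forall>z\<in>ball 0 1. \<phi> z = c * (\<Prod>l\<leftarrow>ls. disc_aut l z)))"

definition blaschke_equiv :: "(complex \<Rightarrow> complex) \<Rightarrow> (complex \<Rightarrow> complex) \<Rightarrow> bool" where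
  "blaschke_equiv \<phi>\<^sub>1 \<phi>\<^sub>2 \<longleftrightarrow>
     (\<exists>l a. l \<in> ball 0 1 \<and> cmod a = 1 \<and> (\<forall>z\<in>ball 0 1. \<phi>\<^sub>2 z = a * disc_aut l (\<phi>\<^sub>1 z)))"

definition blaschke_decomposition ::
    "(complex \<Rightarrow> complex) \<Rightarrow> (complex \<Rightarrow> complex) \<Rightarrow> (complex \<Rightarrow> complex) \<Rightarrow> bool" where
  "blaschke_decomposition \<phi> \<psi>\<^sub>1 \<psi>\<^sub>2 \<longleftrightarrow>
     (\<exists>m>1. finite_blaschke m \<psi>\<^sub>1) \<and> (\<exists>n>1. finite_blaschke n \<psi>\<^sub>2) \<and>
     (\<forall>z\<in>ball 0 1. \<phi> z = \<psi>\<^sub>1 (\<psi>\<^sub>2 z))"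

definition decomposable :: "(complex \<Rightarrow> complex) \<Rightarrow> bool" where
  "decomposable \<phi> \<longleftrightarrow> (\<exists>\<psi>\<^sub>1 \<psi>\<^sub>2. blaschke_decomposition \<phi> \<psi>\<^sub>1 \<psi>\<^sub>2)"


section \<open>The Dirichlet space\<close>

text \<open>A function on the disc is represented by its extension by zero to the plane, so that
  equality in the space is equality of HOL functions and subspaces can be counted as sets.\<close>

definition dirichlet_space :: "(complex \<Rightarrow> complex) set" where
  "dirichlet_space = {f. f holomorphic_on ball 0 1 \<and>
     set_integrable lborel (ball 0 1) (\<lambda>z. (cmod (deriv f z))\<^sup>2) \<and>
     (\<forall>z. z \<notin> ball 0 1 \<longrightarrow> f z = 0)}"

definition taylor_coeff :: "(complex \<Rightarrow> complex) \<Rightarrow> nat \<Rightarrow> complex" where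
  "taylor_coeff f n = (deriv ^^ n) f 0 / fact n"

text \<open>The squared norm is the squared Hardy space norm of \<open>f\<close> plus the integral of \<open>|f'|\<^sup>2\<close>
  against area measure normalized to total mass 1; the two parts contribute the weights
  \<open>1\<close> and \<open>n\<close>.\<close>

definition dirichlet_norm :: "(complex \<Rightarrow> complex) \<Rightarrow> real" where
  "dirichlet_norm f = sqrt (\<Sum>n. real (n + 1) * (cmod (taylor_coeff f n))\<^sup>2)"

text \<open>The inner product inducing \<open>dirichlet_norm\<close>, linear in the first argument.\<close>

definition dirichlet_inner :: "(complex \<Rightarrow> complex) \<Rightarrow> (complex \<Rightarrow> complex) \<Rightarrow> complex" where
  "dirichlet_inner f g = (\<Sum>n. of_nat (n + 1) * taylor_coeff f n * cnj (taylor_coeff g n))"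

definition closed_subspace :: "(complex \<Rightarrow> complex) set \<Rightarrow> bool" where
  "closed_subspace M \<longleftrightarrow> M \<subseteq> dirichlet_space \<and>
     (\<lambda>z. 0) \<in> M \<and>
     (\<forall>f\<in>M. \<forall>g\<in>M. (\<lambda>z. f z + g z) \<in> M) \<and>
     (\<forall>c. \<forall>f\<in>M. (\<lambda>z. c * f z) \<in> M) \<and>
     (\<forall>F f. (\<forall>k. F k \<in> M) \<and> f \<in> dirichlet_space \<and>
        (\<lambda>k::nat. dirichlet_norm (\<lambda>z. F k z - f z)) \<longlonglongrightarrow> 0 \<longrightarrow> f \<in> M)"


section \<open>Operators and reducing subspaces\<close>

type_synonym operator = "(complex \<Rightarrow> complex) \<Rightarrow> (complex \<Rightarrow> complex)"

definition mult_op :: "(complex \<Rightarrow> complex) \<Rightarrow> operator" where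
  "mult_op \<phi> f = (\<lambda>z. \<phi> z * f z)"

text \<open>The Hilbert space adjoint; for a bounded operator on the Dirichlet space the described
  function exists by the Riesz representation theorem.\<close>

definition dirichlet_adjoint :: "operator \<Rightarrow> operator" where
  "dirichlet_adjoint T g =
     (THE h. h \<in> dirichlet_space \<and>
        (\<forall>f\<in>dirichlet_space. dirichlet_inner (T f) g = dirichlet_inner f h))"

definition reducing_subspace :: "operator \<Rightarrow> (complex \<Rightarrow> complex) set \<Rightarrow> bool" where
  "reducing_subspace T M \<longleftrightarrow>
     closed_subspace M \<and> T ` M \<subseteq> M \<and> dirichlet_adjoint T ` M \<subseteq> M"

definition nontrivial_reducing_subspace :: "operator \<Rightarrow> (complex \<Rightarrow> complex) set \<Rightarrow> bool" where
  "nontrivial_reducing_subspace T M \<longleftrightarrow>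
     reducing_subspace T M \<and> M \<noteq> {\<lambda>z. 0} \<and> M \<noteq> dirichlet_space"

definition minimal_reducing_subspace :: "operator \<Rightarrow> (complex \<Rightarrow> complex) set \<Rightarrow> bool" where
  "minimal_reducing_subspace T M \<longleftrightarrow> nontrivial_reducing_subspace T M \<and>
     (\<forall>N. reducing_subspace T N \<and> N \<subseteq> M \<longrightarrow> N = M \<or> N = {\<lambda>z. 0})"

definition reducible :: "operator \<Rightarrow> bool" where
  "reducible T \<longleftrightarrow> (\<exists>M. nontrivial_reducing_subspace T M)"

end

theory Submission
  imports Defs "HOL-Computational_Algebra.Fundamental_Theorem_Algebra"
    "HOL-Computational_Algebra.Field_as_Ring" "HOL-Computational_Algebra.Polynomial_Factorial"
begin

text \<open>A closed subspace \<open>M\<close> reduces \<open>M_\<phi>\<close> iff its orthogonal projection \<open>P\<close> commutes with \<open>M_\<phi>\<close>, and after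
  composing with a disc automorphism \<open>\<phi> 0 = 0\<close>. Symmetry of \<open>P\<close> and \<open>P (\<phi> f) = \<phi> P f\<close> make the functions
  \<open>P z\<^sup>n\<close> rational, and Lagrange interpolation on the fibre of \<open>b\<close> gives
  \<open>b (P f) b = (\<Sum>\<phi> y = \<phi> b. s b y * y * f y)\<close> for polynomials \<open>f\<close>. The derivative in \<open>x\<close> of the rational
  function \<open>x (\<Sum>n. cnj b\<^sup>n (P z\<^sup>n) x)\<close> has residues that are multiples of the derivatives of the weights \<open>s\<close>
  along the local branches of \<open>y\<close>; since a derivative has no residues, the weights are locally
  constant. Hence a branch that is singled out by its weight has no monodromy and extends to a
  holomorphic \<open>\<sigma>\<close> of the disc into itself with \<open>\<phi> \<circ> \<sigma> = \<phi>\<close>. Moreover \<open>s b y\<close> tends to \<open>0\<close> when \<open>b\<close> tends to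
  \<open>0\<close> and \<open>y\<close> to a simple zero of \<open>\<phi>\<close> other than \<open>0\<close>. Inspecting the possible multiplicities of the zeros
  of \<open>\<phi>\<close>, this forces \<open>P\<close> to be \<open>0\<close> or \<open>1\<close> unless \<open>\<phi>\<close> is, up to a constant, \<open>z\<^sup>4\<close>, an even function, or
  \<open>(z \<phi>\<^sub>\<gamma>)\<^sup>2\<close>. In the second case \<open>\<sigma> z = - z\<close> by the Schwarz lemma, and \<open>P\<close> projects to the even or the odd
  functions; in the third case, with \<open>B = z \<phi>\<^sub>\<gamma>\<close>, the orthogonal complement of the functions
  \<open>B\<^bsup>2k+1\<^esup> / z\<close> is reducing and every other \<open>P\<close> is an affine function of its projection.\<close>

section \<open>The area integral of a power series\<close>

text \<open>With the weights \<open>n + 1\<close> the norm of \<open>f\<close> is the Bergman norm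
  of \<open>(z f)'\<close>. Multiplication by \<open>z\<close> therefore moves the problem to
  functions vanishing at \<open>0\<close> under the pure Dirichlet norm, which is where the
  derivatives \<open>u n\<close> and the factor \<open>x\<close> in front of the generating function
  come from. The vanishing at \<open>0\<close> also restricts the symmetries: a local inverse of
  \<phi> can carry weight only if it is compatible with the value \<open>0\<close> at
  \<open>0\<close>. Rationality is indispensable because the poles compared in the residue argument,
  at the reciprocals of \<open>cnj y\<close>, lie outside the closed disc, where functions of the
  space carry no information. Monodromy is handled without paths. Relations between a point and the
  members of its fibre that survive local continuation are counted fibre by fibre; the count is
  locally constant on the disc minus a finite set, which is connected. A relation with one solution
  per fibre is a global branch. Many arguments consist in finding such a relation from the values of
  the weights alone.\<close>

lemma nn_integral_lborel_shift:
  fixes f :: "'a :: euclidean_space \<Rightarrow> ennreal"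
  assumes [measurable]: "f \<in> borel_measurable borel"
  shows "(\<integral>\<^sup>+x. f (c + x) \<partial>lborel) = (\<integral>\<^sup>+x. f x \<partial>lborel)"
proof -
  have "(\<integral>\<^sup>+x. f x \<partial>lborel) = (\<integral>\<^sup>+x. f x \<partial>(distr lborel borel ((+) c)))"
    by (simp add: lborel_distr_plus)
  also have "\<dots> = (\<integral>\<^sup>+x. f (c + x) \<partial>lborel)"
    by (rule nn_integral_distr) simp_all
  finally show ?thesis ..
qed

text \<open>Computing the integral of \<open>f x * indicator (ball 0 1) (w * y)\<close> over \<open>(x, y)\<close> in two ways, as in
  the uniqueness proof for Haar measure.\<close>
lemma nn_integral_lborel_unimodular:
  fixes w :: complex and f :: "complex \<Rightarrow> ennreal"
  assumes w: "cmod w = 1" and [measurable]: "f \<in> borel_measurable borel"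
  shows "(\<integral>\<^sup>+z. f (w * z) \<partial>lborel) = (\<integral>\<^sup>+z. f z \<partial>lborel)"
proof -
  define K where "K = (indicator (ball 0 1) :: complex \<Rightarrow> ennreal)"
  have [measurable]: "K \<in> borel_measurable borel" unfolding K_def by (intro borel_measurable_indicator) simp
  have Kw: "K (w * y) = K y" and Km: "K (- y) = K y" for y
    using w by (auto simp: K_def indicator_def norm_mult)
  have w0: "w \<noteq> 0" using w by auto
  have c: "(\<integral>\<^sup>+y. K y \<partial>lborel) = ennreal pi"
    by (simp add: K_def emeasure_ball unit_ball_vol_2)
  have [measurable]: "(\<lambda>y. w * y) \<in> borel_measurable borel" by simp
  have "(\<integral>\<^sup>+x. f x \<partial>lborel) * ennreal pi = (\<integral>\<^sup>+y. (\<integral>\<^sup>+x. f x * K (w * y) \<partial>lborel) \<partial>lborel)"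
    by (simp add: Kw nn_integral_cmult nn_integral_multc flip: c)
  also have "\<dots> = (\<integral>\<^sup>+y. (\<integral>\<^sup>+x. f (w * y + x) * K (w * y) \<partial>lborel) \<partial>lborel)"
    by (intro nn_integral_cong nn_integral_lborel_shift[symmetric]) simp
  also have "\<dots> = (\<integral>\<^sup>+x. (\<integral>\<^sup>+y. f (w * y + x) * K (w * y) \<partial>lborel) \<partial>lborel)"
    by (rule lborel_pair.Fubini') simp
  also have "\<dots> = (\<integral>\<^sup>+x. (\<integral>\<^sup>+y. f (w * y) * K (w * y - x) \<partial>lborel) \<partial>lborel)"
  proof (rule nn_integral_cong)
    fix x :: complex
    have "(\<integral>\<^sup>+y. f (w * y) * K (w * y - x) \<partial>lborel)
        = (\<integral>\<^sup>+y. f (w * (x / w + y)) * K (w * (x / w + y) - x) \<partial>lborel)"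
      by (rule nn_integral_lborel_shift[symmetric, of "\<lambda>y. f (w * y) * K (w * y - x)"]) simp
    then show "(\<integral>\<^sup>+y. f (w * y + x) * K (w * y) \<partial>lborel) = (\<integral>\<^sup>+y. f (w * y) * K (w * y - x) \<partial>lborel)"
      using w0 by (simp add: distrib_left add.commute)
  qed
  also have "\<dots> = (\<integral>\<^sup>+y. (\<integral>\<^sup>+x. f (w * y) * K (w * y - x) \<partial>lborel) \<partial>lborel)"
    by (rule lborel_pair.Fubini') simp
  also have "\<dots> = (\<integral>\<^sup>+y. f (w * y) * ennreal pi \<partial>lborel)"
  proof (rule nn_integral_cong)
    fix y :: complex
    have "(\<integral>\<^sup>+x. K (w * y - x) \<partial>lborel) = (\<integral>\<^sup>+x. K (- (w * y) + x) \<partial>lborel)"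
      using Km[of "w * y - x" for x] by (simp add: algebra_simps)
    also have "\<dots> = ennreal pi"
      by (subst nn_integral_lborel_shift) (simp_all add: c)
    finally show "(\<integral>\<^sup>+x. f (w * y) * K (w * y - x) \<partial>lborel) = f (w * y) * ennreal pi"
      by (simp add: nn_integral_cmult)
  qed
  also have "\<dots> = (\<integral>\<^sup>+y. f (w * y) \<partial>lborel) * ennreal pi"
    by (rule nn_integral_multc) simp
  finally have "ennreal pi * (\<integral>\<^sup>+x. f x \<partial>lborel) = ennreal pi * (\<integral>\<^sup>+y. f (w * y) \<partial>lborel)"
    by (simp only: mult.commute)
  then show ?thesis
    unfolding ennreal_mult_cancel_left using pi_gt_zero by simp
qed

lemma lborel_distr_unimodular:
  fixes w :: complex
  assumes "cmod w = 1"
  shows "distr lborel borel ((*) w) = lborel"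
proof (rule measure_eqI)
  fix A assume "A \<in> sets (distr lborel borel ((*) w))"
  then have A [measurable]: "A \<in> sets borel" by simp
  have "emeasure (distr lborel borel ((*) w)) A = (\<integral>\<^sup>+z. indicator A (w * z) \<partial>lborel)"
    by (subst nn_integral_indicator[symmetric], simp, subst nn_integral_distr) simp_all
  also have "\<dots> = emeasure lborel A"
    by (subst nn_integral_lborel_unimodular[OF assms]) simp_all
  finally show "emeasure (distr lborel borel ((*) w)) A = emeasure lborel A" .
qed simp

text \<open>Rotation by the angle \<open>pi / (n - m)\<close> preserves the disc and the measure but
  multiplies the integrand by \<open>w ^ n * cnj w ^ m = -1\<close>, so the integral equals its own
  negative.\<close>

lemma set_lebesgue_integral_monomial_off_diagonal:
  fixes r :: real and n m :: nat
  assumes "n \<noteq> m"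
  shows "(LINT z:ball 0 r|lborel. z ^ n * cnj z ^ m) = (0 :: complex)"
proof -
  define t where "t = pi / (real n - real m)"
  define w where "w = cis t"
  let ?F = "\<lambda>z. indicator (ball 0 r) z *\<^sub>R (z ^ n * cnj z ^ m) :: complex"
  have [measurable]: "?F \<in> borel_measurable borel"
    by (intro borel_measurable_scaleR borel_measurable_indicator borel_measurable_continuous_onI continuous_intros) simp
  have nm: "t * (real n - real m) = pi" using assms by (simp add: t_def)
  have "w ^ n * cnj w ^ m = cis (real n * t) * cis (- (real m * t))"
    by (simp only: w_def cis_cnj Complex.DeMoivre mult_minus_right)
  also have "\<dots> = cis (real n * t - real m * t)"
    by (simp add: cis_mult)
  also have "real n * t - real m * t = pi"
    using nm by (simp add: algebra_simps)
  finally have wm: "w ^ n * cnj w ^ m = -1" by simp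
  have wn: "cmod w = 1" by (simp add: w_def)
  have "?F (w * z) = - ?F z" for z
  proof -
    have "(w * z) ^ n * cnj (w * z) ^ m = (w ^ n * cnj w ^ m) * (z ^ n * cnj z ^ m)"
      by (simp add: power_mult_distrib mult_ac)
    then show ?thesis using wm wn by (simp add: indicator_def norm_mult)
  qed
  then have "(LINT z|lborel. ?F (w * z)) = - (LINT z|lborel. ?F z)"
    by simp
  moreover have "(LINT z|lborel. ?F z) = (LINT z|distr lborel borel ((*) w). ?F z)"
    by (simp add: lborel_distr_unimodular wn)
  moreover have "(LINT z|distr lborel borel ((*) w). ?F z) = (LINT z|lborel. ?F (w * z))"
    by (rule integral_distr) simp_all
  ultimately have "(LINT z|lborel. ?F z) = - (LINT z|lborel. ?F z)"
    by presburger
  then have "2 * (LINT z|lborel. ?F z) = 0"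
    by (simp only: eq_neg_iff_add_eq_0 mult_2)
  then show ?thesis
    unfolding set_lebesgue_integral_def by simp
qed

text \<open>An annulus with squared radii \<open>x\<close> and \<open>r^2\<close> has area
  \<open>pi * (r^2 - x)\<close>, so the squared modulus is distributed with constant density. This
  does the work of polar coordinates: radial integrals become one-dimensional.\<close>

lemma distr_cmod_square_ball:
  assumes "r > 0"
  shows "distr (density lborel (indicator (ball (0::complex) r))) borel (\<lambda>z. (cmod z)\<^sup>2)
       = density lborel (\<lambda>t. ennreal (pi * indicator {0..r\<^sup>2} t))" (is "?L = ?R")
proof (rule measure_eqI_lessThan)
  have meas: "emeasure ?L {x <..} = emeasure lborel {z \<in> ball (0::complex) r. x < (cmod z)\<^sup>2}" for x
  proof -
    have "emeasure ?L {x<..} = emeasure (density lborel (indicator (ball (0::complex) r))) {z. x < (cmod z)\<^sup>2}"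
      by (subst emeasure_distr) (auto intro!: arg_cong2[where f=emeasure])
    also have "\<dots> = emeasure lborel (ball 0 r \<inter> {z::complex. x < (cmod z)\<^sup>2})"
    proof (subst emeasure_density)
      show "(\<integral>\<^sup>+x\<in>{z. x < (cmod z)\<^sup>2}. indicator (ball 0 r) x \<partial>lborel)
          = emeasure lborel (ball 0 r \<inter> {z::complex. x < (cmod z)\<^sup>2})" for x
        by (subst nn_integral_indicator[symmetric], simp, intro nn_integral_cong) (auto simp: indicator_def)
    qed (auto intro!: borel_measurable_indicator)
    also have "ball 0 r \<inter> {z::complex. x < (cmod z)\<^sup>2} = {z \<in> ball 0 r. x < (cmod z)\<^sup>2}" by auto
    finally show ?thesis .
  qed
  have measR: "emeasure ?R {x <..} = ennreal pi * emeasure lborel ({0..r\<^sup>2} \<inter> {x<..})" for x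
  proof -
    have "emeasure ?R {x <..} = (\<integral>\<^sup>+t. ennreal pi * indicator ({0..r\<^sup>2} \<inter> {x<..}) t \<partial>lborel)"
      by (subst emeasure_density) (auto intro!: nn_integral_cong simp: indicator_def)
    also have "\<dots> = ennreal pi * emeasure lborel ({0..r\<^sup>2} \<inter> {x<..})"
      by (subst nn_integral_cmult_indicator) simp_all
    finally show ?thesis .
  qed
  fix x :: real
  show "emeasure ?L {x <..} < \<infinity>"
  proof -
    have "emeasure ?L {x <..} \<le> emeasure lborel (ball (0::complex) r)"
      unfolding meas by (intro emeasure_mono) auto
    also have "\<dots> < \<infinity>" using assms by (simp add: emeasure_ball)
    finally show ?thesis .
  qed
  show "emeasure ?L {x <..} = emeasure ?R {x <..}"
  proof -
    consider "x < 0" | "0 \<le> x" "x < r\<^sup>2" | "r\<^sup>2 \<le> x" by linarith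
    then show ?thesis
    proof cases
      case 1
      then have "{z \<in> ball (0::complex) r. x < (cmod z)\<^sup>2} = ball 0 r"
        using less_le_trans[of x 0 "(cmod z)\<^sup>2" for z] by auto
      moreover have "{0..r\<^sup>2} \<inter> {x<..} = {0..r\<^sup>2}" using 1 by auto
      ultimately show ?thesis using assms
        by (simp only: meas measR, simp add: emeasure_ball unit_ball_vol_2 ennreal_mult'')
    next
      case 2
      have sq: "x < (cmod z)\<^sup>2 \<longleftrightarrow> sqrt x < cmod z" for z
        by (metis abs_norm_cancel real_sqrt_abs real_sqrt_less_iff)
      have "{z \<in> ball (0::complex) r. x < (cmod z)\<^sup>2} = ball 0 r - cball 0 (sqrt x)"
        by (auto simp: sq)
      moreover have "emeasure lborel (ball 0 r - cball 0 (sqrt x) :: complex set)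
          = emeasure lborel (ball (0::complex) r) - emeasure lborel (cball (0::complex) (sqrt x))"
      proof (rule emeasure_Diff)
        have "sqrt x < r" using 2 assms by (simp add: real_less_lsqrt)
        then show "cball (0::complex) (sqrt x) \<subseteq> ball 0 r" by auto
      qed (use 2 in \<open>simp_all add: emeasure_cball\<close>)
      moreover have "{0..r\<^sup>2} \<inter> {x<..} = {x<..r\<^sup>2}" using 2 by auto
      moreover have "emeasure lborel (ball (0::complex) r) - emeasure lborel (cball (0::complex) (sqrt x))
          = ennreal (pi * r\<^sup>2 - pi * x)"
      proof -
        have "emeasure lborel (ball (0::complex) r) = ennreal (pi * r\<^sup>2)"
          using assms by (simp add: emeasure_ball unit_ball_vol_2)
        moreover have "emeasure lborel (cball (0::complex) (sqrt x)) = ennreal (pi * x)"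
          using 2 by (simp add: emeasure_cball unit_ball_vol_2)
        ultimately show ?thesis using 2 by (simp only: ennreal_minus mult_nonneg_nonneg pi_ge_zero)
      qed
      moreover have "ennreal (pi * r\<^sup>2 - pi * x) = ennreal pi * ennreal (r\<^sup>2 - x)"
        using 2 by (subst right_diff_distrib[symmetric], intro ennreal_mult'') simp
      moreover have "emeasure lborel {x<..r\<^sup>2} = ennreal (r\<^sup>2 - x)"
        using 2 by simp
      ultimately show ?thesis by (simp only: meas measR)
    next
      case 3
      have "{z \<in> ball (0::complex) r. x < (cmod z)\<^sup>2} = {}"
      proof -
        have "\<not> x < (cmod z)\<^sup>2" if "cmod z < r" for z
          using that 3 power_strict_mono[of "cmod z" r 2] by simp
        then show ?thesis by auto
      qed
      moreover have "{0..r\<^sup>2} \<inter> {x<..} = {}" using 3 by auto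
      ultimately show ?thesis by (simp only: meas measR, simp)
    qed
  qed
qed simp_all

lemma nn_integral_ball_cmod_power:
  assumes "r > 0"
  shows "(\<integral>\<^sup>+z\<in>ball (0::complex) r. ennreal ((cmod z) ^ (2 * n)) \<partial>lborel) = ennreal (pi * r ^ (2 * n + 2) / (n + 1))"
proof -
  have "(\<integral>\<^sup>+z\<in>ball (0::complex) r. ennreal ((cmod z) ^ (2 * n)) \<partial>lborel)
      = (\<integral>\<^sup>+z. ennreal (((cmod z)\<^sup>2) ^ n) \<partial>density lborel (indicator (ball (0::complex) r)))"
    by (subst nn_integral_density)
       (auto intro!: borel_measurable_indicator nn_integral_cong simp: mult.commute simp flip: power_mult)
  also have "\<dots> = (\<integral>\<^sup>+t. ennreal (t ^ n) \<partial>distr (density lborel (indicator (ball (0::complex) r))) borel (\<lambda>z. (cmod z)\<^sup>2))"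
    by (subst nn_integral_distr) simp_all
  also have "\<dots> = (\<integral>\<^sup>+t. ennreal (pi * indicator {0..r\<^sup>2} t) * ennreal (t ^ n) \<partial>lborel)"
    unfolding distr_cmod_square_ball[OF assms] by (subst nn_integral_density) simp_all
  also have "\<dots> = (\<integral>\<^sup>+t. ennreal (pi * t ^ n) * indicator {0..r\<^sup>2} t \<partial>lborel)"
    by (intro nn_integral_cong) (auto simp: indicator_def ennreal_mult)
  also have "\<dots> = ennreal (pi * (r\<^sup>2) ^ Suc n / Suc n - pi * 0 ^ Suc n / Suc n)"
  proof (rule nn_integral_FTC_Icc)
    show "((\<lambda>t. pi * t ^ Suc n / Suc n) has_real_derivative pi * t ^ n) (at t)" for t
      by (rule derivative_eq_intros refl | simp)+
  qed auto
  also have "pi * (r\<^sup>2) ^ Suc n / Suc n - pi * 0 ^ Suc n / Suc n = pi * r ^ (2 * n + 2) / (n + 1)"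
    unfolding power_mult[symmetric] by (simp add: add.commute)
  finally show ?thesis .
qed

lemma taylor_coeff_sums:
  assumes "f holomorphic_on ball 0 1" "z \<in> ball 0 1"
  shows "(\<lambda>n. taylor_coeff f n * z ^ n) sums f z"
  using holomorphic_power_series[OF assms] by (simp add: taylor_coeff_def)

lemma set_integrable_monomial_ball:
  "set_integrable lborel (ball 0 r) (\<lambda>z :: complex. z ^ n * cnj z ^ m)"
proof -
  have "set_integrable lborel (cball 0 r) (\<lambda>z :: complex. z ^ n * cnj z ^ m)"
    unfolding set_integrable_def
    by (intro borel_integrable_compact continuous_intros) simp_all
  then show ?thesis
    by (rule set_integrable_subset) auto
qed

lemma set_lebesgue_integral_monomial_diagonal:
  assumes "r > 0"
  shows "(LINT z:ball 0 r|lborel. z ^ n * cnj z ^ n) = complex_of_real (pi * r ^ (2 * n + 2) / (n + 1))"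
proof -
  have eq: "z ^ n * cnj z ^ n = complex_of_real (cmod z ^ (2 * n))" for z
    by (metis complex_norm_square of_real_power power_mult power_mult_distrib)
  have "(LINT z:ball 0 r|lborel. z ^ n * cnj z ^ n)
      = complex_of_real (LINT z:ball (0::complex) r|lborel. cmod z ^ (2 * n))"
    unfolding set_lebesgue_integral_def eq scaleR_conv_of_real
    by (simp only: integral_complex_of_real flip: of_real_mult) simp
  also have "(LINT z:ball (0::complex) r|lborel. cmod z ^ (2 * n)) = pi * r ^ (2 * n + 2) / (n + 1)"
  proof -
    have "(LINT z:ball (0::complex) r|lborel. cmod z ^ (2 * n))
        = enn2real (\<integral>\<^sup>+z. ennreal (indicator (ball 0 r) z *\<^sub>R cmod (z::complex) ^ (2 * n)) \<partial>lborel)"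
      unfolding set_lebesgue_integral_def
      by (rule integral_eq_nn_integral) (auto intro!: borel_measurable_times borel_measurable_indicator)
    also have "(\<integral>\<^sup>+z. ennreal (indicator (ball 0 r) z *\<^sub>R cmod (z::complex) ^ (2 * n)) \<partial>lborel)
        = (\<integral>\<^sup>+z\<in>ball (0::complex) r. ennreal ((cmod z) ^ (2 * n)) \<partial>lborel)"
      by (rule nn_integral_cong) (auto simp: indicator_def)
    finally show ?thesis
      using assms by (simp only: nn_integral_ball_cmod_power) simp
  qed
  finally show ?thesis .
qed

text \<open>Orthogonality of the monomials leaves only the diagonal of the double sum. The value is
  computed as a Bochner integral, where the expansion is possible, and then read back as a
  nonnegative one.\<close>

lemma nn_integral_ball_polynomial:
  fixes a :: "nat \<Rightarrow> complex"
  assumes "r > 0"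
  shows "(\<integral>\<^sup>+z\<in>ball 0 r. ennreal ((cmod (\<Sum>n<N. a n * z ^ n))\<^sup>2) \<partial>lborel)
       = ennreal (\<Sum>n<N. pi * (cmod (a n))\<^sup>2 * r ^ (2 * n + 2) / (n + 1))"
proof -
  define S where "S z = (\<Sum>n<N. a n * z ^ n)" for z
  define I where "I n m = (LINT z:ball 0 r|lborel. z ^ n * cnj z ^ m)" for n m :: nat
  have int: "integrable lborel (\<lambda>z. indicator (ball 0 r) z *\<^sub>R (z ^ n * cnj z ^ m) :: complex)" for n m
    using set_integrable_monomial_ball[of r n m] by (simp add: set_integrable_def)
  have eq: "complex_of_real (indicator (ball 0 r) z * (cmod (S z))\<^sup>2)
      = (\<Sum>n<N. \<Sum>m<N. a n * cnj (a m) * (indicator (ball 0 r) z *\<^sub>R (z ^ n * cnj z ^ m)))" for z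
  proof -
    have "complex_of_real ((cmod (S z))\<^sup>2) = S z * cnj (S z)"
      by (rule complex_norm_square)
    also have "\<dots> = (\<Sum>n<N. \<Sum>m<N. a n * cnj (a m) * (z ^ n * cnj z ^ m))"
      by (simp add: S_def sum_product mult_ac)
    finally show ?thesis
      by (simp add: scaleR_conv_of_real sum_distrib_left mult_ac)
  qed
  have "integrable lborel (\<lambda>z. complex_of_real (indicator (ball 0 r) z * (cmod (S z))\<^sup>2))"
    unfolding eq by (intro Bochner_Integration.integrable_sum integrable_mult_right int)
  then have int': "integrable lborel (\<lambda>z. indicator (ball 0 r) z * (cmod (S z))\<^sup>2)"
    by (auto dest: integrable_bounded_linear[OF bounded_linear_Re])
  have "complex_of_real (LINT z|lborel. indicator (ball 0 r) z * (cmod (S z))\<^sup>2)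
      = (LINT z|lborel. (\<Sum>n<N. \<Sum>m<N. a n * cnj (a m) * (indicator (ball 0 r) z *\<^sub>R (z ^ n * cnj z ^ m))))"
    unfolding eq[symmetric] integral_complex_of_real ..
  also have "\<dots> = (\<Sum>n<N. \<Sum>m<N. a n * cnj (a m) * I n m)"
    by (simp add: I_def set_lebesgue_integral_def Bochner_Integration.integral_sum int
        Bochner_Integration.integrable_sum del: mult_scaleR_right)
  also have "\<dots> = (\<Sum>n<N. a n * cnj (a n) * I n n)"
  proof (rule sum.cong[OF refl])
    fix n assume "n \<in> {..<N}"
    have "I n m = 0" if "n \<noteq> m" for m
      using set_lebesgue_integral_monomial_off_diagonal[OF that] by (simp add: I_def)
    then have "(\<Sum>m<N. a n * cnj (a m) * I n m) = (\<Sum>m\<in>{n}. a n * cnj (a m) * I n m)"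
      using \<open>n \<in> {..<N}\<close> by (intro sum.mono_neutral_right) auto
    then show "(\<Sum>m<N. a n * cnj (a m) * I n m) = a n * cnj (a n) * I n n" by simp
  qed
  also have "\<dots> = complex_of_real (\<Sum>n<N. pi * (cmod (a n))\<^sup>2 * r ^ (2 * n + 2) / (n + 1))"
    unfolding of_real_sum
  proof (rule sum.cong[OF refl])
    fix n
    show "a n * cnj (a n) * I n n = complex_of_real (pi * (cmod (a n))\<^sup>2 * r ^ (2 * n + 2) / (n + 1))"
      unfolding I_def set_lebesgue_integral_monomial_diagonal[OF assms]
      by (simp add: mult_ac flip: complex_norm_square)
  qed
  finally have val: "(LINT z|lborel. indicator (ball 0 r) z * (cmod (S z))\<^sup>2)
      = (\<Sum>n<N. pi * (cmod (a n))\<^sup>2 * r ^ (2 * n + 2) / (n + 1))"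
    by (simp only: of_real_eq_iff)
  have "(\<integral>\<^sup>+z\<in>ball 0 r. ennreal ((cmod (S z))\<^sup>2) \<partial>lborel)
      = (\<integral>\<^sup>+z. ennreal (indicator (ball 0 r) z * (cmod (S z))\<^sup>2) \<partial>lborel)"
    by (rule nn_integral_cong) (auto simp: indicator_def)
  also have "\<dots> = ennreal (LINT z|lborel. indicator (ball 0 r) z * (cmod (S z))\<^sup>2)"
    by (rule nn_integral_eq_integral[OF int']) auto
  finally show ?thesis unfolding val unfolding S_def .
qed

text \<open>For \<open>r < 1\<close> the Taylor polynomials are dominated on the smaller disc by the
  constant \<open>K\<close>, so dominated convergence passes from polynomials to
  \<open>g\<close>.\<close>

lemma nn_integral_ball_holomorphic:
  assumes g: "g holomorphic_on ball 0 1" and r: "0 < r" "r < 1"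
  shows "(\<integral>\<^sup>+z\<in>ball 0 r. ennreal ((cmod (g z))\<^sup>2) \<partial>lborel)
       = (\<Sum>n. ennreal (pi * (cmod (taylor_coeff g n))\<^sup>2 * r ^ (2 * n + 2) / (n + 1)))"
proof -
  let ?a = "taylor_coeff g"
  define S where "S N z = (\<Sum>n<N. ?a n * z ^ n)" for N and z :: complex
  define c where "c n = pi * (cmod (?a n))\<^sup>2 * r ^ (2 * n + 2) / (n + 1)" for n
  have c0: "c n \<ge> 0" for n using r by (simp add: c_def)
  have summ: "summable (\<lambda>n. norm (?a n * of_real r ^ n))"
  proof -
    \<comment> \<open>Convergence at a point strictly beyond \<open>r\<close> gives absolute
      convergence at \<open>r\<close>.\<close>
    define t where "t = (r + 1) / 2"
    have t: "r < t" "t < 1" using r by (auto simp: t_def)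
    have "(\<lambda>n. ?a n * of_real t ^ n) sums g (of_real t)"
      using t r by (intro taylor_coeff_sums g) auto
    then have "summable (\<lambda>n. ?a n * of_real t ^ n)" by (rule sums_summable)
    then show ?thesis by (rule powser_insidea) (use t r in auto)
  qed
  define K where "K = (\<Sum>n. norm (?a n * of_real r ^ n))"
  have SK: "cmod (S N z) \<le> K" if "z \<in> ball 0 r" for N z
  proof -
    have "cmod (S N z) \<le> (\<Sum>n<N. norm (?a n * z ^ n))"
      unfolding S_def by (rule norm_sum)
    also have "\<dots> \<le> (\<Sum>n<N. norm (?a n * of_real r ^ n))"
      using that r by (intro sum_mono) (auto simp: norm_mult norm_power intro!: mult_left_mono power_mono)
    also have "\<dots> \<le> K"
      unfolding K_def by (intro sum_le_suminf summ) auto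
    finally show ?thesis .
  qed
  have [measurable]: "S N \<in> borel_measurable borel" for N
    unfolding S_def by (intro borel_measurable_continuous_onI continuous_intros)
  have ind [measurable]: "indicator (ball (0::complex) r) \<in> borel_measurable borel"
    by (intro borel_measurable_indicator) simp
  have lim: "(\<lambda>N. S N z) \<longlonglongrightarrow> g z" if "z \<in> ball 0 r" for z
    using taylor_coeff_sums[OF g, of z] that r by (simp add: S_def sums_def)
  have "(\<lambda>N. \<integral>\<^sup>+z\<in>ball 0 r. ennreal ((cmod (S N z))\<^sup>2) \<partial>lborel)
      \<longlonglongrightarrow> (\<integral>\<^sup>+z\<in>ball 0 r. ennreal ((cmod (g z))\<^sup>2) \<partial>lborel)"
  proof (rule nn_integral_dominated_convergence[where w="\<lambda>z. ennreal (K\<^sup>2) * indicator (ball 0 r) z"])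
    have "continuous_on (ball 0 r) g"
      using g r by (intro holomorphic_on_imp_continuous_on holomorphic_on_subset[OF g]) auto
    then have "(\<lambda>z. indicator (ball 0 r) z *\<^sub>R (cmod (g z))\<^sup>2) \<in> borel_measurable borel"
      by (intro borel_measurable_continuous_on_indicator continuous_intros) simp_all
    then have "(\<lambda>z. ennreal (indicator (ball 0 r) z *\<^sub>R (cmod (g z))\<^sup>2)) \<in> borel_measurable borel"
      by simp
    moreover have "(\<lambda>z. ennreal (indicator (ball 0 r) z *\<^sub>R (cmod (g z))\<^sup>2))
        = (\<lambda>z. ennreal ((cmod (g z))\<^sup>2) * indicator (ball 0 r) z)"
      by (auto simp: indicator_def)
    ultimately show "(\<lambda>z. ennreal ((cmod (g z))\<^sup>2) * indicator (ball 0 r) z) \<in> borel_measurable lborel"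
      by (simp only: measurable_lborel2)
    show "AE z in lborel. ennreal ((cmod (S j z))\<^sup>2) * indicator (ball 0 r) z
        \<le> ennreal (K\<^sup>2) * indicator (ball 0 r) z" for j
      using SK by (intro AE_I2) (auto simp: indicator_def intro!: ennreal_leI power_mono)
    have "(\<integral>\<^sup>+z. ennreal (K\<^sup>2) * indicator (ball (0::complex) r) z \<partial>lborel)
        = ennreal (K\<^sup>2) * emeasure lborel (ball (0::complex) r)"
      by (rule nn_integral_cmult_indicator) simp
    also have "\<dots> < \<infinity>"
      using r by (simp add: emeasure_ball ennreal_mult_less_top)
    finally show "(\<integral>\<^sup>+z. ennreal (K\<^sup>2) * indicator (ball (0::complex) r) z \<partial>lborel) < \<infinity>" .
    show "AE z in lborel. (\<lambda>i. ennreal ((cmod (S i z))\<^sup>2) * indicator (ball 0 r) z)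
        \<longlonglongrightarrow> ennreal ((cmod (g z))\<^sup>2) * indicator (ball 0 r) z"
    proof (intro AE_I2)
      fix z
      show "(\<lambda>i. ennreal ((cmod (S i z))\<^sup>2) * indicator (ball 0 r) z)
        \<longlonglongrightarrow> ennreal ((cmod (g z))\<^sup>2) * indicator (ball 0 r) z"
        by (cases "z \<in> ball 0 r") (auto intro!: tendsto_intros lim)
    qed
  qed simp_all
  moreover have "(\<integral>\<^sup>+z\<in>ball 0 r. ennreal ((cmod (S N z))\<^sup>2) \<partial>lborel) = (\<Sum>n<N. ennreal (c n))" for N
    unfolding S_def nn_integral_ball_polynomial[OF r(1)] c_def[symmetric]
    by (rule sum_ennreal[symmetric]) (rule c0)
  moreover have "(\<lambda>N. \<Sum>n<N. ennreal (c n)) \<longlonglongrightarrow> (\<Sum>n. ennreal (c n))"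
    by (rule summable_LIMSEQ) simp
  ultimately have "(\<integral>\<^sup>+z\<in>ball 0 r. ennreal ((cmod (g z))\<^sup>2) \<partial>lborel) = (\<Sum>n. ennreal (c n))"
    by (simp only: LIMSEQ_unique)
  then show ?thesis by (simp only: c_def)
qed

text \<open>Both sides are suprema of their values for radii \<open>r k\<close> increasing to
  \<open>1\<close>. Extended nonnegative values keep the identity valid when it is infinite, so that
  membership in the space can be read off the coefficients.\<close>

theorem nn_integral_unit_disc_holomorphic:
  assumes g: "g holomorphic_on ball 0 1"
  shows "(\<integral>\<^sup>+z\<in>ball 0 1. ennreal ((cmod (g z))\<^sup>2) \<partial>lborel)
       = (\<Sum>n. ennreal (pi * (cmod (taylor_coeff g n))\<^sup>2 / (n + 1)))"
proof -
  define r where "r k = 1 - 1 / (real k + 2)" for k :: nat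
  have r: "0 < r k" "r k < 1" for k by (auto simp: r_def field_simps)
  have r_mono: "r i \<le> r j" if "i \<le> j" for i j using that by (auto simp: r_def field_simps)
  have r_lim: "r \<longlonglongrightarrow> 1" unfolding r_def by real_asymp
  have [measurable]: "ball (0::complex) s \<in> sets borel" for s by simp
  have meas: "(\<lambda>z. ennreal ((cmod (g z))\<^sup>2) * indicator (ball 0 (r k)) z) \<in> borel_measurable lborel" for k
  proof -
    have "continuous_on (ball 0 (r k)) g"
      using r by (intro holomorphic_on_imp_continuous_on holomorphic_on_subset[OF g] subset_ball) (auto intro: less_imp_le)
    then have "(\<lambda>z. indicator (ball 0 (r k)) z *\<^sub>R (cmod (g z))\<^sup>2) \<in> borel_measurable borel"
      by (intro borel_measurable_continuous_on_indicator continuous_intros) simp_all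
    then have "(\<lambda>z. ennreal (indicator (ball 0 (r k)) z *\<^sub>R (cmod (g z))\<^sup>2)) \<in> borel_measurable borel"
      by simp
    moreover have "(\<lambda>z. ennreal (indicator (ball 0 (r k)) z *\<^sub>R (cmod (g z))\<^sup>2))
        = (\<lambda>z. ennreal ((cmod (g z))\<^sup>2) * indicator (ball 0 (r k)) z)"
      by (auto simp: indicator_def)
    ultimately show ?thesis by (simp only: measurable_lborel2)
  qed
  have sup: "ennreal ((cmod (g z))\<^sup>2) * indicator (ball 0 1) z
      = (SUP k. ennreal ((cmod (g z))\<^sup>2) * indicator (ball 0 (r k)) z)" for z
  proof (cases "z \<in> ball 0 1")
    case True
    then have "\<forall>\<^sub>F k in sequentially. cmod z < r k"
      using order_tendstoD(1)[OF r_lim, of "cmod z"] by simp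
    then obtain k where "cmod z < r k" by (meson eventually_sequentially order_refl)
    then show ?thesis using True
      by (intro antisym SUP_upper2[of k] SUP_least) (auto simp: indicator_def)
  next
    case False
    then have "z \<notin> ball 0 (r k)" for k using r[of k] by auto
    then show ?thesis using False by simp
  qed
  have "(\<integral>\<^sup>+z\<in>ball 0 1. ennreal ((cmod (g z))\<^sup>2) \<partial>lborel)
      = (\<integral>\<^sup>+z. (SUP k. ennreal ((cmod (g z))\<^sup>2) * indicator (ball 0 (r k)) z) \<partial>lborel)"
    by (simp only: sup)
  also have "\<dots> = (SUP k. \<integral>\<^sup>+z\<in>ball 0 (r k). ennreal ((cmod (g z))\<^sup>2) \<partial>lborel)"
  proof (rule nn_integral_monotone_convergence_SUP[OF _ meas])
    show "incseq (\<lambda>k z. ennreal ((cmod (g z))\<^sup>2) * indicator (ball 0 (r k)) z)"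
      by (auto simp: incseq_def le_fun_def indicator_def dest: r_mono)
  qed
  also have "\<dots> = (SUP k. \<Sum>n. ennreal (pi * (cmod (taylor_coeff g n))\<^sup>2 * r k ^ (2 * n + 2) / (n + 1)))"
    by (simp only: nn_integral_ball_holomorphic[OF g r])
  also have "\<dots> = (\<Sum>n. SUP k. ennreal (pi * (cmod (taylor_coeff g n))\<^sup>2 * r k ^ (2 * n + 2) / (n + 1)))"
  proof (rule ennreal_suminf_SUP_eq[symmetric])
    show "incseq (\<lambda>k. ennreal (pi * (cmod (taylor_coeff g n))\<^sup>2 * r k ^ (2 * n + 2) / (n + 1)))" for n
      unfolding incseq_def
      by (intro allI impI ennreal_leI divide_right_mono mult_left_mono power_mono r_mono)
         (use r in \<open>auto intro: less_imp_le\<close>)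
  qed
  also have "(\<lambda>n. SUP k. ennreal (pi * (cmod (taylor_coeff g n))\<^sup>2 * r k ^ (2 * n + 2) / (n + 1)))
      = (\<lambda>n. ennreal (pi * (cmod (taylor_coeff g n))\<^sup>2 / (n + 1)))"
  proof
    fix n
    have "(\<lambda>k. ennreal (pi * (cmod (taylor_coeff g n))\<^sup>2 * r k ^ (2 * n + 2) / (n + 1)))
        \<longlonglongrightarrow> ennreal (pi * (cmod (taylor_coeff g n))\<^sup>2 * 1 ^ (2 * n + 2) / (n + 1))"
      by (intro tendsto_intros r_lim) simp
    moreover have "incseq (\<lambda>k. ennreal (pi * (cmod (taylor_coeff g n))\<^sup>2 * r k ^ (2 * n + 2) / (n + 1)))"
      unfolding incseq_def
      by (intro allI impI ennreal_leI divide_right_mono mult_left_mono power_mono r_mono)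
         (use r in \<open>auto intro: less_imp_le\<close>)
    ultimately show "(SUP k. ennreal (pi * (cmod (taylor_coeff g n))\<^sup>2 * r k ^ (2 * n + 2) / (n + 1)))
        = ennreal (pi * (cmod (taylor_coeff g n))\<^sup>2 / (n + 1))"
      using LIMSEQ_SUP LIMSEQ_unique by fastforce
  qed
  finally show ?thesis .
qed

section \<open>The Dirichlet space in terms of Taylor coefficients\<close>

definition disc_ext :: "(complex \<Rightarrow> complex) \<Rightarrow> complex \<Rightarrow> complex" where
  "disc_ext f = (\<lambda>z. if z \<in> ball 0 1 then f z else 0)"

lemma disc_ext_eq: "z \<in> ball 0 1 \<Longrightarrow> disc_ext f z = f z"
  and disc_ext_outside: "z \<notin> ball 0 1 \<Longrightarrow> disc_ext f z = 0"
  by (auto simp: disc_ext_def)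

lemma holomorphic_disc_ext: "disc_ext f holomorphic_on ball 0 1 \<longleftrightarrow> f holomorphic_on ball 0 1"
  by (rule holomorphic_cong) (auto simp: disc_ext_def)

lemma taylor_coeff_unique:
  assumes "r > 0" "\<And>z. z \<in> ball 0 r \<Longrightarrow> (\<lambda>n. a n * z ^ n) sums f z"
  shows "taylor_coeff f n = a n"
proof -
  have "f has_fps_expansion Abs_fps a"
  proof (rule has_fps_expansionI)
    have "\<forall>\<^sub>F u in nhds 0. u \<in> ball (0::complex) r"
      using assms(1) by (intro eventually_nhds_in_open) auto
    then show "\<forall>\<^sub>F u in nhds 0. (\<lambda>n. fps_nth (Abs_fps a) n * u ^ n) sums f u"
      by eventually_elim (use assms in simp)
  qed
  then show ?thesis using fps_nth_fps_expansion[of f "Abs_fps a" n] by (simp add: taylor_coeff_def)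
qed

lemma taylor_coeff_cong:
  assumes "f holomorphic_on ball 0 1" "\<And>z. z \<in> ball 0 1 \<Longrightarrow> f z = g z"
  shows "taylor_coeff g n = taylor_coeff f n"
  by (rule taylor_coeff_unique[of 1]) (use taylor_coeff_sums[OF assms(1)] assms(2) in auto)

lemma taylor_coeff_disc_ext:
  "f holomorphic_on ball 0 1 \<Longrightarrow> taylor_coeff (disc_ext f) n = taylor_coeff f n"
  by (rule taylor_coeff_cong) (auto simp: disc_ext_def)

lemma taylor_coeff_add:
  assumes "f holomorphic_on ball 0 1" "g holomorphic_on ball 0 1"
  shows "taylor_coeff (\<lambda>z. f z + g z) n = taylor_coeff f n + taylor_coeff g n"
  by (rule taylor_coeff_unique[of 1])
     (auto simp: distrib_right intro!: sums_add taylor_coeff_sums assms)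

lemma taylor_coeff_cmult:
  assumes "f holomorphic_on ball 0 1"
  shows "taylor_coeff (\<lambda>z. c * f z) n = c * taylor_coeff f n"
  by (rule taylor_coeff_unique[of 1])
     (auto simp: mult.assoc intro!: sums_mult taylor_coeff_sums assms)

lemma taylor_coeff_diff:
  assumes "f holomorphic_on ball 0 1" "g holomorphic_on ball 0 1"
  shows "taylor_coeff (\<lambda>z. f z - g z) n = taylor_coeff f n - taylor_coeff g n"
  by (rule taylor_coeff_unique[of 1])
     (auto simp: left_diff_distrib intro!: sums_diff taylor_coeff_sums assms)

lemma taylor_coeff_zero [simp]: "taylor_coeff (\<lambda>z. 0) n = 0"
  by (rule taylor_coeff_unique[of 1]) auto

lemma taylor_coeff_monomial: "taylor_coeff (\<lambda>z. z ^ k) n = (if n = k then 1 else 0)"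
proof (rule taylor_coeff_unique[of 1])
  fix z :: complex assume "z \<in> ball 0 1"
  have "(\<lambda>n. if n = k then z ^ n else 0) sums z ^ k" by (rule sums_single)
  then show "(\<lambda>n. (if n = k then 1 else 0) * z ^ n) sums z ^ k"
    by (simp add: if_distrib[of "\<lambda>c. c * _"] cong: if_cong)
qed simp

lemma taylor_coeff_abs_summable:
  assumes "f holomorphic_on ball 0 1" "z \<in> ball 0 1"
  shows "summable (\<lambda>n. norm (taylor_coeff f n * z ^ n))"
proof -
  define t where "t = (cmod z + 1) / 2"
  have t: "cmod z < t" "t < 1" using assms by (auto simp: t_def)
  have "0 \<le> t" using t norm_ge_zero[of z] by linarith
  then have "(\<lambda>n. taylor_coeff f n * of_real t ^ n) sums f (of_real t)"
    using t by (intro taylor_coeff_sums assms) auto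
  then show ?thesis
    by (intro powser_insidea[where x="of_real t"]) (use t \<open>0 \<le> t\<close> in \<open>auto dest: sums_summable\<close>)
qed

lemma taylor_coeff_mult:
  assumes f: "f holomorphic_on ball 0 1" and g: "g holomorphic_on ball 0 1"
  shows "taylor_coeff (\<lambda>z. f z * g z) n = (\<Sum>i\<le>n. taylor_coeff f i * taylor_coeff g (n - i))"
proof (rule taylor_coeff_unique[of 1])
  fix z :: complex assume z: "z \<in> ball 0 1"
  have "(\<lambda>k. \<Sum>i\<le>k. (taylor_coeff f i * z ^ i) * (taylor_coeff g (k - i) * z ^ (k - i)))
      sums ((\<Sum>k. taylor_coeff f k * z ^ k) * (\<Sum>k. taylor_coeff g k * z ^ k))"
    by (intro Cauchy_product_sums taylor_coeff_abs_summable f g z)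
  moreover have "(\<Sum>k. taylor_coeff f k * z ^ k) = f z" "(\<Sum>k. taylor_coeff g k * z ^ k) = g z"
    using taylor_coeff_sums[OF f z] taylor_coeff_sums[OF g z] by (simp_all add: sums_iff)
  moreover have "(\<Sum>i\<le>k. (taylor_coeff f i * z ^ i) * (taylor_coeff g (k - i) * z ^ (k - i)))
      = (\<Sum>i\<le>k. taylor_coeff f i * taylor_coeff g (k - i)) * z ^ k" for k
    unfolding sum_distrib_right
  proof (rule sum.cong[OF refl])
    fix i assume "i \<in> {..k}"
    then have "z ^ i * z ^ (k - i) = z ^ k" by (simp flip: power_add)
    then show "(taylor_coeff f i * z ^ i) * (taylor_coeff g (k - i) * z ^ (k - i))
        = taylor_coeff f i * taylor_coeff g (k - i) * z ^ k"
      by (metis (no_types, lifting) mult.assoc mult.left_commute)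
  qed
  ultimately show "(\<lambda>n. (\<Sum>i\<le>n. taylor_coeff f i * taylor_coeff g (n - i)) * z ^ n) sums (f z * g z)"
    by simp
qed simp

lemma taylor_coeff_times_id:
  assumes f: "f holomorphic_on ball 0 1"
  shows "taylor_coeff (\<lambda>z. z * f z) n = (if n = 0 then 0 else taylor_coeff f (n - 1))"
proof (rule taylor_coeff_unique[of 1])
  fix z :: complex assume z: "z \<in> ball 0 1"
  let ?a = "\<lambda>n. (if n = 0 then 0 else taylor_coeff f (n - 1)) * z ^ n"
  have "(\<lambda>n. z * (taylor_coeff f n * z ^ n)) sums (z * f z)"
    by (intro sums_mult taylor_coeff_sums f z)
  then have "(\<lambda>n. ?a (Suc n)) sums (z * f z)" by (simp add: mult_ac)
  then show "?a sums (z * f z)" by (subst (asm) sums_Suc_iff) simp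
qed simp

lemma taylor_coeff_deriv:
  assumes f: "f holomorphic_on ball 0 1"
  shows "taylor_coeff (deriv f) n = of_nat (n + 1) * taylor_coeff f (n + 1)"
proof -
  have "(deriv ^^ n) (deriv f) = (deriv ^^ Suc n) f" by (simp only: funpow_Suc_right o_def)
  then have "taylor_coeff (deriv f) n = (deriv ^^ Suc n) f 0 / fact n" by (simp only: taylor_coeff_def)
  also have "\<dots> = of_nat (Suc n) * ((deriv ^^ Suc n) f 0 / fact (Suc n))"
    by (simp only: fact_Suc of_nat_mult) (simp add: field_simps del: of_nat_Suc)
  finally show ?thesis by (simp only: taylor_coeff_def Suc_eq_plus1)
qed

lemma taylor_coeff_deriv_times_id:
  assumes f: "f holomorphic_on ball 0 1"
  shows "taylor_coeff (deriv (\<lambda>z. z * f z)) n = of_nat (n + 1) * taylor_coeff f n"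
  by (subst taylor_coeff_deriv) (auto intro!: holomorphic_intros f simp: taylor_coeff_times_id[OF f])

definition dirichlet_nsq :: "(complex \<Rightarrow> complex) \<Rightarrow> real" where
  "dirichlet_nsq f = (\<Sum>n. real (n + 1) * (cmod (taylor_coeff f n))\<^sup>2)"

text \<open>Coefficient \<open>n\<close> of \<open>(z f)'\<close> is \<open>n + 1\<close> times that
  of \<open>f\<close>, and the area integral divides by \<open>n + 1\<close>; what is left is
  exactly the weight of the norm, Hardy part included.\<close>

lemma nn_integral_deriv_times_id:
  assumes f: "f holomorphic_on ball 0 1"
  shows "(\<integral>\<^sup>+z\<in>ball 0 1. ennreal ((cmod (deriv (\<lambda>z. z * f z) z))\<^sup>2) \<partial>lborel)
       = (\<Sum>n. ennreal (pi * (real (n + 1) * (cmod (taylor_coeff f n))\<^sup>2)))"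
proof (subst nn_integral_unit_disc_holomorphic)
  show "deriv (\<lambda>z. z * f z) holomorphic_on ball 0 1"
    by (intro holomorphic_deriv holomorphic_intros f) simp
  have "pi * (cmod (taylor_coeff (deriv (\<lambda>z. z * f z)) n))\<^sup>2 / real (n + 1)
      = pi * (real (n + 1) * (cmod (taylor_coeff f n))\<^sup>2)" for n
    unfolding taylor_coeff_deriv_times_id[OF f] norm_mult norm_of_nat
    by (simp add: power2_eq_square field_simps)
  then show "(\<Sum>n. ennreal (pi * (cmod (taylor_coeff (deriv (\<lambda>z. z * f z)) n))\<^sup>2 / real (n + 1)))
      = (\<Sum>n. ennreal (pi * (real (n + 1) * (cmod (taylor_coeff f n))\<^sup>2)))"
    by (simp only:)
qed

lemma suminf_ennreal_finite_iff:
  assumes "\<And>n. 0 \<le> c n"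
  shows "(\<Sum>n. ennreal (c n)) < \<infinity> \<longleftrightarrow> summable c"
  unfolding infinity_ennreal_def less_top[symmetric]
  using summable_suminf_not_top[of c] ennreal_suminf_neq_top[of c] assms by blast

text \<open>The coefficients of \<open>f'\<close> produce the first series, the norm produces the
  second. After the index shift the weights are \<open>n\<close> and \<open>n + 1\<close>,
  comparable for \<open>n \<ge> 1\<close>.\<close>

lemma summable_weight_shift_iff:
  fixes b :: "nat \<Rightarrow> real"
  assumes "\<And>n. b n \<ge> 0"
  shows "summable (\<lambda>n. real (n + 1) * b (n + 1)) \<longleftrightarrow> summable (\<lambda>n. real (n + 1) * b n)"
proof
  assume "summable (\<lambda>n. real (n + 1) * b (n + 1))"
  then have "summable (\<lambda>n. real n * b n)"
    using summable_Suc_iff[of "\<lambda>n. real n * b n"] by simp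
  then have "summable (\<lambda>n. 2 * (real n * b n))" by (rule summable_mult)
  then show "summable (\<lambda>n. real (n + 1) * b n)"
  proof (rule summable_comparison_test'[where N=1])
    fix n :: nat assume "1 \<le> n"
    then have "real (n + 1) * b n \<le> (2 * real n) * b n"
      using assms by (intro mult_right_mono) auto
    then show "norm (real (n + 1) * b n) \<le> 2 * (real n * b n)"
      using assms by (simp add: abs_mult)
  qed
next
  assume "summable (\<lambda>n. real (n + 1) * b n)"
  then have "summable (\<lambda>n. real n * b n)"
    by (rule summable_comparison_test') (use assms in \<open>auto simp: abs_mult intro!: mult_right_mono\<close>)
  then show "summable (\<lambda>n. real (n + 1) * b (n + 1))"
    using summable_Suc_iff[of "\<lambda>n. real n * b n"] by simp
qed

text \<open>Integrability of \<open>|f'|^2\<close> controls the whole norm, since differentiation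
  loses only the constant coefficient. From here on area measure enters only through the bound for
  multiplication operators.\<close>

theorem dirichlet_space_iff:
  "f \<in> dirichlet_space \<longleftrightarrow> f holomorphic_on ball 0 1 \<and> (\<forall>z. z \<notin> ball 0 1 \<longrightarrow> f z = 0)
     \<and> summable (\<lambda>n. real (n + 1) * (cmod (taylor_coeff f n))\<^sup>2)"
proof -
  have "set_integrable lborel (ball 0 1) (\<lambda>z. (cmod (deriv f z))\<^sup>2)
      \<longleftrightarrow> summable (\<lambda>n. real (n + 1) * (cmod (taylor_coeff f n))\<^sup>2)"
    if f: "f holomorphic_on ball 0 1"
  proof -
    let ?b = "\<lambda>n. (cmod (taylor_coeff f n))\<^sup>2"
    have hd: "deriv f holomorphic_on ball 0 1" by (intro holomorphic_deriv f) simp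
    have nn: "(\<integral>\<^sup>+z. ennreal (norm (indicator (ball 0 1) z *\<^sub>R (cmod (deriv f z))\<^sup>2)) \<partial>lborel)
        = (\<Sum>n. ennreal (pi * (real (n + 1) * ?b (n + 1))))"
    proof -
      have "(\<integral>\<^sup>+z. ennreal (norm (indicator (ball 0 1) z *\<^sub>R (cmod (deriv f z))\<^sup>2)) \<partial>lborel)
          = (\<integral>\<^sup>+z\<in>ball 0 1. ennreal ((cmod (deriv f z))\<^sup>2) \<partial>lborel)"
        by (rule nn_integral_cong) (auto simp: indicator_def)
      also have "\<dots> = (\<Sum>n. ennreal (pi * (cmod (taylor_coeff (deriv f) n))\<^sup>2 / real (n + 1)))"
        by (rule nn_integral_unit_disc_holomorphic[OF hd])
      also have "(\<lambda>n. pi * (cmod (taylor_coeff (deriv f) n))\<^sup>2 / real (n + 1))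
          = (\<lambda>n. pi * (real (n + 1) * ?b (n + 1)))"
      proof
        show "pi * (cmod (taylor_coeff (deriv f) n))\<^sup>2 / real (n + 1) = pi * (real (n + 1) * ?b (n + 1))" for n
          unfolding taylor_coeff_deriv[OF f] norm_mult norm_of_nat
          by (simp add: power2_eq_square)
      qed
      finally show ?thesis .
    qed
    have "(\<lambda>z. indicator (ball 0 1) z *\<^sub>R (cmod (deriv f z))\<^sup>2) \<in> borel_measurable borel"
      by (intro borel_measurable_continuous_on_indicator continuous_intros
          holomorphic_on_imp_continuous_on hd) simp
    then have "set_integrable lborel (ball 0 1) (\<lambda>z. (cmod (deriv f z))\<^sup>2)
        \<longleftrightarrow> (\<Sum>n. ennreal (pi * (real (n + 1) * ?b (n + 1)))) < \<infinity>"
      unfolding set_integrable_def integrable_iff_bounded nn by simp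
    also have "\<dots> \<longleftrightarrow> summable (\<lambda>n. pi * (real (n + 1) * ?b (n + 1)))"
      by (rule suminf_ennreal_finite_iff) simp
    also have "\<dots> \<longleftrightarrow> summable (\<lambda>n. real (n + 1) * ?b (n + 1))"
      by (subst summable_cmult_iff) simp
    also have "\<dots> \<longleftrightarrow> summable (\<lambda>n. real (n + 1) * ?b n)"
      by (rule summable_weight_shift_iff) simp
    finally show ?thesis .
  qed
  then show ?thesis unfolding dirichlet_space_def by blast
qed

lemma dirichlet_space_holomorphic: "f \<in> dirichlet_space \<Longrightarrow> f holomorphic_on ball 0 1"
  and dirichlet_space_outside: "f \<in> dirichlet_space \<Longrightarrow> z \<notin> ball 0 1 \<Longrightarrow> f z = 0"
  and dirichlet_space_summable:
    "f \<in> dirichlet_space \<Longrightarrow> summable (\<lambda>n. real (n + 1) * (cmod (taylor_coeff f n))\<^sup>2)"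
  unfolding dirichlet_space_iff by auto

lemma dirichlet_space_eqI:
  assumes "f \<in> dirichlet_space" "g \<in> dirichlet_space" "\<And>n. taylor_coeff f n = taylor_coeff g n"
  shows "f = g"
proof
  fix z
  show "f z = g z"
  proof (cases "z \<in> ball 0 1")
    case True
    then show ?thesis
      using taylor_coeff_sums[OF dirichlet_space_holomorphic[OF assms(1)] True]
        taylor_coeff_sums[OF dirichlet_space_holomorphic[OF assms(2)] True]
      by (simp add: assms(3) sums_unique2)
  qed (use assms(1,2) in \<open>simp add: dirichlet_space_outside\<close>)
qed

lemma summable_weighted_add:
  fixes a b :: "nat \<Rightarrow> complex"
  assumes "summable (\<lambda>n. real (n + 1) * (cmod (a n))\<^sup>2)" "summable (\<lambda>n. real (n + 1) * (cmod (b n))\<^sup>2)"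
  shows "summable (\<lambda>n. real (n + 1) * (cmod (a n + b n))\<^sup>2)"
proof (rule summable_comparison_test'[where N=0])
  show "summable (\<lambda>n. 2 * (real (n + 1) * (cmod (a n))\<^sup>2) + 2 * (real (n + 1) * (cmod (b n))\<^sup>2))"
    by (intro summable_add summable_mult assms)
  fix n
  have "(cmod (a n + b n))\<^sup>2 \<le> (cmod (a n) + cmod (b n))\<^sup>2"
    by (intro power_mono norm_triangle_ineq) simp
  also have "\<dots> \<le> 2 * (cmod (a n))\<^sup>2 + 2 * (cmod (b n))\<^sup>2"
    using sum_squares_bound[of "cmod (a n)" "cmod (b n)"] by (simp add: power2_sum)
  finally have "real (n + 1) * (cmod (a n + b n))\<^sup>2
      \<le> real (n + 1) * (2 * (cmod (a n))\<^sup>2 + 2 * (cmod (b n))\<^sup>2)"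
    by (intro mult_left_mono) auto
  then show "norm (real (n + 1) * (cmod (a n + b n))\<^sup>2)
      \<le> 2 * (real (n + 1) * (cmod (a n))\<^sup>2) + 2 * (real (n + 1) * (cmod (b n))\<^sup>2)"
    by (simp add: algebra_simps abs_mult)
qed

lemma dirichlet_space_zero [simp, intro]: "(\<lambda>z. 0) \<in> dirichlet_space"
  by (simp add: dirichlet_space_iff)

lemma dirichlet_space_add:
  assumes "f \<in> dirichlet_space" "g \<in> dirichlet_space"
  shows "(\<lambda>z. f z + g z) \<in> dirichlet_space"
  using assms summable_weighted_add[of "taylor_coeff f" "taylor_coeff g"]
  by (auto simp: dirichlet_space_iff taylor_coeff_add intro!: holomorphic_intros)

lemma dirichlet_space_cmult:
  assumes "f \<in> dirichlet_space"
  shows "(\<lambda>z. c * f z) \<in> dirichlet_space"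
proof -
  have "summable (\<lambda>n. (cmod c)\<^sup>2 * (real (n + 1) * (cmod (taylor_coeff f n))\<^sup>2))"
    by (intro summable_mult dirichlet_space_summable assms)
  then have "summable (\<lambda>n. real (n + 1) * (cmod (c * taylor_coeff f n))\<^sup>2)"
    by (simp add: norm_mult power_mult_distrib mult_ac)
  then show ?thesis
    using assms by (auto simp: dirichlet_space_iff taylor_coeff_cmult intro!: holomorphic_intros)
qed

lemma dirichlet_space_diff:
  assumes "f \<in> dirichlet_space" "g \<in> dirichlet_space"
  shows "(\<lambda>z. f z - g z) \<in> dirichlet_space"
  using dirichlet_space_add[OF assms(1) dirichlet_space_cmult[OF assms(2), of "-1"]] by simp

lemma dirichlet_space_of_coeffs:
  assumes "summable (\<lambda>n. real (n + 1) * (cmod (a n))\<^sup>2)"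
  obtains f where "f \<in> dirichlet_space" "\<And>n. taylor_coeff f n = a n"
proof -
  define f where "f = disc_ext (\<lambda>z. \<Sum>n. a n * z ^ n)"
  have "(\<lambda>n. real (n + 1) * (cmod (a n))\<^sup>2) \<longlonglongrightarrow> 0" by (rule summable_LIMSEQ_zero[OF assms])
  then have "Bseq (\<lambda>n. real (n + 1) * (cmod (a n))\<^sup>2)" by (intro convergent_imp_Bseq convergentI)
  then obtain K where K: "\<And>n. norm (real (n + 1) * (cmod (a n))\<^sup>2) \<le> K" unfolding Bseq_def by blast
  \<comment> \<open>Bounded coefficients suffice for convergence in the open disc;
    \<open>2 t \<le> t^2 + 1\<close> trades the bound on squares for one on moduli.\<close>
  have Ka: "cmod (a n) \<le> K + 1" for n
  proof -
    have "(cmod (a n))\<^sup>2 \<le> real (n + 1) * (cmod (a n))\<^sup>2" by (simp add: algebra_simps)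
    also have "\<dots> \<le> K" using K[of n] by simp
    finally have "(cmod (a n))\<^sup>2 \<le> K" .
    moreover have "2 * cmod (a n) \<le> (cmod (a n))\<^sup>2 + 1"
      using sum_squares_bound[of "cmod (a n)" 1] by simp
    moreover have "0 \<le> K" using calculation by (meson order_trans zero_le_power2)
    ultimately show ?thesis by linarith
  qed
  have sums: "(\<lambda>n. a n * z ^ n) sums (\<Sum>n. a n * z ^ n)" if "z \<in> ball 0 1" for z
  proof (rule summable_sums, rule summable_comparison_test'[where N=0])
    show "summable (\<lambda>n. (K + 1) * cmod z ^ n)"
      using that by (intro summable_mult summable_geometric) auto
    show "norm (a n * z ^ n) \<le> (K + 1) * cmod z ^ n" for n
      using Ka[of n] by (auto simp: norm_mult norm_power intro!: mult_right_mono)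
  qed
  have hol: "f holomorphic_on ball 0 1"
    unfolding f_def holomorphic_disc_ext
    by (rule power_series_holomorphic[where a=a]) (use sums in simp)
  have tc: "taylor_coeff f n = a n" for n
    by (rule taylor_coeff_unique[of 1]) (use sums in \<open>auto simp: f_def disc_ext_def\<close>)
  have "f \<in> dirichlet_space"
    unfolding dirichlet_space_iff tc using hol assms by (auto simp: f_def disc_ext_outside)
  then show ?thesis using tc that by blast
qed

definition dmono :: "nat \<Rightarrow> complex \<Rightarrow> complex" where
  "dmono k = disc_ext (\<lambda>z. z ^ k)"

lemma taylor_coeff_dmono: "taylor_coeff (dmono k) n = (if n = k then 1 else 0)"
  unfolding dmono_def by (subst taylor_coeff_disc_ext) (auto intro!: holomorphic_intros simp: taylor_coeff_monomial)

lemma dmono_in [simp, intro]: "dmono k \<in> dirichlet_space"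
  unfolding dirichlet_space_iff taylor_coeff_dmono
proof (intro conjI)
  show "dmono k holomorphic_on ball 0 1"
    unfolding dmono_def holomorphic_disc_ext by (intro holomorphic_intros)
  show "summable (\<lambda>n. real (n + 1) * (cmod (if n = k then 1 else 0))\<^sup>2)"
    by (rule summable_finite[of "{k}"]) auto
qed (auto simp: dmono_def disc_ext_def)

lemma dirichlet_inner_summable:
  assumes f: "f \<in> dirichlet_space" and g: "g \<in> dirichlet_space"
  shows "summable (\<lambda>n. norm (of_nat (n + 1) * taylor_coeff f n * cnj (taylor_coeff g n)))"
proof (rule summable_comparison_test'[where N=0])
  let ?u = "\<lambda>f n. real (n + 1) * (cmod (taylor_coeff f n))\<^sup>2"
  show "summable (\<lambda>n. ?u f n + ?u g n)" by (intro summable_add dirichlet_space_summable f g)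
  fix n
  have "cmod (taylor_coeff f n) * cmod (taylor_coeff g n)
      \<le> (cmod (taylor_coeff f n))\<^sup>2 + (cmod (taylor_coeff g n))\<^sup>2"
    using sum_squares_bound[of "cmod (taylor_coeff f n)" "cmod (taylor_coeff g n)"]
      mult_nonneg_nonneg[OF norm_ge_zero[of "taylor_coeff f n"] norm_ge_zero[of "taylor_coeff g n"]]
    by linarith
  then have "real (n + 1) * (cmod (taylor_coeff f n) * cmod (taylor_coeff g n))
      \<le> real (n + 1) * ((cmod (taylor_coeff f n))\<^sup>2 + (cmod (taylor_coeff g n))\<^sup>2)"
    by (intro mult_left_mono) auto
  then show "norm (norm (of_nat (n + 1) * taylor_coeff f n * cnj (taylor_coeff g n))) \<le> ?u f n + ?u g n"
    unfolding norm_mult norm_of_nat complex_mod_cnj by (simp add: distrib_left mult_ac)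
qed

lemma dirichlet_inner_sums:
  assumes "f \<in> dirichlet_space" "g \<in> dirichlet_space"
  shows "(\<lambda>n. of_nat (n + 1) * taylor_coeff f n * cnj (taylor_coeff g n)) sums dirichlet_inner f g"
  unfolding dirichlet_inner_def
  by (rule summable_sums[OF summable_norm_cancel[OF dirichlet_inner_summable[OF assms]]])

lemma dirichlet_inner_add_left:
  assumes "f \<in> dirichlet_space" "g \<in> dirichlet_space" "h \<in> dirichlet_space"
  shows "dirichlet_inner (\<lambda>z. f z + g z) h = dirichlet_inner f h + dirichlet_inner g h"
proof -
  have "(\<lambda>n. of_nat (n + 1) * taylor_coeff (\<lambda>z. f z + g z) n * cnj (taylor_coeff h n))
     sums (dirichlet_inner f h + dirichlet_inner g h)"
    using sums_add[OF dirichlet_inner_sums[OF assms(1,3)] dirichlet_inner_sums[OF assms(2,3)]] assms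
    by (simp add: taylor_coeff_add dirichlet_space_holomorphic algebra_simps)
  then show ?thesis
    using dirichlet_inner_sums[OF dirichlet_space_add[OF assms(1,2)] assms(3)] by (rule sums_unique2[symmetric])
qed

lemma dirichlet_inner_cmult_left:
  assumes "f \<in> dirichlet_space" "h \<in> dirichlet_space"
  shows "dirichlet_inner (\<lambda>z. c * f z) h = c * dirichlet_inner f h"
proof -
  have "(\<lambda>n. of_nat (n + 1) * taylor_coeff (\<lambda>z. c * f z) n * cnj (taylor_coeff h n))
     sums (c * dirichlet_inner f h)"
    using sums_mult[OF dirichlet_inner_sums[OF assms(1,2)], of c] assms
    by (simp add: taylor_coeff_cmult dirichlet_space_holomorphic algebra_simps)
  then show ?thesis
    using dirichlet_inner_sums[OF dirichlet_space_cmult[OF assms(1)] assms(2)] by (rule sums_unique2[symmetric])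
qed

lemma dirichlet_inner_cnj:
  assumes "f \<in> dirichlet_space" "g \<in> dirichlet_space"
  shows "cnj (dirichlet_inner f g) = dirichlet_inner g f"
proof -
  have "(\<lambda>n. cnj (of_nat (n + 1) * taylor_coeff f n * cnj (taylor_coeff g n))) sums cnj (dirichlet_inner f g)"
    unfolding sums_cnj by (rule dirichlet_inner_sums[OF assms])
  then have "(\<lambda>n. of_nat (n + 1) * taylor_coeff g n * cnj (taylor_coeff f n)) sums cnj (dirichlet_inner f g)"
    by (simp add: mult_ac)
  then show ?thesis using dirichlet_inner_sums[OF assms(2,1)] by (rule sums_unique2)
qed

lemma dirichlet_inner_add_right:
  assumes "f \<in> dirichlet_space" "g \<in> dirichlet_space" "h \<in> dirichlet_space"
  shows "dirichlet_inner h (\<lambda>z. f z + g z) = dirichlet_inner h f + dirichlet_inner h g"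
  using arg_cong[OF dirichlet_inner_add_left[OF assms], of cnj] assms
  by (simp add: dirichlet_inner_cnj dirichlet_space_add)

lemma dirichlet_inner_cmult_right:
  assumes "f \<in> dirichlet_space" "h \<in> dirichlet_space"
  shows "dirichlet_inner h (\<lambda>z. c * f z) = cnj c * dirichlet_inner h f"
  using arg_cong[OF dirichlet_inner_cmult_left[OF assms], of cnj] assms
  by (simp add: dirichlet_inner_cnj dirichlet_space_cmult)

lemma dirichlet_inner_diff_left:
  assumes "f \<in> dirichlet_space" "g \<in> dirichlet_space" "h \<in> dirichlet_space"
  shows "dirichlet_inner (\<lambda>z. f z - g z) h = dirichlet_inner f h - dirichlet_inner g h"
  using dirichlet_inner_add_left[OF assms(1) dirichlet_space_cmult[OF assms(2), of "-1"] assms(3)]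
    dirichlet_inner_cmult_left[OF assms(2,3), of "-1"] by simp

lemma dirichlet_inner_diff_right:
  assumes "f \<in> dirichlet_space" "g \<in> dirichlet_space" "h \<in> dirichlet_space"
  shows "dirichlet_inner h (\<lambda>z. f z - g z) = dirichlet_inner h f - dirichlet_inner h g"
  using dirichlet_inner_add_right[OF assms(1) dirichlet_space_cmult[OF assms(2), of "-1"] assms(3)]
    dirichlet_inner_cmult_right[OF assms(2,3), of "-1"] by simp

lemma dirichlet_inner_zero [simp]: "dirichlet_inner (\<lambda>z. 0) f = 0" "dirichlet_inner f (\<lambda>z. 0) = 0"
  by (simp_all add: dirichlet_inner_def)

lemma dirichlet_inner_dmono:
  assumes "f \<in> dirichlet_space"
  shows "dirichlet_inner f (dmono k) = of_nat (k + 1) * taylor_coeff f k"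
proof -
  have "(\<lambda>n. if n = k then of_nat (n + 1) * taylor_coeff f n else 0) sums (of_nat (k + 1) * taylor_coeff f k)"
    by (rule sums_single)
  then have "(\<lambda>n. of_nat (n + 1) * taylor_coeff f n * cnj (taylor_coeff (dmono k) n))
      sums (of_nat (k + 1) * taylor_coeff f k)"
    by (simp add: taylor_coeff_dmono if_distrib[of "\<lambda>c. _ * c"] if_distrib[of cnj] cong: if_cong)
  then show ?thesis using dirichlet_inner_sums[OF assms dmono_in[of k]] by (rule sums_unique2[symmetric])
qed

lemma dirichlet_inner_self:
  assumes "f \<in> dirichlet_space"
  shows "dirichlet_inner f f = of_real (dirichlet_nsq f)"
proof -
  have "(\<lambda>n. complex_of_real (real (n + 1) * (cmod (taylor_coeff f n))\<^sup>2)) sums of_real (dirichlet_nsq f)"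
    unfolding dirichlet_nsq_def by (intro sums_of_real summable_sums dirichlet_space_summable assms)
  moreover have "complex_of_real (real (n + 1) * (cmod (taylor_coeff f n))\<^sup>2)
      = of_nat (n + 1) * taylor_coeff f n * cnj (taylor_coeff f n)" for n
    unfolding of_real_mult complex_norm_square by (simp add: mult.assoc)
  ultimately have "(\<lambda>n. of_nat (n + 1) * taylor_coeff f n * cnj (taylor_coeff f n)) sums of_real (dirichlet_nsq f)"
    by (simp only:)
  then show ?thesis using dirichlet_inner_sums[OF assms assms] by (rule sums_unique2[symmetric])
qed

lemma dirichlet_nsq_nonneg:
  assumes "f \<in> dirichlet_space" shows "dirichlet_nsq f \<ge> 0"
  unfolding dirichlet_nsq_def by (intro suminf_nonneg dirichlet_space_summable assms) auto

lemma coeff_le_dirichlet_nsq: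
  assumes "f \<in> dirichlet_space" shows "real (n + 1) * (cmod (taylor_coeff f n))\<^sup>2 \<le> dirichlet_nsq f"
proof -
  have "(\<Sum>k\<in>{n}. real (k + 1) * (cmod (taylor_coeff f k))\<^sup>2) \<le> dirichlet_nsq f"
    unfolding dirichlet_nsq_def by (intro sum_le_suminf dirichlet_space_summable assms) auto
  then show ?thesis by simp
qed

lemma dirichlet_nsq_eq_0:
  assumes "f \<in> dirichlet_space" "dirichlet_nsq f = 0" shows "f = (\<lambda>z. 0)"
proof (rule dirichlet_space_eqI[OF assms(1)])
  fix n
  have "real (n + 1) * (cmod (taylor_coeff f n))\<^sup>2 \<le> 0"
    using coeff_le_dirichlet_nsq[OF assms(1), of n] assms(2) by simp
  then have "(cmod (taylor_coeff f n))\<^sup>2 \<le> 0" by (simp add: mult_le_0_iff)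
  then show "taylor_coeff f n = taylor_coeff (\<lambda>z. 0) n" by simp
qed simp

lemma dirichlet_norm_nsq: "dirichlet_norm f = sqrt (dirichlet_nsq f)"
  by (simp add: dirichlet_norm_def dirichlet_nsq_def)

lemma dirichlet_nsq_diff_cmult:
  assumes "f \<in> dirichlet_space" "g \<in> dirichlet_space"
  shows "dirichlet_nsq (\<lambda>z. f z - t * g z)
       = dirichlet_nsq f - 2 * Re (cnj t * dirichlet_inner f g) + (cmod t)\<^sup>2 * dirichlet_nsq g"
proof -
  note tg = dirichlet_space_cmult[OF assms(2), of t]
  have "complex_of_real (dirichlet_nsq (\<lambda>z. f z - t * g z))
      = dirichlet_inner f f - cnj t * dirichlet_inner f g - t * dirichlet_inner g f + t * cnj t * dirichlet_inner g g"
    using assms tg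
    by (simp add: dirichlet_space_diff flip: dirichlet_inner_self)
       (simp add: dirichlet_inner_diff_left dirichlet_inner_diff_right dirichlet_space_diff
          dirichlet_inner_cmult_left dirichlet_inner_cmult_right algebra_simps)
  also have "\<dots> = complex_of_real (dirichlet_nsq f) - (cnj t * dirichlet_inner f g + cnj (cnj t * dirichlet_inner f g))
      + complex_of_real ((cmod t)\<^sup>2) * complex_of_real (dirichlet_nsq g)"
    using assms unfolding complex_norm_square
    by (simp add: dirichlet_inner_self dirichlet_inner_cnj algebra_simps)
  also have "\<dots> = complex_of_real (dirichlet_nsq f - 2 * Re (cnj t * dirichlet_inner f g)
      + (cmod t)\<^sup>2 * dirichlet_nsq g)"
    by (simp only: complex_add_cnj of_real_add of_real_diff of_real_mult)
  finally show ?thesis by (simp only: of_real_eq_iff)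
qed

text \<open>With \<open>t\<close> the projection coefficient, a lower bound on the distance from \<open>f\<close> to the line
  through \<open>g\<close> bounds the inner product. The bound \<open>d = 0\<close> is the Cauchy-Schwarz inequality.\<close>
lemma dirichlet_inner_bound:
  assumes f: "f \<in> dirichlet_space" and g: "g \<in> dirichlet_space"
    and d: "\<And>t. d \<le> dirichlet_nsq (\<lambda>z. f z - t * g z)"
  shows "(cmod (dirichlet_inner f g))\<^sup>2 \<le> dirichlet_nsq g * (dirichlet_nsq f - d)"
proof (cases "dirichlet_nsq g = 0")
  case True
  then have "g = (\<lambda>z. 0)" by (rule dirichlet_nsq_eq_0[OF g])
  then show ?thesis by (simp add: dirichlet_nsq_def)
next
  case False
  then have pos: "dirichlet_nsq g > 0" using dirichlet_nsq_nonneg[OF g] by simp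
  define t where "t = dirichlet_inner f g / of_real (dirichlet_nsq g)"
  have "Re (cnj t * dirichlet_inner f g) = (cmod (dirichlet_inner f g))\<^sup>2 / dirichlet_nsq g"
  proof -
    have "cnj t * dirichlet_inner f g = (dirichlet_inner f g * cnj (dirichlet_inner f g)) / of_real (dirichlet_nsq g)"
      by (simp add: t_def)
    also have "\<dots> = of_real ((cmod (dirichlet_inner f g))\<^sup>2 / dirichlet_nsq g)"
      by (simp only: complex_norm_square[symmetric] of_real_divide)
    finally show ?thesis by (simp only: Re_complex_of_real)
  qed
  moreover have "(cmod t)\<^sup>2 * dirichlet_nsq g = (cmod (dirichlet_inner f g))\<^sup>2 / dirichlet_nsq g"
    using pos by (simp add: t_def norm_divide power_divide power2_eq_square)
  ultimately have "d \<le> dirichlet_nsq f - (cmod (dirichlet_inner f g))\<^sup>2 / dirichlet_nsq g"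
    using d[of t] dirichlet_nsq_diff_cmult[OF f g, of t] by simp
  then show ?thesis using pos by (simp add: field_simps)
qed

lemma dirichlet_Cauchy_Schwarz:
  assumes f: "f \<in> dirichlet_space" and g: "g \<in> dirichlet_space"
  shows "(cmod (dirichlet_inner f g))\<^sup>2 \<le> dirichlet_nsq f * dirichlet_nsq g"
  using dirichlet_inner_bound[OF f g, of 0]
  by (simp add: dirichlet_nsq_nonneg dirichlet_space_diff dirichlet_space_cmult f g mult.commute)

section \<open>Orthogonal projections\<close>

lemma dirichlet_nsq_diff_commute:
  assumes "f \<in> dirichlet_space" "g \<in> dirichlet_space"
  shows "dirichlet_nsq (\<lambda>z. f z - g z) = dirichlet_nsq (\<lambda>z. g z - f z)"
  using assms unfolding dirichlet_nsq_def
  by (simp add: taylor_coeff_diff dirichlet_space_holomorphic norm_minus_commute)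

lemma dirichlet_nsq_parallelogram:
  assumes "f \<in> dirichlet_space" "g \<in> dirichlet_space"
  shows "dirichlet_nsq (\<lambda>z. f z + g z) + dirichlet_nsq (\<lambda>z. f z - g z) = 2 * dirichlet_nsq f + 2 * dirichlet_nsq g"
  using dirichlet_nsq_diff_cmult[OF assms, of 1] dirichlet_nsq_diff_cmult[OF assms, of "-1"] by simp

lemma dirichlet_nsq_cmult:
  assumes "f \<in> dirichlet_space"
  shows "dirichlet_nsq (\<lambda>z. c * f z) = (cmod c)\<^sup>2 * dirichlet_nsq f"
  using dirichlet_nsq_diff_cmult[OF dirichlet_space_zero assms, of "-c"] by (simp add: dirichlet_nsq_def)

text \<open>Completeness of a weighted \<open>l^2\<close>: coefficients converge one by one, finite
  partial sums pass to the limit in \<open>j\<close>, and the bound \<open>e\<close>, uniform in the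
  length \<open>m\<close>, then holds for the full series.\<close>

lemma dirichlet_space_complete:
  assumes F: "\<And>k. F k \<in> dirichlet_space"
    and Cauchy: "\<And>e. e > 0 \<Longrightarrow> \<exists>N. \<forall>i\<ge>N. \<forall>j\<ge>N. dirichlet_nsq (\<lambda>z. F i z - F j z) < e"
  obtains f where "f \<in> dirichlet_space" "(\<lambda>k. dirichlet_nsq (\<lambda>z. F k z - f z)) \<longlonglongrightarrow> 0"
proof -
  define c where "c i n = taylor_coeff (F i) n" for i n
  have cd: "taylor_coeff (\<lambda>z. F i z - F j z) n = c i n - c j n" for i j n
    using F by (simp add: c_def taylor_coeff_diff dirichlet_space_holomorphic)
  have "convergent (\<lambda>i. c i n)" for n
  proof -
    have "Cauchy (\<lambda>i. c i n)"
    proof (rule CauchyI)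
      fix e :: real assume e: "e > 0"
      then obtain N where N: "\<And>i j. i \<ge> N \<Longrightarrow> j \<ge> N \<Longrightarrow> dirichlet_nsq (\<lambda>z. F i z - F j z) < e\<^sup>2"
        using Cauchy[of "e\<^sup>2"] by auto
      show "\<exists>N. \<forall>i\<ge>N. \<forall>j\<ge>N. norm (c i n - c j n) < e"
      proof (intro exI allI impI)
        fix i j assume ij: "i \<ge> N" "j \<ge> N"
        have "(cmod (c i n - c j n))\<^sup>2 \<le> real (n + 1) * (cmod (c i n - c j n))\<^sup>2"
          by (simp add: algebra_simps)
        also have "\<dots> \<le> dirichlet_nsq (\<lambda>z. F i z - F j z)"
          using coeff_le_dirichlet_nsq[OF dirichlet_space_diff[OF F F], of n i j] by (simp only: cd)
        also have "\<dots> < e\<^sup>2" using N ij by simp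
        finally show "norm (c i n - c j n) < e" using e by (simp add: power_less_imp_less_base)
      qed
    qed
    then show ?thesis by (rule Cauchy_convergent)
  qed
  then obtain a where a: "\<And>n. (\<lambda>i. c i n) \<longlonglongrightarrow> a n" unfolding convergent_def by metis
  have bound: "\<exists>N. \<forall>i\<ge>N. summable (\<lambda>n. real (n + 1) * (cmod (c i n - a n))\<^sup>2)
      \<and> (\<Sum>n. real (n + 1) * (cmod (c i n - a n))\<^sup>2) \<le> e" if e: "e > 0" for e
  proof -
    obtain N where N: "\<And>i j. i \<ge> N \<Longrightarrow> j \<ge> N \<Longrightarrow> dirichlet_nsq (\<lambda>z. F i z - F j z) < e"
      using Cauchy[OF e] by auto
    have part: "(\<Sum>n<m. real (n + 1) * (cmod (c i n - a n))\<^sup>2) \<le> e" if i: "i \<ge> N" for i m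
    proof (rule LIMSEQ_le_const2)
      show "(\<lambda>j. \<Sum>n<m. real (n + 1) * (cmod (c i n - c j n))\<^sup>2)
          \<longlonglongrightarrow> (\<Sum>n<m. real (n + 1) * (cmod (c i n - a n))\<^sup>2)"
        by (intro tendsto_intros a)
      show "\<exists>N. \<forall>j\<ge>N. (\<Sum>n<m. real (n + 1) * (cmod (c i n - c j n))\<^sup>2) \<le> e"
      proof (intro exI allI impI)
        fix j assume j: "j \<ge> N"
        have "(\<Sum>n<m. real (n + 1) * (cmod (c i n - c j n))\<^sup>2) \<le> dirichlet_nsq (\<lambda>z. F i z - F j z)"
          unfolding dirichlet_nsq_def cd[symmetric]
          by (intro sum_le_suminf dirichlet_space_summable dirichlet_space_diff F) auto
        also have "\<dots> < e" using N i j by simp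
        finally show "(\<Sum>n<m. real (n + 1) * (cmod (c i n - c j n))\<^sup>2) \<le> e" by simp
      qed
    qed
    show ?thesis
    proof (intro exI allI impI conjI)
      fix i assume i: "i \<ge> N"
      show s: "summable (\<lambda>n. real (n + 1) * (cmod (c i n - a n))\<^sup>2)"
        by (rule bounded_imp_summable[where B=e]) (use part[OF i, of "Suc m" for m] in \<open>auto simp: lessThan_Suc_atMost\<close>)
      show "(\<Sum>n. real (n + 1) * (cmod (c i n - a n))\<^sup>2) \<le> e"
        by (rule suminf_le_const[OF s part[OF i]])
    qed
  qed
  obtain N where N: "summable (\<lambda>n. real (n + 1) * (cmod (c N n - a n))\<^sup>2)"
    using bound[of 1] by auto
  have "summable (\<lambda>n. real (n + 1) * (cmod ((a n - c N n) + c N n))\<^sup>2)"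
    by (rule summable_weighted_add)
       (use N dirichlet_space_summable[OF F] in \<open>auto simp: norm_minus_commute c_def\<close>)
  then have "summable (\<lambda>n. real (n + 1) * (cmod (a n))\<^sup>2)" by simp
  then obtain f where f: "f \<in> dirichlet_space" and fa: "\<And>n. taylor_coeff f n = a n"
    by (rule dirichlet_space_of_coeffs) blast
  have nsq: "dirichlet_nsq (\<lambda>z. F i z - f z) = (\<Sum>n. real (n + 1) * (cmod (c i n - a n))\<^sup>2)" for i
    unfolding dirichlet_nsq_def
    using F f by (simp add: c_def taylor_coeff_diff dirichlet_space_holomorphic fa)
  have "(\<lambda>k. dirichlet_nsq (\<lambda>z. F k z - f z)) \<longlonglongrightarrow> 0"
  proof (rule LIMSEQ_I)
    fix e :: real assume "e > 0"
    then obtain N where N: "\<And>i. i \<ge> N \<Longrightarrow> dirichlet_nsq (\<lambda>z. F i z - f z) \<le> e / 2"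
      using bound[of "e / 2"] by (auto simp: nsq)
    have "norm (dirichlet_nsq (\<lambda>z. F i z - f z) - 0) < e" if "i \<ge> N" for i
      using N[OF that] dirichlet_nsq_nonneg[OF dirichlet_space_diff[OF F f], of i] \<open>e > 0\<close> by simp
    then show "\<exists>N. \<forall>i\<ge>N. norm (dirichlet_nsq (\<lambda>z. F i z - f z) - 0) < e" by blast
  qed
  then show ?thesis using f that by blast
qed

lemma tendsto_const_over_Suc: "(\<lambda>k. C * (1 / real (Suc k))) \<longlonglongrightarrow> 0"
proof -
  have "(\<lambda>k. C * inverse (real (Suc k))) \<longlonglongrightarrow> C * 0"
    by (intro tendsto_mult tendsto_const LIMSEQ_inverse_real_of_nat)
  then show ?thesis by (simp only: mult_zero_right inverse_eq_divide)
qed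

lemma tendsto_zero_sandwich:
  fixes a b :: "nat \<Rightarrow> real"
  assumes "\<And>k. a k \<le> b k" "b \<longlonglongrightarrow> 0" "\<And>k. 0 \<le> a k"
  shows "a \<longlonglongrightarrow> 0"
  by (rule tendsto_sandwich[OF _ _ tendsto_const assms(2)]) (use assms in simp_all)

lemma closed_subspace_in_space: "closed_subspace M \<Longrightarrow> f \<in> M \<Longrightarrow> f \<in> dirichlet_space"
  and closed_subspace_zero: "closed_subspace M \<Longrightarrow> (\<lambda>z. 0) \<in> M"
  and closed_subspace_add: "closed_subspace M \<Longrightarrow> f \<in> M \<Longrightarrow> g \<in> M \<Longrightarrow> (\<lambda>z. f z + g z) \<in> M"
  and closed_subspace_cmult: "closed_subspace M \<Longrightarrow> f \<in> M \<Longrightarrow> (\<lambda>z. c * f z) \<in> M"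
  unfolding closed_subspace_def by auto

lemma closed_subspace_diff:
  "closed_subspace M \<Longrightarrow> f \<in> M \<Longrightarrow> g \<in> M \<Longrightarrow> (\<lambda>z. f z - g z) \<in> M"
  using closed_subspace_add[of M f "\<lambda>z. -1 * g z"] closed_subspace_cmult[of M g "-1"] by simp

lemma closed_subspace_limit:
  assumes "closed_subspace M" "\<And>k. F k \<in> M" "f \<in> dirichlet_space"
    "(\<lambda>k. dirichlet_nsq (\<lambda>z. F k z - f z)) \<longlonglongrightarrow> 0"
  shows "f \<in> M"
proof -
  have "(\<lambda>k. dirichlet_norm (\<lambda>z. F k z - f z)) \<longlonglongrightarrow> 0"
    using tendsto_real_sqrt[OF assms(4)] by (simp add: dirichlet_norm_nsq)
  then show ?thesis using assms unfolding closed_subspace_def by blast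
qed

lemma dirichlet_inner_tendsto_zero:
  assumes F: "\<And>k. F k \<in> dirichlet_space" and h: "h \<in> dirichlet_space"
    and lim: "(\<lambda>k. dirichlet_nsq (F k)) \<longlonglongrightarrow> 0"
  shows "(\<lambda>k. dirichlet_inner (F k) h) \<longlonglongrightarrow> 0"
proof -
  have "(\<lambda>k. (cmod (dirichlet_inner (F k) h))\<^sup>2) \<longlonglongrightarrow> 0"
  proof (rule tendsto_zero_sandwich)
    show "(\<lambda>k. dirichlet_nsq (F k) * dirichlet_nsq h) \<longlonglongrightarrow> 0"
      using tendsto_mult_right[OF lim, of "dirichlet_nsq h"] by simp
  qed (auto intro!: dirichlet_Cauchy_Schwarz F h)
  then have "(\<lambda>k. sqrt ((cmod (dirichlet_inner (F k) h))\<^sup>2)) \<longlonglongrightarrow> sqrt 0" by (rule tendsto_real_sqrt)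
  then show ?thesis by (simp add: tendsto_norm_zero_iff)
qed

text \<open>A minimising sequence is Cauchy by the parallelogram law. Along it the squared distance
  exceeds the infimum \<open>d\<close> by less than \<open>1 / Suc k\<close>, which makes the inner
  products with \<open>M\<close> small by \<open>dirichlet_inner_bound\<close>; orthogonality
  follows in the limit.\<close>

theorem dirichlet_projection_exists:
  assumes M: "closed_subspace M" and f: "f \<in> dirichlet_space"
  shows "\<exists>g\<in>M. \<forall>h\<in>M. dirichlet_inner (\<lambda>z. f z - g z) h = 0"
proof -
  note inD = closed_subspace_in_space[OF M]
  let ?N = "\<lambda>g. dirichlet_nsq (\<lambda>z. f z - g z)"
  define d where "d = (INF g\<in>M. ?N g)"
  have fg: "(\<lambda>z. f z - g z) \<in> dirichlet_space" if "g \<in> M" for g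
    by (rule dirichlet_space_diff[OF f inD[OF that]])
  have bdd: "bdd_below (?N ` M)"
    using dirichlet_nsq_nonneg[OF fg] by (intro bdd_belowI[of _ 0]) auto
  have dle: "d \<le> ?N g" if "g \<in> M" for g
    unfolding d_def by (rule cINF_lower[OF bdd that])
  have "\<exists>g\<in>M. ?N g < d + 1 / real (Suc k)" for k
  proof -
    have "M \<noteq> {}" using closed_subspace_zero[OF M] by blast
    then show ?thesis using cINF_less_iff[OF _ bdd, of "d + 1 / real (Suc k)"] by (simp add: d_def)
  qed
  then obtain G where G: "\<And>k. G k \<in> M" and GN: "\<And>k. ?N (G k) < d + 1 / real (Suc k)" by metis
  have diff: "dirichlet_nsq (\<lambda>z. G i z - G j z) \<le> 2 / real (Suc i) + 2 / real (Suc j)" for i j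
  proof -
    \<comment> \<open>The midpoint cannot be closer to \<open>f\<close> than \<open>d\<close>
      allows, which forces two almost optimal elements to be close to each other.\<close>
    have mid: "(\<lambda>z. (1/2) * (G i z + G j z)) \<in> M"
      by (intro closed_subspace_cmult[OF M] closed_subspace_add[OF M] G)
    have "dirichlet_nsq (\<lambda>z. (f z - G i z) + (f z - G j z)) = 4 * ?N (\<lambda>z. (1/2) * (G i z + G j z))"
      using dirichlet_nsq_cmult[OF fg[OF mid], of 2] by (simp add: algebra_simps)
    then have "dirichlet_nsq (\<lambda>z. (f z - G i z) + (f z - G j z)) \<ge> 4 * d" using dle[OF mid] by simp
    moreover have "dirichlet_nsq (\<lambda>z. G i z - G j z) = dirichlet_nsq (\<lambda>z. (f z - G i z) - (f z - G j z))"
      using dirichlet_nsq_diff_commute[OF inD[OF G] inD[OF G], of i j] by simp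
    ultimately show ?thesis
      using dirichlet_nsq_parallelogram[OF fg[OF G[of i]] fg[OF G[of j]]] GN[of i] GN[of j] by simp
  qed
  obtain g where g: "g \<in> dirichlet_space" and lim: "(\<lambda>k. dirichlet_nsq (\<lambda>z. G k z - g z)) \<longlonglongrightarrow> 0"
  proof (rule dirichlet_space_complete[of G])
    fix e :: real assume e: "e > 0"
    then obtain N where N: "4 / e < real N" using reals_Archimedean2 by blast
    have "dirichlet_nsq (\<lambda>z. G i z - G j z) < e" if "i \<ge> N" "j \<ge> N" for i j
    proof -
      have "2 / real (Suc i) < e / 2" "2 / real (Suc j) < e / 2"
      proof -
        have *: "2 / real (Suc i) < e / 2" if "i \<ge> N" for i
        proof -
          have "4 / e < real (Suc i)" using N that by linarith
          then show ?thesis using e by (simp add: field_simps del: of_nat_Suc)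
        qed
        show "2 / real (Suc i) < e / 2" "2 / real (Suc j) < e / 2" using * that by blast+
      qed
      then show ?thesis using diff[of i j] by linarith
    qed
    then show "\<exists>N. \<forall>i\<ge>N. \<forall>j\<ge>N. dirichlet_nsq (\<lambda>z. G i z - G j z) < e" by blast
  qed (use inD G in auto)
  have gM: "g \<in> M" by (rule closed_subspace_limit[OF M G g lim])
  have "dirichlet_inner (\<lambda>z. f z - g z) h = 0" if h: "h \<in> M" for h
  proof -
    have "(\<lambda>k. dirichlet_inner (\<lambda>z. f z - G k z) h) \<longlonglongrightarrow> 0"
    proof -
      have "(cmod (dirichlet_inner (\<lambda>z. f z - G k z) h))\<^sup>2 \<le> dirichlet_nsq h * (1 / real (Suc k))" for k
      proof -
        have "d \<le> dirichlet_nsq (\<lambda>z. (f z - G k z) - t * h z)" for t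
          using dle[OF closed_subspace_add[OF M G[of k] closed_subspace_cmult[OF M h, of t]]]
          by (simp add: algebra_simps)
        then have "(cmod (dirichlet_inner (\<lambda>z. f z - G k z) h))\<^sup>2 \<le> dirichlet_nsq h * (?N (G k) - d)"
          by (rule dirichlet_inner_bound[OF fg[OF G] inD[OF h]])
        also have "\<dots> \<le> dirichlet_nsq h * (1 / real (Suc k))"
          using GN[of k] dirichlet_nsq_nonneg[OF inD[OF h]] by (intro mult_left_mono) auto
        finally show ?thesis .
      qed
      moreover have "(\<lambda>k. dirichlet_nsq h * (1 / real (Suc k))) \<longlonglongrightarrow> 0"
        by (rule tendsto_const_over_Suc)
      ultimately have "(\<lambda>k. (cmod (dirichlet_inner (\<lambda>z. f z - G k z) h))\<^sup>2) \<longlonglongrightarrow> 0"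
        by (rule tendsto_zero_sandwich) simp
      then have "(\<lambda>k. sqrt ((cmod (dirichlet_inner (\<lambda>z. f z - G k z) h))\<^sup>2)) \<longlonglongrightarrow> sqrt 0"
        by (rule tendsto_real_sqrt)
      then show ?thesis by (simp add: tendsto_norm_zero_iff)
    qed
    moreover have "(\<lambda>k. dirichlet_inner (\<lambda>z. G k z - g z) h) \<longlonglongrightarrow> 0"
      by (rule dirichlet_inner_tendsto_zero) (use inD G g h lim in \<open>auto intro: dirichlet_space_diff\<close>)
    ultimately have "(\<lambda>k. dirichlet_inner (\<lambda>z. f z - G k z) h + dirichlet_inner (\<lambda>z. G k z - g z) h) \<longlonglongrightarrow> 0 + 0"
      by (rule tendsto_add)
    moreover have "dirichlet_inner (\<lambda>z. f z - G k z) h + dirichlet_inner (\<lambda>z. G k z - g z) h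
        = dirichlet_inner (\<lambda>z. f z - g z) h" for k
      using dirichlet_inner_add_left[OF fg[OF G[of k]] dirichlet_space_diff[OF inD[OF G[of k]] g] inD[OF h]] by simp
    ultimately show ?thesis by (simp add: tendsto_const_iff)
  qed
  then show ?thesis using gM by blast
qed

definition dirichlet_proj :: "(complex \<Rightarrow> complex) set \<Rightarrow> operator" where
  "dirichlet_proj M f = (SOME g. g \<in> M \<and> (\<forall>h\<in>M. dirichlet_inner (\<lambda>z. f z - g z) h = 0))"

lemma
  assumes "closed_subspace M" "f \<in> dirichlet_space"
  shows dirichlet_proj_in: "dirichlet_proj M f \<in> M"
    and dirichlet_proj_orth: "h \<in> M \<Longrightarrow> dirichlet_inner (\<lambda>z. f z - dirichlet_proj M f z) h = 0"
proof -
  have "\<exists>g. g \<in> M \<and> (\<forall>h\<in>M. dirichlet_inner (\<lambda>z. f z - g z) h = 0)"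
    using dirichlet_projection_exists[OF assms] by blast
  from someI_ex[OF this]
  have "dirichlet_proj M f \<in> M \<and> (\<forall>h\<in>M. dirichlet_inner (\<lambda>z. f z - dirichlet_proj M f z) h = 0)"
    unfolding dirichlet_proj_def .
  then show "dirichlet_proj M f \<in> M"
    and "h \<in> M \<Longrightarrow> dirichlet_inner (\<lambda>z. f z - dirichlet_proj M f z) h = 0" by auto
qed

lemma dirichlet_proj_space:
  "closed_subspace M \<Longrightarrow> f \<in> dirichlet_space \<Longrightarrow> dirichlet_proj M f \<in> dirichlet_space"
  by (meson closed_subspace_in_space dirichlet_proj_in)

lemma dirichlet_inner_self_eq_0:
  assumes "f \<in> dirichlet_space" "dirichlet_inner f f = 0" shows "f = (\<lambda>z. 0)"
  using assms dirichlet_inner_self[OF assms(1)] dirichlet_nsq_eq_0 by simp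

lemma dirichlet_proj_unique:
  assumes M: "closed_subspace M" and f: "f \<in> dirichlet_space" and g: "g \<in> M"
    and orth: "\<And>h. h \<in> M \<Longrightarrow> dirichlet_inner (\<lambda>z. f z - g z) h = 0"
  shows "dirichlet_proj M f = g"
proof -
  let ?P = "dirichlet_proj M f"
  note inD = closed_subspace_in_space[OF M]
  have PM: "?P \<in> M" by (rule dirichlet_proj_in[OF M f])
  have d: "(\<lambda>z. ?P z - g z) \<in> M" by (rule closed_subspace_diff[OF M PM g])
  have "dirichlet_inner (\<lambda>z. (f z - g z) - (f z - ?P z)) (\<lambda>z. ?P z - g z) = 0 - 0"
    using dirichlet_inner_diff_left[OF dirichlet_space_diff[OF f inD[OF g]] dirichlet_space_diff[OF f inD[OF PM]] inD[OF d]]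
      orth[OF d] dirichlet_proj_orth[OF M f d] by simp
  then have "(\<lambda>z. ?P z - g z) = (\<lambda>z. 0)"
    using dirichlet_inner_self_eq_0[OF inD[OF d]] by simp
  then show ?thesis by (simp add: fun_eq_iff)
qed

lemma dirichlet_proj_id:
  assumes "closed_subspace M" "f \<in> M" shows "dirichlet_proj M f = f"
  by (rule dirichlet_proj_unique) (use assms closed_subspace_in_space in auto)

lemma dirichlet_proj_add:
  assumes M: "closed_subspace M" and f: "f \<in> dirichlet_space" and g: "g \<in> dirichlet_space"
  shows "dirichlet_proj M (\<lambda>z. f z + g z) = (\<lambda>z. dirichlet_proj M f z + dirichlet_proj M g z)"
proof (rule dirichlet_proj_unique[OF M])
  note S = dirichlet_proj_space[OF M] closed_subspace_in_space[OF M]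
  fix h assume h: "h \<in> M"
  have "dirichlet_inner (\<lambda>z. (f z - dirichlet_proj M f z) + (g z - dirichlet_proj M g z)) h = 0"
    using dirichlet_proj_orth[OF M f h] dirichlet_proj_orth[OF M g h] S f g h
    by (subst dirichlet_inner_add_left) (auto intro: dirichlet_space_diff)
  then show "dirichlet_inner (\<lambda>z. f z + g z - (dirichlet_proj M f z + dirichlet_proj M g z)) h = 0"
    by (simp add: algebra_simps)
qed (auto intro: dirichlet_space_add closed_subspace_add[OF M] dirichlet_proj_in[OF M] f g)

lemma dirichlet_proj_cmult:
  assumes M: "closed_subspace M" and f: "f \<in> dirichlet_space"
  shows "dirichlet_proj M (\<lambda>z. c * f z) = (\<lambda>z. c * dirichlet_proj M f z)"
proof (rule dirichlet_proj_unique[OF M])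
  note S = dirichlet_proj_space[OF M] closed_subspace_in_space[OF M]
  fix h assume h: "h \<in> M"
  have "dirichlet_inner (\<lambda>z. c * (f z - dirichlet_proj M f z)) h = 0"
    using dirichlet_proj_orth[OF M f h] S f h
    by (subst dirichlet_inner_cmult_left) (auto intro: dirichlet_space_diff)
  then show "dirichlet_inner (\<lambda>z. c * f z - c * dirichlet_proj M f z) h = 0"
    by (simp add: algebra_simps)
qed (auto intro: dirichlet_space_cmult closed_subspace_cmult[OF M] dirichlet_proj_in[OF M] f)

lemma dirichlet_proj_inner:
  assumes M: "closed_subspace M" and f: "f \<in> dirichlet_space" and h: "h \<in> M"
  shows "dirichlet_inner (dirichlet_proj M f) h = dirichlet_inner f h"
  using dirichlet_proj_orth[OF M f h]
    dirichlet_inner_diff_left[OF f dirichlet_proj_space[OF M f] closed_subspace_in_space[OF M h]] by simp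

lemma dirichlet_proj_symmetric:
  assumes M: "closed_subspace M" and f: "f \<in> dirichlet_space" and g: "g \<in> dirichlet_space"
  shows "dirichlet_inner (dirichlet_proj M f) g = dirichlet_inner f (dirichlet_proj M g)"
proof -
  note S = dirichlet_proj_space[OF M]
  have "dirichlet_inner (dirichlet_proj M f) g = cnj (dirichlet_inner g (dirichlet_proj M f))"
    using S f g by (simp add: dirichlet_inner_cnj)
  also have "\<dots> = cnj (dirichlet_inner (dirichlet_proj M g) (dirichlet_proj M f))"
    using dirichlet_proj_inner[OF M g dirichlet_proj_in[OF M f]] by simp
  also have "\<dots> = dirichlet_inner (dirichlet_proj M f) (dirichlet_proj M g)"
    using S f g by (simp add: dirichlet_inner_cnj)
  also have "\<dots> = dirichlet_inner f (dirichlet_proj M g)"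
    by (rule dirichlet_proj_inner[OF M f dirichlet_proj_in[OF M g]])
  finally show ?thesis .
qed

lemma dirichlet_nsq_proj_le:
  assumes M: "closed_subspace M" and f: "f \<in> dirichlet_space"
  shows "dirichlet_nsq (dirichlet_proj M f) \<le> dirichlet_nsq f"
proof -
  note S = dirichlet_proj_space[OF M f]
  have "complex_of_real (dirichlet_nsq (dirichlet_proj M f)) = dirichlet_inner f (dirichlet_proj M f)"
    using dirichlet_proj_inner[OF M f dirichlet_proj_in[OF M f]] by (simp add: dirichlet_inner_self[OF S])
  then have "Re (dirichlet_inner f (dirichlet_proj M f)) = dirichlet_nsq (dirichlet_proj M f)"
    by (metis Re_complex_of_real)
  then have "dirichlet_nsq (\<lambda>z. f z - dirichlet_proj M f z) = dirichlet_nsq f - dirichlet_nsq (dirichlet_proj M f)"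
    using dirichlet_nsq_diff_cmult[OF f S, of 1] by simp
  then show ?thesis
    using dirichlet_nsq_nonneg[OF dirichlet_space_diff[OF f S]] by simp
qed

section \<open>Multipliers and adjoints\<close>

definition disc_poly :: "(nat \<Rightarrow> complex) \<Rightarrow> nat \<Rightarrow> complex \<Rightarrow> complex" where
  "disc_poly a N = (\<lambda>z. \<Sum>n<N. a n * dmono n z)"

lemma disc_poly_Suc: "disc_poly a (Suc N) = (\<lambda>z. disc_poly a N z + a N * dmono N z)"
  and disc_poly_0: "disc_poly a 0 = (\<lambda>z. 0)"
  by (auto simp: disc_poly_def)

lemma disc_poly_in: "disc_poly a N \<in> dirichlet_space"
  by (induction N) (auto simp: disc_poly_Suc disc_poly_0 intro!: dirichlet_space_add dirichlet_space_cmult)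

lemma taylor_coeff_disc_poly: "taylor_coeff (disc_poly a N) n = (if n < N then a n else 0)"
  by (induction N)
     (auto simp: disc_poly_Suc disc_poly_0 taylor_coeff_add taylor_coeff_cmult taylor_coeff_dmono
        dirichlet_space_holomorphic disc_poly_in dirichlet_space_cmult less_Suc_eq)

lemma dirichlet_nsq_disc_poly:
  "dirichlet_nsq (disc_poly a N) = (\<Sum>n<N. real (n + 1) * (cmod (a n))\<^sup>2)"
proof -
  have "dirichlet_nsq (disc_poly a N)
      = (\<Sum>n\<in>{..<N}. real (n + 1) * (cmod (taylor_coeff (disc_poly a N) n))\<^sup>2)"
    unfolding dirichlet_nsq_def by (rule suminf_finite) (auto simp: taylor_coeff_disc_poly)
  then show ?thesis by (simp add: taylor_coeff_disc_poly)
qed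

lemma dirichlet_nsq_truncation:
  assumes f: "f \<in> dirichlet_space"
  shows "(\<lambda>N. dirichlet_nsq (\<lambda>z. f z - disc_poly (taylor_coeff f) N z)) \<longlonglongrightarrow> 0"
proof -
  let ?w = "\<lambda>n. real (n + 1) * (cmod (taylor_coeff f n))\<^sup>2"
  have w: "summable ?w" by (rule dirichlet_space_summable[OF f])
  have "dirichlet_nsq (\<lambda>z. f z - disc_poly (taylor_coeff f) N z) = dirichlet_nsq f - (\<Sum>n<N. ?w n)" for N
  proof -
    have "(\<lambda>n. if n \<in> {..<N} then ?w n else 0) sums (\<Sum>n\<in>{..<N}. ?w n)"
      by (rule sums_If_finite_set) simp
    from sums_diff[OF summable_sums[OF w] this]
    have "(\<lambda>n. ?w n - (if n \<in> {..<N} then ?w n else 0)) sums (dirichlet_nsq f - (\<Sum>n<N. ?w n))"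
      by (simp only: dirichlet_nsq_def)
    moreover have "?w n - (if n \<in> {..<N} then ?w n else 0)
        = real (n + 1) * (cmod (taylor_coeff (\<lambda>z. f z - disc_poly (taylor_coeff f) N z) n))\<^sup>2" for n
      using f by (simp add: taylor_coeff_diff dirichlet_space_holomorphic disc_poly_in taylor_coeff_disc_poly)
    ultimately show ?thesis unfolding dirichlet_nsq_def by (simp only: sums_iff)
  qed
  moreover have "(\<lambda>N. dirichlet_nsq f - (\<Sum>n<N. ?w n)) \<longlonglongrightarrow> dirichlet_nsq f - dirichlet_nsq f"
    unfolding dirichlet_nsq_def by (intro tendsto_intros summable_LIMSEQ w)
  ultimately show ?thesis by simp
qed

text \<open>Riesz representation by coefficients: testing on monomials forces the coefficients
  \<open>a n\<close> of \<open>h\<close>. They define an element of the space because testing on the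
  polynomial built from \<open>a\<close> itself bounds the partial sums; truncation then carries the
  identity from polynomials to all \<open>f\<close>.\<close>

lemma dirichlet_adjoint_exists:
  assumes T: "\<And>f. f \<in> dirichlet_space \<Longrightarrow> T f \<in> dirichlet_space"
    and T_add: "\<And>f g. f \<in> dirichlet_space \<Longrightarrow> g \<in> dirichlet_space \<Longrightarrow> T (\<lambda>z. f z + g z) = (\<lambda>z. T f z + T g z)"
    and T_cmult: "\<And>f c. f \<in> dirichlet_space \<Longrightarrow> T (\<lambda>z. c * f z) = (\<lambda>z. c * T f z)"
    and T_bound: "\<And>f. f \<in> dirichlet_space \<Longrightarrow> dirichlet_nsq (T f) \<le> C * dirichlet_nsq f"
    and g: "g \<in> dirichlet_space"
  obtains h where "h \<in> dirichlet_space" "\<And>f. f \<in> dirichlet_space \<Longrightarrow> dirichlet_inner (T f) g = dirichlet_inner f h"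
proof -
  define a where "a n = cnj (dirichlet_inner (T (dmono n)) g) / of_nat (n + 1)" for n
  have ai: "dirichlet_inner (T (dmono n)) g = of_nat (n + 1) * cnj (a n)" for n
    by (simp add: a_def del: of_nat_Suc)
  have Tp: "dirichlet_inner (T (disc_poly b N)) g = (\<Sum>n<N. of_nat (n + 1) * b n * cnj (a n))" for b N
  proof (induction N)
    case 0
    have "T (\<lambda>z. 0) = (\<lambda>z. 0)" using T_cmult[of "\<lambda>z. 0" 0] by simp
    then show ?case by (simp add: disc_poly_0)
  next
    case (Suc N)
    have "T (disc_poly b (Suc N)) = (\<lambda>z. T (disc_poly b N) z + b N * T (dmono N) z)"
      unfolding disc_poly_Suc
      by (subst T_add) (auto intro!: disc_poly_in dirichlet_space_cmult simp: T_cmult)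
    then show ?case
      using Suc.IH g ai[of N]
      by (simp add: dirichlet_inner_add_left dirichlet_inner_cmult_left T disc_poly_in dirichlet_space_cmult
          del: of_nat_Suc)
  qed
  have bound: "(\<Sum>n<N. real (n + 1) * (cmod (a n))\<^sup>2) \<le> \<bar>C\<bar> * dirichlet_nsq g" for N
  proof -
    define S where "S = (\<Sum>n<N. real (n + 1) * (cmod (a n))\<^sup>2)"
    have S0: "S \<ge> 0" unfolding S_def by (intro sum_nonneg) auto
    have "of_nat (n + 1) * a n * cnj (a n) = complex_of_real (real (n + 1) * (cmod (a n))\<^sup>2)" for n
      unfolding of_real_mult complex_norm_square by (simp add: mult.assoc)
    then have "dirichlet_inner (T (disc_poly a N)) g = complex_of_real S"
      unfolding Tp S_def of_real_sum by (simp only:)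
    then have "S\<^sup>2 = (cmod (dirichlet_inner (T (disc_poly a N)) g))\<^sup>2" by simp
    also have "\<dots> \<le> dirichlet_nsq (T (disc_poly a N)) * dirichlet_nsq g"
      by (intro dirichlet_Cauchy_Schwarz T disc_poly_in g)
    also have "\<dots> \<le> (\<bar>C\<bar> * S) * dirichlet_nsq g"
    proof (intro mult_right_mono dirichlet_nsq_nonneg g)
      have "dirichlet_nsq (T (disc_poly a N)) \<le> C * S"
        using T_bound[OF disc_poly_in, of a N] by (simp only: dirichlet_nsq_disc_poly S_def)
      also have "\<dots> \<le> \<bar>C\<bar> * S" using S0 by (intro mult_right_mono) auto
      finally show "dirichlet_nsq (T (disc_poly a N)) \<le> \<bar>C\<bar> * S" .
    qed
    \<comment> \<open>The tested value is \<open>S\<close> itself, so this quadratic inequality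
      bounds \<open>S\<close> independently of \<open>N\<close>.\<close>
    finally have "S * S \<le> S * (\<bar>C\<bar> * dirichlet_nsq g)" by (simp add: power2_eq_square mult_ac)
    then show ?thesis
      using S0 dirichlet_nsq_nonneg[OF g] unfolding S_def[symmetric]
      by (cases "S = 0") (auto simp: mult_le_cancel_left)
  qed
  have "summable (\<lambda>n. real (n + 1) * (cmod (a n))\<^sup>2)"
    by (rule bounded_imp_summable[where B="\<bar>C\<bar> * dirichlet_nsq g"])
       (use bound[of "Suc m" for m] in \<open>auto simp: lessThan_Suc_atMost\<close>)
  then obtain h where h: "h \<in> dirichlet_space" and ha: "\<And>n. taylor_coeff h n = a n"
    using dirichlet_space_of_coeffs by blast
  have "dirichlet_inner (T f) g = dirichlet_inner f h" if f: "f \<in> dirichlet_space" for f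
  proof -
    let ?p = "disc_poly (taylor_coeff f)"
    have fp: "(\<lambda>z. f z - ?p N z) \<in> dirichlet_space" for N by (intro dirichlet_space_diff f disc_poly_in)
    have "(\<lambda>N. dirichlet_inner (T (\<lambda>z. f z - ?p N z)) g) \<longlonglongrightarrow> 0"
    proof (rule dirichlet_inner_tendsto_zero)
      have "(\<lambda>N. C * dirichlet_nsq (\<lambda>z. f z - ?p N z)) \<longlonglongrightarrow> 0"
        by (intro tendsto_mult_right_zero dirichlet_nsq_truncation f)
      then show "(\<lambda>N. dirichlet_nsq (T (\<lambda>z. f z - ?p N z))) \<longlonglongrightarrow> 0"
        by (rule tendsto_zero_sandwich[rotated]) (simp_all add: T_bound fp dirichlet_nsq_nonneg T)
    qed (auto intro: T fp g)
    moreover have "dirichlet_inner (T (\<lambda>z. f z - ?p N z)) g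
        = dirichlet_inner (T f) g - (\<Sum>n<N. of_nat (n + 1) * taylor_coeff f n * cnj (a n))" for N
    proof -
      have "T f = (\<lambda>z. T (\<lambda>z. f z - ?p N z) z + T (?p N) z)"
        using T_add[OF fp[of N] disc_poly_in[of "taylor_coeff f" N]] by simp
      then have "dirichlet_inner (T f) g = dirichlet_inner (T (\<lambda>z. f z - ?p N z)) g + dirichlet_inner (T (?p N)) g"
        using dirichlet_inner_add_left[OF T[OF fp[of N]] T[OF disc_poly_in] g] by metis
      then show ?thesis by (simp add: Tp)
    qed
    moreover have "(\<lambda>N. dirichlet_inner (T f) g - (\<Sum>n<N. of_nat (n + 1) * taylor_coeff f n * cnj (a n)))
        \<longlonglongrightarrow> dirichlet_inner (T f) g - dirichlet_inner f h"
      using dirichlet_inner_sums[OF f h] by (intro tendsto_intros) (simp only: sums_def ha)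
    ultimately have "dirichlet_inner (T f) g - dirichlet_inner f h = 0"
      by (metis (no_types, lifting) LIMSEQ_unique ext)
    then show ?thesis by simp
  qed
  then show ?thesis using h that by blast
qed

lemma dirichlet_space_eq_of_inner:
  assumes "g \<in> dirichlet_space" "h \<in> dirichlet_space"
    "\<And>f. f \<in> dirichlet_space \<Longrightarrow> dirichlet_inner f g = dirichlet_inner f h"
  shows "g = h"
proof -
  have "dirichlet_inner (\<lambda>z. g z - h z) (\<lambda>z. g z - h z) = 0"
    using assms(3)[OF dirichlet_space_diff[OF assms(1,2)]]
      dirichlet_inner_diff_right[OF assms(1,2) dirichlet_space_diff[OF assms(1,2)]] by simp
  from dirichlet_inner_self_eq_0[OF dirichlet_space_diff[OF assms(1,2)] this] show ?thesis
    by (simp add: fun_eq_iff)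
qed

text \<open>A convenient class of multipliers rather than all of them: it contains every function
  holomorphic across the closed disc and is closed under sums, products and inverses of functions
  bounded away from \<open>0\<close>.\<close>

definition disc_multiplier :: "(complex \<Rightarrow> complex) \<Rightarrow> bool" where
  "disc_multiplier m \<longleftrightarrow> m holomorphic_on ball 0 1 \<and> bounded (m ` ball 0 1) \<and> bounded (deriv m ` ball 0 1)"

lemma disc_multiplierI:
  assumes "m holomorphic_on S" "open S" "cball 0 1 \<subseteq> S"
  shows "disc_multiplier m"
proof -
  have c: "compact (cball (0::complex) 1)" by simp
  have "continuous_on (cball 0 1) m" "continuous_on (cball 0 1) (deriv m)"
    using assms by (auto intro: holomorphic_on_imp_continuous_on holomorphic_on_subset holomorphic_deriv)
  then have "bounded (m ` cball 0 1)" "bounded (deriv m ` cball 0 1)"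
    using c compact_continuous_image compact_imp_bounded by blast+
  moreover have "ball (0::complex) 1 \<subseteq> cball 0 1" by auto
  ultimately show ?thesis
    unfolding disc_multiplier_def using assms holomorphic_on_subset
    by (meson bounded_subset image_mono order_trans)
qed

lemma disc_multiplier_cong:
  assumes "disc_multiplier m" "\<And>z. z \<in> ball 0 1 \<Longrightarrow> m z = m' z"
  shows "disc_multiplier m'"
proof -
  have "deriv m' z = deriv m z" if "z \<in> ball 0 1" for z
    by (rule deriv_cong_ev)
       (use assms(2) that in \<open>auto intro!: eventually_nhds_in_open[of "ball 0 1", THEN eventually_mono]\<close>)
  then have "m' ` ball 0 1 = m ` ball 0 1" "deriv m' ` ball 0 1 = deriv m ` ball 0 1"
    using assms(2) by force+
  moreover have "m' holomorphic_on ball 0 1 \<longleftrightarrow> m holomorphic_on ball 0 1"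
    by (rule holomorphic_cong) (use assms(2) in auto)
  ultimately show ?thesis using assms(1) unfolding disc_multiplier_def by simp
qed

lemma deriv_times_id_mult:
  assumes m: "m holomorphic_on ball 0 1" and f: "f holomorphic_on ball 0 1" and z: "z \<in> ball 0 1"
  shows "deriv (\<lambda>z. z * (m z * f z)) z = m z * deriv (\<lambda>z. z * f z) z + deriv m z * (z * f z)"
proof -
  have "(\<lambda>z. z * f z) holomorphic_on ball 0 1" by (intro holomorphic_intros f)
  then have "(m has_field_derivative deriv m z) (at z)"
    "((\<lambda>z. z * f z) has_field_derivative deriv (\<lambda>z. z * f z) z) (at z)"
    using m z by (auto intro!: holomorphic_derivI[of _ "ball 0 1"])
  from DERIV_mult[OF this] have "((\<lambda>z. m z * (z * f z)) has_field_derivative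
      deriv m z * (z * f z) + deriv (\<lambda>z. z * f z) z * m z) (at z)" .
  from DERIV_imp_deriv[OF this] show ?thesis by (simp add: mult_ac)
qed

text \<open>In the form \<open>|(z f)'|^2\<close> of the norm the product rule gives
  \<open>(z m f)' = m (z f)' + m' (z f)\<close>. The second term costs the Bergman norm of
  \<open>f\<close>, which is at most its norm in the space. The constant comes from
  \<open>(x + y)^2 \<le> 2 x^2 + 2 y^2\<close>.\<close>

lemma mult_op_bounded:
  assumes m: "disc_multiplier m"
  obtains C where "\<And>f. f \<in> dirichlet_space \<Longrightarrow>
     mult_op m f \<in> dirichlet_space \<and> dirichlet_nsq (mult_op m f) \<le> C * dirichlet_nsq f"
proof -
  have mh: "m holomorphic_on ball 0 1" using m by (simp add: disc_multiplier_def)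
  obtain A1 A2 where A1: "\<And>z. z \<in> ball 0 1 \<Longrightarrow> cmod (m z) \<le> A1"
    and A2: "\<And>z. z \<in> ball 0 1 \<Longrightarrow> cmod (deriv m z) \<le> A2"
    using m unfolding disc_multiplier_def bounded_iff by blast
  define A where "A = max A1 A2"
  have A: "cmod (m z) \<le> A" "cmod (deriv m z) \<le> A" if "z \<in> ball 0 1" for z
    using A1[OF that] A2[OF that] by (auto simp: A_def)
  have A0: "A \<ge> 0" using A[of 0] norm_ge_zero[of "m 0"] by (metis centre_in_ball order_trans zero_less_one)
  have main: "mult_op m f \<in> dirichlet_space \<and> dirichlet_nsq (mult_op m f) \<le> (4 * A\<^sup>2) * dirichlet_nsq f"
    if f: "f \<in> dirichlet_space" for f
  proof -
    have fh: "f holomorphic_on ball 0 1" by (rule dirichlet_space_holomorphic[OF f])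
    have mfh: "mult_op m f holomorphic_on ball 0 1"
      unfolding mult_op_def by (intro holomorphic_intros mh fh)
    let ?F = "deriv (\<lambda>z. z * f z)"
    let ?w = "\<lambda>g n. real (n + 1) * (cmod (taylor_coeff g n))\<^sup>2"
    have meas: "(\<lambda>z. ennreal ((cmod (g z))\<^sup>2) * indicator (ball 0 1) z) \<in> borel_measurable lborel"
      if "g holomorphic_on ball 0 1" for g
    proof -
      have "(\<lambda>z. indicator (ball 0 1) z *\<^sub>R (cmod (g z))\<^sup>2) \<in> borel_measurable borel"
        by (intro borel_measurable_continuous_on_indicator continuous_intros
            holomorphic_on_imp_continuous_on that) simp
      then have "(\<lambda>z. ennreal (indicator (ball 0 1) z *\<^sub>R (cmod (g z))\<^sup>2)) \<in> borel_measurable borel"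
        by simp
      moreover have "(\<lambda>z. ennreal (indicator (ball 0 1) z *\<^sub>R (cmod (g z))\<^sup>2))
          = (\<lambda>z. ennreal ((cmod (g z))\<^sup>2) * indicator (ball 0 1) z)"
        by (auto simp: indicator_def)
      ultimately show ?thesis by (simp only: measurable_lborel2)
    qed
    have Fh: "?F holomorphic_on ball 0 1" by (intro holomorphic_deriv holomorphic_intros fh) simp
    have "(\<Sum>n. ennreal (pi * ?w (mult_op m f) n))
        = (\<integral>\<^sup>+z\<in>ball 0 1. ennreal ((cmod (deriv (\<lambda>z. z * (m z * f z)) z))\<^sup>2) \<partial>lborel)"
      using nn_integral_deriv_times_id[OF mfh] by (simp add: mult_op_def)
    also have "\<dots> \<le> (\<integral>\<^sup>+z. ennreal (2 * A\<^sup>2) * (ennreal ((cmod (?F z))\<^sup>2) * indicator (ball 0 1) z)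
        + ennreal (2 * A\<^sup>2) * (ennreal ((cmod (f z))\<^sup>2) * indicator (ball 0 1) z) \<partial>lborel)"
    proof (rule nn_integral_mono)
      fix z :: complex
      show "ennreal ((cmod (deriv (\<lambda>z. z * (m z * f z)) z))\<^sup>2) * indicator (ball 0 1) z
        \<le> ennreal (2 * A\<^sup>2) * (ennreal ((cmod (?F z))\<^sup>2) * indicator (ball 0 1) z)
        + ennreal (2 * A\<^sup>2) * (ennreal ((cmod (f z))\<^sup>2) * indicator (ball 0 1) z)"
      proof (cases "z \<in> ball 0 1")
        case True
        have "cmod (deriv (\<lambda>z. z * (m z * f z)) z) \<le> A * cmod (?F z) + A * cmod (f z)"
        proof -
          have "cmod (m z * ?F z + deriv m z * (z * f z)) \<le> cmod (m z) * cmod (?F z) + cmod (deriv m z) * cmod (z * f z)"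
            by (metis norm_mult norm_triangle_ineq)
          also have "cmod (z * f z) \<le> 1 * cmod (f z)"
            using True by (auto simp: norm_mult intro!: mult_left_le_one_le)
          finally show ?thesis
            unfolding deriv_times_id_mult[OF mh fh True]
            using A[OF True] A0 by (smt (verit) mult_mono norm_ge_zero mult_1 mult_left_mono)
        qed
        then have "(cmod (deriv (\<lambda>z. z * (m z * f z)) z))\<^sup>2 \<le> (A * cmod (?F z) + A * cmod (f z))\<^sup>2"
          by (intro power_mono) auto
        also have "\<dots> \<le> 2 * (A * cmod (?F z))\<^sup>2 + 2 * (A * cmod (f z))\<^sup>2"
          using sum_squares_bound[of "A * cmod (?F z)" "A * cmod (f z)"] by (simp add: power2_sum)
        finally have "ennreal ((cmod (deriv (\<lambda>z. z * (m z * f z)) z))\<^sup>2)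
            \<le> ennreal (2 * A\<^sup>2 * (cmod (?F z))\<^sup>2 + 2 * A\<^sup>2 * (cmod (f z))\<^sup>2)"
          by (intro ennreal_leI) (simp add: power_mult_distrib mult_ac)
        also have "\<dots> = ennreal (2 * A\<^sup>2) * ennreal ((cmod (?F z))\<^sup>2) + ennreal (2 * A\<^sup>2) * ennreal ((cmod (f z))\<^sup>2)"
          by (simp add: ennreal_plus ennreal_mult)
        finally show ?thesis using True by simp
      qed simp
    qed
    also have "\<dots> = ennreal (2 * A\<^sup>2) * (\<integral>\<^sup>+z\<in>ball 0 1. ennreal ((cmod (?F z))\<^sup>2) \<partial>lborel)
        + ennreal (2 * A\<^sup>2) * (\<integral>\<^sup>+z\<in>ball 0 1. ennreal ((cmod (f z))\<^sup>2) \<partial>lborel)"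
      by (simp only: nn_integral_add nn_integral_cmult meas[OF Fh] meas[OF fh] borel_measurable_times_ennreal
          borel_measurable_const)
    finally have le1: "(\<Sum>n. ennreal (pi * ?w (mult_op m f) n))
        \<le> ennreal (2 * A\<^sup>2) * (\<integral>\<^sup>+z\<in>ball 0 1. ennreal ((cmod (?F z))\<^sup>2) \<partial>lborel)
        + ennreal (2 * A\<^sup>2) * (\<integral>\<^sup>+z\<in>ball 0 1. ennreal ((cmod (f z))\<^sup>2) \<partial>lborel)" .
    have sum_f: "(\<Sum>n. ennreal (pi * ?w f n)) = ennreal (pi * dirichlet_nsq f)"
      unfolding dirichlet_nsq_def
      by (subst suminf_mult[symmetric, OF dirichlet_space_summable[OF f]], rule suminf_ennreal2)
         (use dirichlet_space_summable[OF f] in \<open>auto intro!: summable_mult simp del: of_nat_Suc\<close>)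
    have F_eq: "(\<integral>\<^sup>+z\<in>ball 0 1. ennreal ((cmod (?F z))\<^sup>2) \<partial>lborel) = ennreal (pi * dirichlet_nsq f)"
      using nn_integral_deriv_times_id[OF fh] sum_f by (simp only:)
    have f_le: "(\<integral>\<^sup>+z\<in>ball 0 1. ennreal ((cmod (f z))\<^sup>2) \<partial>lborel) \<le> ennreal (pi * dirichlet_nsq f)"
      unfolding nn_integral_unit_disc_holomorphic[OF fh] sum_f[symmetric]
    proof (intro suminf_le ennreal_leI)
      fix n
      have "pi * (cmod (taylor_coeff f n))\<^sup>2 / real (n + 1) \<le> pi * (cmod (taylor_coeff f n))\<^sup>2 / 1"
        by (intro divide_left_mono) auto
      also have "\<dots> \<le> pi * ?w f n" by (simp add: algebra_simps)
      finally show "pi * (cmod (taylor_coeff f n))\<^sup>2 / real (n + 1) \<le> pi * ?w f n" .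
    qed simp_all
    note le1
    also have "ennreal (2 * A\<^sup>2) * (\<integral>\<^sup>+z\<in>ball 0 1. ennreal ((cmod (?F z))\<^sup>2) \<partial>lborel)
        + ennreal (2 * A\<^sup>2) * (\<integral>\<^sup>+z\<in>ball 0 1. ennreal ((cmod (f z))\<^sup>2) \<partial>lborel)
        \<le> ennreal (2 * A\<^sup>2) * ennreal (pi * dirichlet_nsq f) + ennreal (2 * A\<^sup>2) * ennreal (pi * dirichlet_nsq f)"
      unfolding F_eq by (intro add_left_mono mult_left_mono f_le) simp
    also have "\<dots> = ennreal (pi * (4 * A\<^sup>2 * dirichlet_nsq f))"
    proof -
      have "0 \<le> pi * dirichlet_nsq f" using dirichlet_nsq_nonneg[OF f] by simp
      then have "ennreal (2 * A\<^sup>2) * ennreal (pi * dirichlet_nsq f) + ennreal (2 * A\<^sup>2) * ennreal (pi * dirichlet_nsq f)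
          = ennreal (2 * A\<^sup>2 * (pi * dirichlet_nsq f) + 2 * A\<^sup>2 * (pi * dirichlet_nsq f))"
        by (subst ennreal_plus) (simp_all add: ennreal_mult'')
      then show ?thesis by (simp add: algebra_simps)
    qed
    finally have le: "(\<Sum>n. ennreal (pi * ?w (mult_op m f) n)) \<le> ennreal (pi * (4 * A\<^sup>2 * dirichlet_nsq f))" .
    then have "(\<Sum>n. ennreal (pi * ?w (mult_op m f) n)) < \<infinity>"
      by (rule le_less_trans) simp
    then have "summable (\<lambda>n. pi * ?w (mult_op m f) n)"
      by (subst (asm) suminf_ennreal_finite_iff) simp_all
    then have summ: "summable (?w (mult_op m f))" by (subst (asm) summable_cmult_iff) simp
    then have "mult_op m f \<in> dirichlet_space"
      unfolding dirichlet_space_iff using mfh dirichlet_space_outside[OF f] by (auto simp: mult_op_def)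
    moreover have "(\<Sum>n. ennreal (pi * ?w (mult_op m f) n)) = ennreal (pi * dirichlet_nsq (mult_op m f))"
      unfolding dirichlet_nsq_def
      by (subst suminf_mult[symmetric, OF summ], rule suminf_ennreal2)
         (use summ in \<open>auto intro!: summable_mult simp del: of_nat_Suc\<close>)
    then have "pi * dirichlet_nsq (mult_op m f) \<le> pi * (4 * A\<^sup>2 * dirichlet_nsq f)"
      using le dirichlet_nsq_nonneg[OF f] by (simp add: ennreal_le_iff)
    then have "dirichlet_nsq (mult_op m f) \<le> 4 * A\<^sup>2 * dirichlet_nsq f" by simp
    ultimately show ?thesis by simp
  qed
  show ?thesis by (rule that[of "4 * A\<^sup>2"]) (rule main)
qed

section \<open>Closure properties of multipliers, and reducing subspaces in terms of
  projections\<close>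

lemma disc_multiplier_holomorphic: "disc_multiplier m \<Longrightarrow> m holomorphic_on ball 0 1"
  by (simp add: disc_multiplier_def)

lemma disc_multiplier_deriv:
  assumes "disc_multiplier m" "z \<in> ball 0 1"
  shows "(m has_field_derivative deriv m z) (at z)"
  using assms by (intro holomorphic_derivI[of _ "ball 0 1"]) (auto simp: disc_multiplier_def)

lemma disc_multiplierI_bounds:
  assumes "m holomorphic_on ball 0 1" "\<And>z. z \<in> ball 0 1 \<Longrightarrow> cmod (m z) \<le> A"
    "\<And>z. z \<in> ball 0 1 \<Longrightarrow> cmod (deriv m z) \<le> B"
  shows "disc_multiplier m"
  unfolding disc_multiplier_def bounded_iff using assms by blast

lemma disc_multiplier_mult:
  assumes f: "disc_multiplier f" and g: "disc_multiplier g"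
  shows "disc_multiplier (\<lambda>z. f z * g z)"
proof -
  have hol: "(\<lambda>z. f z * g z) holomorphic_on ball 0 1"
    by (intro holomorphic_intros disc_multiplier_holomorphic f g)
  obtain A B A' B' where b: "\<And>z. z \<in> ball 0 1 \<Longrightarrow> cmod (f z) \<le> A" "\<And>z. z \<in> ball 0 1 \<Longrightarrow> cmod (g z) \<le> B"
    "\<And>z. z \<in> ball 0 1 \<Longrightarrow> cmod (deriv f z) \<le> A'" "\<And>z. z \<in> ball 0 1 \<Longrightarrow> cmod (deriv g z) \<le> B'"
    using f g unfolding disc_multiplier_def bounded_iff by (metis imageI)
  have "cmod (f z * g z) \<le> A * B" if "z \<in> ball 0 1" for z
    unfolding norm_mult using b(1,2)[OF that] by (intro mult_mono) (auto intro: order_trans[OF norm_ge_zero])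
  moreover have "cmod (deriv (\<lambda>z. f z * g z) z) \<le> A * B' + A' * B" if "z \<in> ball 0 1" for z
  proof -
    have "deriv (\<lambda>z. f z * g z) z = f z * deriv g z + deriv f z * g z"
      using DERIV_imp_deriv[OF DERIV_mult[OF disc_multiplier_deriv[OF f that] disc_multiplier_deriv[OF g that]]]
      by (simp add: mult_ac add_ac)
    also have "cmod \<dots> \<le> cmod (f z) * cmod (deriv g z) + cmod (deriv f z) * cmod (g z)"
      by (metis norm_mult norm_triangle_ineq)
    also have "\<dots> \<le> A * B' + A' * B"
      using b[OF that] by (intro add_mono mult_mono) (auto intro: order_trans[OF norm_ge_zero])
    finally show ?thesis .
  qed
  ultimately show ?thesis
    by (rule disc_multiplierI_bounds[OF hol])
qed

lemma disc_multiplier_const: "disc_multiplier (\<lambda>z. c)"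
  by (rule disc_multiplierI[of _ UNIV]) auto

lemma disc_multiplier_poly: "disc_multiplier (poly p)"
  by (rule disc_multiplierI[of _ UNIV]) (auto intro!: holomorphic_intros poly_holomorphic_on[where f="\<lambda>z. z"])

lemma disc_multiplier_add:
  assumes f: "disc_multiplier f" and g: "disc_multiplier g"
  shows "disc_multiplier (\<lambda>z. f z + g z)"
proof -
  have hol: "(\<lambda>z. f z + g z) holomorphic_on ball 0 1"
    by (intro holomorphic_intros disc_multiplier_holomorphic f g)
  obtain A B A' B' where b: "\<And>z. z \<in> ball 0 1 \<Longrightarrow> cmod (f z) \<le> A" "\<And>z. z \<in> ball 0 1 \<Longrightarrow> cmod (g z) \<le> B"
    "\<And>z. z \<in> ball 0 1 \<Longrightarrow> cmod (deriv f z) \<le> A'" "\<And>z. z \<in> ball 0 1 \<Longrightarrow> cmod (deriv g z) \<le> B'"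
    using f g unfolding disc_multiplier_def bounded_iff by (metis imageI)
  have "cmod (f z + g z) \<le> A + B" if "z \<in> ball 0 1" for z
    using b(1,2)[OF that] norm_triangle_ineq[of "f z" "g z"] by linarith
  moreover have "cmod (deriv (\<lambda>z. f z + g z) z) \<le> A' + B'" if "z \<in> ball 0 1" for z
    using b(3,4)[OF that] norm_triangle_ineq[of "deriv f z" "deriv g z"]
      DERIV_imp_deriv[OF DERIV_add[OF disc_multiplier_deriv[OF f that] disc_multiplier_deriv[OF g that]]] by simp
  ultimately show ?thesis
    by (rule disc_multiplierI_bounds[OF hol])
qed

lemma disc_multiplier_inverse:
  assumes f: "disc_multiplier f" and d: "d > 0" "\<And>z. z \<in> ball 0 1 \<Longrightarrow> d \<le> cmod (f z)"
  shows "disc_multiplier (\<lambda>z. inverse (f z))"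
proof -
  obtain A' where A': "\<And>z. z \<in> ball 0 1 \<Longrightarrow> cmod (deriv f z) \<le> A'"
    using f unfolding disc_multiplier_def bounded_iff by (metis imageI)
  have nz: "f z \<noteq> 0" if "z \<in> ball 0 1" for z using d(1) d(2)[OF that] by auto
  have hol: "(\<lambda>z. inverse (f z)) holomorphic_on ball 0 1"
    using nz by (intro holomorphic_on_inverse disc_multiplier_holomorphic f) auto
  have i: "cmod (inverse (f z)) \<le> inverse d" if "z \<in> ball 0 1" for z
    unfolding norm_inverse using d(1) d(2)[OF that] by (rule le_imp_inverse_le[rotated])
  moreover have "cmod (deriv (\<lambda>z. inverse (f z)) z) \<le> inverse d * A' * inverse d" if "z \<in> ball 0 1" for z
  proof -
    have "deriv (\<lambda>z. inverse (f z)) z = - (inverse (f z) * deriv f z * inverse (f z))"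
      using DERIV_imp_deriv[OF DERIV_inverse'[OF disc_multiplier_deriv[OF f that] nz[OF that]]] by simp
    also have "cmod \<dots> = cmod (inverse (f z)) * cmod (deriv f z) * cmod (inverse (f z))"
      by (simp only: norm_minus_cancel norm_mult)
    also have "\<dots> \<le> inverse d * A' * inverse d"
      using i[OF that] A'[OF that] d(1) order_trans[OF norm_ge_zero A'[OF that]] by (intro mult_mono) auto
    finally show ?thesis .
  qed
  ultimately show ?thesis
    by (rule disc_multiplierI_bounds[OF hol])
qed

lemma mult_op_in:
  "disc_multiplier m \<Longrightarrow> f \<in> dirichlet_space \<Longrightarrow> mult_op m f \<in> dirichlet_space"
  using mult_op_bounded by blast

lemma mult_op_add: "mult_op m (\<lambda>z. f z + g z) = (\<lambda>z. mult_op m f z + mult_op m g z)"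
  and mult_op_diff: "mult_op m (\<lambda>z. f z - g z) = (\<lambda>z. mult_op m f z - mult_op m g z)"
  and mult_op_cmult: "mult_op m (\<lambda>z. c * f z) = (\<lambda>z. c * mult_op m f z)"
  by (auto simp: mult_op_def algebra_simps)

text \<open>Existence and uniqueness of the representing vector give the definite description in
  \<open>dirichlet_adjoint\<close> its meaning.\<close>

lemma
  assumes m: "disc_multiplier m" and g: "g \<in> dirichlet_space"
  shows mult_op_adjoint_in: "dirichlet_adjoint (mult_op m) g \<in> dirichlet_space"
    and mult_op_adjoint: "f \<in> dirichlet_space \<Longrightarrow>
      dirichlet_inner (mult_op m f) g = dirichlet_inner f (dirichlet_adjoint (mult_op m) g)"
proof -
  obtain C where C: "\<And>f. f \<in> dirichlet_space \<Longrightarrow>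
     mult_op m f \<in> dirichlet_space \<and> dirichlet_nsq (mult_op m f) \<le> C * dirichlet_nsq f"
    using mult_op_bounded[OF m] by blast
  obtain h where h: "h \<in> dirichlet_space"
    "\<And>f. f \<in> dirichlet_space \<Longrightarrow> dirichlet_inner (mult_op m f) g = dirichlet_inner f h"
    by (rule dirichlet_adjoint_exists[of "mult_op m" C g])
       (use C g in \<open>auto simp: mult_op_add mult_op_cmult\<close>)
  have "h' = h" if "h' \<in> dirichlet_space"
    "\<forall>f\<in>dirichlet_space. dirichlet_inner (mult_op m f) g = dirichlet_inner f h'" for h'
    by (rule dirichlet_space_eq_of_inner) (use that h in auto)
  then have "dirichlet_adjoint (mult_op m) g = h"
    unfolding dirichlet_adjoint_def using h by (intro the_equality) blast+
  then show "dirichlet_adjoint (mult_op m) g \<in> dirichlet_space"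
    and "f \<in> dirichlet_space \<Longrightarrow>
      dirichlet_inner (mult_op m f) g = dirichlet_inner f (dirichlet_adjoint (mult_op m) g)"
    using h by auto
qed

text \<open>Invariance under an operator and its adjoint is invariance of \<open>M\<close> and of
  its complement, that is, commutation with the projection. The adjoint reappears only in results on
  orthogonal complements.\<close>

theorem reducing_subspace_iff_commute:
  assumes m: "disc_multiplier m"
  shows "reducing_subspace (mult_op m) M \<longleftrightarrow> closed_subspace M \<and>
    (\<forall>f\<in>dirichlet_space. dirichlet_proj M (mult_op m f) = mult_op m (dirichlet_proj M f))"
proof (intro iffI conjI ballI)
  assume red: "reducing_subspace (mult_op m) M"
  then show M: "closed_subspace M" by (simp add: reducing_subspace_def)
  fix f assume f: "f \<in> dirichlet_space"
  note S = dirichlet_proj_space[OF M f] dirichlet_proj_in[OF M f]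
  show "dirichlet_proj M (mult_op m f) = mult_op m (dirichlet_proj M f)"
  proof (rule dirichlet_proj_unique[OF M mult_op_in[OF m f]])
    show "mult_op m (dirichlet_proj M f) \<in> M"
      using red S unfolding reducing_subspace_def by blast
    fix h assume h: "h \<in> M"
    then have hD: "h \<in> dirichlet_space" by (rule closed_subspace_in_space[OF M])
    have "dirichlet_adjoint (mult_op m) h \<in> M" using red h unfolding reducing_subspace_def by blast
    then have "dirichlet_inner (mult_op m (\<lambda>z. f z - dirichlet_proj M f z)) h = 0"
      using mult_op_adjoint[OF m hD dirichlet_space_diff[OF f S(1)]] dirichlet_proj_orth[OF M f] by simp
    then show "dirichlet_inner (\<lambda>z. mult_op m f z - mult_op m (dirichlet_proj M f) z) h = 0"
      by (simp add: mult_op_diff)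
  qed
next
  assume as: "closed_subspace M \<and>
    (\<forall>f\<in>dirichlet_space. dirichlet_proj M (mult_op m f) = mult_op m (dirichlet_proj M f))"
  then have M: "closed_subspace M" by simp
  have "mult_op m f \<in> M" if f: "f \<in> M" for f
    using as f dirichlet_proj_in[OF M mult_op_in[OF m]] dirichlet_proj_id[OF M f]
      closed_subspace_in_space[OF M f] by metis
  moreover have "dirichlet_adjoint (mult_op m) h \<in> M" if h: "h \<in> M" for h
  proof -
    have hD: "h \<in> dirichlet_space" by (rule closed_subspace_in_space[OF M h])
    define k where "k = dirichlet_adjoint (mult_op m) h"
    have k: "k \<in> dirichlet_space" unfolding k_def by (rule mult_op_adjoint_in[OF m hD])
    note Pk = dirichlet_proj_space[OF M k]
    have "dirichlet_inner f k = dirichlet_inner f (dirichlet_proj M k)" if f: "f \<in> dirichlet_space" for f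
    proof -
      note Pf = dirichlet_proj_space[OF M f]
      have "dirichlet_inner f (dirichlet_proj M k) = dirichlet_inner (dirichlet_proj M f) k"
        by (rule dirichlet_proj_symmetric[OF M f k, symmetric])
      also have "\<dots> = dirichlet_inner (mult_op m (dirichlet_proj M f)) h"
        unfolding k_def by (rule mult_op_adjoint[OF m hD Pf, symmetric])
      also have "\<dots> = dirichlet_inner (dirichlet_proj M (mult_op m f)) h" using as f by simp
      also have "\<dots> = dirichlet_inner (mult_op m f) h"
        by (rule dirichlet_proj_inner[OF M mult_op_in[OF m f] h])
      also have "\<dots> = dirichlet_inner f k" unfolding k_def by (rule mult_op_adjoint[OF m hD f])
      finally show ?thesis ..
    qed
    from dirichlet_space_eq_of_inner[OF k Pk this] show ?thesis
      using dirichlet_proj_in[OF M k] by (simp add: k_def)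
  qed
  ultimately show "reducing_subspace (mult_op m) M"
    unfolding reducing_subspace_def using M by blast
qed

definition dirichlet_perp :: "(complex \<Rightarrow> complex) set \<Rightarrow> (complex \<Rightarrow> complex) set" where
  "dirichlet_perp E = {f \<in> dirichlet_space. \<forall>e\<in>E. dirichlet_inner f e = 0}"

lemma closed_subspace_perp:
  assumes E: "E \<subseteq> dirichlet_space"
  shows "closed_subspace (dirichlet_perp E)"
  unfolding closed_subspace_def
proof (intro conjI allI impI ballI)
  fix F f assume as: "(\<forall>k. F k \<in> dirichlet_perp E) \<and> f \<in> dirichlet_space \<and>
    (\<lambda>k. dirichlet_norm (\<lambda>z. F k z - f z)) \<longlonglongrightarrow> 0"
  then have F: "\<And>k. F k \<in> dirichlet_space" and Fe: "\<And>k e. e \<in> E \<Longrightarrow> dirichlet_inner (F k) e = 0"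
    and f: "f \<in> dirichlet_space" by (auto simp: dirichlet_perp_def)
  have lim: "(\<lambda>k. dirichlet_nsq (\<lambda>z. F k z - f z)) \<longlonglongrightarrow> 0"
  proof -
    have "(\<lambda>k. (dirichlet_norm (\<lambda>z. F k z - f z))\<^sup>2) \<longlonglongrightarrow> 0\<^sup>2"
      using as by (intro tendsto_power) auto
    then show ?thesis
      by (simp add: dirichlet_norm_nsq dirichlet_nsq_nonneg dirichlet_space_diff F f)
  qed
  have "dirichlet_inner f e = 0" if e: "e \<in> E" for e
  proof -
    have "(\<lambda>k. dirichlet_inner (\<lambda>z. F k z - f z) e) \<longlonglongrightarrow> 0"
      by (rule dirichlet_inner_tendsto_zero) (use lim F f e E in \<open>auto intro: dirichlet_space_diff\<close>)
    moreover have "dirichlet_inner (\<lambda>z. F k z - f z) e = - dirichlet_inner f e" for k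
      using Fe[OF e] F f e E by (subst dirichlet_inner_diff_left) auto
    ultimately show ?thesis by (simp add: tendsto_const_iff)
  qed
  then show "f \<in> dirichlet_perp E" using f by (simp add: dirichlet_perp_def)
qed (use E in \<open>auto simp: dirichlet_perp_def dirichlet_inner_add_left dirichlet_inner_cmult_left subset_eq
      intro: dirichlet_space_add dirichlet_space_cmult\<close>)

text \<open>Pairing the adjoint of \<open>f\<close> with \<open>e\<close> moves the operator to
  \<open>e\<close>, so adjoint invariance reduces to orthogonality of \<open>f\<close> to the images
  of the generators, and no adjoint has to be computed.\<close>

lemma reducing_subspace_perp:
  assumes m: "disc_multiplier m" and E: "E \<subseteq> dirichlet_space"
    and inv: "\<And>f. f \<in> dirichlet_perp E \<Longrightarrow> mult_op m f \<in> dirichlet_perp E"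
    and orth: "\<And>f e. f \<in> dirichlet_perp E \<Longrightarrow> e \<in> E \<Longrightarrow> dirichlet_inner f (mult_op m e) = 0"
  shows "reducing_subspace (mult_op m) (dirichlet_perp E)"
proof -
  have "dirichlet_adjoint (mult_op m) f \<in> dirichlet_perp E" if f: "f \<in> dirichlet_perp E" for f
  proof -
    have fD: "f \<in> dirichlet_space" using f by (simp add: dirichlet_perp_def)
    note A = mult_op_adjoint_in[OF m fD]
    have "dirichlet_inner (dirichlet_adjoint (mult_op m) f) e = 0" if e: "e \<in> E" for e
    proof -
      have eD: "e \<in> dirichlet_space" using e E by auto
      have "dirichlet_inner (mult_op m e) f = cnj (dirichlet_inner f (mult_op m e))"
        by (rule dirichlet_inner_cnj[OF fD mult_op_in[OF m eD], symmetric])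
      then have "dirichlet_inner e (dirichlet_adjoint (mult_op m) f) = 0"
        using mult_op_adjoint[OF m fD eD] orth[OF f e] by simp
      then show ?thesis using dirichlet_inner_cnj[OF eD A] by simp
    qed
    then show ?thesis using A by (simp add: dirichlet_perp_def)
  qed
  then show ?thesis
    unfolding reducing_subspace_def using closed_subspace_perp[OF E] inv by blast
qed

section \<open>Equivalent symbols have the same reducing subspaces\<close>

lemma disc_aut_denom_nonzero:
  assumes "cmod l < 1" "cmod w \<le> 1" shows "1 - cnj l * w \<noteq> 0"
proof
  assume "1 - cnj l * w = 0"
  then have "cmod (cnj l * w) = 1" by (metis eq_iff_diff_eq_0 norm_one)
  moreover have "cmod (cnj l * w) < 1"
    using assms mult_left_le[of "cmod w" "cmod l"] by (simp add: norm_mult)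
  ultimately show False by simp
qed

lemma blaschke_equiv_sym:
  assumes "blaschke_equiv \<phi>\<^sub>1 \<phi>\<^sub>2" and le: "\<And>z. z \<in> ball 0 1 \<Longrightarrow> cmod (\<phi>\<^sub>1 z) \<le> 1"
  shows "blaschke_equiv \<phi>\<^sub>2 \<phi>\<^sub>1"
proof -
  obtain l a where l: "cmod l < 1" and a: "cmod a = 1"
    and eq: "\<And>z. z \<in> ball 0 1 \<Longrightarrow> \<phi>\<^sub>2 z = a * disc_aut l (\<phi>\<^sub>1 z)"
    using assms(1) unfolding blaschke_equiv_def by auto
  have aa: "a * cnj a = 1" using a by (simp add: complex_norm_square[symmetric])
  \<comment> \<open>\<open>disc_aut l\<close> is an involution; pulling the rotation by
    \<open>cnj a\<close> through it turns the parameter \<open>l\<close> into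
    \<open>a * l\<close>.\<close>
  have "\<phi>\<^sub>1 z = cnj a * disc_aut (a * l) (\<phi>\<^sub>2 z)" if z: "z \<in> ball 0 1" for z
  proof -
    define w where "w = \<phi>\<^sub>1 z"
    define D where "D = 1 - cnj l * w"
    have D: "D \<noteq> 0" unfolding D_def w_def by (rule disc_aut_denom_nonzero[OF l le[OF z]])
    have L: "1 - cnj l * l \<noteq> 0" by (rule disc_aut_denom_nonzero) (use l in auto)
    have e: "\<phi>\<^sub>2 z = a * ((l - w) / D)" using eq[OF z] by (simp add: disc_aut_def w_def D_def)
    have "1 - cnj (a * l) * \<phi>\<^sub>2 z = 1 - (a * cnj a) * (cnj l * ((l - w) / D))"
      by (simp add: e mult_ac)
    also have "\<dots> = (1 - cnj l * l) / D" using D by (simp add: aa field_simps) (simp add: D_def algebra_simps)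
    finally have den: "1 - cnj (a * l) * \<phi>\<^sub>2 z = (1 - cnj l * l) / D" .
    have "a * l - \<phi>\<^sub>2 z = a * (w * (1 - cnj l * l) / D)"
      using D by (simp add: e field_simps) (simp add: D_def algebra_simps)
    then have "cnj a * disc_aut (a * l) (\<phi>\<^sub>2 z) = (a * cnj a) * w"
      unfolding disc_aut_def den using D L by (simp add: mult_ac)
    then show ?thesis by (simp add: aa w_def)
  qed
  moreover have "a * l \<in> ball 0 1" using l a by (simp add: norm_mult)
  ultimately have "a * l \<in> ball 0 1 \<and> cmod (cnj a) = 1 \<and> (\<forall>z\<in>ball 0 1. \<phi>\<^sub>1 z = cnj a * disc_aut (a * l) (\<phi>\<^sub>2 z))"
    using a by simp
  then show ?thesis unfolding blaschke_equiv_def by blast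
qed

text \<open>The projection \<open>P\<close> commutes with affine functions of
  \<open>\<phi>\<^sub>1\<close>, hence with the numerator \<open>N\<close> and the denominator
  \<open>D\<close> of \<open>\<phi>\<^sub>2\<close>. Writing \<open>f = D g\<close> gives \<open>P
  (\<phi>\<^sub>2 f) = P (N g) = N P g = \<phi>\<^sub>2 D P g = \<phi>\<^sub>2 P f\<close>.\<close>

lemma
  assumes m: "disc_multiplier \<phi>\<^sub>1" and equiv: "blaschke_equiv \<phi>\<^sub>1 \<phi>\<^sub>2"
    and le: "\<And>z. z \<in> ball 0 1 \<Longrightarrow> cmod (\<phi>\<^sub>1 z) \<le> 1"
  shows disc_multiplier_blaschke_equiv: "disc_multiplier \<phi>\<^sub>2"
    and reducing_subspace_blaschke_equiv_imp:
      "reducing_subspace (mult_op \<phi>\<^sub>1) M \<Longrightarrow> reducing_subspace (mult_op \<phi>\<^sub>2) M"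
proof -
  obtain l a where l: "cmod l < 1" and a: "cmod a = 1"
    and eq: "\<And>z. z \<in> ball 0 1 \<Longrightarrow> \<phi>\<^sub>2 z = a * disc_aut l (\<phi>\<^sub>1 z)"
    using equiv unfolding blaschke_equiv_def by auto
  define D where "D z = 1 - cnj l * \<phi>\<^sub>1 z" for z
  define N where "N z = a * (l - \<phi>\<^sub>1 z)" for z
  have Dm: "disc_multiplier D"
    using disc_multiplier_add[OF disc_multiplier_const[of 1] disc_multiplier_mult[OF disc_multiplier_const[of "- cnj l"] m]]
    by (simp add: D_def[abs_def])
  have Nm: "disc_multiplier N"
    using disc_multiplier_add[OF disc_multiplier_const[of "a * l"] disc_multiplier_mult[OF disc_multiplier_const[of "- a"] m]]
    by (simp add: N_def[abs_def] algebra_simps)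
  have Dge: "1 - cmod l \<le> cmod (D z)" if "z \<in> ball 0 1" for z
  proof -
    have "1 - cmod l \<le> 1 - cmod (cnj l * \<phi>\<^sub>1 z)"
      using le[OF that] l by (simp add: norm_mult mult_left_le)
    also have "\<dots> \<le> cmod (D z)" unfolding D_def by (metis norm_one norm_triangle_ineq2)
    finally show ?thesis .
  qed
  have Dnz: "D z \<noteq> 0" if "z \<in> ball 0 1" for z using Dge[OF that] l by auto
  have Im: "disc_multiplier (\<lambda>z. inverse (D z))"
    by (rule disc_multiplier_inverse[OF Dm _ Dge]) (use l in auto)
  show m2: "disc_multiplier \<phi>\<^sub>2"
    by (rule disc_multiplier_cong[OF disc_multiplier_mult[OF Nm Im]])
       (simp add: eq N_def D_def disc_aut_def divide_inverse)
  assume "reducing_subspace (mult_op \<phi>\<^sub>1) M"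
  then have M: "closed_subspace M"
    and com: "\<And>f. f \<in> dirichlet_space \<Longrightarrow> dirichlet_proj M (mult_op \<phi>\<^sub>1 f) = mult_op \<phi>\<^sub>1 (dirichlet_proj M f)"
    using reducing_subspace_iff_commute[OF m] by auto
  have aff: "dirichlet_proj M (mult_op (\<lambda>z. c + d * \<phi>\<^sub>1 z) f) = mult_op (\<lambda>z. c + d * \<phi>\<^sub>1 z) (dirichlet_proj M f)"
    if f: "f \<in> dirichlet_space" for c d f
  proof -
    have "mult_op (\<lambda>z. c + d * \<phi>\<^sub>1 z) g = (\<lambda>z. c * g z + d * mult_op \<phi>\<^sub>1 g z)" for g
      by (auto simp: mult_op_def algebra_simps)
    then show ?thesis
      using f mult_op_in[OF m f]
      by (simp add: dirichlet_proj_add[OF M] dirichlet_proj_cmult[OF M] dirichlet_space_cmult com)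
  qed
  have Dc: "dirichlet_proj M (mult_op D f) = mult_op D (dirichlet_proj M f)"
    and Nc: "dirichlet_proj M (mult_op N f) = mult_op N (dirichlet_proj M f)" if "f \<in> dirichlet_space" for f
    using aff[OF that, of 1 "- cnj l"] aff[OF that, of "a * l" "- a"]
    by (simp_all add: D_def[abs_def] N_def[abs_def] algebra_simps)
  have "dirichlet_proj M (mult_op \<phi>\<^sub>2 f) = mult_op \<phi>\<^sub>2 (dirichlet_proj M f)" if f: "f \<in> dirichlet_space" for f
  proof -
    define g where "g = mult_op (\<lambda>z. inverse (D z)) f"
    have g: "g \<in> dirichlet_space" unfolding g_def by (rule mult_op_in[OF Im f])
    have fg: "f = mult_op D g"
      using Dnz dirichlet_space_outside[OF f] by (fastforce simp: g_def mult_op_def fun_eq_iff)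
    have \<phi>2: "mult_op \<phi>\<^sub>2 (mult_op D h) = mult_op N h" if h: "h \<in> dirichlet_space" for h
    proof
      fix z
      show "mult_op \<phi>\<^sub>2 (mult_op D h) z = mult_op N h z"
        using Dnz[of z] dirichlet_space_outside[OF h, of z]
        by (cases "z \<in> ball 0 1") (auto simp: mult_op_def eq disc_aut_def N_def D_def)
    qed
    show ?thesis
      unfolding fg Dc[OF g] \<phi>2[OF g] \<phi>2[OF dirichlet_proj_space[OF M g]] Nc[OF g] ..
  qed
  then show "reducing_subspace (mult_op \<phi>\<^sub>2) M"
    using reducing_subspace_iff_commute[OF m2] M by blast
qed

lemma disc_aut_norm_le_1:
  assumes "cmod l < 1" "cmod w \<le> 1" shows "cmod (disc_aut l w) \<le> 1"
proof -
  have "(cmod (1 - cnj l * w))\<^sup>2 - (cmod (l - w))\<^sup>2 = (1 - (cmod l)\<^sup>2) * (1 - (cmod w)\<^sup>2)"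
    unfolding cmod_power2 by (simp add: power2_eq_square algebra_simps)
  moreover have "(1 - (cmod l)\<^sup>2) * (1 - (cmod w)\<^sup>2) \<ge> 0"
    using assms by (intro mult_nonneg_nonneg) (auto simp: power_le_one)
  ultimately have "(cmod (l - w))\<^sup>2 \<le> (cmod (1 - cnj l * w))\<^sup>2" by linarith
  then have "cmod (l - w) \<le> cmod (1 - cnj l * w)" by (rule power2_le_imp_le) simp
  then show ?thesis
    using disc_aut_denom_nonzero[OF assms] by (simp add: disc_aut_def norm_divide divide_le_eq_1)
qed

theorem reducing_subspace_blaschke_equiv:
  assumes m: "disc_multiplier \<phi>\<^sub>1" and equiv: "blaschke_equiv \<phi>\<^sub>1 \<phi>\<^sub>2"
    and le: "\<And>z. z \<in> ball 0 1 \<Longrightarrow> cmod (\<phi>\<^sub>1 z) \<le> 1"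
  shows "reducing_subspace (mult_op \<phi>\<^sub>1) M \<longleftrightarrow> reducing_subspace (mult_op \<phi>\<^sub>2) M"
proof -
  have "cmod (\<phi>\<^sub>2 z) \<le> 1" if "z \<in> ball 0 1" for z
    using equiv le[OF that] that unfolding blaschke_equiv_def by (auto simp: norm_mult disc_aut_norm_le_1)
  then show ?thesis
    using reducing_subspace_blaschke_equiv_imp[OF m equiv le]
      reducing_subspace_blaschke_equiv_imp[OF disc_multiplier_blaschke_equiv[OF m equiv le] blaschke_equiv_sym[OF equiv le]]
    by blast
qed

section \<open>Coordinate subspaces\<close>

definition coord_space :: "nat set \<Rightarrow> (complex \<Rightarrow> complex) set" where
  "coord_space S = {f \<in> dirichlet_space. \<forall>m. m \<notin> S \<longrightarrow> taylor_coeff f m = 0}"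

lemma coord_space_eq_perp: "coord_space S = dirichlet_perp (dmono ` (- S))"
  by (auto simp: coord_space_def dirichlet_perp_def dirichlet_inner_dmono simp del: of_nat_Suc)

lemma dmono_in_coord_space: "dmono m \<in> coord_space S \<longleftrightarrow> m \<in> S"
  by (auto simp: coord_space_def taylor_coeff_dmono)

lemma dmono_nonzero: "dmono m \<noteq> (\<lambda>z. 0)"
  using taylor_coeff_dmono[of m m] by (metis taylor_coeff_zero zero_neq_one)

lemma coord_space_eq_iff: "coord_space S = coord_space S' \<longleftrightarrow> S = S'"
  using dmono_in_coord_space by blast

lemma coord_space_mono: "S \<subseteq> S' \<Longrightarrow> coord_space S \<subseteq> coord_space S'"
  by (auto simp: coord_space_def)

lemma coord_space_empty: "coord_space {} = {\<lambda>z. 0}"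
  by (auto simp: coord_space_def intro: dirichlet_space_eqI)

lemma coord_space_UNIV: "coord_space UNIV = dirichlet_space"
  by (auto simp: coord_space_def)

text \<open>A projection that is diagonal on the monomials has eigenvalues \<open>0\<close> and
  \<open>1\<close> only, so each monomial lies in \<open>M\<close> or in the kernel; symmetry
  carries this to the coefficients of any \<open>f\<close>.\<close>

lemma closed_subspace_eq_coord_space:
  assumes M: "closed_subspace M"
    and diag: "\<And>m. \<exists>d. dirichlet_proj M (dmono m) = (\<lambda>z. d * dmono m z)"
  shows "M = coord_space {m. dmono m \<in> M}"
proof -
  have P01: "dirichlet_proj M (dmono m) = (if dmono m \<in> M then dmono m else (\<lambda>z. 0))" for m
  proof -
    obtain d where d: "dirichlet_proj M (dmono m) = (\<lambda>z. d * dmono m z)" using diag by blast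
    have "dirichlet_proj M (dirichlet_proj M (dmono m)) = dirichlet_proj M (dmono m)"
      by (rule dirichlet_proj_id[OF M dirichlet_proj_in[OF M]]) simp
    then have "(\<lambda>z. d * (d * dmono m z)) = (\<lambda>z. d * dmono m z)"
      by (simp add: d dirichlet_proj_cmult[OF M])
    then have "taylor_coeff (\<lambda>z. d * (d * dmono m z)) m = taylor_coeff (\<lambda>z. d * dmono m z) m" by simp
    then have "d * d = d"
      by (simp add: taylor_coeff_cmult dirichlet_space_holomorphic dirichlet_space_cmult taylor_coeff_dmono)
    then consider "d = 0" | "d = 1" by auto
    then show ?thesis
    proof cases
      case 1
      then show ?thesis using d dirichlet_proj_id[OF M, of "dmono m"] dmono_nonzero[of m] by auto
    next
      case 2
      then show ?thesis using d dirichlet_proj_in[OF M dmono_in[of m]] by simp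
    qed
  qed
  have coeff: "taylor_coeff (dirichlet_proj M f) m = (if dmono m \<in> M then taylor_coeff f m else 0)"
    if f: "f \<in> dirichlet_space" for f m
  proof -
    have "of_nat (m + 1) * taylor_coeff (dirichlet_proj M f) m = dirichlet_inner f (dirichlet_proj M (dmono m))"
      using dirichlet_proj_symmetric[OF M f dmono_in[of m]] dirichlet_inner_dmono[OF dirichlet_proj_space[OF M f], of m]
      by simp
    also have "\<dots> = of_nat (m + 1) * (if dmono m \<in> M then taylor_coeff f m else 0)"
      using dirichlet_inner_dmono[OF f, of m] by (simp add: P01)
    finally show ?thesis by (simp only: mult_left_cancel of_nat_eq_0_iff add_is_0 one_neq_zero simp_thms)
  qed
  have iff: "f \<in> M \<longleftrightarrow> dirichlet_proj M f = f" if "f \<in> dirichlet_space" for f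
    using dirichlet_proj_id[OF M] dirichlet_proj_in[OF M that] by metis
  show ?thesis
  proof (intro set_eqI iffI)
    fix f assume f: "f \<in> M"
    then have fD: "f \<in> dirichlet_space" by (rule closed_subspace_in_space[OF M])
    have "dirichlet_proj M f = f" by (rule dirichlet_proj_id[OF M f])
    then have "taylor_coeff f m = 0" if "dmono m \<notin> M" for m
      using coeff[OF fD, of m] that by simp
    then show "f \<in> coord_space {m. dmono m \<in> M}" using fD by (auto simp: coord_space_def)
  next
    fix f assume f: "f \<in> coord_space {m. dmono m \<in> M}"
    then have fD: "f \<in> dirichlet_space" by (simp add: coord_space_def)
    have "dirichlet_proj M f = f"
      by (rule dirichlet_space_eqI[OF dirichlet_proj_space[OF M fD] fD])
         (use f in \<open>auto simp: coeff[OF fD] coord_space_def\<close>)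
    then show "f \<in> M" using iff[OF fD] by simp
  qed
qed

lemma disc_multiplier_power: "disc_multiplier (\<lambda>z. z ^ k)"
  by (rule disc_multiplierI[of _ UNIV]) (auto intro!: holomorphic_intros)

lemma mult_op_power_dmono: "mult_op (\<lambda>z. z ^ k) (dmono m) = dmono (m + k)"
  by (auto simp: mult_op_def dmono_def disc_ext_def power_add)

lemma taylor_coeff_mult_op_power:
  assumes f: "f \<in> dirichlet_space"
  shows "taylor_coeff (mult_op (\<lambda>z. z ^ k) f) n = (if n < k then 0 else taylor_coeff f (n - k))"
proof (induction k arbitrary: n)
  case 0
  then show ?case by (simp add: mult_op_def)
next
  case (Suc k)
  have "mult_op (\<lambda>z. z ^ Suc k) f = (\<lambda>z. z * mult_op (\<lambda>z. z ^ k) f z)"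
    by (auto simp: mult_op_def)
  then show ?case
    using Suc.IH[of "n - 1"] mult_op_in[OF disc_multiplier_power f, of k]
    by (auto simp: taylor_coeff_times_id dirichlet_space_holomorphic)
qed

lemma reducing_subspace_power_coord_space:
  assumes "\<And>m. m + k \<in> S \<longleftrightarrow> m \<in> S"
  shows "reducing_subspace (mult_op (\<lambda>z. z ^ k)) (coord_space S)"
  unfolding coord_space_eq_perp
proof (rule reducing_subspace_perp[OF disc_multiplier_power])
  fix f assume "f \<in> dirichlet_perp (dmono ` (- S))"
  then have f: "f \<in> coord_space S" by (simp add: coord_space_eq_perp)
  then have fD: "f \<in> dirichlet_space" by (simp add: coord_space_def)
  have "taylor_coeff (mult_op (\<lambda>z. z ^ k) f) m = 0" if "m \<notin> S" for m
    using f that assms[of "m - k"] by (auto simp: taylor_coeff_mult_op_power[OF fD] coord_space_def)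
  then have "mult_op (\<lambda>z. z ^ k) f \<in> coord_space S"
    using mult_op_in[OF disc_multiplier_power fD, of k] by (auto simp: coord_space_def)
  then show "mult_op (\<lambda>z. z ^ k) f \<in> dirichlet_perp (dmono ` (- S))" by (simp add: coord_space_eq_perp)
  fix e assume "e \<in> dmono ` (- S)"
  then obtain m where m: "m \<notin> S" "e = dmono m" by auto
  then show "dirichlet_inner f (mult_op (\<lambda>z. z ^ k) e) = 0"
    using f assms[of m] by (simp add: mult_op_power_dmono dirichlet_inner_dmono[OF fD] coord_space_def)
qed auto

text \<open>The weights \<open>n + 1\<close> are not invariant under the shift by \<open>k\<close>: comparing the symmetry
  of the projection before and after the shift kills its off-diagonal entries.\<close>
lemma reducing_subspace_power:
  assumes k: "k > 0" and red: "reducing_subspace (mult_op (\<lambda>z. z ^ k)) M"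
  obtains S where "M = coord_space S" "\<And>m. m + k \<in> S \<longleftrightarrow> m \<in> S"
proof -
  have M: "closed_subspace M"
    and com: "\<And>f. f \<in> dirichlet_space \<Longrightarrow>
        dirichlet_proj M (mult_op (\<lambda>z. z ^ k) f) = mult_op (\<lambda>z. z ^ k) (dirichlet_proj M f)"
    using red reducing_subspace_iff_commute[OF disc_multiplier_power] by auto
  define B where "B m n = taylor_coeff (dirichlet_proj M (dmono m)) n" for m n
  note PD = dirichlet_proj_space[OF M dmono_in]
  have sym: "of_nat (n + 1) * B m n = of_nat (m + 1) * cnj (B n m)" for m n
  proof -
    have "of_nat (n + 1) * B m n = dirichlet_inner (dmono m) (dirichlet_proj M (dmono n))"
      unfolding B_def dirichlet_inner_dmono[OF PD, symmetric]
      by (rule dirichlet_proj_symmetric[OF M]) auto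
    also have "\<dots> = cnj (of_nat (m + 1) * B n m)"
      unfolding B_def dirichlet_inner_dmono[OF PD, symmetric]
      by (rule dirichlet_inner_cnj[symmetric]) (auto intro: PD)
    finally show ?thesis by simp
  qed
  have shift: "dirichlet_proj M (dmono (m + k)) = mult_op (\<lambda>z. z ^ k) (dirichlet_proj M (dmono m))" for m
    using com[OF dmono_in[of m]] by (simp add: mult_op_power_dmono)
  have Bshift: "B (m + k) (n + k) = B m n" for m n
    unfolding B_def shift by (simp add: taylor_coeff_mult_op_power[OF PD])
  have B0: "B m n = 0" if "m \<noteq> n" for m n
  proof -
    have "of_nat (n + 1) * B m n = of_nat (m + 1) * cnj (B n m)" by (rule sym)
    moreover have "of_nat (n + k + 1) * B m n = of_nat (m + k + 1) * cnj (B n m)"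
      using sym[of "n + k" "m + k"] by (simp only: Bshift)
    \<comment> \<open>Subtracting the two symmetry relations leaves
      \<open>k B m n = k cnj (B n m)\<close>; inserted into either of them this forces the entry to
      vanish when \<open>m \<noteq> n\<close>.\<close>
    ultimately have "of_nat (n + k + 1) * B m n - of_nat (n + 1) * B m n
        = of_nat (m + k + 1) * cnj (B n m) - of_nat (m + 1) * cnj (B n m)"
      by (simp only:)
    then have "of_nat k * B m n = of_nat k * cnj (B n m)"
      by (simp add: algebra_simps)
    then have "B m n = cnj (B n m)" using k by simp
    then have "of_nat (n + 1) * B m n = of_nat (m + 1) * B m n" using sym[of n m] by simp
    then have "(of_nat (n + 1) :: complex) = of_nat (m + 1) \<or> B m n = 0" by (metis mult_right_cancel)
    then show ?thesis using that by (simp only: of_nat_eq_iff) simp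
  qed
  have diag: "dirichlet_proj M (dmono m) = (\<lambda>z. B m m * dmono m z)" for m
    by (rule dirichlet_space_eqI[OF PD dirichlet_space_cmult[OF dmono_in]])
       (auto simp: taylor_coeff_cmult dirichlet_space_holomorphic taylor_coeff_dmono B0 simp flip: B_def)
  have "M = coord_space {m. dmono m \<in> M}"
    by (rule closed_subspace_eq_coord_space[OF M]) (use diag in blast)
  moreover have "dmono (m + k) \<in> M \<longleftrightarrow> dmono m \<in> M" for m
  proof -
    have "dmono m \<in> M \<longleftrightarrow> B m m = 1" for m
    proof
      assume "dmono m \<in> M"
      then show "B m m = 1" by (simp add: B_def dirichlet_proj_id[OF M] taylor_coeff_dmono)
    next
      assume "B m m = 1"
      then show "dmono m \<in> M" using diag[of m] dirichlet_proj_in[OF M dmono_in[of m]] by simp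
    qed
    then show ?thesis using Bshift[of m m] by simp
  qed
  ultimately show ?thesis using that[of "{m. dmono m \<in> M}"] by blast
qed

text \<open>Index sets invariant under the shift by \<open>k\<close> are unions of residue classes.
  Single classes are the atoms, and \<open>k \<ge> 2\<close> makes each of them a proper
  subset.\<close>

theorem card_minimal_reducing_power:
  assumes k: "k \<ge> 2"
  shows "card {M. minimal_reducing_subspace (mult_op (\<lambda>z. z ^ k)) M} = k"
proof -
  let ?T = "mult_op (\<lambda>z. z ^ k)"
  let ?R = "\<lambda>r. {m. m mod k = r}"
  let ?N = "\<lambda>r. coord_space (?R r)"
  have red: "reducing_subspace ?T (?N r)" for r
    by (rule reducing_subspace_power_coord_space) simp
  have step: "m + k * j \<in> S \<longleftrightarrow> m \<in> S" if "\<And>m. m + k \<in> S \<longleftrightarrow> m \<in> S" for S m j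
  proof (induction j)
    case (Suc j)
    have "m + k * Suc j = (m + k * j) + k" by simp
    then show ?case using Suc.IH that[of "m + k * j"] by (simp only:)
  qed simp
  have cls: "m \<in> S \<longleftrightarrow> m mod k \<in> S" if "\<And>m. m + k \<in> S \<longleftrightarrow> m \<in> S" for S m
    using step[OF that, of "m mod k" "m div k"] by simp
  have ex: "\<exists>S. N = coord_space S \<and> (\<forall>m. m + k \<in> S \<longleftrightarrow> m \<in> S)" if "reducing_subspace ?T N" for N
  proof -
    have "k > 0" using k by simp
    from reducing_subspace_power[OF this that] show ?thesis by metis
  qed
  have R_ne: "r \<in> ?R r" if "r < k" for r using that by simp
  have nontriv: "nontrivial_reducing_subspace ?T (?N r)" if r: "r < k" for r
  proof -
    have "?R r \<noteq> {}" using R_ne[OF r] by blast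
    moreover have "?R r \<noteq> UNIV"
    proof -
      have "Suc r \<notin> ?R r" using k mod_Suc[of r k] r by auto
      then show ?thesis by blast
    qed
    ultimately show ?thesis
      unfolding nontrivial_reducing_subspace_def coord_space_empty[symmetric] coord_space_UNIV[symmetric] coord_space_eq_iff
      using red by blast
  qed
  have min: "minimal_reducing_subspace ?T (?N r)" if r: "r < k" for r
    unfolding minimal_reducing_subspace_def
  proof (intro conjI allI impI nontriv r)
    fix N assume N: "reducing_subspace ?T N \<and> N \<subseteq> ?N r"
    obtain S where S: "N = coord_space S" "\<And>m. m + k \<in> S \<longleftrightarrow> m \<in> S"
      using ex[of N] N by blast
    have sub: "S \<subseteq> ?R r"
    proof
      fix m assume "m \<in> S"
      then have "dmono m \<in> N" by (simp only: S(1) dmono_in_coord_space)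
      then have "dmono m \<in> ?N r" using N by blast
      then show "m \<in> ?R r" by (simp only: dmono_in_coord_space)
    qed
    show "N = ?N r \<or> N = {\<lambda>z. 0}"
    proof (cases "r \<in> S")
      case True
      then have "?R r \<subseteq> S" using cls[OF S(2)] by auto
      then show ?thesis using sub S(1) by auto
    next
      case False
      have "m \<notin> S" for m using cls[OF S(2), of m] sub False by (cases "m mod k = r") auto
      then have "S = {}" by blast
      then show ?thesis using S(1) coord_space_empty by simp
    qed
  qed
  have only: "\<exists>r<k. M = ?N r" if M: "minimal_reducing_subspace ?T M" for M
  proof -
    obtain S where S: "M = coord_space S" "\<And>m. m + k \<in> S \<longleftrightarrow> m \<in> S"
      using ex[of M] M unfolding minimal_reducing_subspace_def nontrivial_reducing_subspace_def by blast
    have "M \<noteq> {\<lambda>z. 0}" using M unfolding minimal_reducing_subspace_def nontrivial_reducing_subspace_def by blast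
    then have "S \<noteq> {}" using S(1) coord_space_empty by auto
    then obtain m where m: "m \<in> S" by blast
    define r where "r = m mod k"
    have r: "r < k" "r \<in> S" using k cls[OF S(2), of m] m by (auto simp: r_def)
    have "?R r \<subseteq> S" using cls[OF S(2)] r by auto
    then have "?N r \<subseteq> M" unfolding S(1) by (rule coord_space_mono)
    then have "?N r = M \<or> ?N r = {\<lambda>z. 0}" using M red[of r] unfolding minimal_reducing_subspace_def by blast
    moreover have "?N r \<noteq> {\<lambda>z. 0}" using nontriv[OF r(1)] unfolding nontrivial_reducing_subspace_def by blast
    ultimately show ?thesis using r(1) by blast
  qed
  have "{M. minimal_reducing_subspace ?T M} = ?N ` {..<k}" using min only by auto
  moreover have "inj_on ?N {..<k}"
  proof (rule inj_onI)
    fix x y assume xy: "x \<in> {..<k}" "?N x = ?N y"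
    then have "x \<in> ?R y" using R_ne[of x] by (simp only: coord_space_eq_iff lessThan_iff)
    then show "x = y" using xy(1) by simp
  qed
  ultimately show ?thesis by (simp add: card_image)
qed

section \<open>Even symbols, and counting when only two subspaces occur\<close>

lemma taylor_coeff_even:
  assumes f: "f holomorphic_on ball 0 1" and even: "\<And>z. z \<in> ball 0 1 \<Longrightarrow> f (- z) = f z" and n: "odd n"
  shows "taylor_coeff f n = 0"
proof -
  have "taylor_coeff f n = (-1) ^ n * taylor_coeff f n"
  proof (rule taylor_coeff_unique[of 1])
    fix z :: complex assume z: "z \<in> ball 0 1"
    then have "(\<lambda>n. taylor_coeff f n * (- z) ^ n) sums f (- z)" by (intro taylor_coeff_sums f) simp
    moreover have "taylor_coeff f n * (- z) ^ n = (- 1) ^ n * taylor_coeff f n * z ^ n" for n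
      by (subst power_minus) simp
    ultimately show "(\<lambda>n. (- 1) ^ n * taylor_coeff f n * z ^ n) sums f z" by (simp add: even[OF z])
  qed simp
  then show ?thesis using n by simp
qed

text \<open>Multiplication by an even function preserves parity, and functions of opposite parity
  have disjoint sets of coefficients. The boolean \<open>b\<close> treats both parities at
  once.\<close>

lemma reducing_subspace_even_coord_space:
  assumes m: "disc_multiplier \<phi>" and even: "\<And>z. z \<in> ball 0 1 \<Longrightarrow> \<phi> (- z) = \<phi> z"
  shows "reducing_subspace (mult_op \<phi>) (coord_space {n. even n \<longleftrightarrow> b})"
proof -
  let ?S = "{n. even n \<longleftrightarrow> b}"
  have \<phi>0: "taylor_coeff \<phi> n = 0" if "odd n" for n
    by (rule taylor_coeff_even[OF disc_multiplier_holomorphic[OF m] even that])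
  have inv: "mult_op \<phi> f \<in> coord_space {n. even n \<longleftrightarrow> c}" if f: "f \<in> coord_space {n. even n \<longleftrightarrow> c}" for f c
  proof -
    have fD: "f \<in> dirichlet_space" using f by (simp add: coord_space_def)
    have "taylor_coeff (mult_op \<phi> f) n = 0" if n: "even n \<longleftrightarrow> \<not> c" for n
      unfolding mult_op_def taylor_coeff_mult[OF disc_multiplier_holomorphic[OF m] dirichlet_space_holomorphic[OF fD]]
    proof (rule sum.neutral, intro ballI)
      fix i assume "i \<in> {..n}"
      then show "taylor_coeff \<phi> i * taylor_coeff f (n - i) = 0"
        using \<phi>0[of i] f n by (cases "even i") (auto simp: coord_space_def)
    qed
    then show ?thesis using mult_op_in[OF m fD] by (auto simp: coord_space_def)
  qed
  show ?thesis
    unfolding coord_space_eq_perp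
  proof (rule reducing_subspace_perp[OF m])
    fix f assume "f \<in> dirichlet_perp (dmono ` (- ?S))"
    then have f: "f \<in> coord_space ?S" by (simp add: coord_space_eq_perp)
    show "mult_op \<phi> f \<in> dirichlet_perp (dmono ` (- ?S))" using inv[OF f] by (simp add: coord_space_eq_perp)
    fix e assume "e \<in> dmono ` (- ?S)"
    then have "e \<in> coord_space {n. even n \<longleftrightarrow> \<not> b}" by (auto simp: dmono_in_coord_space)
    from inv[OF this] have e: "mult_op \<phi> e \<in> coord_space {n. even n \<longleftrightarrow> \<not> b}" .
    have "of_nat (n + 1) * taylor_coeff f n * cnj (taylor_coeff (mult_op \<phi> e) n) = 0" for n
      using f e by (cases "even n \<longleftrightarrow> b") (auto simp: coord_space_def)
    then show "dirichlet_inner f (mult_op \<phi> e) = 0"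
      unfolding dirichlet_inner_def by (simp only: suminf_zero)
  qed auto
qed

text \<open>Serves the even and odd functions, and a subspace with its complement: once nothing else
  is reducing, the trivial intersection makes both minimal.\<close>

lemma card_minimal_reducing_two:
  assumes A: "nontrivial_reducing_subspace T A" and B: "nontrivial_reducing_subspace T B"
    and AB: "A \<inter> B = {\<lambda>z. 0}"
    and only: "\<And>M. nontrivial_reducing_subspace T M \<Longrightarrow> M = A \<or> M = B"
  shows "card {M. minimal_reducing_subspace T M} = 2"
proof -
  have A0: "A \<noteq> {\<lambda>z. 0}" "B \<noteq> {\<lambda>z. 0}" "A \<noteq> dirichlet_space" "B \<noteq> dirichlet_space"
    "closed_subspace A" "closed_subspace B"
    using A B by (auto simp: nontrivial_reducing_subspace_def reducing_subspace_def)
  then have sub: "A \<subseteq> dirichlet_space" "B \<subseteq> dirichlet_space" by (auto simp: closed_subspace_def)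
  have min: "minimal_reducing_subspace T X" if X: "X = A \<or> X = B" for X
    unfolding minimal_reducing_subspace_def
  proof (intro conjI allI impI)
    show "nontrivial_reducing_subspace T X" using X A B by auto
    fix N assume N: "reducing_subspace T N \<and> N \<subseteq> X"
    show "N = X \<or> N = {\<lambda>z. 0}"
    proof (cases "N = {\<lambda>z. 0}")
      case False
      have "X \<subset> dirichlet_space" using X sub A0(3,4) by (elim disjE) simp_all
      then have "N \<noteq> dirichlet_space" using N by (simp add: psubset_eq) (metis subset_antisym)
      then have "N = A \<or> N = B" using only[of N] N False by (auto simp: nontrivial_reducing_subspace_def)
      then show ?thesis using X AB False N by (metis Int_commute inf.absorb1)
    qed simp
  qed
  have "minimal_reducing_subspace T M \<longleftrightarrow> M = A \<or> M = B" for M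
    using min[of M] only[of M] unfolding minimal_reducing_subspace_def by blast
  then have "{M. minimal_reducing_subspace T M} = {A, B}"
    by (intro set_eqI) simp
  moreover have "A \<noteq> B" using AB A0 by auto
  ultimately show ?thesis by simp
qed

section \<open>Finite Blaschke products\<close>

definition blaschke_num :: "complex list \<Rightarrow> complex poly" where
  "blaschke_num ls = (\<Prod>l\<leftarrow>ls. [:l, -1:])"

definition blaschke_den :: "complex list \<Rightarrow> complex poly" where
  "blaschke_den ls = (\<Prod>l\<leftarrow>ls. [:1, - cnj l:])"

lemma blaschke_num_simps [simp]:
  "blaschke_num [] = 1" "blaschke_num (l # ls) = [:l, -1:] * blaschke_num ls"
  "blaschke_den [] = 1" "blaschke_den (l # ls) = [:1, - cnj l:] * blaschke_den ls"
  by (simp_all add: blaschke_num_def blaschke_den_def)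

lemma poly_blaschke_Cons:
  "poly (blaschke_num (l # ls)) z = (l - z) * poly (blaschke_num ls) z"
  "poly (blaschke_den (l # ls)) z = (1 - cnj l * z) * poly (blaschke_den ls) z"
  by (simp_all add: algebra_simps)

lemma prod_disc_aut_eq:
  "(\<Prod>l\<leftarrow>ls. disc_aut l z) = poly (blaschke_num ls) z / poly (blaschke_den ls) z"
  by (induction ls) (auto simp: disc_aut_def algebra_simps)

lemma degree_blaschke_num: "degree (blaschke_num ls) = length ls"
  and lead_coeff_blaschke_num: "coeff (blaschke_num ls) (length ls) = (-1) ^ length ls"
proof -
  have *: "degree (blaschke_num ls) = length ls \<and> lead_coeff (blaschke_num ls) = (-1) ^ length ls"
  proof (induction ls)
    case (Cons l ls)
    have ne: "blaschke_num ls \<noteq> 0" using Cons by auto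
    have "degree (blaschke_num (l # ls)) = Suc (length ls)"
      unfolding blaschke_num_simps using ne Cons by (subst degree_mult_eq) auto
    moreover have "lead_coeff (blaschke_num (l # ls)) = (-1) ^ Suc (length ls)"
      unfolding blaschke_num_simps lead_coeff_mult conjunct2[OF Cons.IH] by simp
    ultimately show ?case by simp
  qed simp
  show "degree (blaschke_num ls) = length ls" using * by simp
  show "coeff (blaschke_num ls) (length ls) = (-1) ^ length ls"
    using conjunct2[OF *] unfolding conjunct1[OF *] .
qed

lemma blaschke_num_nonzero: "blaschke_num ls \<noteq> 0"
  using lead_coeff_blaschke_num[of ls] by auto

lemma degree_blaschke_den: "degree (blaschke_den ls) \<le> length ls"
proof (induction ls)
  case (Cons l ls)
  have "degree (blaschke_den (l # ls)) \<le> degree [:1, - cnj l:] + degree (blaschke_den ls)"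
    unfolding blaschke_num_simps by (rule degree_mult_le)
  then show ?case using Cons by (auto split: if_splits)
qed simp

lemma norm_blaschke_den_coeff:
  "set ls \<subseteq> ball 0 1 \<Longrightarrow> cmod (coeff (blaschke_den ls) (length ls)) \<le> 1"
proof (induction ls)
  case (Cons l ls)
  have "coeff (blaschke_den ls) (Suc (length ls)) = 0"
    using degree_blaschke_den[of ls] by (intro coeff_eq_0) simp
  then have "coeff (blaschke_den (l # ls)) (length (l # ls)) = - cnj l * coeff (blaschke_den ls) (length ls)"
    by simp
  then show ?case using Cons by (simp add: norm_mult mult_le_one)
qed simp

lemma poly_blaschke_num_eq_0_iff: "poly (blaschke_num ls) z = 0 \<longleftrightarrow> z \<in> set ls"
  by (induction ls) auto

lemma poly_blaschke_den_nonzero: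
  assumes "set ls \<subseteq> ball 0 1" "cmod z \<le> 1" shows "poly (blaschke_den ls) z \<noteq> 0"
  using assms by (induction ls) (auto dest: disc_aut_denom_nonzero simp: mult.commute)

lemma poly_blaschke_den_0 [simp]: "poly (blaschke_den ls) 0 = 1"
  by (induction ls) auto

lemma disc_aut_norm_identity:
  "(cmod (1 - cnj l * w))\<^sup>2 - (cmod (l - w))\<^sup>2 = (1 - (cmod l)\<^sup>2) * (1 - (cmod w)\<^sup>2)"
  unfolding cmod_power2 by (simp add: power2_eq_square algebra_simps)

lemma disc_aut_in_ball:
  assumes "l \<in> ball 0 1" "w \<in> ball 0 1" shows "disc_aut l w \<in> ball 0 1"
proof -
  have "(1 - (cmod l)\<^sup>2) * (1 - (cmod w)\<^sup>2) > 0"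
    using assms by (intro mult_pos_pos) (auto simp: power_less_one_iff abs_square_less_1)
  then have "(cmod (l - w))\<^sup>2 < (cmod (1 - cnj l * w))\<^sup>2" using disc_aut_norm_identity[of l w] by linarith
  then have "cmod (l - w) < cmod (1 - cnj l * w)" by (rule power2_less_imp_less) simp
  moreover have "1 - cnj l * w \<noteq> 0" using assms by (intro disc_aut_denom_nonzero) auto
  ultimately show ?thesis by (simp add: disc_aut_def norm_divide divide_less_eq_1)
qed

lemma norm_blaschke_den_le_num:
  assumes "set ls \<subseteq> ball 0 1" "cmod w \<ge> 1"
  shows "cmod (poly (blaschke_den ls) w) \<le> cmod (poly (blaschke_num ls) w)"
  using assms(1)
proof (induction ls)
  case (Cons l ls)
  have "(1 - (cmod l)\<^sup>2) * (1 - (cmod w)\<^sup>2) \<le> 0"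
    using Cons.prems assms(2) by (intro mult_nonneg_nonpos) (auto simp: power_le_one one_le_power)
  then have "(cmod (1 - cnj l * w))\<^sup>2 \<le> (cmod (l - w))\<^sup>2" using disc_aut_norm_identity[of l w] by linarith
  then have "cmod (1 - cnj l * w) \<le> cmod (l - w)" by (rule power2_le_imp_le) simp
  then show ?case
    using Cons unfolding poly_blaschke_Cons norm_mult by (intro mult_mono) auto
qed simp

text \<open>Each factor satisfies \<open>1 - cnj l * w = - w * cnj (l - 1 / cnj w)\<close>. This
  reflection in the unit circle is the algebraic form of \<open>|\<phi>| = 1\<close> on the
  circle.\<close>

lemma blaschke_reflect:
  assumes "w \<noteq> 0"
  shows "poly (blaschke_den ls) w = (- w) ^ length ls * cnj (poly (blaschke_num ls) (1 / cnj w))"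
    and "poly (blaschke_num ls) w = (- w) ^ length ls * cnj (poly (blaschke_den ls) (1 / cnj w))"
proof (induction ls)
  case (Cons l ls)
  have "1 - cnj l * w = - w * cnj (l - 1 / cnj w)" "l - w = - w * cnj (1 - cnj l * (1 / cnj w))"
    using assms by (auto simp: field_simps)
  then show "poly (blaschke_den (l # ls)) w = (- w) ^ length (l # ls) * cnj (poly (blaschke_num (l # ls)) (1 / cnj w))"
    and "poly (blaschke_num (l # ls)) w = (- w) ^ length (l # ls) * cnj (poly (blaschke_den (l # ls)) (1 / cnj w))"
    unfolding poly_blaschke_Cons using Cons by (simp_all only: complex_cnj_mult length_Cons power_Suc mult_ac)
qed simp_all

text \<open>For \<open>|\<mu>| < 1\<close> the degree of \<open>p - \<mu> q\<close> does not drop,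
  and all its roots lie in the disc because \<open>|q| \<le> |p|\<close> outside; the second
  factorisation is the reflection of the first. The lemma serves both the composition with disc
  automorphisms and the fibres of \<phi>.\<close>

lemma blaschke_fibre_factorization:
  assumes ls: "set ls \<subseteq> ball 0 1" and c: "cmod c = 1" and lam: "cmod \<mu> < 1"
  obtains \<kappa> bs where "\<kappa> \<noteq> 0" "length bs = length ls" "set bs \<subseteq> ball 0 1"
    "smult c (blaschke_num ls) - smult \<mu> (blaschke_den ls) = smult \<kappa> (blaschke_num bs)"
    "blaschke_den ls - smult (cnj \<mu> * c) (blaschke_num ls) = smult (c * cnj \<kappa>) (blaschke_den bs)"
proof -
  define n where "n = length ls"
  define u where "u = smult c (blaschke_num ls) - smult \<mu> (blaschke_den ls)"
  \<comment> \<open>The coefficient of index \<open>n\<close> has modulus \<open>1\<close> in the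
    first term and at most \<open>|\<mu>| < 1\<close> in the second, so the two cannot
    cancel.\<close>
  have un: "coeff u n \<noteq> 0"
  proof
    assume "coeff u n = 0"
    then have "c * (-1) ^ n = \<mu> * coeff (blaschke_den ls) n"
      by (simp add: u_def n_def lead_coeff_blaschke_num)
    then have "cmod (c * (-1) ^ n) = cmod (\<mu> * coeff (blaschke_den ls) n)" by simp
    then have "1 = cmod \<mu> * cmod (coeff (blaschke_den ls) n)" using c by (simp add: norm_mult norm_power)
    moreover have "cmod \<mu> * cmod (coeff (blaschke_den ls) n) \<le> cmod \<mu>"
      using norm_blaschke_den_coeff[OF ls] by (simp add: n_def mult_left_le)
    ultimately show False using lam by linarith
  qed
  have deg: "degree u = n"
  proof (rule antisym)
    show "degree u \<le> n"
      unfolding u_def n_def using degree_blaschke_den[of ls]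
      by (intro degree_diff_le) (auto simp: degree_blaschke_num intro: order_trans[OF degree_smult_le])
    show "n \<le> degree u" by (rule le_degree[OF un])
  qed
  have u0: "u \<noteq> 0" using un by auto
  obtain A where A: "size A = n" "u = smult (lead_coeff u) (\<Prod>x\<in>#A. [:- x, 1:])"
    using alg_closed_imp_factorization[OF u0] deg by auto
  obtain bs where bs: "mset bs = A" using ex_mset by blast
  have len: "length bs = n" using A(1) bs by (metis size_mset)
  have prod: "(\<Prod>x\<in>#mset xs. [:- x, 1:]) = smult ((-1) ^ length xs) (blaschke_num xs)" for xs :: "complex list"
  proof (induction xs)
    case (Cons x xs)
    have "[:- x, 1:] = smult (-1) [:x, -1:]" by simp
    then show ?case using Cons by (simp only: mset.simps image_mset_add_mset prod_mset.add_mset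
      blaschke_num_simps length_Cons power_Suc mult_smult_left mult_smult_right smult_smult) (simp add: mult.commute)
  qed simp
  define \<kappa> where "\<kappa> = lead_coeff u * (-1) ^ n"
  have k0: "\<kappa> \<noteq> 0" using u0 by (simp add: \<kappa>_def)
  have u_eq: "u = smult \<kappa> (blaschke_num bs)"
    using A(2) unfolding bs[symmetric] prod len by (simp add: \<kappa>_def)
  have bsb: "set bs \<subseteq> ball 0 1"
  proof
    fix w assume "w \<in> set bs"
    then have "poly u w = 0" by (simp add: u_eq poly_blaschke_num_eq_0_iff)
    then have e: "c * poly (blaschke_num ls) w = \<mu> * poly (blaschke_den ls) w" by (simp add: u_def)
    show "w \<in> ball 0 1"
    proof (rule ccontr)
      assume "w \<notin> ball 0 1"
      then have w: "cmod w \<ge> 1" by simp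
      have "cmod (poly (blaschke_num ls) w) = cmod \<mu> * cmod (poly (blaschke_den ls) w)"
        using arg_cong[OF e, of cmod] c by (simp add: norm_mult)
      moreover have "poly (blaschke_num ls) w \<noteq> 0"
        using w ls by (auto simp: poly_blaschke_num_eq_0_iff)
      moreover note norm_blaschke_den_le_num[OF ls w]
      ultimately show False using lam
        by (metis (no_types, lifting) mult_less_cancel_right2 norm_ge_zero norm_le_zero_iff not_less order_trans linorder_not_le mult_zero_right order_antisym zero_less_norm_iff)
    qed
  qed
  have "blaschke_den ls - smult (cnj \<mu> * c) (blaschke_num ls) = smult (c * cnj \<kappa>) (blaschke_den bs)"
  proof -
    let ?v = "blaschke_den ls - smult (cnj \<mu> * c) (blaschke_num ls)"
    have cc: "c * cnj c = 1" using c by (simp add: complex_norm_square[symmetric])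
    have e: "poly ?v w = poly (smult (c * cnj \<kappa>) (blaschke_den bs)) w" if w: "w \<noteq> 0" for w
    proof -
      define w' where "w' = 1 / cnj w"
      have uw: "poly u w' = c * poly (blaschke_num ls) w' - \<mu> * poly (blaschke_den ls) w'" by (simp add: u_def)
      have "poly ?v w = (- w) ^ n * (cnj (poly (blaschke_num ls) w') - cnj \<mu> * c * cnj (poly (blaschke_den ls) w'))"
        unfolding poly_diff poly_smult blaschke_reflect[OF w, of ls] n_def w'_def by (simp add: algebra_simps)
      also have "\<dots> = (- w) ^ n * (c * cnj (poly u w'))"
        unfolding uw using cc by (simp add: algebra_simps)
      also have "\<dots> = c * cnj \<kappa> * poly (blaschke_den bs) w"
        unfolding blaschke_reflect(1)[OF w, of bs] len u_eq w'_def by simp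
      finally show ?thesis by simp
    qed
    have "infinite (- {0 :: complex})" by (simp add: infinite_UNIV_char_0 Compl_eq_Diff_UNIV)
    moreover have "- {0} \<subseteq> {w. poly (?v - smult (c * cnj \<kappa>) (blaschke_den bs)) w = 0}" using e by auto
    ultimately have "infinite {w. poly (?v - smult (c * cnj \<kappa>) (blaschke_den bs)) w = 0}"
      by (meson finite_subset)
    then have "?v - smult (c * cnj \<kappa>) (blaschke_den bs) = 0" using poly_roots_finite by blast
    then show ?thesis by simp
  qed
  then show ?thesis using that[OF k0 _ bsb] u_eq len by (simp add: u_def n_def)
qed

section \<open>Products, composites and order of finite Blaschke products\<close>

lemma finite_blaschkeE:
  assumes "finite_blaschke n \<phi>"
  obtains c ls where "n \<ge> 1" "cmod c = 1" "length ls = n" "set ls \<subseteq> ball 0 1"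
    "\<And>z. z \<in> ball 0 1 \<Longrightarrow> \<phi> z = c * (\<Prod>l\<leftarrow>ls. disc_aut l z)"
  using assms unfolding finite_blaschke_def by auto

lemma finite_blaschkeI:
  assumes "n \<ge> 1" "cmod c = 1" "length ls = n" "set ls \<subseteq> ball 0 1"
    "\<And>z. z \<in> ball 0 1 \<Longrightarrow> \<phi> z = c * (\<Prod>l\<leftarrow>ls. disc_aut l z)"
  shows "finite_blaschke n \<phi>"
  using assms unfolding finite_blaschke_def by blast

lemma finite_blaschke_cong:
  assumes "finite_blaschke n \<phi>" "\<And>z. z \<in> ball 0 1 \<Longrightarrow> \<psi> z = \<phi> z"
  shows "finite_blaschke n \<psi>"
  using assms unfolding finite_blaschke_def by simp

lemma finite_blaschke_cmult:
  assumes "finite_blaschke n \<phi>" "cmod a = 1" shows "finite_blaschke n (\<lambda>z. a * \<phi> z)"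
proof -
  obtain c ls where *: "n \<ge> 1" "cmod c = 1" "length ls = n" "set ls \<subseteq> ball 0 1"
    "\<And>z. z \<in> ball 0 1 \<Longrightarrow> \<phi> z = c * (\<Prod>l\<leftarrow>ls. disc_aut l z)"
    using finite_blaschkeE[OF assms(1)] by metis
  show ?thesis by (rule finite_blaschkeI[of n "a * c" ls]) (use * assms(2) in \<open>auto simp: norm_mult\<close>)
qed

lemma finite_blaschke_mult:
  assumes "finite_blaschke m \<phi>" "finite_blaschke n \<psi>" shows "finite_blaschke (m + n) (\<lambda>z. \<phi> z * \<psi> z)"
proof -
  obtain c ls where 1: "m \<ge> 1" "cmod c = 1" "length ls = m" "set ls \<subseteq> ball 0 1"
    "\<And>z. z \<in> ball 0 1 \<Longrightarrow> \<phi> z = c * (\<Prod>l\<leftarrow>ls. disc_aut l z)"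
    using finite_blaschkeE[OF assms(1)] by metis
  obtain d ks where 2: "n \<ge> 1" "cmod d = 1" "length ks = n" "set ks \<subseteq> ball 0 1"
    "\<And>z. z \<in> ball 0 1 \<Longrightarrow> \<psi> z = d * (\<Prod>l\<leftarrow>ks. disc_aut l z)"
    using finite_blaschkeE[OF assms(2)] by metis
  show ?thesis
    by (rule finite_blaschkeI[of "m + n" "c * d" "ls @ ks"]) (use 1 2 in \<open>auto simp: norm_mult\<close>)
qed

lemma finite_blaschke_disc_aut: "l \<in> ball 0 1 \<Longrightarrow> finite_blaschke 1 (disc_aut l)"
  by (rule finite_blaschkeI[of 1 1 "[l]"]) auto

lemma finite_blaschke_in_ball:
  assumes "finite_blaschke n \<phi>" "z \<in> ball 0 1" shows "\<phi> z \<in> ball 0 1"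
proof -
  obtain c ls where *: "n \<ge> 1" "cmod c = 1" "length ls = n" "set ls \<subseteq> ball 0 1"
    "\<And>z. z \<in> ball 0 1 \<Longrightarrow> \<phi> z = c * (\<Prod>l\<leftarrow>ls. disc_aut l z)"
    using finite_blaschkeE[OF assms(1)] by metis
  have "cmod (\<Prod>l\<leftarrow>ls. disc_aut l z) < 1" if "ls \<noteq> []" "set ls \<subseteq> ball 0 1" for ls
    using that
  proof (induction ls)
    case (Cons l ls)
    have 1: "cmod (disc_aut l z) < 1" using disc_aut_in_ball[of l z] Cons.prems assms(2) by simp
    have "cmod (\<Prod>l\<leftarrow>ls. disc_aut l z) \<le> 1"
      using Cons.IH Cons.prems by (cases "ls = []") auto
    then have "cmod (disc_aut l z) * cmod (\<Prod>l\<leftarrow>ls. disc_aut l z) \<le> cmod (disc_aut l z)"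
      by (simp add: mult_left_le)
    then show ?case using 1 by (simp add: norm_mult)
  qed simp
  moreover have "ls \<noteq> []" using * by auto
  ultimately show ?thesis using * assms(2) by (simp add: norm_mult)
qed

lemma finite_blaschke_multiplier:
  assumes "finite_blaschke n \<phi>" shows "disc_multiplier \<phi>"
proof -
  obtain c ls where *: "n \<ge> 1" "cmod c = 1" "length ls = n" "set ls \<subseteq> ball 0 1"
    "\<And>z. z \<in> ball 0 1 \<Longrightarrow> \<phi> z = c * (\<Prod>l\<leftarrow>ls. disc_aut l z)"
    using finite_blaschkeE[OF assms(1)] by metis
  let ?S = "{z. poly (blaschke_den ls) z \<noteq> 0}"
  have "disc_multiplier (\<lambda>z. c * (poly (blaschke_num ls) z / poly (blaschke_den ls) z))"
  proof (rule disc_multiplierI[of _ ?S])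
    show "open ?S" by (intro open_Collect_neq continuous_intros)
    show "cball 0 1 \<subseteq> ?S" using poly_blaschke_den_nonzero[OF *(4)] by auto
    show "(\<lambda>z. c * (poly (blaschke_num ls) z / poly (blaschke_den ls) z)) holomorphic_on ?S"
      by (intro holomorphic_intros poly_holomorphic_on[where f="\<lambda>z. z"]) auto
  qed
  then show ?thesis by (rule disc_multiplier_cong) (simp add: *(5) prod_disc_aut_eq)
qed

lemma finite_blaschke_disc_aut_comp:
  assumes "finite_blaschke n \<phi>" and lam: "\<mu> \<in> ball 0 1"
  shows "finite_blaschke n (\<lambda>z. disc_aut \<mu> (\<phi> z))"
proof -
  obtain c ls where *: "n \<ge> 1" "cmod c = 1" "length ls = n" "set ls \<subseteq> ball 0 1"
    "\<And>z. z \<in> ball 0 1 \<Longrightarrow> \<phi> z = c * (\<Prod>l\<leftarrow>ls. disc_aut l z)"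
    using finite_blaschkeE[OF assms(1)] by metis
  obtain \<kappa> bs where f: "\<kappa> \<noteq> 0" "length bs = length ls" "set bs \<subseteq> ball 0 1"
    "smult c (blaschke_num ls) - smult \<mu> (blaschke_den ls) = smult \<kappa> (blaschke_num bs)"
    "blaschke_den ls - smult (cnj \<mu> * c) (blaschke_num ls) = smult (c * cnj \<kappa>) (blaschke_den bs)"
    using blaschke_fibre_factorization[OF *(4,2), of \<mu>] lam by auto
  show ?thesis
  \<comment> \<open>Quotient of the two factorisations: the constant is unimodular because \<kappa>
    and \<open>cnj \<kappa>\<close> have equal modulus, and the sign comes from
    \<open>\<mu> - \<phi>\<close> in place of \<open>\<phi> - \<mu>\<close>.\<close>
  proof (rule finite_blaschkeI[of n "- (\<kappa> / (c * cnj \<kappa>))" bs])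
    show "cmod (- (\<kappa> / (c * cnj \<kappa>))) = 1" using f(1) *(2) by (simp add: norm_divide norm_mult)
    fix z :: complex assume z: "z \<in> ball 0 1"
    let ?p = "poly (blaschke_num ls) z" and ?q = "poly (blaschke_den ls) z"
    have q: "?q \<noteq> 0" using poly_blaschke_den_nonzero[OF *(4)] z by simp
    have 1: "c * ?p - \<mu> * ?q = \<kappa> * poly (blaschke_num bs) z"
      using arg_cong[OF f(4), of "\<lambda>p. poly p z"] by simp
    have 2: "?q - cnj \<mu> * c * ?p = c * cnj \<kappa> * poly (blaschke_den bs) z"
      using arg_cong[OF f(5), of "\<lambda>p. poly p z"] by simp
    have "disc_aut \<mu> (\<phi> z) = (\<mu> - c * (?p / ?q)) / (1 - cnj \<mu> * (c * (?p / ?q)))"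
      by (simp only: disc_aut_def[of \<mu>] *(5)[OF z] prod_disc_aut_eq)
    also have "\<dots> = (- (c * ?p - \<mu> * ?q) / ?q) / ((?q - cnj \<mu> * c * ?p) / ?q)"
      using q by (simp add: diff_divide_distrib mult_ac)
    also have "\<dots> = - (\<kappa> * poly (blaschke_num bs) z) / (c * cnj \<kappa> * poly (blaschke_den bs) z)"
      unfolding 1 2 using q by simp
    finally show "disc_aut \<mu> (\<phi> z) = - (\<kappa> / (c * cnj \<kappa>)) * (\<Prod>l\<leftarrow>bs. disc_aut l z)"
      by (simp add: prod_disc_aut_eq)
  qed (use * f in auto)
qed

text \<open>Every factor of the outer product contributes one product of order \<open>n\<close>, so
  the orders multiply.\<close>

lemma finite_blaschke_compose:
  assumes "finite_blaschke m \<psi>\<^sub>1" "finite_blaschke n \<psi>\<^sub>2"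
  shows "finite_blaschke (m * n) (\<lambda>z. \<psi>\<^sub>1 (\<psi>\<^sub>2 z))"
proof -
  obtain c ls where *: "m \<ge> 1" "cmod c = 1" "length ls = m" "set ls \<subseteq> ball 0 1"
    "\<And>z. z \<in> ball 0 1 \<Longrightarrow> \<psi>\<^sub>1 z = c * (\<Prod>l\<leftarrow>ls. disc_aut l z)"
    using finite_blaschkeE[OF assms(1)] by metis
  have "finite_blaschke (length ls * n) (\<lambda>z. \<Prod>l\<leftarrow>ls. disc_aut l (\<psi>\<^sub>2 z))" if "ls \<noteq> []" "set ls \<subseteq> ball 0 1" for ls
    using that
  proof (induction ls)
    case (Cons l ls)
    have 1: "finite_blaschke n (\<lambda>z. disc_aut l (\<psi>\<^sub>2 z))"
      using Cons.prems by (intro finite_blaschke_disc_aut_comp assms) auto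
    show ?case
    proof (cases "ls = []")
      case False
      then have "finite_blaschke (length ls * n) (\<lambda>z. \<Prod>l\<leftarrow>ls. disc_aut l (\<psi>\<^sub>2 z))" using Cons by simp
      from finite_blaschke_mult[OF 1 this] show ?thesis by simp
    qed (use 1 in simp)
  qed simp
  moreover have "ls \<noteq> []" using * by auto
  ultimately have "finite_blaschke (m * n) (\<lambda>z. c * (\<Prod>l\<leftarrow>ls. disc_aut l (\<psi>\<^sub>2 z)))"
    using * by (intro finite_blaschke_cmult) auto
  then show ?thesis
    by (rule finite_blaschke_cong) (use *(5) finite_blaschke_in_ball[OF assms(2)] in auto)
qed

lemma poly_eq_on_disc:
  fixes p q :: "complex poly"
  assumes "\<And>z. z \<in> ball 0 1 \<Longrightarrow> poly p z = poly q z" shows "p = q"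
proof -
  have "infinite (ball (0::complex) 1)" by (simp add: uncountable_ball uncountable_infinite)
  moreover have "ball 0 1 \<subseteq> {z. poly (p - q) z = 0}" using assms by auto
  ultimately have "infinite {z. poly (p - q) z = 0}" by (meson finite_subset)
  then have "p - q = 0" using poly_roots_finite by blast
  then show ?thesis by simp
qed

lemma coprime_blaschke_num_den:
  assumes ls: "set ls \<subseteq> ball 0 1" "set ks \<subseteq> ball 0 1"
  shows "coprime (blaschke_num ls) (blaschke_den ks)"
proof (rule coprimeI)
  fix d assume d: "d dvd blaschke_num ls" "d dvd blaschke_den ks"
  show "is_unit d"
  proof (rule ccontr)
    assume nu: "\<not> is_unit d"
    have "d \<noteq> 0" using d(1) blaschke_num_nonzero by auto
    then have "degree d \<noteq> 0" using nu is_unit_iff_degree by blast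
    then obtain x where "poly d x = 0" using alg_closed_imp_poly_has_root[of d] by auto
    then have "poly (blaschke_num ls) x = 0" "poly (blaschke_den ks) x = 0"
      using d by (auto elim!: dvdE)
    then show False
      using poly_blaschke_den_nonzero[OF ls(2), of x] ls(1) by (auto simp: poly_blaschke_num_eq_0_iff)
  qed
qed

text \<open>Numerators have their zeros inside the disc and denominators outside. They are therefore
  coprime, and two numerators of the same \<phi> divide each other.\<close>

lemma finite_blaschke_order_unique:
  assumes "finite_blaschke m \<phi>" "finite_blaschke n \<phi>" shows "m = n"
proof -
  obtain c ls where 1: "m \<ge> 1" "cmod c = 1" "length ls = m" "set ls \<subseteq> ball 0 1"
    "\<And>z. z \<in> ball 0 1 \<Longrightarrow> \<phi> z = c * (\<Prod>l\<leftarrow>ls. disc_aut l z)"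
    using finite_blaschkeE[OF assms(1)] by metis
  obtain d ks where 2: "n \<ge> 1" "cmod d = 1" "length ks = n" "set ks \<subseteq> ball 0 1"
    "\<And>z. z \<in> ball 0 1 \<Longrightarrow> \<phi> z = d * (\<Prod>l\<leftarrow>ks. disc_aut l z)"
    using finite_blaschkeE[OF assms(2)] by metis
  have cd: "c \<noteq> 0" "d \<noteq> 0" using 1(2) 2(2) by auto
  have eq: "smult c (blaschke_num ls * blaschke_den ks) = smult d (blaschke_num ks * blaschke_den ls)"
  proof (rule poly_eq_on_disc)
    fix z :: complex assume z: "z \<in> ball 0 1"
    then have "poly (blaschke_den ls) z \<noteq> 0" "poly (blaschke_den ks) z \<noteq> 0"
      using poly_blaschke_den_nonzero[OF 1(4)] poly_blaschke_den_nonzero[OF 2(4)] by auto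
    moreover have "c * (poly (blaschke_num ls) z / poly (blaschke_den ls) z)
        = d * (poly (blaschke_num ks) z / poly (blaschke_den ks) z)"
      using 1(5)[OF z] 2(5)[OF z] by (simp add: prod_disc_aut_eq)
    ultimately show "poly (smult c (blaschke_num ls * blaschke_den ks)) z
        = poly (smult d (blaschke_num ks * blaschke_den ls)) z"
      by (simp add: field_simps)
  qed
  have "blaschke_num ls dvd smult d (blaschke_num ks * blaschke_den ls)"
    unfolding eq[symmetric] by (intro dvd_smult) simp
  then have "blaschke_num ls dvd blaschke_num ks"
    using cd coprime_blaschke_num_den[OF 1(4,4)] by (simp add: dvd_smult_iff coprime_dvd_mult_left_iff)
  moreover have "blaschke_num ks dvd smult c (blaschke_num ls * blaschke_den ks)"
    unfolding eq by (intro dvd_smult) simp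
  then have "blaschke_num ks dvd blaschke_num ls"
    using cd coprime_blaschke_num_den[OF 2(4,4)] by (simp add: dvd_smult_iff coprime_dvd_mult_left_iff)
  ultimately have "degree (blaschke_num ls) = degree (blaschke_num ks)"
    using blaschke_num_nonzero by (intro antisym dvd_imp_degree_le) auto
  then show ?thesis by (simp add: degree_blaschke_num 1 2)
qed

section \<open>Decompositions of products of order four\<close>

lemma disc_aut_self [simp]: "disc_aut l l = 0"
  by (simp add: disc_aut_def)

lemma disc_aut_zero_left [simp]: "disc_aut 0 z = - z"
  by (simp add: disc_aut_def)

lemma disc_aut_zero_right [simp]: "disc_aut l 0 = l"
  by (simp add: disc_aut_def)

lemma disc_aut_eq_0_iff:
  assumes "l \<in> ball 0 1" "z \<in> ball 0 1" shows "disc_aut l z = 0 \<longleftrightarrow> z = l"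
proof -
  have "1 - cnj l * z \<noteq> 0" using assms by (intro disc_aut_denom_nonzero) auto
  then show ?thesis by (auto simp: disc_aut_def)
qed

lemma disc_aut_has_derivative:
  assumes "l \<in> ball 0 1" "z \<in> ball 0 1"
  shows "(disc_aut l has_field_derivative (cnj l * l - 1) / (1 - cnj l * z)\<^sup>2) (at z)"
proof -
  have "1 - cnj l * z \<noteq> 0" using assms by (intro disc_aut_denom_nonzero) auto
  then show ?thesis
    unfolding disc_aut_def[abs_def]
    by (auto intro!: derivative_eq_intros simp: power2_eq_square divide_simps) (simp add: algebra_simps)
qed

lemma finite_blaschke_zero_factor:
  assumes b: "finite_blaschke n \<phi>" and w: "w \<in> ball 0 1" "\<phi> w = 0"
  obtains c ls where "cmod c = 1" "length ls = n - 1" "set ls \<subseteq> ball 0 1"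
    "\<And>z. z \<in> ball 0 1 \<Longrightarrow> \<phi> z = c * (disc_aut w z * (\<Prod>l\<leftarrow>ls. disc_aut l z))"
proof -
  obtain c ls where *: "n \<ge> 1" "cmod c = 1" "length ls = n" "set ls \<subseteq> ball 0 1"
    "\<And>z. z \<in> ball 0 1 \<Longrightarrow> \<phi> z = c * (\<Prod>l\<leftarrow>ls. disc_aut l z)"
    using finite_blaschkeE[OF b] by metis
  have "c \<noteq> 0" using *(2) by auto
  then have "(\<Prod>l\<leftarrow>ls. disc_aut l w) = 0" using *(5)[OF w(1)] w(2) by simp
  then obtain l where l: "l \<in> set ls" "disc_aut l w = 0" by (auto simp: prod_list_zero_iff)
  then have "w \<in> set ls" using disc_aut_eq_0_iff[of l w] *(4) w(1) by auto
  then obtain xs ys where ls: "ls = xs @ w # ys" by (meson split_list)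
  show ?thesis
    by (rule that[of c "xs @ ys"]) (use * ls in \<open>auto simp: mult_ac\<close>)
qed

text \<open>After one zero at \<open>w\<close> is split off, the derivative at \<open>w\<close> is a
  nonzero multiple of the remaining factor there, so that factor vanishes at \<open>w\<close> as
  well.\<close>

lemma finite_blaschke_double_zero:
  assumes b: "finite_blaschke 2 h" and w: "w \<in> ball 0 1" "h w = 0" "deriv h w = 0"
  obtains c where "cmod c = 1" "\<And>z. z \<in> ball 0 1 \<Longrightarrow> h z = c * (disc_aut w z)\<^sup>2"
proof -
  obtain c ls where c: "cmod c = 1" "length ls = 2 - 1" "set ls \<subseteq> ball 0 1"
    "\<And>z. z \<in> ball 0 1 \<Longrightarrow> h z = c * (disc_aut w z * (\<Prod>l\<leftarrow>ls. disc_aut l z))"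
    using finite_blaschke_zero_factor[OF b w(1,2)] by metis
  obtain l where ls: "ls = [l]" using c(2) by (cases ls) auto
  have l: "l \<in> ball 0 1" using c(3) ls by simp
  have hz: "h z = c * (disc_aut w z * disc_aut l z)" if "z \<in> ball 0 1" for z using c(4)[OF that] by (simp add: ls)
  have "((\<lambda>z. c * (disc_aut w z * disc_aut l z)) has_field_derivative
      c * (disc_aut w w * ((cnj l * l - 1) / (1 - cnj l * w)\<^sup>2) + (cnj w * w - 1) / (1 - cnj w * w)\<^sup>2 * disc_aut l w)) (at w)"
    by (intro DERIV_cmult DERIV_mult disc_aut_has_derivative l w(1))
       (auto intro!: derivative_eq_intros disc_aut_has_derivative l w(1) simp: mult_ac)
  then have "(h has_field_derivative
      c * ((cnj w * w - 1) / (1 - cnj w * w)\<^sup>2 * disc_aut l w)) (at w)"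
    using hz w(1) by (subst DERIV_cong_ev[OF refl _ refl, where g="\<lambda>z. c * (disc_aut w z * disc_aut l z)"])
      (auto intro!: eventually_nhds_in_open[of "ball 0 1", THEN eventually_mono])
  then have "c * ((cnj w * w - 1) / (1 - cnj w * w)\<^sup>2 * disc_aut l w) = 0"
    using w(3) DERIV_imp_deriv by force
  moreover have "1 - cnj w * w \<noteq> 0" using w(1) by (intro disc_aut_denom_nonzero) auto
  moreover have "c \<noteq> 0" using c(1) by auto
  ultimately have "disc_aut l w = 0" by (auto simp: algebra_simps)
  then have "l = w" using disc_aut_eq_0_iff[OF l w(1)] by simp
  then show ?thesis using that[of c] c(1) hz by (simp add: power2_eq_square)
qed

lemma deriv_compose_disc:
  assumes "disc_multiplier f" "disc_multiplier g" "w \<in> ball 0 1" "g w \<in> ball 0 1"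
  shows "deriv (\<lambda>z. f (g z)) w = deriv f (g w) * deriv g w"
  by (rule DERIV_imp_deriv)
     (rule DERIV_chain2[OF disc_multiplier_deriv[OF assms(1,4)] disc_multiplier_deriv[OF assms(2,3)]])

text \<open>Moving the value at \<open>0\<close> to \<open>0\<close> by an automorphism turns the
  critical point into a double zero, which exhausts the order.\<close>

lemma blaschke_equiv_square_of_critical:
  assumes b: "finite_blaschke 2 \<psi>" and d: "deriv \<psi> 0 = 0"
  shows "blaschke_equiv (\<lambda>z. z\<^sup>2) \<psi>"
proof -
  define l where "l = \<psi> 0"
  have l: "l \<in> ball 0 1" unfolding l_def by (rule finite_blaschke_in_ball[OF b]) simp
  have b': "finite_blaschke 2 (\<lambda>z. disc_aut l (\<psi> z))" by (rule finite_blaschke_disc_aut_comp[OF b l])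
  have "deriv (\<lambda>z. disc_aut l (\<psi> z)) 0 = 0"
    using deriv_compose_disc[OF finite_blaschke_multiplier[OF finite_blaschke_disc_aut[OF l]]
      finite_blaschke_multiplier[OF b], of 0] l d by (simp add: l_def)
  then obtain c where c: "cmod c = 1" "\<And>z. z \<in> ball 0 1 \<Longrightarrow> disc_aut l (\<psi> z) = c * (disc_aut 0 z)\<^sup>2"
    using finite_blaschke_double_zero[OF b', of 0] by (auto simp: l_def)
  have cc: "c * cnj c = 1" using c(1) by (simp add: complex_norm_square[symmetric])
  have "z\<^sup>2 = cnj c * disc_aut l (\<psi> z)" if "z \<in> ball 0 1" for z
    using c(2)[OF that] cc by (simp add: mult.assoc[symmetric] mult.commute[of "cnj c"])
  then have "blaschke_equiv \<psi> (\<lambda>z. z\<^sup>2)"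
    unfolding blaschke_equiv_def using l c(1) by (metis complex_mod_cnj)
  then show ?thesis
    by (rule blaschke_equiv_sym) (use finite_blaschke_in_ball[OF b] in \<open>auto intro: less_imp_le\<close>)
qed

lemma decomposition_orders:
  assumes \<phi>: "finite_blaschke 4 \<phi>" and d: "blaschke_decomposition \<phi> \<psi>\<^sub>1 \<psi>\<^sub>2"
  shows "finite_blaschke 2 \<psi>\<^sub>1" "finite_blaschke 2 \<psi>\<^sub>2"
proof -
  obtain m n where mn: "m > 1" "n > 1" and b: "finite_blaschke m \<psi>\<^sub>1" "finite_blaschke n \<psi>\<^sub>2"
    and eq: "\<And>z. z \<in> ball 0 1 \<Longrightarrow> \<phi> z = \<psi>\<^sub>1 (\<psi>\<^sub>2 z)"
    using d unfolding blaschke_decomposition_def by auto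
  have "finite_blaschke (m * n) \<phi>"
    by (rule finite_blaschke_cong[OF finite_blaschke_compose[OF b] eq])
  then have e: "m * n = 4" by (rule finite_blaschke_order_unique[OF _ \<phi>])
  have "2 * n \<le> m * n" "m * 2 \<le> m * n" using mn by (intro mult_right_mono mult_left_mono; simp)+
  then have "m = 2" "n = 2" using e mn by linarith+
  then show "finite_blaschke 2 \<psi>\<^sub>1" "finite_blaschke 2 \<psi>\<^sub>2" using b by auto
qed

lemma finite_blaschke_norm_le: "finite_blaschke n \<phi> \<Longrightarrow> z \<in> ball 0 1 \<Longrightarrow> cmod (\<phi> z) \<le> 1"
  using finite_blaschke_in_ball by (fastforce intro: less_imp_le)

text \<open>By the chain rule either the inner factor is critical at \<open>0\<close>, hence
  equivalent to \<open>z^2\<close>, or the outer factor is critical at \<open>w\<close>. In the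
  second case the outer factor is the square of \<open>disc_aut w\<close> up to an automorphism and
  a constant, and the inner one, moved to vanish at \<open>0\<close>, is a multiple of
  \<open>z * disc_aut \<gamma> z\<close>.\<close>

lemma decomposition_critical_at_0:
  assumes \<phi>: "finite_blaschke 4 \<phi>" and d: "blaschke_decomposition \<phi> \<psi>\<^sub>1 \<psi>\<^sub>2" and crit: "deriv \<phi> 0 = 0"
  shows "blaschke_equiv (\<lambda>z. z\<^sup>2) \<psi>\<^sub>2 \<or>
    (\<exists>\<gamma>\<in>ball 0 1 - {0}. blaschke_equiv (\<lambda>z. (z * disc_aut \<gamma> z)\<^sup>2) \<phi>)"
proof -
  note b = decomposition_orders[OF \<phi> d]
  note m1 = finite_blaschke_multiplier[OF b(1)] and m2 = finite_blaschke_multiplier[OF b(2)]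
  have eq: "\<phi> z = \<psi>\<^sub>1 (\<psi>\<^sub>2 z)" if "z \<in> ball 0 1" for z
    using d that unfolding blaschke_decomposition_def by auto
  define w where "w = \<psi>\<^sub>2 0"
  have w: "w \<in> ball 0 1" unfolding w_def by (rule finite_blaschke_in_ball[OF b(2)]) simp
  have "deriv \<phi> 0 = deriv (\<lambda>z. \<psi>\<^sub>1 (\<psi>\<^sub>2 z)) 0"
    by (rule deriv_cong_ev) (use eq in \<open>auto intro!: eventually_nhds_in_open[of "ball 0 1", THEN eventually_mono]\<close>)
  then have "deriv \<psi>\<^sub>1 w * deriv \<psi>\<^sub>2 0 = 0"
    using deriv_compose_disc[OF m1 m2, of 0] w crit by (simp add: w_def)
  then consider "deriv \<psi>\<^sub>2 0 = 0" | "deriv \<psi>\<^sub>1 w = 0" by auto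
  then show ?thesis
  proof cases
    case 1
    then show ?thesis using blaschke_equiv_square_of_critical[OF b(2)] by blast
  next
    case 2
    define l where "l = \<psi>\<^sub>1 w"
    have l: "l \<in> ball 0 1" unfolding l_def by (rule finite_blaschke_in_ball[OF b(1) w])
    have b1: "finite_blaschke 2 (\<lambda>z. disc_aut l (\<psi>\<^sub>1 z))" by (rule finite_blaschke_disc_aut_comp[OF b(1) l])
    have "deriv (\<lambda>z. disc_aut l (\<psi>\<^sub>1 z)) w = 0"
      using deriv_compose_disc[OF finite_blaschke_multiplier[OF finite_blaschke_disc_aut[OF l]] m1 w] l 2
      by (simp add: l_def)
    then obtain c where c: "cmod c = 1" "\<And>z. z \<in> ball 0 1 \<Longrightarrow> disc_aut l (\<psi>\<^sub>1 z) = c * (disc_aut w z)\<^sup>2"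
      using finite_blaschke_double_zero[OF b1 w] by (auto simp: l_def)
    have b2: "finite_blaschke 2 (\<lambda>z. disc_aut w (\<psi>\<^sub>2 z))" by (rule finite_blaschke_disc_aut_comp[OF b(2) w])
    obtain c' ls where c': "cmod c' = 1" "length ls = 2 - 1" "set ls \<subseteq> ball 0 1"
      "\<And>z. z \<in> ball 0 1 \<Longrightarrow> disc_aut w (\<psi>\<^sub>2 z) = c' * (disc_aut 0 z * (\<Prod>l\<leftarrow>ls. disc_aut l z))"
      using finite_blaschke_zero_factor[OF b2, of 0] by (auto simp: w_def)
    obtain \<gamma> where ls: "ls = [\<gamma>]" using c'(2) by (cases ls) auto
    have \<gamma>: "\<gamma> \<in> ball 0 1" using c'(3) ls by simp
    have \<psi>2: "disc_aut w (\<psi>\<^sub>2 z) = - c' * (z * disc_aut \<gamma> z)" if "z \<in> ball 0 1" for z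
      using c'(4)[OF that] by (simp add: ls)
    show ?thesis
    \<comment> \<open>A double zero of the moved inner factor leads back to the first
      alternative.\<close>
    proof (cases "\<gamma> = 0")
      case True
      have cc: "c' * cnj c' = 1" using c'(1) by (simp add: complex_norm_square[symmetric])
      have "z\<^sup>2 = cnj c' * disc_aut w (\<psi>\<^sub>2 z)" if "z \<in> ball 0 1" for z
        using \<psi>2[OF that] True cc by (simp add: mult.assoc[symmetric] mult.commute[of "cnj c'"] power2_eq_square)
      then have "blaschke_equiv \<psi>\<^sub>2 (\<lambda>z. z\<^sup>2)"
        unfolding blaschke_equiv_def using w c'(1) by (metis complex_mod_cnj)
      then have "blaschke_equiv (\<lambda>z. z\<^sup>2) \<psi>\<^sub>2"
        by (rule blaschke_equiv_sym) (rule finite_blaschke_norm_le[OF b(2)])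
      then show ?thesis ..
    next
      case False
      define e where "e = c * c'\<^sup>2"
      have e: "cmod e = 1" using c(1) c'(1) by (simp add: e_def norm_mult norm_power)
      have ee: "e * cnj e = 1" using e by (simp add: complex_norm_square[symmetric])
      have "(z * disc_aut \<gamma> z)\<^sup>2 = cnj e * disc_aut l (\<phi> z)" if z: "z \<in> ball 0 1" for z
      proof -
        have "disc_aut l (\<phi> z) = e * (z * disc_aut \<gamma> z)\<^sup>2"
          unfolding eq[OF z] c(2)[OF finite_blaschke_in_ball[OF b(2) z]] \<psi>2[OF z] e_def
          by (simp add: power_mult_distrib mult_ac)
        then show ?thesis using ee by (simp add: mult.assoc[symmetric] mult.commute[of "cnj e"])
      qed
      then have "blaschke_equiv \<phi> (\<lambda>z. (z * disc_aut \<gamma> z)\<^sup>2)"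
        unfolding blaschke_equiv_def using l e by (metis complex_mod_cnj)
      then have "blaschke_equiv (\<lambda>z. (z * disc_aut \<gamma> z)\<^sup>2) \<phi>"
        by (rule blaschke_equiv_sym) (rule finite_blaschke_norm_le[OF \<phi>])
      then show ?thesis using False \<gamma> by blast
    qed
  qed
qed

section \<open>Transport along equivalence, and two explicit decompositions\<close>

lemma blaschke_equiv_normalize:
  assumes \<phi>: "finite_blaschke 4 \<phi>"
  obtains \<phi>\<^sub>0 where "blaschke_equiv \<phi> \<phi>\<^sub>0" "finite_blaschke 4 \<phi>\<^sub>0" "\<phi>\<^sub>0 0 = 0"
proof -
  have l: "\<phi> 0 \<in> ball 0 1" by (rule finite_blaschke_in_ball[OF \<phi>]) simp
  show ?thesis
  proof (rule that[of "\<lambda>z. disc_aut (\<phi> 0) (\<phi> z)"])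
    show "blaschke_equiv \<phi> (\<lambda>z. disc_aut (\<phi> 0) (\<phi> z))"
      unfolding blaschke_equiv_def using l by (rule_tac x="\<phi> 0" in exI, rule_tac x=1 in exI) auto
  qed (use finite_blaschke_disc_aut_comp[OF \<phi> l] in simp_all)
qed

lemma blaschke_equiv_deriv:
  assumes m: "disc_multiplier \<phi>" and e: "blaschke_equiv \<phi> \<phi>\<^sub>0" and w: "w \<in> ball 0 1" "\<phi> w \<in> ball 0 1"
    and d: "deriv \<phi>\<^sub>0 w = 0"
  shows "deriv \<phi> w = 0"
proof -
  obtain l a where l: "l \<in> ball 0 1" and a: "cmod a = 1"
    and eq: "\<And>z. z \<in> ball 0 1 \<Longrightarrow> \<phi>\<^sub>0 z = a * disc_aut l (\<phi> z)"
    using e unfolding blaschke_equiv_def by auto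
  have "(\<phi>\<^sub>0 has_field_derivative a * ((cnj l * l - 1) / (1 - cnj l * \<phi> w)\<^sup>2 * deriv \<phi> w)) (at w)"
  proof (subst DERIV_cong_ev[OF refl _ refl, where g="\<lambda>z. a * disc_aut l (\<phi> z)"])
    show "\<forall>\<^sub>F z in nhds w. \<phi>\<^sub>0 z = a * disc_aut l (\<phi> z)"
      using eq w(1) by (auto intro!: eventually_nhds_in_open[of "ball 0 1", THEN eventually_mono])
    show "((\<lambda>z. a * disc_aut l (\<phi> z)) has_field_derivative a * ((cnj l * l - 1) / (1 - cnj l * \<phi> w)\<^sup>2 * deriv \<phi> w)) (at w)"
      by (intro DERIV_cmult DERIV_chain2[OF disc_aut_has_derivative[OF l w(2)] disc_multiplier_deriv[OF m w(1)]])
  qed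
  then have "a * ((cnj l * l - 1) / (1 - cnj l * \<phi> w)\<^sup>2 * deriv \<phi> w) = 0"
    using d DERIV_imp_deriv by force
  moreover have "1 - cnj l * l \<noteq> 0" "1 - cnj l * \<phi> w \<noteq> 0" "a \<noteq> 0"
    using l w(2) a disc_aut_denom_nonzero[of l l] disc_aut_denom_nonzero[of l "\<phi> w"] by auto
  ultimately show ?thesis by auto
qed

lemma decomposable_blaschke_equiv:
  assumes "blaschke_equiv \<phi> \<phi>\<^sub>0" "decomposable \<phi>" shows "decomposable \<phi>\<^sub>0"
proof -
  obtain l a where l: "l \<in> ball 0 1" and a: "cmod a = 1"
    and eq: "\<And>z. z \<in> ball 0 1 \<Longrightarrow> \<phi>\<^sub>0 z = a * disc_aut l (\<phi> z)"
    using assms(1) unfolding blaschke_equiv_def by auto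
  obtain \<psi>\<^sub>1 \<psi>\<^sub>2 m n where mn: "m > 1" "n > 1" "finite_blaschke m \<psi>\<^sub>1" "finite_blaschke n \<psi>\<^sub>2"
    "\<And>z. z \<in> ball 0 1 \<Longrightarrow> \<phi> z = \<psi>\<^sub>1 (\<psi>\<^sub>2 z)"
    using assms(2) unfolding decomposable_def blaschke_decomposition_def by auto
  have "finite_blaschke m (\<lambda>z. a * disc_aut l (\<psi>\<^sub>1 z))"
    by (intro finite_blaschke_cmult finite_blaschke_disc_aut_comp mn l a)
  then have "blaschke_decomposition \<phi>\<^sub>0 (\<lambda>z. a * disc_aut l (\<psi>\<^sub>1 z)) \<psi>\<^sub>2"
    unfolding blaschke_decomposition_def using mn eq by auto
  then show ?thesis unfolding decomposable_def by blast
qed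

lemma decomposable_square:
  assumes c: "cmod c = 1" and \<gamma>: "\<gamma> \<in> ball 0 1"
    and eq: "\<And>z. z \<in> ball 0 1 \<Longrightarrow> \<phi> z = c * (z * disc_aut \<gamma> z)\<^sup>2"
  shows "decomposable \<phi>"
proof -
  have 1: "finite_blaschke 2 (\<lambda>w. c * w\<^sup>2)"
    by (rule finite_blaschkeI[of 2 c "[0, 0]"]) (use c in \<open>auto simp: power2_eq_square\<close>)
  have 2: "finite_blaschke 2 (\<lambda>z. z * disc_aut \<gamma> z)"
    by (rule finite_blaschkeI[of 2 "-1" "[0, \<gamma>]"]) (use \<gamma> in auto)
  have "(1::nat) < 2" by simp
  then have "blaschke_decomposition \<phi> (\<lambda>w. c * w\<^sup>2) (\<lambda>z. z * disc_aut \<gamma> z)"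
    unfolding blaschke_decomposition_def using 1 2 eq by blast
  then show ?thesis unfolding decomposable_def by blast
qed

text \<open>A pair of opposite zeros gives an even function, hence a function of \<open>z^2\<close>;
  this exhibits the inner factor \<open>z^2\<close> of an even symbol.\<close>

lemma disc_aut_mult_minus:
  "disc_aut \<alpha> z * disc_aut (- \<alpha>) z = - disc_aut (\<alpha>\<^sup>2) (z\<^sup>2)"
proof -
  have "(\<alpha> - z) * (- \<alpha> - z) = - (\<alpha>\<^sup>2 - z\<^sup>2)" "(1 - cnj \<alpha> * z) * (1 + cnj \<alpha> * z) = 1 - (cnj \<alpha>)\<^sup>2 * z\<^sup>2"
    by (simp_all add: power2_eq_square algebra_simps)
  then show ?thesis by (simp add: disc_aut_def minus_divide_left)
qed

lemma decomposable_even: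
  assumes c: "cmod c = 1" and \<alpha>: "\<alpha> \<in> ball 0 1"
    and eq: "\<And>z. z \<in> ball 0 1 \<Longrightarrow> \<phi> z = c * (z\<^sup>2 * disc_aut \<alpha> z * disc_aut (- \<alpha>) z)"
  shows "decomposable \<phi>"
proof -
  have a2: "\<alpha>\<^sup>2 \<in> ball 0 1" using \<alpha> by (simp add: norm_power power_less_one_iff)
  have 1: "finite_blaschke 2 (\<lambda>w. - c * (w * disc_aut (\<alpha>\<^sup>2) w))"
    by (rule finite_blaschkeI[of 2 c "[0, \<alpha>\<^sup>2]"]) (use c a2 in auto)
  have 2: "finite_blaschke 2 (\<lambda>z. z\<^sup>2)"
    by (rule finite_blaschkeI[of 2 1 "[0, 0]"]) (auto simp: power2_eq_square)
  have "\<phi> z = - c * (z\<^sup>2 * disc_aut (\<alpha>\<^sup>2) (z\<^sup>2))" if "z \<in> ball 0 1" for z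
    unfolding eq[OF that] mult.assoc disc_aut_mult_minus by simp
  moreover have "(1::nat) < 2" by simp
  ultimately have "blaschke_decomposition \<phi> (\<lambda>w. - c * (w * disc_aut (\<alpha>\<^sup>2) w)) (\<lambda>z. z\<^sup>2)"
    unfolding blaschke_decomposition_def using 1 2 by blast
  then show ?thesis unfolding decomposable_def by blast
qed

section \<open>Rational functions on the disc\<close>

text \<open>A polynomial identity, so that neither division nor values off the disc matter:
  functions of the space are \<open>0\<close> there, while the poles of interest lie there and are
  seen only through \<open>u\<close> and \<open>v\<close>.\<close>

definition rat_on_disc :: "(complex \<Rightarrow> complex) \<Rightarrow> bool" where
  "rat_on_disc f \<longleftrightarrow> (\<exists>u v. v \<noteq> 0 \<and> (\<forall>z\<in>ball 0 1. poly v z * f z = poly u z))"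

lemma rat_on_discI: "v \<noteq> 0 \<Longrightarrow> (\<And>z. z \<in> ball 0 1 \<Longrightarrow> poly v z * f z = poly u z) \<Longrightarrow> rat_on_disc f"
  unfolding rat_on_disc_def by blast

lemma rat_on_disc_poly: "rat_on_disc (poly p)"
  by (rule rat_on_discI[of 1 _ p]) auto

lemma rat_on_disc_add:
  assumes "rat_on_disc f" "rat_on_disc g" shows "rat_on_disc (\<lambda>z. f z + g z)"
proof -
  obtain u v u' v' where *: "v \<noteq> 0" "\<And>z. z \<in> ball 0 1 \<Longrightarrow> poly v z * f z = poly u z"
    "v' \<noteq> 0" "\<And>z. z \<in> ball 0 1 \<Longrightarrow> poly v' z * g z = poly u' z"
    using assms unfolding rat_on_disc_def by auto
  show ?thesis
  proof (rule rat_on_discI[of "v * v'" _ "u * v' + u' * v"])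
    fix z :: complex assume z: "z \<in> ball 0 1"
    have "poly (v * v') z * (f z + g z) = (poly v z * f z) * poly v' z + (poly v' z * g z) * poly v z"
      by (simp add: algebra_simps)
    then show "poly (v * v') z * (f z + g z) = poly (u * v' + u' * v) z" using * z by simp
  qed (use * in auto)
qed

lemma rat_on_disc_mult:
  assumes "rat_on_disc f" "rat_on_disc g" shows "rat_on_disc (\<lambda>z. f z * g z)"
proof -
  obtain u v u' v' where *: "v \<noteq> 0" "\<And>z. z \<in> ball 0 1 \<Longrightarrow> poly v z * f z = poly u z"
    "v' \<noteq> 0" "\<And>z. z \<in> ball 0 1 \<Longrightarrow> poly v' z * g z = poly u' z"
    using assms unfolding rat_on_disc_def by auto
  show ?thesis
  proof (rule rat_on_discI[of "v * v'" _ "u * u'"])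
    fix z :: complex assume z: "z \<in> ball 0 1"
    have "poly (v * v') z * (f z * g z) = (poly v z * f z) * (poly v' z * g z)"
      by (simp add: algebra_simps)
    then show "poly (v * v') z * (f z * g z) = poly (u * u') z" unfolding *(2)[OF z] *(4)[OF z] by simp
  qed (use * in auto)
qed

lemma rat_on_disc_const: "rat_on_disc (\<lambda>z. a)"
  using rat_on_disc_poly[of "[:a:]"] by (simp add: rat_on_disc_def)

lemma rat_on_disc_sum:
  "(\<And>i. i \<in> A \<Longrightarrow> rat_on_disc (f i)) \<Longrightarrow> rat_on_disc (\<lambda>z. \<Sum>i\<in>A. f i z)"
  by (induction A rule: infinite_finite_induct) (auto intro: rat_on_disc_const rat_on_disc_add)

lemma rat_on_disc_cancel:
  assumes "rat_on_disc (\<lambda>z. poly w z * f z)" "w \<noteq> 0" shows "rat_on_disc f"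
proof -
  obtain u v where *: "v \<noteq> 0" "\<And>z. z \<in> ball 0 1 \<Longrightarrow> poly v z * (poly w z * f z) = poly u z"
    using assms unfolding rat_on_disc_def by auto
  show ?thesis by (rule rat_on_discI[of "v * w" _ u]) (use * assms(2) in \<open>auto simp: mult.assoc\<close>)
qed

lemma rat_on_disc_cong:
  "rat_on_disc f \<Longrightarrow> (\<And>z. z \<in> ball 0 1 \<Longrightarrow> g z = f z) \<Longrightarrow> rat_on_disc g"
  unfolding rat_on_disc_def by metis

lemma sum_zero_beyond_eq_poly:
  assumes f: "f holomorphic_on ball 0 1" and d: "\<And>n. n \<ge> d \<Longrightarrow> taylor_coeff f n = 0" and z: "z \<in> ball 0 1"
  shows "f z = poly (\<Sum>n<d. monom (taylor_coeff f n) n) z"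
proof -
  have "(\<lambda>n. taylor_coeff f n * z ^ n) sums (\<Sum>n<d. taylor_coeff f n * z ^ n)"
    by (rule sums_finite) (use d in auto)
  then have "f z = (\<Sum>n<d. taylor_coeff f n * z ^ n)"
    using taylor_coeff_sums[OF f z] by (rule sums_unique2[symmetric])
  then show ?thesis by (simp add: poly_sum poly_monom)
qed

lemma taylor_coeff_poly: "taylor_coeff (poly p) n = coeff p n"
proof (rule taylor_coeff_unique[of 1])
  fix z :: complex
  have "(\<lambda>n. coeff p n * z ^ n) sums (\<Sum>n\<le>degree p. coeff p n * z ^ n)"
    by (rule sums_finite) (auto simp: coeff_eq_0)
  then show "(\<lambda>n. coeff p n * z ^ n) sums poly p z" by (simp add: poly_altdef)
qed simp

lemma holomorphic_poly [intro]: "poly p holomorphic_on A"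
  by (rule poly_holomorphic_on[where f="\<lambda>z. z"]) auto

text \<open>A power series whose coefficients satisfy a linear recurrence is rational. Here
  \<open>v\<close> has the conjugated coefficients of \<open>a\<close> in reverse order, so the
  recurrence says that the coefficients of \<open>v u\<close> vanish from index
  \<open>degree a\<close> on.\<close>

lemma linear_recurrence_rat:
  assumes u: "u holomorphic_on ball 0 1" and a: "a \<noteq> 0"
    and rec: "\<And>k. (\<Sum>i\<le>degree a. coeff a i * cnj (taylor_coeff u (i + k))) = 0"
  shows "rat_on_disc u"
proof -
  define d where "d = degree a"
  define v where "v = (\<Sum>j\<le>d. monom (cnj (coeff a (d - j))) j)"
  have vj: "coeff v j = (if j \<le> d then cnj (coeff a (d - j)) else 0)" for j
    by (auto simp: v_def coeff_sum coeff_monom)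
  have v0: "v \<noteq> 0" using vj[of 0] a by (auto simp: d_def)
  have zero: "taylor_coeff (\<lambda>z. poly v z * u z) n = 0" if n: "n \<ge> d" for n
  proof -
    have "taylor_coeff (\<lambda>z. poly v z * u z) n = (\<Sum>j\<le>n. coeff v j * taylor_coeff u (n - j))"
      by (subst taylor_coeff_mult[OF holomorphic_poly u]) (simp add: taylor_coeff_poly)
    also have "\<dots> = (\<Sum>j\<le>d. coeff v j * taylor_coeff u (n - j))"
      using n by (intro sum.mono_neutral_right) (auto simp: vj)
    also have "\<dots> = (\<Sum>i\<le>d. coeff v (d - i) * taylor_coeff u (n - (d - i)))"
      by (rule sum.reindex_bij_witness[of _ "\<lambda>i. d - i" "\<lambda>i. d - i"]) auto
    also have "\<dots> = (\<Sum>i\<le>d. cnj (coeff a i) * taylor_coeff u (i + (n - d)))"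
    proof (rule sum.cong[OF refl])
      fix i assume "i \<in> {..d}"
      then have "d - (d - i) = i" "n - (d - i) = i + (n - d)" "d - i \<le> d" using n by auto
      then show "coeff v (d - i) * taylor_coeff u (n - (d - i)) = cnj (coeff a i) * taylor_coeff u (i + (n - d))"
        by (simp only: vj if_True)
    qed
    also have "\<dots> = cnj (\<Sum>i\<le>d. coeff a i * cnj (taylor_coeff u (i + (n - d))))" by simp
    also have "\<dots> = 0" unfolding d_def rec by simp
    finally show ?thesis .
  qed
  have "(\<lambda>z. poly v z * u z) holomorphic_on ball 0 1" by (intro holomorphic_intros holomorphic_poly u)
  from sum_zero_beyond_eq_poly[OF this zero] show ?thesis by (intro rat_on_discI[OF v0]) auto
qed

text \<open>Comparing orders at the pole \<open>1 / r j\<close>: the derivative of a rational function has no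
  simple pole.\<close>
lemma rat_deriv_no_simple_pole:
  fixes r \<alpha> :: "'i \<Rightarrow> complex"
  assumes K: "K holomorphic_on ball 0 1" and rat: "rat_on_disc K" and J: "finite J" "inj_on r J"
    and r: "\<And>j. j \<in> J \<Longrightarrow> r j \<noteq> 0 \<and> cmod (r j) < 1"
    and der: "\<And>x. x \<in> ball 0 1 \<Longrightarrow> deriv K x = (\<Sum>j\<in>J. \<alpha> j / (1 - x * r j))"
    and j: "j \<in> J"
  shows "\<alpha> j = 0"
proof -
  obtain u v where v: "v \<noteq> 0" and uv: "\<And>z. z \<in> ball 0 1 \<Longrightarrow> poly v z * K z = poly u z"
    using rat unfolding rat_on_disc_def by auto
  define lin where "lin i = [:1, - r i:]" for i
  define Pi1 where "Pi1 = (\<Prod>i\<in>J - {j}. lin i)"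
  define A where "A = (\<Sum>i\<in>J. smult (\<alpha> i) (\<Prod>k\<in>J - {i}. lin k))"
  define x0 where "x0 = 1 / r j"
  have rj: "r j \<noteq> 0" using r j by blast
  have nz: "1 - x * r i \<noteq> 0" if "x \<in> ball 0 1" "i \<in> J" for x i
    using that r[OF that(2)] disc_aut_denom_nonzero[of "cnj (r i)" x] by (auto simp: mult.commute)
  have poly_lin: "poly (lin i) x = 1 - x * r i" for i x by (simp add: lin_def)
  \<comment> \<open>\<open>K' = (u' v - u v') / v^2\<close> compared with the sum over its common
    denominator. As a polynomial identity it holds everywhere, in particular at the pole
    \<open>x0\<close> outside the disc. It remains to show \<open>poly A x0 = 0\<close>, since all
    terms of \<open>A\<close> but the one for \<open>j\<close> vanish there.\<close>
  have D: "(pderiv u * v - u * pderiv v) * (lin j * Pi1) = v * v * A"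
  proof (rule poly_eq_on_disc)
    fix x :: complex assume x: "x \<in> ball 0 1"
    have "(K has_field_derivative deriv K x) (at x)"
      by (rule holomorphic_derivI[OF K _ x]) simp
    from DERIV_mult[OF poly_DERIV[of v x] this]
    have "((\<lambda>z. poly v z * K z) has_field_derivative poly (pderiv v) x * K x + deriv K x * poly v x) (at x)" .
    moreover have "((\<lambda>z. poly v z * K z) has_field_derivative poly (pderiv u) x) (at x)"
      by (subst DERIV_cong_ev[OF refl _ refl, where g="poly u"])
         (use uv x in \<open>auto intro!: eventually_nhds_in_open[of "ball 0 1", THEN eventually_mono] poly_DERIV\<close>)
    ultimately have e: "poly (pderiv u) x = poly (pderiv v) x * K x + deriv K x * poly v x"
      by (rule DERIV_unique[symmetric])
    have prodJ: "lin j * Pi1 = (\<Prod>i\<in>J. lin i)"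
      unfolding Pi1_def using J(1) j by (simp add: prod.remove)
    have AK: "deriv K x * poly (lin j * Pi1) x = poly A x"
    proof -
      have "deriv K x * poly (lin j * Pi1) x = (\<Sum>i\<in>J. \<alpha> i / (1 - x * r i) * poly (\<Prod>k\<in>J. lin k) x)"
        unfolding der[OF x] prodJ by (rule sum_distrib_right)
      also have "\<dots> = (\<Sum>i\<in>J. \<alpha> i * poly (\<Prod>k\<in>J - {i}. lin k) x)"
      proof (rule sum.cong[OF refl])
        fix i assume i: "i \<in> J"
        have "(\<Prod>k\<in>J. lin k) = lin i * (\<Prod>k\<in>J - {i}. lin k)" using J(1) i by (simp add: prod.remove)
        then show "\<alpha> i / (1 - x * r i) * poly (\<Prod>k\<in>J. lin k) x = \<alpha> i * poly (\<Prod>k\<in>J - {i}. lin k) x"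
          using nz[OF x i] by (simp add: poly_lin)
      qed
      finally show ?thesis by (simp add: A_def poly_sum)
    qed
    have "poly (pderiv u * v - u * pderiv v) x = deriv K x * (poly v x * poly v x)"
      using uv[OF x] by (simp add: e algebra_simps flip: uv[OF x])
    then have "poly ((pderiv u * v - u * pderiv v) * (lin j * Pi1)) x
        = poly v x * poly v x * (deriv K x * poly (lin j * Pi1) x)"
      by (simp add: mult_ac)
    then show "poly ((pderiv u * v - u * pderiv v) * (lin j * Pi1)) x = poly (v * v * A) x"
      unfolding AK by simp
  qed
  have A0: "poly A x0 = 0"
  proof (cases "u = 0")
    case True
    then have "v * v * A = 0" using D by simp
    then show ?thesis using v by simp
  next
    case False
    define X where "X = [:- x0, 1:]"
    define a k where "a = order x0 u" and "k = order x0 v"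
    obtain u1 where u1: "u = X ^ a * u1" "\<not> X dvd u1"
      using order_decomp[OF False, of x0] by (auto simp: X_def a_def)
    obtain v1 where v1: "v = X ^ k * v1" "\<not> X dvd v1"
      using order_decomp[OF v, of x0] by (auto simp: X_def k_def)
    have u1x: "poly u1 x0 \<noteq> 0" and v1x: "poly v1 x0 \<noteq> 0"
      using u1(2) v1(2) by (auto simp: X_def poly_eq_0_iff_dvd)
    have pX: "pderiv X = 1" by (simp add: X_def pderiv_pCons)
    have Xp: "X * pderiv (X ^ n) = smult (of_nat n) (X ^ n)" for n
      by (cases n) (simp_all add: pderiv_power_Suc pX mult_ac del: power_Suc, simp add: mult_ac)
    \<comment> \<open>Up to powers of \<open>X\<close> this is the numerator of the derivative. Its
      value at \<open>x0\<close> is \<open>(a - k) u1 v1\<close>, nonzero unless the orders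
      agree.\<close>
    define T where "T = smult (of_nat a - of_nat k) (u1 * v1) + X * (pderiv u1 * v1 - u1 * pderiv v1)"
    have XD: "X * (pderiv u * v - u * pderiv v) = X ^ (a + k) * T"
    proof -
      have "X * pderiv u = smult (of_nat a) (X ^ a) * u1 + X ^ a * (X * pderiv u1)"
        unfolding u1(1) pderiv_mult Xp[symmetric] by (simp add: algebra_simps)
      moreover have "X * pderiv v = smult (of_nat k) (X ^ k) * v1 + X ^ k * (X * pderiv v1)"
        unfolding v1(1) pderiv_mult Xp[symmetric] by (simp add: algebra_simps)
      ultimately have "(X * pderiv u) * v - u * (X * pderiv v) = X ^ (a + k) * T"
        unfolding u1(1) v1(1) T_def
        by (simp add: algebra_simps power_add smult_diff_left)
      then show ?thesis by (simp add: algebra_simps)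
    qed
    have linX: "lin j = smult (- r j) X" using rj by (simp add: lin_def X_def x0_def)
    have main: "X ^ (a + k) * (smult (- r j) (T * Pi1)) = X ^ (2 * k) * (v1 * v1 * A)"
    proof -
      have "X ^ (a + k) * (smult (- r j) (T * Pi1)) = smult (- r j) ((X ^ (a + k) * T) * Pi1)"
        by (simp add: mult_ac)
      also have "\<dots> = (pderiv u * v - u * pderiv v) * (lin j * Pi1)"
        unfolding XD[symmetric] linX by (simp add: mult_ac)
      also have "\<dots> = v * v * A" by (rule D)
      also have "\<dots> = X ^ (2 * k) * (v1 * v1 * A)"
      proof -
        have "X ^ (2 * k) = X ^ k * X ^ k" by (simp add: mult_2 power_add)
        then show ?thesis using v1(1) by (simp only: mult_ac)
      qed
      finally show ?thesis .
    qed
    have X0: "X \<noteq> 0" by (simp add: X_def)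
    have Xx: "poly X x0 = 0" by (simp add: X_def)
    have canc: "Y = Z" if "X ^ m * Y = X ^ m * Z" for Y Z m using that X0 by simp
    have Pi1x: "poly Pi1 x0 \<noteq> 0"
    proof -
      have "1 - x0 * r i \<noteq> 0" if "i \<in> J - {j}" for i
        using that inj_onD[OF J(2), of i j] j rj by (auto simp: x0_def field_simps)
      then show ?thesis using J(1) by (simp add: Pi1_def poly_prod poly_lin)
    qed
    \<comment> \<open>A pole of \<open>u / v\<close> would give its derivative a pole of order at
      least two, which the simple factor \<open>lin j\<close> cannot produce; without a pole,
      \<open>A\<close> acquires a zero at \<open>x0\<close>.\<close>
    consider "a < k" | "a = k" | "k < a" by linarith
    then show ?thesis
    proof cases
      case 1
      then have "2 * k = (a + k) + (k - a)" by simp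
      then have "X ^ (a + k) * (smult (- r j) (T * Pi1)) = X ^ (a + k) * (X ^ (k - a) * (v1 * v1 * A))"
        using main by (simp only: power_add mult.assoc)
      then have "smult (- r j) (T * Pi1) = X ^ (k - a) * (v1 * v1 * A)" by (rule canc)
      then have "poly (smult (- r j) (T * Pi1)) x0 = poly (X ^ (k - a) * (v1 * v1 * A)) x0" by simp
      then have "poly T x0 = 0" using 1 rj Pi1x Xx by (simp add: poly_power power_0_left)
      then have "(of_nat a - of_nat k) * (poly u1 x0 * poly v1 x0) = 0" by (simp add: T_def Xx)
      then show ?thesis using u1x v1x 1 by simp
    next
      case 2
      then have "X ^ (2 * k) * smult (- r j) (T * Pi1) = X ^ (2 * k) * (v1 * v1 * A)"
        using main by (simp only: mult_2)
      then have "smult (- r j) (T * Pi1) = v1 * v1 * A" by (rule canc)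
      then have "poly (smult (- r j) (T * Pi1)) x0 = poly (v1 * v1 * A) x0" by simp
      moreover have "poly T x0 = 0" using 2 by (simp add: T_def Xx)
      ultimately show ?thesis using v1x by simp
    next
      case 3
      then have "a + k = 2 * k + (a - k)" by simp
      then have "X ^ (2 * k) * (X ^ (a - k) * smult (- r j) (T * Pi1)) = X ^ (2 * k) * (v1 * v1 * A)"
        using main by (simp only: power_add mult.assoc)
      then have "X ^ (a - k) * smult (- r j) (T * Pi1) = v1 * v1 * A" by (rule canc)
      then have "poly (X ^ (a - k) * smult (- r j) (T * Pi1)) x0 = poly (v1 * v1 * A) x0" by simp
      then show ?thesis using v1x Xx 3 by (simp add: poly_power power_0_left)
    qed
  qed
  have "poly A x0 = (\<Sum>i\<in>J. \<alpha> i * (\<Prod>k\<in>J - {i}. 1 - x0 * r k))"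
    by (simp add: A_def poly_sum poly_prod poly_lin)
  also have "\<dots> = (\<Sum>i\<in>{j}. \<alpha> i * (\<Prod>k\<in>J - {i}. 1 - x0 * r k))"
  proof (rule sum.mono_neutral_right)
    show "\<forall>i\<in>J - {j}. \<alpha> i * (\<Prod>k\<in>J - {i}. 1 - x0 * r k) = 0"
    proof
      fix i assume i: "i \<in> J - {j}"
      have "(\<Prod>k\<in>J - {i}. 1 - x0 * r k) = 0"
        using i j rj J(1) by (intro prod_zero) (auto simp: x0_def intro!: bexI[of _ j])
      then show "\<alpha> i * (\<Prod>k\<in>J - {i}. 1 - x0 * r k) = 0" by simp
    qed
  qed (use J j in auto)
  finally have "\<alpha> j * (\<Prod>k\<in>J - {j}. 1 - x0 * r k) = 0" using A0 by simp
  moreover have "(\<Prod>k\<in>J - {j}. 1 - x0 * r k) \<noteq> 0"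
  proof -
    have "1 - x0 * r i \<noteq> 0" if "i \<in> J - {j}" for i
      using that inj_onD[OF J(2), of i j] j rj by (auto simp: x0_def field_simps)
    then show ?thesis using J(1) by simp
  qed
  ultimately show ?thesis by simp
qed

text \<open>Double poles are derivatives of rational functions, so adding the primitive
  \<open>G\<close> of their negatives removes them and leaves only simple poles.\<close>

lemma rat_deriv_no_residue:
  fixes r \<alpha> \<beta> :: "'i \<Rightarrow> complex"
  assumes K: "K holomorphic_on ball 0 1" and rat: "rat_on_disc K" and J: "finite J" "inj_on r J"
    and r: "\<And>j. j \<in> J \<Longrightarrow> r j \<noteq> 0 \<and> cmod (r j) < 1"
    and der: "\<And>x. x \<in> ball 0 1 \<Longrightarrow> deriv K x = (\<Sum>j\<in>J. \<alpha> j / (1 - x * r j) + \<beta> j / (1 - x * r j)\<^sup>2)"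
    and j: "j \<in> J"
  shows "\<alpha> j = 0"
proof -
  define G where "G x = (\<Sum>j\<in>J. (- \<beta> j / r j) * inverse (1 - x * r j))" for x
  have nz: "1 - x * r i \<noteq> 0" if "x \<in> ball 0 1" "i \<in> J" for x i
    using that r[OF that(2)] disc_aut_denom_nonzero[of "cnj (r i)" x] by (auto simp: mult.commute)
  have Gh: "G holomorphic_on ball 0 1"
    unfolding G_def[abs_def] by (intro holomorphic_intros) (use nz in auto)
  have "rat_on_disc (\<lambda>x. inverse (1 - x * r i))" if i: "i \<in> J" for i
    by (rule rat_on_discI[of "[:1, - r i:]" _ 1]) (use nz[OF _ i] r[OF i] in auto)
  then have Gr: "rat_on_disc G"
    unfolding G_def[abs_def] by (intro rat_on_disc_sum rat_on_disc_mult rat_on_disc_const)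
  have Gd: "(G has_field_derivative (\<Sum>j\<in>J. - \<beta> j / (1 - x * r j)\<^sup>2)) (at x)" if x: "x \<in> ball 0 1" for x
  proof -
    have "((\<lambda>x. (- \<beta> i / r i) * inverse (1 - x * r i)) has_field_derivative - \<beta> i / (1 - x * r i)\<^sup>2) (at x)"
      if i: "i \<in> J" for i
    proof -
      have "((\<lambda>x. inverse (1 - x * r i)) has_field_derivative r i / (1 - x * r i)\<^sup>2) (at x)"
        using nz[OF x i] by (auto intro!: derivative_eq_intros simp: power2_eq_square divide_inverse)
      from DERIV_cmult[OF this, of "- \<beta> i / r i"] show ?thesis using r[OF i] by simp
    qed
    then show ?thesis unfolding G_def[abs_def] by (intro DERIV_sum)
  qed
  show ?thesis
  proof (rule rat_deriv_no_simple_pole[of "\<lambda>x. K x + G x" J r \<alpha>])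
    fix x :: complex assume x: "x \<in> ball 0 1"
    have "(K has_field_derivative deriv K x) (at x)" by (rule holomorphic_derivI[OF K _ x]) simp
    from DERIV_imp_deriv[OF DERIV_add[OF this Gd[OF x]]]
    have "deriv (\<lambda>x. K x + G x) x = deriv K x + (\<Sum>j\<in>J. - \<beta> j / (1 - x * r j)\<^sup>2)" .
    then show "deriv (\<lambda>x. K x + G x) x = (\<Sum>j\<in>J. \<alpha> j / (1 - x * r j))"
      unfolding der[OF x] by (simp add: sum.distrib sum_negf)
  qed (use K Gh J r j rat Gr in \<open>auto intro: rat_on_disc_add holomorphic_intros\<close>)
qed

section \<open>The projections of the monomials\<close>

lemma taylor_coeff_power_mult:
  assumes "f holomorphic_on ball 0 1"
  shows "taylor_coeff (\<lambda>z. z ^ k * f z) n = (if n < k then 0 else taylor_coeff f (n - k))"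
proof (induction k arbitrary: n)
  case (Suc k)
  have "(\<lambda>z. z ^ k * f z) holomorphic_on ball 0 1" by (intro holomorphic_intros assms)
  from taylor_coeff_times_id[OF this, of n] show ?case
    using Suc.IH[of "n - 1"] by (auto simp: mult.assoc)
qed simp

lemma disc_ext_poly_in: "disc_ext (poly g) \<in> dirichlet_space"
proof -
  have "disc_ext (poly g) = mult_op (poly g) (dmono 0)"
    by (auto simp: disc_ext_def mult_op_def dmono_def)
  then show ?thesis using mult_op_in[OF disc_multiplier_poly dmono_in] by simp
qed

lemma taylor_coeff_disc_ext_poly: "taylor_coeff (disc_ext (poly g)) n = coeff g n"
  by (simp add: taylor_coeff_disc_ext[OF holomorphic_poly] taylor_coeff_poly)

lemma disc_ext_poly_add: "disc_ext (poly (g + h)) = (\<lambda>z. disc_ext (poly g) z + disc_ext (poly h) z)"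
  and disc_ext_poly_smult: "disc_ext (poly (smult a g)) = (\<lambda>z. a * disc_ext (poly g) z)"
  and disc_ext_poly_monom: "disc_ext (poly (monom 1 n)) = dmono n"
  by (auto simp: disc_ext_def dmono_def poly_monom)

lemma dirichlet_inner_poly:
  assumes "degree g \<le> d"
  shows "dirichlet_inner (disc_ext (poly g)) h = (\<Sum>n\<le>d. of_nat (n + 1) * coeff g n * cnj (taylor_coeff h n))"
  unfolding dirichlet_inner_def taylor_coeff_disc_ext_poly
  by (rule suminf_finite) (use assms in \<open>auto simp: coeff_eq_0\<close>)

text \<open>The zeros are fixed as a list to make numerator and denominator explicit polynomials.
  \<open>zero_in\<close> is the normalisation \<open>\<phi> 0 = 0\<close>, which an automorphism of
  the range always achieves.\<close>

locale reducing_blaschke =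
  fixes c :: complex and ls :: "complex list" and \<phi> :: "complex \<Rightarrow> complex" and M :: "(complex \<Rightarrow> complex) set"
  assumes norm_c: "cmod c = 1" and length_ls: "length ls = 4" and ls_ball: "set ls \<subseteq> ball 0 1"
    and zero_in: "0 \<in> set ls"
    and phi_eq: "\<And>z. z \<in> ball 0 1 \<Longrightarrow> \<phi> z = c * (\<Prod>l\<leftarrow>ls. disc_aut l z)"
    and red: "reducing_subspace (mult_op \<phi>) M"
begin

definition p :: "complex poly" where "p = smult c (blaschke_num ls)"
definition q :: "complex poly" where "q = blaschke_den ls"
definition P :: operator where "P = dirichlet_proj M"
definition L :: "complex poly \<Rightarrow> complex \<Rightarrow> complex" where "L g = P (disc_ext (poly g))"
definition h :: "nat \<Rightarrow> complex \<Rightarrow> complex" where "h n = P (dmono n)"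
text \<open>In terms of \<open>u\<close> the symmetry of the projection says that the array of
  Taylor coefficients of the \<open>u m\<close> is Hermitian.\<close>

definition u :: "nat \<Rightarrow> complex \<Rightarrow> complex" where "u n = deriv (\<lambda>z. z * h n z)"

lemma c_nonzero: "c \<noteq> 0" using norm_c by auto

lemma blaschke: "finite_blaschke 4 \<phi>"
  by (rule finite_blaschkeI[of 4 c ls]) (use norm_c length_ls ls_ball phi_eq in auto)

lemma multiplier: "disc_multiplier \<phi>"
  by (rule finite_blaschke_multiplier[OF blaschke])

lemma q_nonzero: "cmod z \<le> 1 \<Longrightarrow> poly q z \<noteq> 0"
  unfolding q_def by (rule poly_blaschke_den_nonzero[OF ls_ball])

lemma phi_pq: "z \<in> ball 0 1 \<Longrightarrow> \<phi> z = poly p z / poly q z"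
  by (simp add: phi_eq prod_disc_aut_eq p_def q_def)

lemma phi_q: "z \<in> ball 0 1 \<Longrightarrow> \<phi> z * poly q z = poly p z"
  using q_nonzero[of z] by (simp add: phi_pq)

lemma p_nonzero: "p \<noteq> 0" and poly_p_0: "poly p 0 = 0" and poly_q_0: "poly q 0 = 1"
  and degree_p: "degree p = 4" and degree_q: "degree q \<le> 4"
  using blaschke_num_nonzero[of ls] zero_in c_nonzero degree_blaschke_den[of ls] length_ls
  by (auto simp: p_def q_def poly_blaschke_num_eq_0_iff degree_blaschke_num)

lemma poly_p_eq_0: "poly p z = 0 \<Longrightarrow> z \<in> ball 0 1"
  using ls_ball c_nonzero by (auto simp: p_def poly_blaschke_num_eq_0_iff)

lemma M_closed: "closed_subspace M"
  and P_commute: "f \<in> dirichlet_space \<Longrightarrow> P (mult_op \<phi> f) = mult_op \<phi> (P f)"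
  using red reducing_subspace_iff_commute[OF multiplier] by (auto simp: P_def)

lemma P_in: "f \<in> dirichlet_space \<Longrightarrow> P f \<in> dirichlet_space"
  unfolding P_def by (rule dirichlet_proj_space[OF M_closed])

lemma P_symmetric:
  "f \<in> dirichlet_space \<Longrightarrow> g \<in> dirichlet_space \<Longrightarrow> dirichlet_inner (P f) g = dirichlet_inner f (P g)"
  unfolding P_def by (rule dirichlet_proj_symmetric[OF M_closed])

lemma h_in: "h n \<in> dirichlet_space" unfolding h_def by (intro P_in dmono_in)

lemma h_holomorphic: "h n holomorphic_on ball 0 1" by (rule dirichlet_space_holomorphic[OF h_in])

lemma L_in: "L g \<in> dirichlet_space" unfolding L_def by (intro P_in disc_ext_poly_in)

lemma L_holomorphic: "L g holomorphic_on ball 0 1" by (rule dirichlet_space_holomorphic[OF L_in])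

lemma L_add: "L (f + g) = (\<lambda>z. L f z + L g z)"
  unfolding L_def P_def disc_ext_poly_add by (intro dirichlet_proj_add M_closed disc_ext_poly_in)

lemma L_smult: "L (smult a g) = (\<lambda>z. a * L g z)"
  unfolding L_def P_def disc_ext_poly_smult by (intro dirichlet_proj_cmult M_closed disc_ext_poly_in)

lemma L_monom: "L (monom 1 n) = h n"
  by (simp add: L_def h_def disc_ext_poly_monom)

lemma L_zero: "L 0 = (\<lambda>z. 0)"
  using L_smult[of 0 0] by simp

lemma L_diff: "L (f - g) = (\<lambda>z. L f z - L g z)"
  using L_add[of f "smult (-1) g"] L_smult[of "-1" g] by simp

lemma L_sum: "L (\<Sum>i\<in>A. f i) = (\<lambda>z. \<Sum>i\<in>A. L (f i) z)"
  by (induction A rule: infinite_finite_induct) (simp_all add: L_zero L_add)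

lemma L_expand:
  assumes "degree g \<le> d" shows "L g z = (\<Sum>i\<le>d. coeff g i * h i z)"
proof -
  have "g = (\<Sum>i\<le>d. smult (coeff g i) (monom 1 i))"
    using poly_as_sum_of_monoms'[OF assms] by (simp add: smult_monom)
  then have "L g z = L (\<Sum>i\<le>d. smult (coeff g i) (monom 1 i)) z" by simp
  then show ?thesis by (simp add: L_sum L_smult L_monom)
qed

text \<open>As \<open>p = \<phi> q\<close> on the disc, commutation with the projection says that
  \<open>L\<close> evaluated at \<open>z\<close> annihilates the multiples of
  \<open>p - \<phi> z q\<close>. All use of commutation goes through this identity.\<close>

lemma L_p: "z \<in> ball 0 1 \<Longrightarrow> L (p * g) z = \<phi> z * L (q * g) z"
proof -
  assume z: "z \<in> ball 0 1"
  have "disc_ext (poly (p * g)) = mult_op \<phi> (disc_ext (poly (q * g)))"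
    by (auto simp: disc_ext_def mult_op_def simp flip: phi_q)
  then have "L (p * g) = mult_op \<phi> (L (q * g))"
    unfolding L_def using P_commute[OF disc_ext_poly_in] by simp
  then show ?thesis by (simp add: mult_op_def)
qed

lemma L_p_power: "z \<in> ball 0 1 \<Longrightarrow> L (p ^ k * g) z = \<phi> z ^ k * L (q ^ k * g) z"
proof (induction k arbitrary: g)
  case (Suc k)
  have "L (p ^ Suc k * g) z = L (p * (p ^ k * g)) z" by (simp add: mult_ac)
  also have "\<dots> = \<phi> z * L (q * (p ^ k * g)) z" by (rule L_p[OF Suc.prems])
  also have "q * (p ^ k * g) = p ^ k * (q * g)" by (simp add: mult_ac)
  also have "L (p ^ k * (q * g)) z = \<phi> z ^ k * L (q ^ k * (q * g)) z" by (rule Suc.IH[OF Suc.prems])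
  finally show ?case by (simp add: mult_ac)
qed simp

lemma taylor_coeff_h_symmetric:
  "of_nat (n + 1) * taylor_coeff (h m) n = cnj (of_nat (m + 1) * taylor_coeff (h n) m)"
proof -
  have "of_nat (n + 1) * taylor_coeff (h m) n = dirichlet_inner (h m) (dmono n)"
    by (rule dirichlet_inner_dmono[OF h_in, symmetric])
  also have "\<dots> = dirichlet_inner (dmono m) (h n)"
    unfolding h_def by (rule P_symmetric) auto
  also have "\<dots> = cnj (dirichlet_inner (h n) (dmono m))"
    by (rule dirichlet_inner_cnj[symmetric]) (auto intro: h_in)
  finally show ?thesis by (simp only: dirichlet_inner_dmono[OF h_in])
qed

lemma taylor_coeff_u: "taylor_coeff (u m) n = of_nat (n + 1) * taylor_coeff (h m) n"
  unfolding u_def by (rule taylor_coeff_deriv_times_id[OF h_holomorphic])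

lemma u_holomorphic: "u n holomorphic_on ball 0 1"
  unfolding u_def by (intro holomorphic_deriv holomorphic_intros h_holomorphic) simp

text \<open>Since \<open>\<phi> 0 = 0\<close>, the monomial \<open>z ^ n\<close> is orthogonal to \<open>\<phi> ^ (n + 1) D\<close>, hence so is its
  projection; this is a linear recurrence for the Taylor coefficients.\<close>
lemma rat_u: "rat_on_disc (u n)"
proof (rule linear_recurrence_rat[OF u_holomorphic])
  show "p ^ (n + 1) \<noteq> 0" using p_nonzero by simp
  fix k
  let ?a = "p ^ (n + 1)"
  define d where "d = degree ?a"
  define g :: "complex poly" where "g = monom 1 k"
  have deg: "degree (?a * g) \<le> d + k"
    unfolding d_def g_def by (rule order_trans[OF degree_mult_le]) (simp add: degree_monom_eq)
  have "dirichlet_inner (disc_ext (poly (?a * g))) (h n) = 0"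
  proof -
    have "dirichlet_inner (disc_ext (poly (?a * g))) (h n) = dirichlet_inner (L (?a * g)) (dmono n)"
      unfolding L_def h_def by (rule P_symmetric[symmetric]) (auto intro: disc_ext_poly_in)
    also have "\<dots> = of_nat (n + 1) * taylor_coeff (L (?a * g)) n"
      by (rule dirichlet_inner_dmono[OF L_in])
    also have "taylor_coeff (L (?a * g)) n = 0"
    proof -
      obtain p1 where p1: "p = [:0, 1:] * p1"
        using poly_p_0 by (metis dvdE minus_zero poly_eq_0_iff_dvd)
      \<comment> \<open>Taking the factor \<open>z\<close> out of each of the \<open>n + 1\<close>
        copies of \<phi> leaves a holomorphic cofactor, so the coefficient of index \<open>n\<close>
        vanishes.\<close>
      let ?f = "\<lambda>z. (poly p1 z / poly q z) ^ (n + 1) * L (q ^ (n + 1) * g) z"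
      have fh: "?f holomorphic_on ball 0 1"
        by (intro holomorphic_intros holomorphic_poly L_holomorphic) (use q_nonzero in auto)
      have "taylor_coeff (L (?a * g)) n = taylor_coeff (\<lambda>z. z ^ (n + 1) * ?f z) n"
      proof (rule taylor_coeff_cong)
        fix z :: complex assume z: "z \<in> ball 0 1"
        have "\<phi> z = z * (poly p1 z / poly q z)" using phi_pq[OF z] by (simp add: p1)
        then show "z ^ (n + 1) * ?f z = L (?a * g) z"
          unfolding L_p_power[OF z] by (simp only: power_mult_distrib mult.assoc)
      qed (rule holomorphic_on_mult[OF holomorphic_on_power[OF holomorphic_on_ident] fh])
      then show ?thesis using taylor_coeff_power_mult[OF fh, of "n + 1" n] by simp
    qed
    finally show ?thesis by (simp only: mult_zero_right)
  qed
  then have "(\<Sum>m\<le>d + k. of_nat (m + 1) * coeff (?a * g) m * cnj (taylor_coeff (h n) m)) = 0"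
    by (simp only: dirichlet_inner_poly[OF deg])
  also have "(\<Sum>m\<le>d + k. of_nat (m + 1) * coeff (?a * g) m * cnj (taylor_coeff (h n) m))
      = (\<Sum>m\<le>d + k. coeff (?a * g) m * cnj (taylor_coeff (u n) m))"
    by (rule sum.cong) (simp_all add: taylor_coeff_u)
  also have "\<dots> = (\<Sum>m\<in>{k..d + k}. coeff (?a * g) m * cnj (taylor_coeff (u n) m))"
    by (rule sum.mono_neutral_right) (auto simp: g_def coeff_monom_mult mult.commute[of _ "monom 1 k"])
  also have "\<dots> = (\<Sum>i\<le>d. coeff ?a i * cnj (taylor_coeff (u n) (i + k)))"
    by (rule sum.reindex_bij_witness[of _ "\<lambda>i. i + k" "\<lambda>m. m - k"])
       (auto simp: g_def coeff_monom_mult mult.commute[of _ "monom 1 k"])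
  finally show "(\<Sum>i\<le>degree ?a. coeff ?a i * cnj (taylor_coeff (u n) (i + k))) = 0"
    by (simp add: d_def)
qed

lemma coprime_pq: "coprime p q"
  unfolding p_def q_def
  by (rule coprime_divisors[OF _ dvd_refl coprime_blaschke_num_den[OF ls_ball ls_ball]])
     (simp add: smult_dvd_iff c_nonzero)

lemma wronskian_nonzero: "pderiv p * q - p * pderiv q \<noteq> 0"
proof
  assume "pderiv p * q - p * pderiv q = 0"
  then have "p dvd pderiv p * q" by (metis dvd_triv_left eq_iff_diff_eq_0)
  then have dvd: "p dvd pderiv p" using coprime_pq by (simp add: coprime_dvd_mult_left_iff)
  have "pderiv p \<noteq> 0" using degree_p by (simp add: pderiv_eq_0_iff)
  then have "degree p \<le> degree (pderiv p)" using dvd by (intro dvd_imp_degree_le)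
  then show False using degree_p by (simp add: degree_pderiv)
qed

lemma phi_has_derivative:
  assumes z: "z \<in> ball 0 1"
  shows "(\<phi> has_field_derivative poly (pderiv p * q - p * pderiv q) z / (poly q z)\<^sup>2) (at z)"
proof (subst DERIV_cong_ev[OF refl _ refl, where g="\<lambda>z. poly p z / poly q z"])
  show "\<forall>\<^sub>F z in nhds z. \<phi> z = poly p z / poly q z"
    using phi_pq z by (auto intro!: eventually_nhds_in_open[of "ball 0 1", THEN eventually_mono])
  have "poly q z \<noteq> 0" using q_nonzero[of z] z by simp
  from DERIV_divide[OF poly_DERIV poly_DERIV this, of p]
  show "((\<lambda>z. poly p z / poly q z) has_field_derivative poly (pderiv p * q - p * pderiv q) z / (poly q z)\<^sup>2) (at z)"
    by (simp add: power2_eq_square)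
qed

lemma deriv_phi:
  "z \<in> ball 0 1 \<Longrightarrow> deriv \<phi> z * (poly q z)\<^sup>2 = poly (pderiv p * q - p * pderiv q) z"
  using DERIV_imp_deriv[OF phi_has_derivative] q_nonzero[of z] by simp

lemma rat_phi: "rat_on_disc \<phi>"
proof (rule rat_on_discI[of q _ p])
  show "q \<noteq> 0" using poly_q_0 by auto
  fix z :: complex assume "z \<in> ball 0 1"
  then show "poly q z * \<phi> z = poly p z" using phi_q[of z] by (simp add: mult.commute)
qed

lemma rat_deriv_L: "rat_on_disc (deriv (\<lambda>z. z * L g z))"
proof -
  have "rat_on_disc (\<lambda>z. \<Sum>i\<le>degree g. coeff g i * u i z)"
    by (intro rat_on_disc_sum rat_on_disc_mult rat_on_disc_const rat_u)
  then show ?thesis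
  proof (rule rat_on_disc_cong)
    fix z :: complex assume z: "z \<in> ball 0 1"
    have "((\<lambda>z. z * h i z) has_field_derivative u i z) (at z)" for i
      unfolding u_def by (rule holomorphic_derivI[of _ "ball 0 1"]) (use z in \<open>auto intro!: holomorphic_intros h_holomorphic\<close>)
    then have "((\<lambda>z. \<Sum>i\<le>degree g. coeff g i * (z * h i z)) has_field_derivative (\<Sum>i\<le>degree g. coeff g i * u i z)) (at z)"
      by (intro DERIV_sum DERIV_cmult)
    moreover have "(\<lambda>z. \<Sum>i\<le>degree g. coeff g i * (z * h i z)) = (\<lambda>z. z * L g z)"
      using L_expand[OF order_refl, of g] by (auto simp: sum_distrib_left mult_ac)
    ultimately show "deriv (\<lambda>z. z * L g z) z = (\<Sum>i\<le>degree g. coeff g i * u i z)"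
      by (metis DERIV_imp_deriv)
  qed
qed

text \<open>Only derivatives are known to be rational so far, and a primitive of a rational function
  may contain logarithms. Differentiating
  \<open>z * L (p * g) z = \<phi> z * (z * L (q * g) z)\<close> expresses
  \<open>\<phi>' z L (q g)\<close> by rational functions, and \<phi>' does not vanish
  identically.\<close>

lemma rat_L_q: "rat_on_disc (L (q * g))"
proof (rule rat_on_disc_cancel)
  let ?W = "pderiv p * q - p * pderiv q"
  let ?R = "deriv (\<lambda>z. z * L (q * g) z)"
  show "[:0, 1:] * ?W \<noteq> 0" using wronskian_nonzero by simp
  have "rat_on_disc (\<lambda>z. (deriv (\<lambda>z. z * L (p * g) z) z + (- 1) * \<phi> z * ?R z) * poly (q * q) z)"
    by (intro rat_on_disc_mult rat_on_disc_add rat_on_disc_const rat_phi rat_deriv_L rat_on_disc_poly)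
  then show "rat_on_disc (\<lambda>z. poly ([:0, 1:] * ?W) z * L (q * g) z)"
  proof (rule rat_on_disc_cong)
    fix z :: complex assume z: "z \<in> ball 0 1"
    have "(\<phi> has_field_derivative deriv \<phi> z) (at z)" by (rule disc_multiplier_deriv[OF multiplier z])
    moreover have "((\<lambda>z. z * L (q * g) z) has_field_derivative ?R z) (at z)"
      by (rule holomorphic_derivI[of _ "ball 0 1"]) (use z in \<open>auto intro!: holomorphic_intros L_holomorphic\<close>)
    ultimately have "((\<lambda>z. \<phi> z * (z * L (q * g) z)) has_field_derivative
        deriv \<phi> z * (z * L (q * g) z) + ?R z * \<phi> z) (at z)"
      by (rule DERIV_mult)
    then have "((\<lambda>z. z * L (p * g) z) has_field_derivative
        deriv \<phi> z * (z * L (q * g) z) + ?R z * \<phi> z) (at z)"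
      by (subst DERIV_cong_ev[OF refl _ refl, where g="\<lambda>z. \<phi> z * (z * L (q * g) z)"])
         (use z L_p in \<open>auto intro!: eventually_nhds_in_open[of "ball 0 1", THEN eventually_mono]\<close>)
    from DERIV_imp_deriv[OF this]
    have "deriv (\<lambda>z. z * L (p * g) z) z + (- 1) * \<phi> z * ?R z = deriv \<phi> z * (z * L (q * g) z)" by simp
    then show "poly ([:0, 1:] * ?W) z * L (q * g) z
        = (deriv (\<lambda>z. z * L (p * g) z) z + (- 1) * \<phi> z * ?R z) * poly (q * q) z"
      using deriv_phi[OF z] by (simp add: power2_eq_square flip: deriv_phi[OF z])
  qed
qed

text \<open>By Bezout for the coprime \<open>p\<close> and \<open>q\<close>, every polynomial is a
  multiple of \<open>p\<close> plus a multiple of \<open>q\<close>; the former reduces to the latter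
  through \<phi>.\<close>

lemma rat_h: "rat_on_disc (h n)"
proof -
  obtain U V where UV: "U * p + V * q = 1"
    using bezout_coefficients_fst_snd[of p q] coprime_pq by (metis coprime_iff_gcd_eq_1)
  let ?m = "monom 1 n"
  have "rat_on_disc (\<lambda>z. \<phi> z * L (q * (U * ?m)) z + L (q * (V * ?m)) z)"
    by (intro rat_on_disc_add rat_on_disc_mult rat_phi rat_L_q)
  then show ?thesis
  proof (rule rat_on_disc_cong)
    fix z :: complex assume z: "z \<in> ball 0 1"
    have "?m = (U * p + V * q) * ?m" by (simp only: UV mult_1)
    also have "\<dots> = p * (U * ?m) + q * (V * ?m)" by (simp add: algebra_simps)
    finally have "?m = p * (U * ?m) + q * (V * ?m)" .
    then have "L ?m z = L (p * (U * ?m)) z + L (q * (V * ?m)) z" using L_add by metis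
    then show "h n z = \<phi> z * L (q * (U * ?m)) z + L (q * (V * ?m)) z"
      by (simp only: L_monom L_p[OF z])
  qed
qed

end

section \<open>The generating function of the projected monomials\<close>

lemma suminf_swap_bounded:
  fixes f :: "nat \<Rightarrow> nat \<Rightarrow> complex"
  assumes b: "\<And>m n. cmod (f m n) \<le> A m * B n" and A: "summable A" "\<And>m. 0 \<le> A m" and B: "summable B" "\<And>n. 0 \<le> B n"
  shows "(\<Sum>n. \<Sum>m. f m n) = (\<Sum>m. \<Sum>n. f m n)"
proof -
  have sA: "A summable_on UNIV" and sB: "B summable_on UNIV"
    using A B by (auto intro!: norm_summable_imp_summable_on)
  have bd: "(\<lambda>(m, n). A m * B n) summable_on UNIV \<times> UNIV"
  proof (rule summable_on_SigmaI[where g="\<lambda>m. A m * (\<Sum>\<^sub>\<infinity>n. B n)"])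
    show "((\<lambda>n. case (m, n) of (m, n) \<Rightarrow> A m * B n) has_sum A m * (\<Sum>\<^sub>\<infinity>n. B n)) UNIV" for m
      using has_sum_cmult_right[OF has_sum_infsum[OF sB], of "A m"] by simp
    show "(\<lambda>m. A m * (\<Sum>\<^sub>\<infinity>n. B n)) summable_on UNIV" by (intro summable_on_cmult_left sA)
    show "0 \<le> (case (m, n) of (m, n) \<Rightarrow> A m * B n)" for m n using A B by simp
  qed
  have s: "(\<lambda>(m, n). f m n) summable_on UNIV \<times> UNIV"
    by (rule abs_summable_summable, rule summable_on_comparison_test[OF bd])
       (use b in auto)
  have row: "summable (\<lambda>n. norm (f m n))" for m
    by (rule summable_comparison_test'[OF summable_mult[OF B(1), of "A m"]]) (use b in auto)
  have col: "summable (\<lambda>m. norm (f m n))" for n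
    by (rule summable_comparison_test'[OF summable_mult2[OF A(1), of "B n"]]) (use b in auto)
  have rowsum: "summable (\<lambda>m. norm (\<Sum>n. f m n))"
  proof (rule summable_comparison_test'[OF summable_mult2[OF A(1), of "suminf B"]])
    fix m
    have "norm (\<Sum>n. f m n) \<le> (\<Sum>n. norm (f m n))" by (rule summable_norm[OF row])
    also have "\<dots> \<le> (\<Sum>n. A m * B n)" by (intro suminf_le row summable_mult B b)
    finally show "norm (norm (\<Sum>n. f m n)) \<le> A m * suminf B" by (simp add: suminf_mult B)
  qed
  have colsum: "summable (\<lambda>n. norm (\<Sum>m. f m n))"
  proof (rule summable_comparison_test'[OF summable_mult[OF B(1), of "suminf A"]])
    fix n
    have "norm (\<Sum>m. f m n) \<le> (\<Sum>m. norm (f m n))" by (rule summable_norm[OF col])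
    also have "\<dots> \<le> (\<Sum>m. A m * B n)" by (intro suminf_le col summable_mult2 A b)
    finally show "norm (norm (\<Sum>m. f m n)) \<le> suminf A * B n" by (simp add: suminf_mult2[symmetric] A)
  qed
  have inf: "infsum g UNIV = suminf g" if "summable (\<lambda>n. norm (g n))" for g :: "nat \<Rightarrow> complex"
    using norm_summable_imp_has_sum[OF that summable_sums[OF summable_norm_cancel[OF that]]] by (rule infsumI)
  have "(\<Sum>n. \<Sum>m. f m n) = (\<Sum>\<^sub>\<infinity>n. \<Sum>\<^sub>\<infinity>m. f m n)" by (simp add: inf col colsum)
  also have "\<dots> = (\<Sum>\<^sub>\<infinity>m. \<Sum>\<^sub>\<infinity>n. f m n)"
    by (rule infsum_swap_banach[symmetric]) (rule s)
  also have "\<dots> = (\<Sum>m. \<Sum>n. f m n)" by (simp add: inf row rowsum)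
  finally show ?thesis .
qed

lemma dirichlet_nsq_dmono: "dirichlet_nsq (dmono m) = real (m + 1)"
proof -
  have "dirichlet_nsq (dmono m) = (\<Sum>n\<in>{m}. real (n + 1) * (cmod (taylor_coeff (dmono m) n))\<^sup>2)"
    unfolding dirichlet_nsq_def by (rule suminf_finite) (auto simp: taylor_coeff_dmono)
  then show ?thesis by (simp add: taylor_coeff_dmono)
qed

context reducing_blaschke
begin

lemma taylor_coeff_h_bound: "cmod (taylor_coeff (h m) n) \<le> real (m + 1)"
proof -
  have "real (n + 1) * (cmod (taylor_coeff (h m) n))\<^sup>2 \<le> dirichlet_nsq (h m)"
    by (rule coeff_le_dirichlet_nsq[OF h_in])
  also have "\<dots> \<le> real (m + 1)"
    using dirichlet_nsq_proj_le[OF M_closed dmono_in[of m]] by (simp add: h_def P_def dirichlet_nsq_dmono)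
  finally have 1: "real (n + 1) * (cmod (taylor_coeff (h m) n))\<^sup>2 \<le> real (m + 1)" .
  have "(cmod (taylor_coeff (h m) n))\<^sup>2 \<le> real (n + 1) * (cmod (taylor_coeff (h m) n))\<^sup>2"
    by (simp add: algebra_simps)
  also note 1
  also have "real (m + 1) \<le> (real (m + 1))\<^sup>2" by (simp add: power2_eq_square)
  finally show ?thesis by (rule power2_le_imp_le) simp
qed

text \<open>\<open>V b\<close> is, up to conjugation, the projection of the generating function of the monomials.
  Its derivative is computed in \<open>deriv_V\<close> by exchanging the two indices.\<close>
definition v :: "complex \<Rightarrow> nat \<Rightarrow> complex" where
  "v b n = (\<Sum>m. b ^ m * taylor_coeff (h m) n)"

definition V :: "complex \<Rightarrow> complex \<Rightarrow> complex" where
  "V b x = (\<Sum>n. v b n * x ^ n)"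

lemma summable_weighted_geometric:
  assumes "cmod b < 1" shows "summable (\<lambda>m. real (m + 1) * cmod b ^ m)"
  using geometric_deriv_sums[of "cmod b"] assms by (simp add: sums_iff)

lemma v_summable:
  assumes "cmod b < 1" shows "summable (\<lambda>m. norm (b ^ m * taylor_coeff (h m) n))"
proof (rule summable_comparison_test'[OF summable_weighted_geometric[OF assms]])
  show "norm (norm (b ^ m * taylor_coeff (h m) n)) \<le> real (m + 1) * cmod b ^ m" for m
    using taylor_coeff_h_bound[of m n] mult_right_mono[of "cmod (taylor_coeff (h m) n)" "real (m + 1)" "cmod b ^ m"]
    by (simp add: norm_mult norm_power mult.commute del: of_nat_Suc)
qed

lemma v_bound:
  assumes "cmod b < 1" obtains C where "\<And>n. cmod (v b n) \<le> C"
proof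
  fix n
  have "cmod (v b n) \<le> (\<Sum>m. norm (b ^ m * taylor_coeff (h m) n))"
    unfolding v_def by (rule summable_norm[OF v_summable[OF assms]])
  also have "\<dots> \<le> (\<Sum>m. real (m + 1) * cmod b ^ m)"
  proof (intro suminf_le v_summable summable_weighted_geometric assms)
    show "norm (b ^ m * taylor_coeff (h m) n) \<le> real (m + 1) * cmod b ^ m" for m
      using taylor_coeff_h_bound[of m n] mult_right_mono[of "cmod (taylor_coeff (h m) n)" "real (m + 1)" "cmod b ^ m"]
      by (simp add: norm_mult norm_power mult.commute del: of_nat_Suc)
  qed
  finally show "cmod (v b n) \<le> (\<Sum>m. real (m + 1) * cmod b ^ m)" .
qed

lemma V_sums:
  assumes b: "cmod b < 1" and x: "x \<in> ball 0 1" shows "(\<lambda>n. v b n * x ^ n) sums V b x"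
proof -
  obtain C where C: "\<And>n. cmod (v b n) \<le> C" using v_bound[OF b] by blast
  have "summable (\<lambda>n. v b n * x ^ n)"
  proof (rule summable_comparison_test')
    show "summable (\<lambda>n. C * cmod x ^ n)" using x by (intro summable_mult summable_geometric) auto
    show "norm (v b n * x ^ n) \<le> C * cmod x ^ n" for n
      using C[of n] by (auto simp: norm_mult norm_power intro!: mult_right_mono)
  qed
  then show ?thesis unfolding V_def by (rule summable_sums)
qed

lemma V_holomorphic: "cmod b < 1 \<Longrightarrow> V b holomorphic_on ball 0 1"
  by (rule power_series_holomorphic[where a="v b"]) (use V_sums in auto)

lemma taylor_coeff_V: "cmod b < 1 \<Longrightarrow> taylor_coeff (V b) n = v b n"
  by (rule taylor_coeff_unique[of 1]) (use V_sums in auto)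

text \<open>The double series converges absolutely, so \<open>V\<close> may be expanded in
  \<open>b\<close> as well. The expansion in \<open>b\<close> yields rationality, the one in
  \<open>x\<close> the derivative.\<close>

lemma V_eq_sum_h:
  assumes b: "cmod b < 1" and x: "x \<in> ball 0 1"
  shows "(\<lambda>m. b ^ m * h m x) sums V b x"
proof -
  let ?f = "\<lambda>m n. b ^ m * taylor_coeff (h m) n * x ^ n"
  have bd: "cmod (?f m n) \<le> (real (m + 1) * cmod b ^ m) * cmod x ^ n" for m n
    using mult_right_mono[OF mult_right_mono[OF taylor_coeff_h_bound[of m n], of "cmod b ^ m"], of "cmod x ^ n"]
    by (simp add: norm_mult norm_power mult_ac del: of_nat_Suc)
  have sx: "summable (\<lambda>n. cmod x ^ n)" using x by (intro summable_geometric) auto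
  have "V b x = (\<Sum>n. \<Sum>m. ?f m n)"
    unfolding V_def v_def by (intro suminf_cong suminf_mult2 summable_norm_cancel[OF v_summable[OF b]])
  also have "\<dots> = (\<Sum>m. \<Sum>n. ?f m n)"
    by (rule suminf_swap_bounded[OF bd]) (use summable_weighted_geometric[OF b] sx in auto)
  also have "(\<lambda>m. \<Sum>n. ?f m n) = (\<lambda>m. b ^ m * h m x)"
  proof
    fix m
    have "(\<lambda>n. b ^ m * (taylor_coeff (h m) n * x ^ n)) sums (b ^ m * h m x)"
      by (intro sums_mult taylor_coeff_sums h_holomorphic x)
    then show "(\<Sum>n. ?f m n) = b ^ m * h m x" by (simp add: sums_iff mult.assoc)
  qed
  finally have V: "V b x = (\<Sum>m. b ^ m * h m x)" .
  have "summable (\<lambda>m. b ^ m * h m x)"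
  proof (rule summable_comparison_test')
    show "summable (\<lambda>m. (real (m + 1) * cmod b ^ m) * (\<Sum>n. cmod x ^ n))"
      by (intro summable_mult2 summable_weighted_geometric b)
    fix m
    have s: "summable (\<lambda>n. norm (?f m n))"
      by (rule summable_comparison_test'[OF summable_mult[OF sx, of "real (m + 1) * cmod b ^ m"]]) (use bd in auto)
    have "(\<lambda>n. ?f m n) sums (b ^ m * h m x)"
      using sums_mult[OF taylor_coeff_sums[OF h_holomorphic[of m] x], of "b ^ m"] by (simp add: mult.assoc)
    then have "norm (b ^ m * h m x) \<le> (\<Sum>n. norm (?f m n))" using summable_norm[OF s] by (simp add: sums_iff)
    also have "\<dots> \<le> (\<Sum>n. (real (m + 1) * cmod b ^ m) * cmod x ^ n)"
      by (intro suminf_le s summable_mult sx bd)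
    also have "\<dots> = (real (m + 1) * cmod b ^ m) * (\<Sum>n. cmod x ^ n)" by (rule suminf_mult[OF sx])
    finally show "norm (b ^ m * h m x) \<le> (real (m + 1) * cmod b ^ m) * (\<Sum>n. cmod x ^ n)" .
  qed
  then show ?thesis unfolding V by (rule summable_sums)
qed

text \<open>Hermitian symmetry turns coefficient \<open>n\<close>, a series in \<open>b\<close>,
  into the conjugate of the value of \<open>u n\<close> at \<open>cnj b\<close>. Thus the values of
  all \<open>u n\<close> at one point become the coefficients of one rational function.\<close>

lemma deriv_V:
  assumes b: "cmod b < 1" and x: "x \<in> ball 0 1"
  shows "(\<lambda>n. cnj (u n (cnj b)) * x ^ n) sums deriv (\<lambda>x. x * V b x) x"
proof -
  have hol: "deriv (\<lambda>x. x * V b x) holomorphic_on ball 0 1"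
    by (intro holomorphic_deriv holomorphic_intros V_holomorphic b) simp
  have "taylor_coeff (deriv (\<lambda>x. x * V b x)) n = cnj (u n (cnj b))" for n
  proof -
    have "taylor_coeff (deriv (\<lambda>x. x * V b x)) n = of_nat (n + 1) * v b n"
      by (simp only: taylor_coeff_deriv_times_id[OF V_holomorphic[OF b]] taylor_coeff_V[OF b])
    also have "\<dots> = (\<Sum>m. of_nat (n + 1) * (b ^ m * taylor_coeff (h m) n))"
      unfolding v_def by (rule suminf_mult[OF summable_norm_cancel[OF v_summable[OF b]], symmetric])
    also have "\<dots> = (\<Sum>m. cnj (taylor_coeff (u n) m * cnj b ^ m))"
    proof (rule suminf_cong)
      fix m
      have "of_nat (n + 1) * (b ^ m * taylor_coeff (h m) n) = b ^ m * (of_nat (n + 1) * taylor_coeff (h m) n)"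
        by (simp only: mult_ac)
      also have "\<dots> = b ^ m * cnj (taylor_coeff (u n) m)"
        by (subst taylor_coeff_h_symmetric) (simp only: taylor_coeff_u)
      finally show "of_nat (n + 1) * (b ^ m * taylor_coeff (h m) n) = cnj (taylor_coeff (u n) m * cnj b ^ m)"
        by (simp add: mult.commute)
    qed
    also have "\<dots> = cnj (u n (cnj b))"
    proof -
      have "(\<lambda>m. taylor_coeff (u n) m * cnj b ^ m) sums u n (cnj b)"
        by (rule taylor_coeff_sums[OF u_holomorphic]) (use b in simp)
      then have "(\<lambda>m. cnj (taylor_coeff (u n) m * cnj b ^ m)) sums cnj (u n (cnj b))" by (simp only: sums_cnj)
      then show ?thesis by (simp only: sums_iff)
    qed
    finally show ?thesis .
  qed
  then show ?thesis using taylor_coeff_sums[OF hol x] by simp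
qed

text \<open>At a fixed \<open>x\<close> the functional \<open>L\<close> annihilates multiples of
  \<open>p - \<phi> x q\<close>, so the values \<open>h m x\<close> satisfy a linear recurrence. Its
  characteristic polynomial is that one multiplied by \<open>poly q x\<close>, and the roots are the
  fibre of \<open>x\<close>.\<close>

lemma h_recurrence:
  assumes x: "x \<in> ball 0 1"
  shows "(\<Sum>i\<le>4. (coeff p i * poly q x - poly p x * coeff q i) * h (m + i) x) = 0"
proof -
  have e: "L (g * monom 1 m) x = (\<Sum>i\<le>4. coeff g i * h (m + i) x)" if "degree g \<le> 4" for g
  proof -
    have "g = (\<Sum>i\<le>4. smult (coeff g i) (monom 1 i))"
      using poly_as_sum_of_monoms'[OF that] by (simp add: smult_monom)
    then have "g * monom 1 m = (\<Sum>i\<le>4. smult (coeff g i) (monom 1 i)) * monom 1 m" by simp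
    also have "\<dots> = (\<Sum>i\<le>4. smult (coeff g i) (monom 1 (m + i)))"
      by (simp add: sum_distrib_right mult_monom add.commute)
    finally have "L (g * monom 1 m) x = L (\<Sum>i\<le>4. smult (coeff g i) (monom 1 (m + i))) x" by simp
    then show ?thesis by (simp add: L_sum L_smult L_monom)
  qed
  have "poly q x * (\<Sum>i\<le>4. coeff p i * h (m + i) x) = poly p x * (\<Sum>i\<le>4. coeff q i * h (m + i) x)"
  proof -
    have r: "(\<Sum>i\<le>4. coeff p i * h (m + i) x) = \<phi> x * (\<Sum>i\<le>4. coeff q i * h (m + i) x)"
      using L_p[OF x, of "monom 1 m"] e[of p] e[of q] degree_p degree_q by simp
    show ?thesis unfolding r phi_q[OF x, symmetric] by (simp only: mult_ac)
  qed
  moreover have "(\<Sum>i\<le>4. (coeff p i * poly q x - poly p x * coeff q i) * h (m + i) x)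
      = poly q x * (\<Sum>i\<le>4. coeff p i * h (m + i) x) - poly p x * (\<Sum>i\<le>4. coeff q i * h (m + i) x)"
    unfolding left_diff_distrib sum_subtractf sum_distrib_left by (simp add: mult_ac)
  ultimately show ?thesis by simp
qed

lemma rat_V:
  assumes b: "cmod b < 1" "b \<noteq> 0"
  shows "rat_on_disc (V b)"
proof -
  define w where "w i = smult (coeff p i) q - smult (coeff q i) p" for i
  \<comment> \<open>The reversed characteristic polynomial evaluated at \<open>b\<close>, as a
    polynomial in \<open>x\<close>; the initial terms that the recurrence does not reach are
    collected in \<open>R\<close>.\<close>
  define E where "E = (\<Sum>i\<le>4. smult (b ^ (4 - i)) (w i))"
  define R where "R x = (\<Sum>i\<le>4. b ^ (4 - i) * poly (w i) x * (\<Sum>m<i. b ^ m * h m x))" for x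
  have "rat_on_disc R"
    unfolding R_def[abs_def]
    by (intro rat_on_disc_sum rat_on_disc_mult rat_on_disc_const rat_on_disc_poly rat_h)
  moreover have "poly E x * V b x = R x" if x: "x \<in> ball 0 1" for x
  proof -
    have "(\<lambda>m. b ^ (m + 4) * 0) sums (\<Sum>i\<le>4. b ^ (4 - i) * poly (w i) x * (V b x - (\<Sum>m<i. b ^ m * h m x)))"
    proof -
      have "(\<lambda>m. b ^ (m + i) * h (m + i) x) sums (V b x - (\<Sum>m<i. b ^ m * h m x))" for i
        by (rule sums_split_initial_segment[OF V_eq_sum_h[OF b(1) x]])
      then have "(\<lambda>m. \<Sum>i\<le>4. b ^ (4 - i) * poly (w i) x * (b ^ (m + i) * h (m + i) x))
          sums (\<Sum>i\<le>4. b ^ (4 - i) * poly (w i) x * (V b x - (\<Sum>m<i. b ^ m * h m x)))"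
        by (intro sums_sum sums_mult)
      moreover have "(\<Sum>i\<le>4. b ^ (4 - i) * poly (w i) x * (b ^ (m + i) * h (m + i) x)) = b ^ (m + 4) * 0" for m
      proof -
        have "(\<Sum>i\<le>4. b ^ (4 - i) * poly (w i) x * (b ^ (m + i) * h (m + i) x))
            = (\<Sum>i\<le>4. b ^ (m + 4) * ((coeff p i * poly q x - poly p x * coeff q i) * h (m + i) x))"
        proof (rule sum.cong[OF refl])
          fix i :: nat assume "i \<in> {..4}"
          then have "b ^ (4 - i) * b ^ (m + i) = b ^ (m + 4)" by (simp add: add.commute flip: power_add)
          then show "b ^ (4 - i) * poly (w i) x * (b ^ (m + i) * h (m + i) x)
              = b ^ (m + 4) * ((coeff p i * poly q x - poly p x * coeff q i) * h (m + i) x)"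
            by (simp add: w_def mult_ac)
        qed
        also have "\<dots> = b ^ (m + 4) * 0"
          unfolding sum_distrib_left[symmetric] h_recurrence[OF x] ..
        finally show ?thesis .
      qed
      ultimately show ?thesis by (simp only:)
    qed
    then have "(\<Sum>i\<le>4. b ^ (4 - i) * poly (w i) x * (V b x - (\<Sum>m<i. b ^ m * h m x))) = 0"
      by (simp add: sums_iff)
    then show ?thesis
      by (simp add: E_def R_def poly_sum right_diff_distrib sum_subtractf sum_distrib_right)
  qed
  ultimately have "rat_on_disc (\<lambda>x. poly E x * V b x)" by (rule rat_on_disc_cong)
  \<comment> \<open>At \<open>x = 0\<close> the value is \<open>b ^ 4 * poly p (1 / b)\<close>, and
    \<open>1 / b\<close> lies outside the disc that contains all zeros of \<open>p\<close>.\<close>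
  moreover have "E \<noteq> 0"
  proof
    assume "E = 0"
    then have "poly E 0 = 0" by simp
    then have "(\<Sum>i\<le>4. b ^ (4 - i) * coeff p i) = 0"
      by (simp add: E_def w_def poly_sum poly_p_0 poly_q_0)
    moreover have "(\<Sum>i\<le>4. b ^ (4 - i) * coeff p i) = b ^ 4 * poly p (1 / b)"
      unfolding poly_altdef degree_p sum_distrib_left
      using b(2) by (intro sum.cong refl) (simp add: power_diff power_divide field_simps)
    ultimately have "poly p (1 / b) = 0" using b(2) by simp
    then have "1 / b \<in> ball 0 1" by (rule poly_p_eq_0)
    then show False using b by (simp add: norm_divide)
  qed
  ultimately show ?thesis by (rule rat_on_disc_cancel)
qed

end

section \<open>Weights on the fibres\<close>

lemma blaschke_num_dvd:
  assumes "distinct bs" "\<And>x. x \<in> set bs \<Longrightarrow> poly f x = 0"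
  shows "blaschke_num bs dvd f"
  using assms
proof (induction bs arbitrary: f)
  case (Cons l bs)
  have "poly f l = 0" using Cons.prems(2) by simp
  then obtain f' where f': "f = [:- l, 1:] * f'" using poly_eq_0_iff_dvd by (metis dvdE)
  have "poly f' x = 0" if x: "x \<in> set bs" for x
  proof -
    have "x \<noteq> l" using x Cons.prems(1) by auto
    moreover have "poly f x = 0" using Cons.prems(2) x by simp
    ultimately show ?thesis by (simp add: f')
  qed
  then have "blaschke_num bs dvd f'" using Cons by simp
  then obtain k where "f' = blaschke_num bs * k" by (elim dvdE)
  then have "f = blaschke_num (l # bs) * (- k)" by (simp add: f' algebra_simps)
  then show ?case by (rule dvdI)
qed simp

lemma holomorphic_coeff_prod_linear:
  assumes "finite A" "\<And>i. i \<in> A \<Longrightarrow> a i holomorphic_on S" "\<And>i. i \<in> A \<Longrightarrow> b i holomorphic_on S"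
  shows "(\<lambda>z. coeff (\<Prod>i\<in>A. [:a i z, b i z:]) m) holomorphic_on S"
  using assms
proof (induction A arbitrary: m rule: finite_induct)
  case (insert i A)
  have "coeff (\<Prod>i\<in>insert i A. [:a i z, b i z:]) m = a i z * coeff (\<Prod>i\<in>A. [:a i z, b i z:]) m
      + (if m = 0 then 0 else b i z * coeff (\<Prod>i\<in>A. [:a i z, b i z:]) (m - 1))" for z
    using insert.hyps by (cases m) (auto simp: coeff_pCons)
  then show ?case
    using insert by (cases "m = 0") (auto intro!: holomorphic_intros)
qed simp

context reducing_blaschke
begin

definition fib :: "complex \<Rightarrow> complex set" where
  "fib b = {y \<in> ball 0 1. \<phi> y = \<phi> b}"

text \<open>The points whose fibre consists of four distinct nonzero points that move
  holomorphically. Excluding \<open>\<phi> b = 0\<close> keeps \<open>0\<close> out of the fibre,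
  where the ratio \<open>b / y\<close> would break down.\<close>

definition Reg :: "complex set" where
  "Reg = {b \<in> ball 0 1. \<phi> b \<noteq> 0 \<and> (\<forall>y\<in>fib b. deriv \<phi> y \<noteq> 0)}"

lemma Reg_ball: "b \<in> Reg \<Longrightarrow> b \<in> ball 0 1"
  by (simp add: Reg_def)

lemma fib_ball: "y \<in> fib b \<Longrightarrow> y \<in> ball 0 1"
  by (simp add: fib_def)

lemma fib_self: "b \<in> ball 0 1 \<Longrightarrow> b \<in> fib b"
  by (simp add: fib_def)

lemma fib_eq: "y \<in> fib b \<Longrightarrow> fib y = fib b"
  by (auto simp: fib_def)

lemma phi_zero: "\<phi> 0 = 0"
  using phi_pq[of 0] poly_p_0 by simp

lemma fib_nonzero: "b \<in> Reg \<Longrightarrow> y \<in> fib b \<Longrightarrow> y \<noteq> 0"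
  using phi_zero by (auto simp: fib_def Reg_def)

lemma phi_in_ball: "b \<in> ball 0 1 \<Longrightarrow> \<phi> b \<in> ball 0 1"
  by (rule finite_blaschke_in_ball[OF blaschke])

lemma fib_factorization:
  assumes b: "b \<in> ball 0 1"
  obtains \<kappa> bs where "\<kappa> \<noteq> 0" "length bs = 4" "set bs = fib b"
    "p - smult (\<phi> b) q = smult \<kappa> (blaschke_num bs)"
proof -
  have "cmod (\<phi> b) < 1" using phi_in_ball[OF b] by simp
  then obtain \<kappa> bs where f: "\<kappa> \<noteq> 0" "length bs = length ls" "set bs \<subseteq> ball 0 1"
    "smult c (blaschke_num ls) - smult (\<phi> b) (blaschke_den ls) = smult \<kappa> (blaschke_num bs)"
    using blaschke_fibre_factorization[OF ls_ball norm_c] by metis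
  then have e: "p - smult (\<phi> b) q = smult \<kappa> (blaschke_num bs)" by (simp add: p_def q_def)
  have "y \<in> set bs \<longleftrightarrow> y \<in> fib b" for y
  proof -
    have "y \<in> set bs \<longleftrightarrow> poly (p - smult (\<phi> b) q) y = 0"
      using f(1) by (simp add: e poly_blaschke_num_eq_0_iff)
    also have "\<dots> \<longleftrightarrow> \<phi> y = \<phi> b" if "y \<in> ball 0 1"
      using phi_q[OF that] q_nonzero[of y] that by (auto simp flip: phi_q)
    finally show ?thesis using f(3) by (auto simp: fib_def)
  qed
  then show ?thesis using that[OF f(1) _ _ e] f(2) length_ls by auto
qed

lemma finite_fib: "b \<in> ball 0 1 \<Longrightarrow> finite (fib b)"
  and card_fib_le: "b \<in> ball 0 1 \<Longrightarrow> card (fib b) \<le> 4"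
  using fib_factorization by (metis List.finite_set, metis card_length)

text \<open>A repeated root of \<open>p - \<phi> b q\<close> would be a critical point of \<phi> in
  the fibre.\<close>

lemma Reg_fib_factorization:
  assumes b: "b \<in> Reg"
  obtains \<kappa> bs where "\<kappa> \<noteq> 0" "length bs = 4" "set bs = fib b" "distinct bs"
    "p - smult (\<phi> b) q = smult \<kappa> (blaschke_num bs)"
proof -
  obtain \<kappa> bs where f: "\<kappa> \<noteq> 0" "length bs = 4" "set bs = fib b"
    "p - smult (\<phi> b) q = smult \<kappa> (blaschke_num bs)"
    using fib_factorization[OF Reg_ball[OF b]] by metis
  have "distinct bs"
  proof (rule ccontr)
    assume "\<not> distinct bs"
    then obtain xs ys zs y where bs: "bs = xs @ [y] @ ys @ [y] @ zs" using not_distinct_decomp by blast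
    have y: "y \<in> fib b" using f(3) bs by auto
    then have yb: "y \<in> ball 0 1" and eq: "\<phi> y = \<phi> b" by (auto simp: fib_def)
    define k where "k = blaschke_num (xs @ ys @ zs)"
    have k: "blaschke_num bs = [:y, -1:] * ([:y, -1:] * k)"
      unfolding k_def bs blaschke_num_def by (simp add: mult_ac del: mult_pCons_left mult_pCons_right)
    have "poly (pderiv (p - smult (\<phi> b) q)) y = 0"
      unfolding f(4) k pderiv_smult pderiv_mult poly_smult poly_add poly_mult by simp
    then have "poly (pderiv p) y = \<phi> y * poly (pderiv q) y"
      by (simp add: pderiv_diff pderiv_smult eq)
    then have "deriv \<phi> y * (poly q y)\<^sup>2 = 0"
      unfolding deriv_phi[OF yb] using phi_q[OF yb] by (simp add: algebra_simps flip: phi_q[OF yb])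
    then show False using b y q_nonzero[of y] yb by (auto simp: Reg_def)
  qed
  then show ?thesis using that f by blast
qed

lemma card_fib: "b \<in> Reg \<Longrightarrow> card (fib b) = 4"
  using Reg_fib_factorization by (metis distinct_card)

text \<open>The branch through \<open>y\<close> is the local inverse of \<phi> at \<open>y\<close>
  composed with \<phi>. On disjoint balls around the four fibre points these give four distinct
  preimages, and a fibre has no more than four.\<close>

lemma local_branches:
  assumes b0: "b0 \<in> Reg"
  obtains e \<rho> where "e > 0" "ball b0 e \<subseteq> Reg"
    "\<And>y. y \<in> fib b0 \<Longrightarrow> \<rho> y holomorphic_on ball b0 e" "\<And>y. y \<in> fib b0 \<Longrightarrow> \<rho> y b0 = y"
    "\<And>b. b \<in> ball b0 e \<Longrightarrow> inj_on (\<lambda>y. \<rho> y b) (fib b0)"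
    "\<And>b. b \<in> ball b0 e \<Longrightarrow> (\<lambda>y. \<rho> y b) ` fib b0 = fib b"
    "\<And>b. b \<in> ball b0 e \<Longrightarrow> \<rho> b0 b = b"
proof -
  note b0b = Reg_ball[OF b0]
  note fin = finite_fib[OF b0b]
  have hol: "\<phi> holomorphic_on ball 0 1" by (rule disc_multiplier_holomorphic[OF multiplier])
  have "\<exists>r>0. ball y r \<subseteq> ball 0 1 \<and> inj_on \<phi> (ball y r)" if y: "y \<in> fib b0" for y
  proof -
    have "deriv \<phi> y \<noteq> 0" using b0 y by (simp add: Reg_def)
    from has_complex_derivative_locally_invertible[OF hol fib_ball[OF y] open_ball this]
    show ?thesis by metis
  qed
  then obtain R where R: "\<And>y. y \<in> fib b0 \<Longrightarrow> R y > 0" "\<And>y. y \<in> fib b0 \<Longrightarrow> ball y (R y) \<subseteq> ball 0 1"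
    "\<And>y. y \<in> fib b0 \<Longrightarrow> inj_on \<phi> (ball y (R y))" by metis
  \<comment> \<open>Radii of injectivity, and half distances that make the balls of the common
    radius disjoint.\<close>
  define D where "D = R ` fib b0 \<union> (\<lambda>(x, y). dist x y / 2) ` {(x, y) \<in> fib b0 \<times> fib b0. x \<noteq> y}"
  define r where "r = Min D"
  have D: "finite D" "D \<noteq> {}"
    using fin fib_self[OF b0b] by (auto simp: D_def intro: finite_subset[of _ "fib b0 \<times> fib b0"])
  have r0: "r > 0" unfolding r_def using D R(1) by (subst Min_gr_iff) (auto simp: D_def)
  have rR: "r \<le> R y" if "y \<in> fib b0" for y
    unfolding r_def using D that by (intro Min_le) (auto simp: D_def)
  have rd: "2 * r \<le> dist x y" if "x \<in> fib b0" "y \<in> fib b0" "x \<noteq> y" for x y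
  proof -
    have "r \<le> dist x y / 2" unfolding r_def using D that by (intro Min_le) (auto simp: D_def)
    then show ?thesis by simp
  qed
  have sub: "ball y r \<subseteq> ball 0 1" and inj: "inj_on \<phi> (ball y r)" if "y \<in> fib b0" for y
    using R(2,3)[OF that] rR[OF that] subset_ball[of r "R y" y] by (auto intro: inj_on_subset)
  have disj: "x = y" if "x \<in> fib b0" "y \<in> fib b0" "z \<in> ball x r" "z \<in> ball y r" for x y z
  proof (rule ccontr)
    assume "x \<noteq> y"
    then have "2 * r \<le> dist x y" using rd that by blast
    also have "dist x y \<le> dist x z + dist y z" by (rule dist_triangle2)
    finally show False using that by simp
  qed
  have "\<exists>g. g holomorphic_on (\<phi> ` ball y r) \<and> (\<forall>z\<in>ball y r. deriv \<phi> z * deriv g (\<phi> z) = 1 \<and> g (\<phi> z) = z)"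
    if y: "y \<in> fib b0" for y
    using holomorphic_has_inverse[OF holomorphic_on_subset[OF hol sub[OF y]] open_ball inj[OF y]] by metis
  then obtain g where g: "\<And>y. y \<in> fib b0 \<Longrightarrow> g y holomorphic_on (\<phi> ` ball y r)"
    "\<And>y z. y \<in> fib b0 \<Longrightarrow> z \<in> ball y r \<Longrightarrow> deriv \<phi> z * deriv (g y) (\<phi> z) = 1"
    "\<And>y z. y \<in> fib b0 \<Longrightarrow> z \<in> ball y r \<Longrightarrow> g y (\<phi> z) = z" by metis
  \<comment> \<open>Values taken in all four balls; \<open>0\<close> is removed so that nearby
    points stay in \<open>Reg\<close>.\<close>
  define W where "W = (\<Inter>y\<in>fib b0. \<phi> ` ball y r) \<inter> - {0}"
  have Wo: "open W"
  proof -
    have "open (\<phi> ` ball y r)" if "y \<in> fib b0" for y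
      by (rule open_mapping_thm3[OF holomorphic_on_subset[OF hol sub[OF that]] open_ball inj[OF that]])
    then show ?thesis unfolding W_def using fin by (intro open_Int open_INT) auto
  qed
  have W0: "\<phi> b0 \<in> W"
  proof -
    have "\<phi> b0 \<in> \<phi> ` ball y r" if "y \<in> fib b0" for y
      using that r0 by (intro image_eqI[of _ _ y]) (auto simp: fib_def)
    then show ?thesis using b0 by (simp add: W_def Reg_def)
  qed
  define U where "U = ball b0 r \<inter> (ball 0 1 \<inter> \<phi> -` W)"
  have "open (ball 0 1 \<inter> \<phi> -` W)"
    by (rule continuous_open_preimage[OF holomorphic_on_imp_continuous_on[OF hol] open_ball Wo])
  from open_Int[OF open_ball this] have "open U" unfolding U_def .
  moreover have "b0 \<in> U" using W0 b0b r0 by (simp add: U_def)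
  ultimately obtain e where e: "e > 0" "ball b0 e \<subseteq> U" by (meson open_contains_ball)
  define \<rho> where "\<rho> y b = g y (\<phi> b)" for y b
  have \<rho>: "\<rho> y b \<in> ball y r" "\<phi> (\<rho> y b) = \<phi> b" if y: "y \<in> fib b0" and b: "b \<in> U" for y b
  proof -
    have "\<phi> b \<in> \<phi> ` ball y r" using y b by (auto simp: U_def W_def)
    then obtain z where z: "z \<in> ball y r" "\<phi> b = \<phi> z" by auto
    then show "\<rho> y b \<in> ball y r" "\<phi> (\<rho> y b) = \<phi> b" using g(3)[OF y z(1)] by (auto simp: \<rho>_def)
  qed
  have injU: "inj_on (\<lambda>y. \<rho> y b) (fib b0)" if b: "b \<in> U" for b
    by (rule inj_onI) (metis \<rho>(1) b disj)
  have imgU: "(\<lambda>y. \<rho> y b) ` fib b0 = fib b" if b: "b \<in> U" for b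
  proof (rule card_subset_eq)
    have bb: "b \<in> ball 0 1" using b by (simp add: U_def)
    show "finite (fib b)" by (rule finite_fib[OF bb])
    show sub': "(\<lambda>y. \<rho> y b) ` fib b0 \<subseteq> fib b"
    proof clarify
      fix y assume y: "y \<in> fib b0"
      show "\<rho> y b \<in> fib b" using \<rho>[OF y b] sub[OF y] by (auto simp: fib_def)
    qed
    have "card ((\<lambda>y. \<rho> y b) ` fib b0) = 4" using card_image[OF injU[OF b]] card_fib[OF b0] by simp
    moreover have "card ((\<lambda>y. \<rho> y b) ` fib b0) \<le> card (fib b)"
      by (rule card_mono[OF finite_fib[OF bb] sub'])
    ultimately show "card ((\<lambda>y. \<rho> y b) ` fib b0) = card (fib b)" using card_fib_le[OF bb] by simp
  qed
  show ?thesis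
  proof (rule that[OF e(1)])
    show "ball b0 e \<subseteq> Reg"
    proof
      fix b assume "b \<in> ball b0 e"
      then have b: "b \<in> U" using e by blast
      have "deriv \<phi> y' \<noteq> 0" if "y' \<in> fib b" for y'
      proof -
        have "y' \<in> (\<lambda>y. \<rho> y b) ` fib b0" using that imgU[OF b] by simp
        then obtain y where y: "y \<in> fib b0" "y' = \<rho> y b" by blast
        then show ?thesis using g(2)[OF y(1) \<rho>(1)[OF y(1) b]] by auto
      qed
      then show "b \<in> Reg" using b by (auto simp: Reg_def U_def W_def)
    qed
    show "\<rho> y holomorphic_on ball b0 e" if y: "y \<in> fib b0" for y
    proof -
      have "g y \<circ> \<phi> holomorphic_on ball b0 e"
      proof (rule holomorphic_on_compose_gen)
        show "\<phi> holomorphic_on ball b0 e" by (rule holomorphic_on_subset[OF hol]) (use e in \<open>auto simp: U_def\<close>)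
        show "g y holomorphic_on (\<phi> ` ball y r)" by (rule g(1)[OF y])
        show "\<phi> ` ball b0 e \<subseteq> \<phi> ` ball y r" using e(2) y by (auto simp: U_def W_def)
      qed
      then show ?thesis by (simp add: \<rho>_def[abs_def] o_def)
    qed
    show "\<rho> y b0 = y" if y: "y \<in> fib b0" for y
      using g(3)[OF y, of y] r0 y by (simp add: \<rho>_def fib_def)
    fix b assume "b \<in> ball b0 e"
    then have b: "b \<in> U" using e by blast
    show "inj_on (\<lambda>y. \<rho> y b) (fib b0)" by (rule injU[OF b])
    show "(\<lambda>y. \<rho> y b) ` fib b0 = fib b" by (rule imgU[OF b])
    have "b \<in> ball b0 r" using b by (simp add: U_def)
    then show "\<rho> b0 b = b"
      using inj_onD[OF inj[OF fib_self[OF b0b]] \<rho>(2)[OF fib_self[OF b0b] b] \<rho>(1)[OF fib_self[OF b0b] b]] by simp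
  qed
qed

section \<open>Interpolation on a fibre\<close>

definition lagr :: "complex \<Rightarrow> complex \<Rightarrow> complex poly" where
  "lagr b y = (\<Prod>x\<in>fib b - {y}. [:- x / (y - x), 1 / (y - x):])"

text \<open>The coefficient of the value at \<open>y\<close> when the functional
  \<open>g \<mapsto> L g b\<close> is expressed by the values of \<open>g\<close> on the
  fibre.\<close>

definition S :: "complex \<Rightarrow> complex \<Rightarrow> complex" where "S b y = L (lagr b y) b"

text \<open>The factor \<open>b / y\<close> passes to the unitarily equivalent space of functions vanishing at \<open>0\<close>
  with norm \<open>\<integral>|f'|\<^sup>2\<close>, where the weights become constant along branches.\<close>
definition s :: "complex \<Rightarrow> complex \<Rightarrow> complex" where "s b y = S b y * b / y"

lemma poly_lagr:
  assumes b: "b \<in> ball 0 1" and y: "y \<in> fib b" and x: "x \<in> fib b"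
  shows "poly (lagr b y) x = (if x = y then 1 else 0)"
proof (cases "x = y")
  case True
  have "- z / (y - z) + y * (1 / (y - z)) = 1" if "z \<in> fib b - {y}" for z
  proof -
    have "- z / (y - z) + y * (1 / (y - z)) = (- z + y) / (y - z)"
      unfolding add_divide_distrib by simp
    also have "\<dots> = 1" using that by auto
    finally show ?thesis .
  qed
  then show ?thesis unfolding lagr_def poly_prod True by (simp add: prod.neutral)
next
  case False
  have "(\<Prod>z\<in>fib b - {y}. poly [:- z / (y - z), 1 / (y - z):] x) = 0"
    using False x finite_fib[OF b] by (intro prod_zero) (auto intro!: bexI[of _ x])
  then show ?thesis using False by (simp add: lagr_def poly_prod)
qed

lemma degree_lagr:
  assumes b: "b \<in> Reg" and y: "y \<in> fib b" shows "degree (lagr b y) \<le> 3"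
proof -
  have "degree (lagr b y) \<le> (\<Sum>x\<in>fib b - {y}. degree [:- x / (y - x), 1 / (y - x):])"
    unfolding lagr_def
    using degree_prod_sum_le[of "fib b - {y}" "\<lambda>x. [:- x / (y - x), 1 / (y - x):]"] finite_fib[OF Reg_ball[OF b]]
    by (simp add: o_def)
  also have "\<dots> \<le> (\<Sum>x\<in>fib b - {y}. 1)" by (rule sum_mono) simp
  also have "\<dots> = 3" using card_fib[OF b] y finite_fib[OF Reg_ball[OF b]] by simp
  finally show ?thesis .
qed

text \<open>The interpolation error vanishes on the four simple fibre points, so it is a multiple of
  \<open>p - \<phi> b q\<close>, which \<open>L\<close> annihilates at \<open>b\<close>.\<close>

lemma L_lagrange:
  assumes b: "b \<in> Reg" shows "L g b = (\<Sum>y\<in>fib b. S b y * poly g y)"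
proof -
  note bb = Reg_ball[OF b]
  define r where "r = (\<Sum>y\<in>fib b. smult (poly g y) (lagr b y))"
  obtain \<kappa> bs where f: "\<kappa> \<noteq> 0" "set bs = fib b" "distinct bs"
    "p - smult (\<phi> b) q = smult \<kappa> (blaschke_num bs)"
    using Reg_fib_factorization[OF b] by metis
  have "poly (g - r) x = 0" if x: "x \<in> fib b" for x
  proof -
    have "poly r x = (\<Sum>y\<in>fib b. if x = y then poly g y else 0)"
      unfolding r_def poly_sum by (rule sum.cong) (auto simp: poly_lagr[OF bb _ x])
    then show ?thesis using x finite_fib[OF bb] by simp
  qed
  then have "blaschke_num bs dvd g - r" by (intro blaschke_num_dvd f) (simp add: f)
  then have "p - smult (\<phi> b) q dvd g - r" unfolding f(4) using f(1) by (simp add: smult_dvd_iff)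
  then obtain k where k: "g - r = (p - smult (\<phi> b) q) * k" by (elim dvdE)
  have "L (g - r) b = L (p * k - smult (\<phi> b) (q * k)) b" unfolding k by (simp add: algebra_simps)
  also have "\<dots> = 0" by (simp add: L_diff L_smult L_p[OF bb])
  finally have "L g b = L r b" by (simp add: L_diff)
  also have "\<dots> = (\<Sum>y\<in>fib b. S b y * poly g y)"
    by (simp add: r_def L_sum L_smult S_def mult.commute)
  finally show ?thesis .
qed

lemma L_fibre_sum:
  assumes b: "b \<in> Reg" shows "b * L g b = (\<Sum>y\<in>fib b. s b y * y * poly g y)"
proof -
  have "b * (S b y * poly g y) = s b y * y * poly g y" if "y \<in> fib b" for y
    using fib_nonzero[OF b that] by (simp add: s_def)
  then show ?thesis unfolding L_lagrange[OF b] sum_distrib_left by (rule sum.cong[OF refl])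
qed

theorem s_locally_constant:
  assumes b0: "b0 \<in> Reg"
  obtains e \<rho> where "e > 0" "ball b0 e \<subseteq> Reg"
    "\<And>y. y \<in> fib b0 \<Longrightarrow> \<rho> y holomorphic_on ball b0 e" "\<And>y. y \<in> fib b0 \<Longrightarrow> \<rho> y b0 = y"
    "\<And>b. b \<in> ball b0 e \<Longrightarrow> inj_on (\<lambda>y. \<rho> y b) (fib b0)"
    "\<And>b. b \<in> ball b0 e \<Longrightarrow> (\<lambda>y. \<rho> y b) ` fib b0 = fib b"
    "\<And>b. b \<in> ball b0 e \<Longrightarrow> \<rho> b0 b = b"
    "\<And>b y. b \<in> ball b0 e \<Longrightarrow> y \<in> fib b0 \<Longrightarrow> s b (\<rho> y b) = s b0 y"
proof -
  obtain e \<rho> where e: "e > 0" "ball b0 e \<subseteq> Reg"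
    and \<rho>h: "\<And>y. y \<in> fib b0 \<Longrightarrow> \<rho> y holomorphic_on ball b0 e"
    and \<rho>0: "\<And>y. y \<in> fib b0 \<Longrightarrow> \<rho> y b0 = y"
    and inj: "\<And>b. b \<in> ball b0 e \<Longrightarrow> inj_on (\<lambda>y. \<rho> y b) (fib b0)"
    and img: "\<And>b. b \<in> ball b0 e \<Longrightarrow> (\<lambda>y. \<rho> y b) ` fib b0 = fib b"
    and \<rho>b: "\<And>b. b \<in> ball b0 e \<Longrightarrow> \<rho> b0 b = b"
    using local_branches[OF b0] by metis
  note fin = finite_fib[OF Reg_ball[OF b0]]
  let ?B = "ball b0 e"
  have Bsub: "?B \<subseteq> ball 0 1" using e(2) Reg_ball by auto
  have \<rho>fib: "\<rho> y b \<in> fib b" if "y \<in> fib b0" "b \<in> ?B" for y b using img[OF that(2)] that(1) by auto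
  have \<rho>ne: "\<rho> y b \<noteq> \<rho> x b" if "y \<in> fib b0" "x \<in> fib b0" "x \<noteq> y" "b \<in> ?B" for x y b
    using inj_onD[OF inj[OF that(4)], of y x] that by auto
  \<comment> \<open>The weight followed along a branch; it is holomorphic because the Lagrange
    coefficients are rational in the branches.\<close>
  define t where "t y b = s b (\<rho> y b)" for y b
  have th: "t y holomorphic_on ?B" if y: "y \<in> fib b0" for y
  proof -
    let ?l = "\<lambda>b. \<Prod>x\<in>fib b0 - {y}. [:- \<rho> x b / (\<rho> y b - \<rho> x b), 1 / (\<rho> y b - \<rho> x b):]"
    have lag: "lagr b (\<rho> y b) = ?l b" if b: "b \<in> ?B" for b
    proof -
      have "fib b - {\<rho> y b} = (\<lambda>x. \<rho> x b) ` (fib b0 - {y})"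
        using img[OF b] inj_on_image_set_diff[OF inj[OF b], of "fib b0" "{y}"] y by auto
      moreover have "inj_on (\<lambda>x. \<rho> x b) (fib b0 - {y})" using inj[OF b] by (rule inj_on_subset) auto
      ultimately show ?thesis unfolding lagr_def by (simp add: prod.reindex)
    qed
    have "(\<lambda>b. (\<Sum>m\<le>3. coeff (?l b) m * h m b) * b / \<rho> y b) holomorphic_on ?B"
    proof (intro holomorphic_intros holomorphic_coeff_prod_linear)
      show "finite (fib b0 - {y})" using fin by simp
      show "h m holomorphic_on ?B" for m by (rule holomorphic_on_subset[OF h_holomorphic Bsub])
      show "\<rho> y b \<noteq> 0" if "b \<in> ?B" for b using fib_nonzero[OF _ \<rho>fib[OF y that]] e(2) that by blast
    qed (use \<rho>h y \<rho>ne in auto)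
    moreover have "t y b = (\<Sum>m\<le>3. coeff (?l b) m * h m b) * b / \<rho> y b" if b: "b \<in> ?B" for b
    proof -
      have "b \<in> Reg" using e(2) b by auto
      from degree_lagr[OF this \<rho>fib[OF y b]]
      have "S b (\<rho> y b) = (\<Sum>m\<le>3. coeff (lagr b (\<rho> y b)) m * h m b)"
        unfolding S_def by (rule L_expand)
      then show ?thesis by (simp only: t_def s_def lag[OF b])
    qed
    ultimately show ?thesis by (subst holomorphic_cong[OF refl]) auto
  qed
  have bh: "b * h n b = (\<Sum>y\<in>fib b0. t y b * \<rho> y b ^ Suc n)" if b: "b \<in> ?B" for b n
  proof -
    have "b * h n b = (\<Sum>y\<in>fib b. s b y * y * poly (monom 1 n) y)"
      using L_fibre_sum[of b "monom 1 n"] b e(2) by (auto simp: L_monom)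
    also have "\<dots> = (\<Sum>y\<in>(\<lambda>y. \<rho> y b) ` fib b0. s b y * y * y ^ n)" by (simp add: img[OF b] poly_monom)
    also have "\<dots> = (\<Sum>y\<in>fib b0. t y b * \<rho> y b ^ Suc n)"
      by (subst sum.reindex[OF inj[OF b]]) (simp add: t_def mult.assoc)
    finally show ?thesis .
  qed
  \<comment> \<open>Derivative of \<open>b * h n b\<close>. The terms with
    \<open>deriv (t y)\<close> are geometric in \<open>n\<close> and will give simple poles; those
    with \<open>deriv (\<rho> y)\<close> carry a factor \<open>Suc n\<close> and will give double
    poles.\<close>
  have un: "u n b = (\<Sum>y\<in>fib b0. deriv (t y) b * \<rho> y b ^ Suc n + t y b * (of_nat (Suc n) * \<rho> y b ^ n * deriv (\<rho> y) b))"
    if b: "b \<in> ?B" for b n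
  proof -
    have "((\<lambda>b. \<Sum>y\<in>fib b0. t y b * \<rho> y b ^ Suc n) has_field_derivative
        (\<Sum>y\<in>fib b0. deriv (t y) b * \<rho> y b ^ Suc n + t y b * (of_nat (Suc n) * \<rho> y b ^ n * deriv (\<rho> y) b))) (at b)"
    proof (intro DERIV_sum)
      fix y assume y: "y \<in> fib b0"
      have 1: "(t y has_field_derivative deriv (t y) b) (at b)"
        by (rule holomorphic_derivI[OF th[OF y] open_ball b])
      have "(\<rho> y has_field_derivative deriv (\<rho> y) b) (at b)"
        by (rule holomorphic_derivI[OF \<rho>h[OF y] open_ball b])
      from DERIV_power[OF this, of "Suc n"]
      have 2: "((\<lambda>b. \<rho> y b ^ Suc n) has_field_derivative of_nat (Suc n) * \<rho> y b ^ n * deriv (\<rho> y) b) (at b)"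
        by (simp add: mult_ac)
      from DERIV_mult[OF 1 2]
      show "((\<lambda>b. t y b * \<rho> y b ^ Suc n) has_field_derivative
          deriv (t y) b * \<rho> y b ^ Suc n + t y b * (of_nat (Suc n) * \<rho> y b ^ n * deriv (\<rho> y) b)) (at b)"
        by (simp add: mult_ac)
    qed
    moreover have "\<forall>\<^sub>F b in nhds b. b * h n b = (\<Sum>y\<in>fib b0. t y b * \<rho> y b ^ Suc n)"
      using bh b by (auto intro!: eventually_nhds_in_open[of ?B, THEN eventually_mono])
    ultimately show ?thesis
      unfolding u_def by (subst deriv_cong_ev[OF _ refl]) (auto dest: DERIV_imp_deriv)
  qed
  have dt: "deriv (t y) b = 0" if y: "y \<in> fib b0" and b: "b \<in> ?B" for y b
  proof -
    have bb: "b \<in> ball 0 1" and bR: "b \<in> Reg" using b Bsub e(2) by auto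
    then have cb: "cmod (cnj b) < 1" "cnj b \<noteq> 0"
      using fib_nonzero[OF bR fib_self[OF bb]] by auto
    have \<rho>1: "cmod (\<rho> x b) < 1" if "x \<in> fib b0" for x using fib_ball[OF \<rho>fib[OF that b]] by simp
    \<comment> \<open>Summing the conjugates of \<open>u n b\<close> against \<open>x ^ n\<close>
      gives the derivative of the rational function \<open>x * V (cnj b) x\<close>, with poles at
      the reciprocals of \<open>cnj (\<rho> y b)\<close>; the coefficient of each simple pole must
      vanish.\<close>
    have "cnj (deriv (t y) b * \<rho> y b) = 0"
    proof (rule rat_deriv_no_residue[of "\<lambda>x. x * V (cnj b) x" "fib b0" "\<lambda>y. cnj (\<rho> y b)"
          "\<lambda>y. cnj (deriv (t y) b * \<rho> y b)" "\<lambda>y. cnj (t y b * deriv (\<rho> y) b)"])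
      show "(\<lambda>x. x * V (cnj b) x) holomorphic_on ball 0 1"
        by (intro holomorphic_intros V_holomorphic cb)
      show "rat_on_disc (\<lambda>x. x * V (cnj b) x)"
        using rat_on_disc_mult[OF rat_on_disc_poly[of "[:0, 1:]"] rat_V[OF cb]] by simp
      show "inj_on (\<lambda>y. cnj (\<rho> y b)) (fib b0)"
        by (rule inj_onI) (use inj_onD[OF inj[OF b]] in simp)
      show "cnj (\<rho> x b) \<noteq> 0 \<and> cmod (cnj (\<rho> x b)) < 1" if "x \<in> fib b0" for x
        using fib_nonzero[OF bR \<rho>fib[OF that b]] \<rho>1[OF that] by simp
      fix x :: complex assume x: "x \<in> ball 0 1"
      have "(\<lambda>n. cnj (u n b) * x ^ n) sums (\<Sum>y\<in>fib b0. cnj (deriv (t y) b * \<rho> y b) / (1 - x * cnj (\<rho> y b))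
          + cnj (t y b * deriv (\<rho> y) b) / (1 - x * cnj (\<rho> y b))\<^sup>2)"
      proof -
        have "(\<lambda>n. cnj (deriv (t y) b * \<rho> y b ^ Suc n + t y b * (of_nat (Suc n) * \<rho> y b ^ n * deriv (\<rho> y) b)) * x ^ n)
            sums (cnj (deriv (t y) b * \<rho> y b) / (1 - x * cnj (\<rho> y b))
              + cnj (t y b * deriv (\<rho> y) b) / (1 - x * cnj (\<rho> y b))\<^sup>2)" if y: "y \<in> fib b0" for y
        proof -
          let ?w = "x * cnj (\<rho> y b)"
          have "cmod ?w \<le> cmod x" using \<rho>1[OF y] by (simp add: norm_mult mult_left_le)
          then have w: "norm ?w < 1" using x by simp
          have "(\<lambda>n. cnj (deriv (t y) b * \<rho> y b) * ?w ^ n + cnj (t y b * deriv (\<rho> y) b) * (of_nat (Suc n) * ?w ^ n))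
            sums (cnj (deriv (t y) b * \<rho> y b) * (1 / (1 - ?w)) + cnj (t y b * deriv (\<rho> y) b) * (1 / (1 - ?w)\<^sup>2))"
            by (intro sums_add sums_mult geometric_sums geometric_deriv_sums w)
          then show ?thesis by (simp add: power_mult_distrib algebra_simps)
        qed
        then have "(\<lambda>n. \<Sum>y\<in>fib b0. cnj (deriv (t y) b * \<rho> y b ^ Suc n + t y b * (of_nat (Suc n) * \<rho> y b ^ n * deriv (\<rho> y) b)) * x ^ n)
            sums (\<Sum>y\<in>fib b0. cnj (deriv (t y) b * \<rho> y b) / (1 - x * cnj (\<rho> y b))
              + cnj (t y b * deriv (\<rho> y) b) / (1 - x * cnj (\<rho> y b))\<^sup>2)"
          by (intro sums_sum)
        then show ?thesis by (simp only: un[OF b] cnj_sum sum_distrib_right)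
      qed
      moreover have "(\<lambda>n. cnj (u n b) * x ^ n) sums deriv (\<lambda>x. x * V (cnj b) x) x"
        using deriv_V[OF cb(1) x] by simp
      ultimately show "deriv (\<lambda>x. x * V (cnj b) x) x = (\<Sum>y\<in>fib b0. cnj (deriv (t y) b * \<rho> y b) / (1 - x * cnj (\<rho> y b))
          + cnj (t y b * deriv (\<rho> y) b) / (1 - x * cnj (\<rho> y b))\<^sup>2)"
        by (rule sums_unique2[symmetric])
    qed (use fin y in auto)
    then show ?thesis using fib_nonzero[OF bR \<rho>fib[OF y b]] by simp
  qed
  have "t y b = t y b0" if y: "y \<in> fib b0" and b: "b \<in> ?B" for y b
  proof -
    have "(t y has_field_derivative 0) (at x within ?B)" if "x \<in> ?B" for x
      using holomorphic_derivI[OF th[OF y] open_ball that] dt[OF y that] has_field_derivative_at_within by fastforce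
    then obtain k where "\<And>x. x \<in> ?B \<Longrightarrow> t y x = k"
      using has_field_derivative_zero_constant[OF convex_ball] by metis
    then show ?thesis using b e(1) by simp
  qed
  then have "s b (\<rho> y b) = s b0 y" if "b \<in> ?B" "y \<in> fib b0" for b y
    using that by (simp add: t_def \<rho>0)
  then show ?thesis using that[OF e \<rho>h \<rho>0 inj img \<rho>b] by blast
qed

end

section \<open>Weights and global branches\<close>

lemma holomorphic_extend_finite:
  assumes "finite F" "open S" "f holomorphic_on S - F" "\<And>z. z \<in> S - F \<Longrightarrow> cmod (f z) \<le> B"
  obtains g where "g holomorphic_on S" "\<And>z. z \<in> S - F \<Longrightarrow> g z = f z"
proof -
  have "\<exists>g. g holomorphic_on S \<and> (\<forall>z\<in>S - F. g z = f z)"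
    using assms
  proof (induction F arbitrary: S rule: finite_induct)
    case (insert a F)
    define T where "T = S - {a}"
    have T: "open T" "T - F = S - insert a F" using insert.prems(1) by (auto simp: T_def open_delete)
    then obtain g where g: "g holomorphic_on T" "\<And>z. z \<in> T - F \<Longrightarrow> g z = f z"
      using insert.IH[of T] insert.prems by auto
    show ?case
    proof (cases "a \<in> S")
      case False
      then have "T = S" by (simp add: T_def)
      then show ?thesis using g T(2) by auto
    next
      case True
      have "open (S - (F - {a}))" using insert.prems(1) insert.hyps by (intro open_Diff finite_imp_closed) auto
      then have "\<forall>\<^sub>F z in at a. z \<in> S - (F - {a}) - {a}"
        unfolding eventually_at_topological using True by (intro exI[of _ "S - (F - {a})"]) auto
      then have "\<forall>\<^sub>F z in at a. cmod (g z) \<le> B"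
        by eventually_elim (use g(2) insert.prems(3) in \<open>auto simp: T_def\<close>)
      then obtain k where k: "k holomorphic_on S" "\<forall>z\<in>S - {a}. k z = g z"
        using holomorphic_on_extend_bounded[of g S a] g(1) True insert.prems(1)
        by (auto simp: T_def interior_open)
      then show ?thesis using g(2) by (intro exI[of _ k]) (auto simp: T_def)
    qed
  qed auto
  then show ?thesis using that by blast
qed

context reducing_blaschke
begin

lemma phi_holomorphic: "\<phi> holomorphic_on ball 0 1"
  by (rule disc_multiplier_holomorphic[OF multiplier])

lemma finite_nonReg: "finite (ball 0 1 - Reg)"
proof -
  let ?W = "pderiv p * q - p * pderiv q"
  have "ball 0 1 - Reg \<subseteq> {z. poly p z = 0} \<union> (\<Union>y\<in>{y. poly ?W y = 0} \<inter> ball 0 1. fib y)"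
  proof
    fix b assume b: "b \<in> ball 0 1 - Reg"
    then have bb: "b \<in> ball 0 1" by simp
    consider "\<phi> b = 0" | y where "y \<in> fib b" "deriv \<phi> y = 0" using b by (auto simp: Reg_def)
    then show "b \<in> {z. poly p z = 0} \<union> (\<Union>y\<in>{y. poly ?W y = 0} \<inter> ball 0 1. fib y)"
    proof cases
      case 1
      then show ?thesis using phi_q[OF bb] by simp
    next
      case 2
      then have "poly ?W y = 0" using deriv_phi[OF fib_ball[OF 2(1)]] by simp
      moreover have "b \<in> fib y" using 2(1) bb by (auto simp: fib_def)
      ultimately show ?thesis using fib_ball[OF 2(1)] by blast
    qed
  qed
  moreover have "finite ({z. poly p z = 0} \<union> (\<Union>y\<in>{y. poly ?W y = 0} \<inter> ball 0 1. fib y))"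
    using poly_roots_finite[OF p_nonzero] poly_roots_finite[OF wronskian_nonzero] finite_fib by auto
  ultimately show ?thesis by (rule finite_subset)
qed

lemma Reg_eq: "Reg = ball 0 1 - (ball 0 1 - Reg)"
  using Reg_ball by auto

lemma connected_Reg: "connected Reg"
  by (subst Reg_eq, rule connected_open_delete_finite) (auto intro: finite_nonReg)

lemma eventually_Reg:
  assumes "z0 \<in> ball 0 1" shows "\<forall>\<^sub>F z in at z0. z \<in> Reg"
proof -
  have "open (ball 0 1 - ((ball 0 1 - Reg) - {z0}))"
    using finite_nonReg by (intro open_Diff finite_imp_closed) auto
  then show ?thesis
    unfolding eventually_at_topological using assms
    by (intro exI[of _ "ball 0 1 - ((ball 0 1 - Reg) - {z0})"]) auto
qed

lemma eq_on_disc_of_Reg: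
  fixes f g :: "complex \<Rightarrow> complex"
  assumes "f holomorphic_on ball 0 1" "g holomorphic_on ball 0 1" "\<And>z. z \<in> Reg \<Longrightarrow> f z = g z" "z0 \<in> ball 0 1"
  shows "f z0 = g z0"
proof -
  have t: "(k \<longlongrightarrow> k z0) (at z0)" if "k holomorphic_on ball 0 1" for k :: "complex \<Rightarrow> complex"
    using holomorphic_on_imp_continuous_on[OF that] assms(4)
    by (metis continuous_on_eq_continuous_at isCont_def open_ball)
  have "\<forall>\<^sub>F z in at z0. f z = g z" using eventually_Reg[OF assms(4)] by eventually_elim (rule assms(3))
  then have "(g \<longlongrightarrow> f z0) (at z0)" using t[OF assms(1)] tendsto_cong by fast
  then show ?thesis using t[OF assms(2)] tendsto_unique by (metis at_neq_bot)
qed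

text \<open>The conclusion of \<open>s_locally_constant\<close> as one predicate, so that the next
  definition can quantify over every choice of local branches.\<close>

definition branches :: "complex \<Rightarrow> real \<Rightarrow> (complex \<Rightarrow> complex \<Rightarrow> complex) \<Rightarrow> bool" where
  "branches b0 e \<rho> \<longleftrightarrow> e > 0 \<and> ball b0 e \<subseteq> Reg
    \<and> (\<forall>y\<in>fib b0. \<rho> y holomorphic_on ball b0 e \<and> \<rho> y b0 = y)
    \<and> (\<forall>b\<in>ball b0 e. inj_on (\<lambda>y. \<rho> y b) (fib b0) \<and> (\<lambda>y. \<rho> y b) ` fib b0 = fib b \<and> \<rho> b0 b = b
        \<and> (\<forall>y\<in>fib b0. s b (\<rho> y b) = s b0 y))"

lemma branches_exist: "b0 \<in> Reg \<Longrightarrow> \<exists>e \<rho>. branches b0 e \<rho>"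
proof -
  assume "b0 \<in> Reg"
  then show "\<exists>e \<rho>. branches b0 e \<rho>"
  proof (rule s_locally_constant)
    fix e :: real and \<rho>
    assume "e > 0" "ball b0 e \<subseteq> Reg"
      "\<And>y. y \<in> fib b0 \<Longrightarrow> \<rho> y holomorphic_on ball b0 e" "\<And>y. y \<in> fib b0 \<Longrightarrow> \<rho> y b0 = y"
      "\<And>b. b \<in> ball b0 e \<Longrightarrow> inj_on (\<lambda>y. \<rho> y b) (fib b0)"
      "\<And>b. b \<in> ball b0 e \<Longrightarrow> (\<lambda>y. \<rho> y b) ` fib b0 = fib b"
      "\<And>b. b \<in> ball b0 e \<Longrightarrow> \<rho> b0 b = b"
      "\<And>b y. b \<in> ball b0 e \<Longrightarrow> y \<in> fib b0 \<Longrightarrow> s b (\<rho> y b) = s b0 y"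
    then have "branches b0 e \<rho>" unfolding branches_def by (intro conjI ballI)
    then show ?thesis by blast
  qed
qed

text \<open>\<open>Q\<close> selects, from the pairs of points in a common fibre, a part closed
  under local analytic continuation. The smaller radius \<open>d\<close> allows different invariants
  to be combined.\<close>

definition branch_invariant :: "(complex \<Rightarrow> complex \<Rightarrow> bool) \<Rightarrow> bool" where
  "branch_invariant Q \<longleftrightarrow> (\<forall>b0\<in>Reg. \<forall>e \<rho>. branches b0 e \<rho> \<longrightarrow>
     (\<exists>d>0. d \<le> e \<and> (\<forall>b\<in>ball b0 d. \<forall>y\<in>fib b0. Q b (\<rho> y b) = Q b0 y)))"

lemma branch_invariant_s: "branch_invariant (\<lambda>b y. R (s b y))"
  unfolding branch_invariant_def
proof (intro ballI allI impI)
  fix b0 e \<rho> assume "branches b0 e \<rho>"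
  then show "\<exists>d>0. d \<le> e \<and> (\<forall>b\<in>ball b0 d. \<forall>y\<in>fib b0. R (s b (\<rho> y b)) = R (s b0 y))"
    unfolding branches_def by (intro exI[of _ e]) auto
qed

lemma branch_invariant_self: "branch_invariant (\<lambda>b y. y = b)"
  unfolding branch_invariant_def
proof (intro ballI allI impI)
  fix b0 e \<rho> assume b0: "b0 \<in> Reg" and br: "branches b0 e \<rho>"
  have "(\<rho> y b = b) = (y = b0)" if "b \<in> ball b0 e" "y \<in> fib b0" for b y
  proof -
    have "inj_on (\<lambda>y. \<rho> y b) (fib b0)" "\<rho> b0 b = b" using br that by (auto simp: branches_def)
    then show ?thesis using inj_onD[of "\<lambda>y. \<rho> y b" "fib b0" y b0] that fib_self[OF Reg_ball[OF b0]] by auto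
  qed
  moreover have "e > 0" using br by (simp add: branches_def)
  ultimately show "\<exists>d>0. d \<le> e \<and> (\<forall>b\<in>ball b0 d. \<forall>y\<in>fib b0. (\<rho> y b = b) = (y = b0))" by blast
qed

lemma branch_invariant_conj:
  assumes "branch_invariant Q" "branch_invariant Q'"
  shows "branch_invariant (\<lambda>b y. Q b y \<and> Q' b y)"
  unfolding branch_invariant_def
proof (intro ballI allI impI)
  fix b0 e \<rho> assume b: "b0 \<in> Reg" "branches b0 e \<rho>"
  obtain d where d: "d > 0" "d \<le> e" "\<forall>b\<in>ball b0 d. \<forall>y\<in>fib b0. Q b (\<rho> y b) = Q b0 y"
    using assms(1) b unfolding branch_invariant_def by meson
  obtain d' where d': "d' > 0" "d' \<le> e" "\<forall>b\<in>ball b0 d'. \<forall>y\<in>fib b0. Q' b (\<rho> y b) = Q' b0 y"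
    using assms(2) b unfolding branch_invariant_def by meson
  show "\<exists>d>0. d \<le> e \<and> (\<forall>b\<in>ball b0 d. \<forall>y\<in>fib b0. (Q b (\<rho> y b) \<and> Q' b (\<rho> y b)) = (Q b0 y \<and> Q' b0 y))"
    using d d' by (intro exI[of _ "min d d'"]) auto
qed

lemma branch_invariant_not:
  assumes "branch_invariant Q" shows "branch_invariant (\<lambda>b y. \<not> Q b y)"
  using assms unfolding branch_invariant_def by simp

text \<open>Local branches match the selected points of neighbouring fibres, so the count is locally
  constant, and \<open>Reg\<close> is connected. This replaces continuation along paths.\<close>

lemma branch_invariant_card:
  assumes Q: "branch_invariant Q" and b: "b1 \<in> Reg" "b2 \<in> Reg"
  shows "card {y \<in> fib b1. Q b1 y} = card {y \<in> fib b2. Q b2 y}"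
proof -
  let ?f = "\<lambda>b. card {y \<in> fib b. Q b y}"
  have "?f constant_on Reg"
  proof (rule locally_constant_imp_constant[OF connected_Reg])
    fix b0 assume b0: "b0 \<in> Reg"
    then obtain e \<rho> where br: "branches b0 e \<rho>" using branches_exist by blast
    then obtain d where d: "d > 0" "d \<le> e" "\<forall>b\<in>ball b0 d. \<forall>y\<in>fib b0. Q b (\<rho> y b) = Q b0 y"
      using Q b0 unfolding branch_invariant_def by meson
    have "?f b = ?f b0" if b: "b \<in> ball b0 d" for b
    proof -
      have be: "b \<in> ball b0 e" using b d(2) by auto
      then have inj: "inj_on (\<lambda>y. \<rho> y b) (fib b0)" and img: "(\<lambda>y. \<rho> y b) ` fib b0 = fib b"
        using br by (auto simp: branches_def)
      have "{y \<in> fib b. Q b y} = (\<lambda>y. \<rho> y b) ` {y \<in> fib b0. Q b0 y}"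
        unfolding img[symmetric] using d(3) b by auto
      then show ?thesis by (simp add: card_image inj_on_subset[OF inj])
    qed
    moreover have "ball b0 d \<subseteq> Reg" using br d(2) by (force simp: branches_def)
    then have "openin (top_of_set Reg) (ball b0 d)" by (rule open_subset) simp
    ultimately show "\<exists>T. openin (top_of_set Reg) T \<and> b0 \<in> T \<and> (\<forall>x\<in>T. ?f x = ?f b0)"
      using centre_in_ball[of b0 d] d(1) by blast
  qed
  then obtain k where "\<And>b. b \<in> Reg \<Longrightarrow> ?f b = k" unfolding constant_on_def by blast
  from this[OF b(1)] this[OF b(2)] show ?thesis by simp
qed

text \<open>Continuation neither makes an off-diagonal branch diagonal nor changes its weight, so an
  off-diagonal weight found in one fibre is present in all, including the fibres of points near
  \<open>0\<close>.\<close>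

lemma s_values:
  assumes b: "b1 \<in> Reg" "b2 \<in> Reg" and y: "y \<in> fib b1" "y \<noteq> b1"
  shows "\<exists>y'\<in>fib b2. y' \<noteq> b2 \<and> s b2 y' = s b1 y"
proof -
  let ?Q = "\<lambda>b y'. \<not> (y' = b) \<and> s b y' = s b1 y"
  have "branch_invariant ?Q"
    by (intro branch_invariant_conj branch_invariant_not branch_invariant_self branch_invariant_s[of "\<lambda>w. w = s b1 y"])
  from branch_invariant_card[OF this b]
  have "card {y \<in> fib b1. ?Q b1 y} = card {y \<in> fib b2. ?Q b2 y}" .
  moreover have "card {y \<in> fib b1. ?Q b1 y} \<noteq> 0"
  proof -
    have "y \<in> {y \<in> fib b1. ?Q b1 y}" using y by simp
    moreover have "finite {y \<in> fib b1. ?Q b1 y}" using finite_fib[OF Reg_ball[OF b(1)]] by simp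
    ultimately show ?thesis unfolding card_eq_0_iff by (metis empty_iff)
  qed
  ultimately have "{y \<in> fib b2. ?Q b2 y} \<noteq> {}" by (metis (lifting) card.empty)
  then show ?thesis by blast
qed

lemma s_diag: "b1 \<in> Reg \<Longrightarrow> b2 \<in> Reg \<Longrightarrow> s b1 b1 = s b2 b2"
proof -
  assume b: "b1 \<in> Reg" "b2 \<in> Reg"
  let ?Q = "\<lambda>b y'. y' = b \<and> s b y' = s b1 b1"
  have "branch_invariant ?Q"
    by (intro branch_invariant_conj branch_invariant_self branch_invariant_s[of "\<lambda>w. w = s b1 b1"])
  from branch_invariant_card[OF this b]
  have "card {y \<in> fib b1. ?Q b1 y} = card {y \<in> fib b2. ?Q b2 y}" .
  moreover have "{y \<in> fib b1. ?Q b1 y} = {b1}" using fib_self[OF Reg_ball[OF b(1)]] by auto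
  ultimately have "card {y \<in> fib b2. ?Q b2 y} = 1" by simp
  then obtain y where "{y \<in> fib b2. ?Q b2 y} = {y}" by (rule card_1_singletonE)
  then have "y \<in> {y \<in> fib b2. ?Q b2 y}" by simp
  then show ?thesis by auto
qed

lemma continuous_at_disc:
  assumes "k holomorphic_on ball 0 1" "z0 \<in> ball 0 1" shows "isCont k z0"
  using holomorphic_on_imp_continuous_on[OF assms(1)] assms(2)
  by (simp add: continuous_on_eq_continuous_at)

text \<open>A class with a single member in each fibre agrees locally with one branch, so it is
  holomorphic on \<open>Reg\<close>; being bounded, it extends over the finitely many exceptional
  points.\<close>

theorem unique_branch:
  assumes Q: "branch_invariant Q" and b1: "b1 \<in> Reg" and one: "card {y \<in> fib b1. Q b1 y} = 1"
  obtains \<sigma> where "\<sigma> holomorphic_on ball 0 1" "\<And>b. b \<in> ball 0 1 \<Longrightarrow> \<sigma> b \<in> fib b"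
    "\<And>b. b \<in> Reg \<Longrightarrow> {y \<in> fib b. Q b y} = {\<sigma> b}"
proof -
  have "\<exists>y. {y \<in> fib b. Q b y} = {y}" if "b \<in> Reg" for b
    using branch_invariant_card[OF Q b1 that] one by (metis card_1_singletonE)
  then obtain \<tau> where \<tau>: "\<And>b. b \<in> Reg \<Longrightarrow> {y \<in> fib b. Q b y} = {\<tau> b}" by metis
  have \<tau>fib: "\<tau> b \<in> fib b" "Q b (\<tau> b)" if "b \<in> Reg" for b using \<tau>[OF that] by auto
  have "\<tau> holomorphic_on Reg"
  proof -
    have "\<tau> field_differentiable (at b0)" if b0: "b0 \<in> Reg" for b0
    proof -
      obtain e \<rho> where br: "branches b0 e \<rho>" using branches_exist[OF b0] by blast
      then obtain d where d: "d > 0" "d \<le> e" "\<forall>b\<in>ball b0 d. \<forall>y\<in>fib b0. Q b (\<rho> y b) = Q b0 y"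
        using Q b0 unfolding branch_invariant_def by meson
      have eq: "\<tau> b = \<rho> (\<tau> b0) b" if b: "b \<in> ball b0 d" for b
      proof -
        have be: "b \<in> ball b0 e" using b d(2) by auto
        have "Q b (\<rho> (\<tau> b0) b)" using d(3) b \<tau>fib[OF b0] by blast
        moreover have "\<rho> (\<tau> b0) b \<in> fib b" using br be \<tau>fib(1)[OF b0] by (fastforce simp: branches_def)
        moreover have "b \<in> Reg" using br be by (auto simp: branches_def)
        ultimately have "\<rho> (\<tau> b0) b \<in> {\<tau> b}" unfolding \<tau>[OF \<open>b \<in> Reg\<close>, symmetric] by simp
        then show ?thesis by simp
      qed
      have "\<rho> (\<tau> b0) holomorphic_on ball b0 e" using br \<tau>fib(1)[OF b0] by (auto simp: branches_def)
      then have "\<rho> (\<tau> b0) field_differentiable (at b0)"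
        using d by (intro holomorphic_on_imp_differentiable_at[of _ "ball b0 e"]) auto
      then obtain D where "(\<rho> (\<tau> b0) has_field_derivative D) (at b0)" by (auto simp: field_differentiable_def)
      moreover have evq: "\<forall>\<^sub>F b in nhds b0. \<tau> b = \<rho> (\<tau> b0) b"
        by (rule eventually_mono[OF eventually_nhds_in_open[OF open_ball centre_in_ball[THEN iffD2, OF d(1)]] eq])
      ultimately have "(\<tau> has_field_derivative D) (at b0)"
        using DERIV_cong_ev[OF refl evq refl] by blast
      then show ?thesis by (auto simp: field_differentiable_def)
    qed
    then show ?thesis by (simp add: holomorphic_on_def field_differentiable_at_within)
  qed
  then have th: "\<tau> holomorphic_on ball 0 1 - (ball 0 1 - Reg)" using Reg_eq by simp
  have bnd: "cmod (\<tau> z) \<le> 1" if "z \<in> ball 0 1 - (ball 0 1 - Reg)" for z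
    using \<tau>fib(1)[of z] fib_ball[of "\<tau> z" z] that by (auto intro: less_imp_le)
  obtain \<sigma> where \<sigma>: "\<sigma> holomorphic_on ball 0 1" "\<And>z. z \<in> ball 0 1 - (ball 0 1 - Reg) \<Longrightarrow> \<sigma> z = \<tau> z"
    using holomorphic_extend_finite[OF finite_nonReg open_ball th bnd] by metis
  have \<sigma>\<tau>: "\<sigma> b = \<tau> b" if "b \<in> Reg" for b using \<sigma>(2)[of b] that Reg_ball[OF that] by simp
  have le: "cmod (\<sigma> b) \<le> 1" if b: "b \<in> ball 0 1" for b
  proof (rule tendsto_upperbound)
    show "((\<lambda>z. cmod (\<sigma> z)) \<longlongrightarrow> cmod (\<sigma> b)) (at b)"
      using continuous_at_disc[OF \<sigma>(1) b] by (intro tendsto_norm) (simp add: isCont_def)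
    show "\<forall>\<^sub>F z in at b. cmod (\<sigma> z) \<le> 1"
      using eventually_Reg[OF b]
    proof eventually_elim
      case (elim z)
      then show ?case using fib_ball[OF \<tau>fib(1)[OF elim]] by (simp add: \<sigma>\<tau> less_imp_le)
    qed
  qed simp
  \<comment> \<open>The fibre relation in polynomial form, meaningful before the extension is known
    to stay in the open disc.\<close>
  have pq: "poly p (\<sigma> b) * poly q b = poly p b * poly q (\<sigma> b)" if b: "b \<in> ball 0 1" for b
  proof (rule eq_on_disc_of_Reg[OF _ _ _ b])
    show "(\<lambda>b. poly p (\<sigma> b) * poly q b) holomorphic_on ball 0 1"
      "(\<lambda>b. poly p b * poly q (\<sigma> b)) holomorphic_on ball 0 1"
      by (intro holomorphic_intros holomorphic_poly poly_holomorphic_on \<sigma>(1))+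
    fix z assume z: "z \<in> Reg"
    then have f: "\<sigma> z \<in> fib z" using \<tau>fib \<sigma>\<tau> by simp
    then show "poly p (\<sigma> z) * poly q z = poly p z * poly q (\<sigma> z)"
      using phi_q[OF fib_ball[OF f]] phi_q[OF Reg_ball[OF z]] by (simp add: fib_def mult_ac flip: phi_q)
  qed
  \<comment> \<open>On the circle \<open>|q| \<le> |p|\<close>; through the fibre relation this
    would give \<open>|\<phi> b| \<ge> 1\<close>.\<close>
  have \<sigma>b: "\<sigma> b \<in> ball 0 1" if b: "b \<in> ball 0 1" for b
  proof (rule ccontr)
    assume "\<sigma> b \<notin> ball 0 1"
    then have n1: "cmod (\<sigma> b) = 1" using le[OF b] by simp
    have q1: "poly q (\<sigma> b) \<noteq> 0" by (rule q_nonzero) (simp add: n1)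
    have "cmod (poly q (\<sigma> b)) \<le> cmod (poly p (\<sigma> b))"
      using norm_blaschke_den_le_num[OF ls_ball, of "\<sigma> b"] n1 norm_c by (simp add: p_def q_def norm_mult)
    then have "cmod (poly q (\<sigma> b)) * cmod (poly q b) \<le> cmod (poly p (\<sigma> b)) * cmod (poly q b)"
      by (rule mult_right_mono) simp
    also have "\<dots> = cmod (poly p b) * cmod (poly q (\<sigma> b))"
      using arg_cong[OF pq[OF b], of cmod] by (simp add: norm_mult)
    finally have "cmod (poly q b) \<le> cmod (poly p b)" using q1 by (simp add: mult.commute)
    moreover have "cmod (\<phi> b) < 1" using phi_in_ball[OF b] by simp
    then have "cmod (poly p b) < cmod (poly q b)"
      using q_nonzero[of b] b by (simp add: phi_pq norm_divide divide_less_eq_1)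
    ultimately show False by simp
  qed
  have "\<sigma> b \<in> fib b" if b: "b \<in> ball 0 1" for b
  proof -
    have "\<phi> (\<sigma> b) = \<phi> b"
      using pq[OF b] q_nonzero[of b] q_nonzero[of "\<sigma> b"] b \<sigma>b[OF b]
      by (simp add: phi_pq frac_eq_eq)
    then show ?thesis using \<sigma>b[OF b] by (simp add: fib_def)
  qed
  then show ?thesis using that[OF \<sigma>(1)] \<tau> \<sigma>\<tau> by simp
qed

section \<open>Size of the weights near 0\<close>

lemma coeff_prod_bound:
  fixes A :: "complex set"
  assumes "finite A" "\<And>x. x \<in> A \<Longrightarrow> cmod x \<le> 1"
  shows "cmod (coeff (\<Prod>x\<in>A. [:x, -1:]) m) \<le> 2 ^ card A"
  using assms
proof (induction A arbitrary: m rule: finite_induct)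
  case empty
  then show ?case by (cases m) auto
next
  case (insert x A)
  let ?r = "\<Prod>x\<in>A. [:x, -1:]"
  have "coeff (\<Prod>x\<in>insert x A. [:x, -1:]) m = x * coeff ?r m - (if m = 0 then 0 else coeff ?r (m - 1))"
    using insert.hyps by (cases m) (auto simp: coeff_pCons)
  also have "cmod \<dots> \<le> cmod (x * coeff ?r m) + cmod (if m = 0 then 0 else coeff ?r (m - 1))"
    by (rule norm_triangle_ineq4)
  also have "\<dots> \<le> 2 ^ card A + 2 ^ card A"
  proof (rule add_mono)
    have "cmod (x * coeff ?r m) \<le> 1 * 2 ^ card A"
      unfolding norm_mult using insert by (intro mult_mono) auto
    then show "cmod (x * coeff ?r m) \<le> 2 ^ card A" by simp
    show "cmod (if m = 0 then 0 else coeff ?r (m - 1)) \<le> 2 ^ card A" using insert by auto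
  qed
  finally show ?case using insert.hyps by simp
qed

text \<open>The numerator carries a factor \<open>b\<close> because the projection preserves vanishing at \<open>0\<close>.\<close>
lemma s_bound:
  obtains C where "C > 0"
    "\<And>b y. b \<in> Reg \<Longrightarrow> cmod b \<le> 1 / 2 \<Longrightarrow> y \<in> fib b \<Longrightarrow>
       cmod (s b y) * cmod y * cmod (poly q y * deriv \<phi> y) \<le> C * cmod b"
proof -
  have "\<exists>K. \<forall>b\<in>cball 0 (1/2). cmod (h m b) \<le> K" for m
  proof -
    have "continuous_on (cball 0 (1/2)) (h m)"
      by (intro holomorphic_on_imp_continuous_on holomorphic_on_subset[OF h_holomorphic]) auto
    then have "bounded (h m ` cball 0 (1/2))" by (intro compact_imp_bounded compact_continuous_image) auto
    then show ?thesis by (auto simp: bounded_iff)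
  qed
  then obtain K where K: "\<And>m b. b \<in> cball 0 (1/2) \<Longrightarrow> cmod (h m b) \<le> K m" by metis
  \<comment> \<open>\<open>16 = 2 * 2 ^ 3\<close>: the leading constant \<kappa> has modulus at most
    \<open>2\<close>, and a product of three linear factors with roots in the disc has coefficients
    at most \<open>2 ^ 3\<close>. The summand \<open>1\<close> keeps \<open>C\<close>
    positive.\<close>
  define C where "C = 1 + (\<Sum>m\<le>3. 16 * \<bar>K m\<bar>)"
  have C: "C > 0" unfolding C_def by (intro add_pos_nonneg sum_nonneg) auto
  have "cmod (s b y) * cmod y * cmod (poly q y * deriv \<phi> y) \<le> C * cmod b"
    if b: "b \<in> Reg" "cmod b \<le> 1 / 2" and y: "y \<in> fib b" for b y
  proof -
    note bb = Reg_ball[OF b(1)]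
    note fin = finite_fib[OF bb]
    obtain \<kappa> bs where f: "\<kappa> \<noteq> 0" "length bs = 4" "set bs = fib b" "distinct bs"
      "p - smult (\<phi> b) q = smult \<kappa> (blaschke_num bs)"
      using Reg_fib_factorization[OF b(1)] by metis
    have num: "blaschke_num bs = (\<Prod>x\<in>fib b. [:x, -1:])"
      unfolding blaschke_num_def f(3)[symmetric] using f(4) by (simp add: prod.distinct_set_conv_list)
    \<comment> \<open>\<open>G\<close> is \<open>p - \<phi> b q\<close> without its root at
      \<open>y\<close>. Up to sign its value at \<open>y\<close> is
      \<open>poly q y * deriv \<phi> y\<close>, so multiplying by this factor clears the small
      denominators of the Lagrange polynomial and leaves the bounded quantity
      \<open>L G b\<close>.\<close>
    define G where "G = smult \<kappa> (\<Prod>x\<in>fib b - {y}. [:x, -1:])"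
    have F: "p - smult (\<phi> b) q = [:y, -1:] * G"
      unfolding f(5) num G_def using fin y by (simp add: prod.remove[of _ y] mult_ac del: mult_pCons_left mult_pCons_right)
    have yb: "y \<in> ball 0 1" and py: "\<phi> y = \<phi> b" using y by (auto simp: fib_def)
    have qy: "poly q y \<noteq> 0" using q_nonzero[of y] yb by simp
    have "poly (pderiv (p - smult (\<phi> b) q)) y = - poly G y"
      unfolding F pderiv_mult poly_add poly_mult by (simp add: pderiv_pCons)
    then have "- poly G y = poly (pderiv p) y - \<phi> y * poly (pderiv q) y"
      by (simp add: pderiv_diff pderiv_smult py)
    moreover have "poly q y * (poly q y * deriv \<phi> y) = poly q y * (poly (pderiv p) y - \<phi> y * poly (pderiv q) y)"
    proof -
      have "poly q y * (poly q y * deriv \<phi> y) = poly (pderiv p) y * poly q y - poly p y * poly (pderiv q) y"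
        using deriv_phi[OF yb] by (simp add: power2_eq_square mult_ac)
      then show ?thesis unfolding phi_q[OF yb, symmetric] by (simp add: algebra_simps)
    qed
    ultimately have G: "poly q y * deriv \<phi> y = - poly G y" using qy by simp
    have "G = smult (poly G y) (lagr b y)"
    proof -
      have "(\<Prod>x\<in>fib b - {y}. [:x, -1:]) = (\<Prod>x\<in>fib b - {y}. smult (x - y) [:- x / (y - x), 1 / (y - x):])"
      proof (rule prod.cong[OF refl])
        fix x assume "x \<in> fib b - {y}"
        then have "y - x \<noteq> 0" by auto
        then have "(x - y) * (- x / (y - x)) = x" "(x - y) * (1 / (y - x)) = -1"
          by (simp_all add: field_simps)
        then show "[:x, -1:] = smult (x - y) [:- x / (y - x), 1 / (y - x):]" by simp
      qed
      also have "\<dots> = smult (\<Prod>x\<in>fib b - {y}. x - y) (lagr b y)"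
        unfolding lagr_def by (rule prod_smult)
      finally have e: "(\<Prod>x\<in>fib b - {y}. [:x, -1:]) = smult (\<Prod>x\<in>fib b - {y}. x - y) (lagr b y)" .
      have Gy: "poly G y = \<kappa> * (\<Prod>x\<in>fib b - {y}. x - y)" by (simp add: G_def poly_prod)
      show ?thesis unfolding Gy unfolding G_def e by simp
    qed
    then have "L G b = poly G y * S b y" using L_smult[of "poly G y" "lagr b y"] by (simp add: S_def)
    then have LG: "cmod (S b y) * cmod (poly q y * deriv \<phi> y) = cmod (L G b)"
      unfolding G by (simp add: norm_mult mult.commute)
    have \<kappa>: "cmod \<kappa> \<le> 2"
    proof -
      have "coeff (p - smult (\<phi> b) q) 4 = \<kappa>"
        unfolding f(5) using lead_coeff_blaschke_num[of bs] f(2) by simp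
      moreover have "coeff (p - smult (\<phi> b) q) 4 = c - \<phi> b * coeff q 4"
        using lead_coeff_blaschke_num[of ls] length_ls by (simp add: p_def)
      moreover have "cmod (c - \<phi> b * coeff q 4) \<le> cmod c + cmod (\<phi> b * coeff q 4)" by (rule norm_triangle_ineq4)
      moreover have "cmod (\<phi> b * coeff q 4) \<le> 1 * 1"
        unfolding norm_mult using phi_in_ball[OF bb] norm_blaschke_den_coeff[OF ls_ball] length_ls
        by (intro mult_mono) (auto simp: q_def)
      ultimately show ?thesis using norm_c by simp
    qed
    have card3: "card (fib b - {y}) = 3" using card_fib[OF b(1)] fin y by simp
    have coeffG: "cmod (coeff G m) \<le> 16" for m
    proof -
      have "cmod (coeff (\<Prod>x\<in>fib b - {y}. [:x, -1:]) m) \<le> 2 ^ card (fib b - {y})"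
        by (rule coeff_prod_bound) (use fin fib_ball in \<open>auto intro: less_imp_le\<close>)
      then have "cmod \<kappa> * cmod (coeff (\<Prod>x\<in>fib b - {y}. [:x, -1:]) m) \<le> 2 * 2 ^ 3"
        using \<kappa> unfolding card3 by (intro mult_mono) auto
      then show ?thesis by (simp add: G_def norm_mult)
    qed
    have "degree G \<le> 3"
    proof -
      have "degree G \<le> degree (\<Prod>x\<in>fib b - {y}. [:x, -1:])" unfolding G_def by (rule degree_smult_le)
      also have "\<dots> \<le> (\<Sum>x\<in>fib b - {y}. degree [:x, -1:])"
        using degree_prod_sum_le[of "fib b - {y}" "\<lambda>x. [:x, -1:]"] fin by (simp add: o_def)
      also have "\<dots> \<le> (\<Sum>x\<in>fib b - {y}. 1)" by (rule sum_mono) simp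
      finally show ?thesis using card3 by simp
    qed
    then have "cmod (L G b) = cmod (\<Sum>m\<le>3. coeff G m * h m b)" by (simp only: L_expand)
    also have "\<dots> \<le> (\<Sum>m\<le>3. cmod (coeff G m * h m b))" by (rule norm_sum)
    also have "\<dots> \<le> (\<Sum>m\<le>3. 16 * \<bar>K m\<bar>)"
    proof (rule sum_mono)
      fix m
      have "cmod (h m b) \<le> \<bar>K m\<bar>" using K[of b m] b(2) by simp
      then show "cmod (coeff G m * h m b) \<le> 16 * \<bar>K m\<bar>"
        unfolding norm_mult using coeffG by (intro mult_mono) auto
    qed
    also have "\<dots> \<le> C" by (simp add: C_def)
    finally have LGC: "cmod (L G b) \<le> C" .
    have "cmod (s b y) * cmod y = cmod (S b y) * cmod b"
      using fib_nonzero[OF b(1) y] by (simp add: s_def norm_mult norm_divide)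
    then have "cmod (s b y) * cmod y * cmod (poly q y * deriv \<phi> y) = cmod (L G b) * cmod b"
      by (simp add: mult_ac flip: LG)
    also have "\<dots> \<le> C * cmod b" using LGC by (rule mult_right_mono) simp
    finally show ?thesis .
  qed
  then show ?thesis using that[OF C] by blast
qed

end

section \<open>The zeros of the symbol\<close>

text \<open>An eigenvalue depending on parity covers two situations at once: scalar projections,
  with constant \<open>d\<close>, and projections to even or odd functions.\<close>

lemma closed_subspace_even_diagonal:
  assumes M: "closed_subspace M" and d: "\<And>m. dirichlet_proj M (dmono m) = (\<lambda>z. d (even m) * dmono m z)"
  shows "M = coord_space {m. d (even m) = 1}"
proof -
  have "dmono m \<in> M \<longleftrightarrow> d (even m) = 1" for m
  proof
    assume "dmono m \<in> M"
    then have e: "(\<lambda>z. d (even m) * dmono m z) = dmono m"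
      unfolding d[of m, symmetric] by (rule dirichlet_proj_id[OF M])
    have "taylor_coeff (\<lambda>z. d (even m) * dmono m z) m = d (even m) * taylor_coeff (dmono m) m"
      by (rule taylor_coeff_cmult[OF dirichlet_space_holomorphic[OF dmono_in]])
    then show "d (even m) = 1" unfolding e by (simp add: taylor_coeff_dmono)
  next
    assume "d (even m) = 1"
    then show "dmono m \<in> M" using dirichlet_proj_in[OF M dmono_in, of m] by (simp add: d)
  qed
  moreover have "M = coord_space {m. dmono m \<in> M}"
    by (rule closed_subspace_eq_coord_space[OF M]) (use d in blast)
  ultimately show ?thesis by simp
qed

context reducing_blaschke
begin

lemma Reg_near_0:
  assumes "e > 0" obtains b where "b \<in> Reg" "cmod b < e"
proof -
  have "\<forall>\<^sub>F z in at 0. z \<in> Reg" by (rule eventually_Reg) simp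
  moreover have "\<forall>\<^sub>F z in at (0::complex). cmod z < e"
    using eventually_at_ball[OF assms, of 0 UNIV] by eventually_elim simp
  ultimately have "\<forall>\<^sub>F z in at 0. z \<in> Reg \<and> cmod z < e" by (rule eventually_conj)
  then have "\<exists>z. z \<in> Reg \<and> cmod z < e" by (rule eventually_happens'[OF at_neq_bot])
  then show ?thesis using that by blast
qed

lemma h_fibre_sum: "b \<in> Reg \<Longrightarrow> b * h n b = (\<Sum>y\<in>fib b. s b y * y ^ Suc n)"
  using L_fibre_sum[of b "monom 1 n"] by (simp add: L_monom poly_monom mult.assoc)

lemma h_eq_cmult_dmono:
  assumes "\<And>b. b \<in> Reg \<Longrightarrow> b * h n b = \<omega> * b ^ Suc n"
  shows "h n = (\<lambda>z. \<omega> * dmono n z)"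
proof
  fix z :: complex
  show "h n z = \<omega> * dmono n z"
  proof (cases "z \<in> ball 0 1")
    case True
    have "h n z = \<omega> * z ^ n"
    proof (rule eq_on_disc_of_Reg[OF h_holomorphic _ _ True])
      show "(\<lambda>z. \<omega> * z ^ n) holomorphic_on ball 0 1" by (intro holomorphic_intros)
      fix b assume b: "b \<in> Reg"
      have "b \<noteq> 0" by (rule fib_nonzero[OF b fib_self[OF Reg_ball[OF b]]])
      then show "h n b = \<omega> * b ^ n" using assms[OF b] by simp
    qed
    then show ?thesis using True by (simp add: dmono_def disc_ext_def)
  next
    case False
    then show ?thesis using dirichlet_space_outside[OF h_in False] by (simp add: dmono_def disc_ext_def)
  qed
qed

text \<open>With only the diagonal weight left, every monomial is an eigenvector with the same
  eigenvalue, since the diagonal weight is the same at all points of \<open>Reg\<close>.\<close>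

lemma trivial_of_s_eq_0:
  assumes "\<And>b y. b \<in> Reg \<Longrightarrow> y \<in> fib b \<Longrightarrow> y \<noteq> b \<Longrightarrow> s b y = 0"
  shows "M = {\<lambda>z. 0} \<or> M = dirichlet_space"
proof -
  obtain b2 where b2: "b2 \<in> Reg" using Reg_near_0[of 1] by auto
  have "h n = (\<lambda>z. s b2 b2 * dmono n z)" for n
  proof (rule h_eq_cmult_dmono)
    fix b assume b: "b \<in> Reg"
    have "(\<Sum>y\<in>fib b. s b y * y ^ Suc n) = (\<Sum>y\<in>{b}. s b y * y ^ Suc n)"
      by (rule sum.mono_neutral_right)
         (use finite_fib[OF Reg_ball[OF b]] fib_self[OF Reg_ball[OF b]] assms[OF b] in auto)
    then show "b * h n b = s b2 b2 * b ^ Suc n"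
      using h_fibre_sum[OF b] s_diag[OF b b2] by simp
  qed
  then have "M = coord_space {m. s b2 b2 = 1}"
    using closed_subspace_even_diagonal[OF M_closed, of "\<lambda>_. s b2 b2"] by (simp add: h_def P_def)
  then show ?thesis by (cases "s b2 b2 = 1") (simp_all add: coord_space_UNIV coord_space_empty)
qed

lemma fib_pq: "y \<in> fib b \<Longrightarrow> b \<in> ball 0 1 \<Longrightarrow> poly p y * poly q b = poly p b * poly q y"
  using phi_q[of y] phi_q[of b] fib_ball[of y b] by (simp add: fib_def mult_ac flip: phi_q)

text \<open>A nonzero weight would occur over points \<open>b k\<close> tending to \<open>0\<close>,
  at fibre points accumulating at a zero \<open>yl\<close> of \<phi>. If \<open>yl = 0\<close>,
  local injectivity at \<open>0\<close> makes the branch diagonal. Otherwise, at a zero of order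
  \<open>m + 1\<close>, the derivative of \<phi> is of size \<open>|y - yl| ^ m\<close> while
  \<open>|b|\<close> is of size \<open>|y - yl| ^ (m + 1)\<close>, which \<open>s_bound\<close> does
  not permit.\<close>

lemma s_eq_0_of_simple_zero:
  assumes d: "deriv \<phi> 0 \<noteq> 0" and b1: "b1 \<in> Reg" and y1: "y1 \<in> fib b1" "y1 \<noteq> b1"
  shows "s b1 y1 = 0"
proof (rule ccontr)
  define \<omega> where "\<omega> = s b1 y1"
  assume "s b1 y1 \<noteq> 0"
  then have \<omega>: "\<omega> \<noteq> 0" by (simp add: \<omega>_def)
  obtain C where C: "C > 0" "\<And>b y. b \<in> Reg \<Longrightarrow> cmod b \<le> 1 / 2 \<Longrightarrow> y \<in> fib b \<Longrightarrow>
       cmod (s b y) * cmod y * cmod (poly q y * deriv \<phi> y) \<le> C * cmod b"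
    using s_bound by metis
  have "\<exists>b y. b \<in> Reg \<and> cmod b < 1 / real (k + 2) \<and> y \<in> fib b \<and> y \<noteq> b \<and> s b y = \<omega>" for k
  proof -
    obtain b where b: "b \<in> Reg" "cmod b < 1 / real (k + 2)" using Reg_near_0[of "1 / real (k + 2)"] by auto
    then show ?thesis using s_values[OF b1 b(1) y1] unfolding \<omega>_def by blast
  qed
  then obtain b y where b: "\<And>k. b k \<in> Reg" "\<And>k. cmod (b k) < 1 / real (k + 2)"
    and y: "\<And>k. y k \<in> fib (b k)" "\<And>k. y k \<noteq> b k" "\<And>k. s (b k) (y k) = \<omega>" by metis
  have b0: "b \<longlonglongrightarrow> 0"
  proof (rule tendsto_norm_zero_cancel, rule tendsto_zero_sandwich)
    show "(\<lambda>k. 1 / real (k + 2)) \<longlonglongrightarrow> 0" using LIMSEQ_ignore_initial_segment[OF lim_1_over_n] .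
  qed (use b(2) less_imp_le in auto)
  have "y k \<in> cball 0 1" for k using fib_ball[OF y(1)[of k]] by simp
  then obtain yl r where r: "strict_mono (r :: nat \<Rightarrow> nat)" "(y \<circ> r) \<longlonglongrightarrow> yl"
    using compact_cball[of "0::complex" 1] unfolding compact_def by metis
  have br: "(\<lambda>k. b (r k)) \<longlonglongrightarrow> 0" using LIMSEQ_subseq_LIMSEQ[OF b0 r(1)] by (simp add: o_def)
  have yr: "(\<lambda>k. y (r k)) \<longlonglongrightarrow> yl" using r(2) by (simp add: o_def)
  have lim_b: "(\<lambda>k. poly f (b (r k))) \<longlonglongrightarrow> poly f 0" for f :: "complex poly"
    by (rule isCont_tendsto_compose[OF _ br]) simp
  have lim_y: "(\<lambda>k. poly f (y (r k))) \<longlonglongrightarrow> poly f yl" for f :: "complex poly"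
    by (rule isCont_tendsto_compose[OF _ yr]) simp
  have pq: "poly p (y k) * poly q (b k) = poly p (b k) * poly q (y k)" for k
    by (rule fib_pq[OF y(1) Reg_ball[OF b(1)]])
  have "poly p yl * poly q 0 = poly p 0 * poly q yl"
  proof (rule LIMSEQ_unique)
    show "(\<lambda>k. poly p (y (r k)) * poly q (b (r k))) \<longlonglongrightarrow> poly p yl * poly q 0" by (intro tendsto_mult lim_y lim_b)
    show "(\<lambda>k. poly p (y (r k)) * poly q (b (r k))) \<longlonglongrightarrow> poly p 0 * poly q yl"
      unfolding pq by (intro tendsto_mult lim_y lim_b)
  qed
  then have pyl: "poly p yl = 0" using poly_p_0 poly_q_0 by simp
  show False
  proof (cases "yl = 0")
    case True
    obtain e where e: "e > 0" "inj_on \<phi> (ball 0 e)"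
      using has_complex_derivative_locally_invertible[OF phi_holomorphic _ open_ball d] by auto
    have "\<forall>\<^sub>F k in sequentially. y (r k) \<in> ball 0 e \<and> b (r k) \<in> ball 0 e"
      using topological_tendstoD[OF yr open_ball[of 0 e]] topological_tendstoD[OF br open_ball[of 0 e]] e(1) True
      by (intro eventually_conj) auto
    then obtain k where k: "y (r k) \<in> ball 0 e" "b (r k) \<in> ball 0 e"
      using eventually_happens'[OF sequentially_bot] by blast
    then have "y (r k) = b (r k)" using inj_onD[OF e(2)] y(1)[of "r k"] by (auto simp: fib_def)
    then show False using y(2) by blast
  next
    case False
    obtain p1 where p1: "p = [:- yl, 1:] ^ order yl p * p1" "\<not> [:- yl, 1:] dvd p1"
      using order_decomp[OF p_nonzero] by metis
    have p1yl: "poly p1 yl \<noteq> 0" using p1(2) by (simp add: poly_eq_0_iff_dvd)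
    obtain m where m: "order yl p = Suc m" using order_root[of p yl] pyl p_nonzero by (cases "order yl p") auto
    let ?X = "[:- yl, 1:]"
    have p: "p = ?X ^ Suc m * p1" using p1(1) m by simp
    let ?W = "pderiv p * q - p * pderiv q"
    \<comment> \<open>Cofactor of the numerator of \<phi>' after the power \<open>?X ^ m\<close> is
      removed; it does not vanish at \<open>yl\<close>.\<close>
    define T where "T = smult (of_nat (Suc m)) (p1 * q) + ?X * (pderiv p1 * q - p1 * pderiv q)"
    have dp: "pderiv p = smult (of_nat (Suc m)) (?X ^ m) * p1 + ?X ^ Suc m * pderiv p1"
      unfolding p pderiv_mult pderiv_power_Suc by (simp add: pderiv_pCons mult.commute[of p1])
    have W: "?W = ?X ^ m * T"
    proof -
      have "(smult a A * p1 + X * A * p1') * q - X * A * p1 * q' = A * (smult a (p1 * q) + X * (p1' * q - p1 * q'))"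
        for a and A X p1' q' :: "complex poly"
        by (simp add: algebra_simps)
      from this[of "of_nat (Suc m)" "?X ^ m" ?X "pderiv p1" "pderiv q"] show ?thesis
        unfolding dp T_def unfolding p by (simp only: power_Suc)
    qed
    have Tyl: "poly T yl \<noteq> 0"
      using p1yl q_nonzero[of yl] poly_p_eq_0[OF pyl] by (simp add: T_def del: of_nat_Suc)
    obtain p0 where p0: "p = [:0, 1:] * p0" using poly_p_0 by (metis dvdE minus_zero poly_eq_0_iff_dvd)
    have "poly ?W 0 \<noteq> 0" using deriv_phi[of 0] d poly_q_0 by simp
    then have p00: "poly p0 0 \<noteq> 0" using poly_p_0 poly_q_0 unfolding p0 pderiv_mult by (simp add: pderiv_pCons)
    \<comment> \<open>\<open>s_bound\<close> is multiplied by the moduli of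
      \<open>poly q (y k)\<close> and \<open>poly p0 (b k)\<close>, and the fibre relation replaces
      \<open>p\<close> at \<open>b k\<close> by \<open>p\<close> at \<open>y k\<close>. The common
      power of \<open>?X\<close> cancels, and one factor \<open>?X\<close>, tending to
      \<open>0\<close>, remains on the right.\<close>
    have "cmod \<omega> * cmod (y k) * cmod (poly T (y k)) * cmod (poly p0 (b k))
        \<le> C * (cmod (poly ?X (y k)) * cmod (poly p1 (y k)) * cmod (poly q (b k)))" for k
    proof -
      let ?y = "y k" and ?b = "b k"
      have yb: "?y \<in> ball 0 1" and bb: "?b \<in> ball 0 1" using fib_ball[OF y(1)] Reg_ball[OF b(1)] by auto
      have "cmod ?b \<le> 1 / 2" using b(2)[of k] by (rule order_trans[OF less_imp_le]) (simp add: field_simps)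
      then have "cmod \<omega> * cmod ?y * cmod (poly q ?y * deriv \<phi> ?y) \<le> C * cmod ?b"
        using C(2)[OF b(1) _ y(1)] y(3) by metis
      then have "cmod \<omega> * cmod ?y * cmod (poly q ?y * deriv \<phi> ?y) * (cmod (poly q ?y) * cmod (poly p0 ?b))
          \<le> C * cmod ?b * (cmod (poly q ?y) * cmod (poly p0 ?b))"
        by (rule mult_right_mono) simp
      moreover have "cmod (poly q ?y * deriv \<phi> ?y) * cmod (poly q ?y) = cmod (poly ?X ?y) ^ m * cmod (poly T ?y)"
        using arg_cong[OF deriv_phi[OF yb], of cmod] unfolding W
        by (simp add: norm_mult norm_power power2_eq_square mult_ac)
      moreover have "cmod ?b * (cmod (poly q ?y) * cmod (poly p0 ?b))
          = cmod (poly ?X ?y) ^ m * (cmod (poly ?X ?y) * cmod (poly p1 ?y) * cmod (poly q ?b))"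
      proof -
        have "cmod ?b * (cmod (poly q ?y) * cmod (poly p0 ?b)) = cmod (poly p ?b * poly q ?y)"
          by (simp add: p0 norm_mult)
        also have "\<dots> = cmod (poly p ?y * poly q ?b)" by (simp only: pq)
        also have "\<dots> = cmod (poly ?X ?y) ^ m * (cmod (poly ?X ?y) * cmod (poly p1 ?y) * cmod (poly q ?b))"
          by (subst p) (simp only: poly_mult poly_power norm_mult norm_power power_Suc mult_ac)
        finally show ?thesis .
      qed
      ultimately have le: "cmod (poly ?X ?y) ^ m * (cmod \<omega> * cmod ?y * cmod (poly T ?y) * cmod (poly p0 ?b))
          \<le> cmod (poly ?X ?y) ^ m * (C * (cmod (poly ?X ?y) * cmod (poly p1 ?y) * cmod (poly q ?b)))"
        by (simp only: mult_ac)
      have "\<phi> ?y \<noteq> 0" using b(1)[of k] y(1)[of k] by (auto simp: Reg_def fib_def)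
      then have "poly p ?y \<noteq> 0" using phi_pq[OF yb] by auto
      then have "cmod (poly ?X ?y) ^ m > 0" by (auto simp: p)
      then show ?thesis using le by (rule mult_left_le_imp_le[rotated])
    qed
    then have le: "cmod \<omega> * cmod (y (r k)) * cmod (poly T (y (r k))) * cmod (poly p0 (b (r k)))
        \<le> C * (cmod (poly ?X (y (r k))) * cmod (poly p1 (y (r k))) * cmod (poly q (b (r k))))" for k .
    have "cmod \<omega> * cmod yl * cmod (poly T yl) * cmod (poly p0 0)
        \<le> C * (cmod (poly ?X yl) * cmod (poly p1 yl) * cmod (poly q 0))"
    proof (rule LIMSEQ_le)
      show "(\<lambda>k. cmod \<omega> * cmod (y (r k)) * cmod (poly T (y (r k))) * cmod (poly p0 (b (r k))))
          \<longlonglongrightarrow> cmod \<omega> * cmod yl * cmod (poly T yl) * cmod (poly p0 0)"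
        by (intro tendsto_mult tendsto_norm tendsto_const lim_b lim_y yr)
      show "(\<lambda>k. C * (cmod (poly ?X (y (r k))) * cmod (poly p1 (y (r k))) * cmod (poly q (b (r k)))))
          \<longlonglongrightarrow> C * (cmod (poly ?X yl) * cmod (poly p1 yl) * cmod (poly q 0))"
        by (intro tendsto_mult tendsto_norm tendsto_const lim_b lim_y)
    qed (use le in blast)
    then have "cmod \<omega> * cmod yl * cmod (poly T yl) * cmod (poly p0 0) \<le> 0" by simp
    moreover have "cmod \<omega> * cmod yl * cmod (poly T yl) * cmod (poly p0 0) > 0"
      using \<omega> False Tyl p00 by simp
    ultimately show False by simp
  qed
qed

text \<open>By \<open>s_values\<close> off-diagonal weights take finitely many values, so one that
  tends to \<open>0\<close> is eventually \<open>0\<close>. At a simple zero away from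
  \<open>0\<close> the factor \<open>f\<close> stays bounded below, and \<open>s_bound\<close> makes
  the weight at most of size \<open>|z|\<close>.\<close>

lemma s_eq_0_near_simple_zero:
  assumes \<alpha>: "\<alpha> \<in> ball 0 1" "\<alpha> \<noteq> 0" "\<phi> \<alpha> = 0" "deriv \<phi> \<alpha> \<noteq> 0" and r: "r > 0"
  obtains d where "d > 0"
    "\<And>z. z \<in> Reg \<Longrightarrow> cmod z < d \<Longrightarrow> \<exists>y\<in>fib z. cmod (y - \<alpha>) < r \<and> y \<noteq> z \<and> s z y = 0"
proof -
  obtain C where C: "C > 0" "\<And>b y. b \<in> Reg \<Longrightarrow> cmod b \<le> 1 / 2 \<Longrightarrow> y \<in> fib b \<Longrightarrow>
       cmod (s b y) * cmod y * cmod (poly q y * deriv \<phi> y) \<le> C * cmod b"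
    using s_bound by metis
  define f where "f y = cmod y * cmod (poly q y * deriv \<phi> y)" for y
  have f\<alpha>: "f \<alpha> > 0" using \<alpha> q_nonzero[of \<alpha>] by (simp add: f_def)
  have "continuous_on (ball 0 1) f"
    unfolding f_def
    by (intro continuous_intros holomorphic_on_imp_continuous_on[OF holomorphic_deriv[OF phi_holomorphic]]) auto
  then have "isCont f \<alpha>" using \<alpha>(1) by (simp add: continuous_on_eq_continuous_at)
  then have "\<forall>\<^sub>F y in nhds \<alpha>. f y > f \<alpha> / 2"
    using f\<alpha> by (intro order_tendstoD(1)[of f "f \<alpha>"]) (auto simp: isCont_def tendsto_at_iff_tendsto_nhds)
  then obtain r1 where r1: "r1 > 0" "\<And>y. dist y \<alpha> < r1 \<Longrightarrow> f y > f \<alpha> / 2"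
    unfolding eventually_nhds_metric by blast
  \<comment> \<open>\<open>cmod \<alpha> / 2\<close> keeps \<open>y\<close> farther from
    \<open>0\<close> than \<open>z\<close>, hence different from it;
    \<open>1 - cmod \<alpha>\<close> keeps \<open>y\<close> in the disc.\<close>
  define r2 where "r2 = Min {r, r1, cmod \<alpha> / 2, 1 - cmod \<alpha>}"
  have r2: "r2 > 0" "r2 \<le> r" "r2 \<le> r1" "r2 \<le> cmod \<alpha> / 2" "r2 \<le> 1 - cmod \<alpha>"
    using r r1(1) \<alpha> by (simp_all add: r2_def min_def)
  have sub: "ball \<alpha> r2 \<subseteq> ball 0 1"
  proof
    fix x assume "x \<in> ball \<alpha> r2"
    then show "x \<in> ball 0 1" using r2(5) norm_triangle_sub[of x \<alpha>] by (simp add: dist_norm norm_minus_commute)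
  qed
  obtain r3 where r3: "r3 > 0" "ball \<alpha> r3 \<subseteq> ball \<alpha> r2" "open (\<phi> ` ball \<alpha> r3)"
    using has_complex_derivative_locally_invertible[OF holomorphic_on_subset[OF phi_holomorphic sub] _ open_ball \<alpha>(4)] r2(1)
    by auto
  have "0 \<in> \<phi> ` ball \<alpha> r3" using \<alpha>(3) r3(1) by (metis centre_in_ball imageI)
  moreover have "(\<phi> \<longlongrightarrow> \<phi> 0) (nhds 0)"
    using continuous_at_disc[OF phi_holomorphic, of 0] by (simp add: isCont_def tendsto_at_iff_tendsto_nhds)
  ultimately have "\<forall>\<^sub>F z in nhds 0. \<phi> z \<in> \<phi> ` ball \<alpha> r3"
    using topological_tendstoD[OF _ r3(3)] phi_zero by simp
  then obtain d1 where d1: "d1 > 0" "\<And>z. dist z 0 < d1 \<Longrightarrow> \<phi> z \<in> \<phi> ` ball \<alpha> r3"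
    unfolding eventually_nhds_metric by blast
  obtain b2 where b2: "b2 \<in> Reg" using Reg_near_0[of 1] by auto
  \<comment> \<open>Moduli of the nonzero weights; \<open>1\<close> is inserted so that the minimum
    exists when there are none.\<close>
  define F where "F = insert 1 ((\<lambda>y. cmod (s b2 y)) ` {y \<in> fib b2. s b2 y \<noteq> 0})"
  have F: "finite F" using finite_fib[OF Reg_ball[OF b2]] by (simp add: F_def)
  define \<eta> where "\<eta> = Min F"
  have \<eta>: "\<eta> > 0" unfolding \<eta>_def using F by (subst Min_gr_iff) (auto simp: F_def)
  define d where "d = Min {d1, 1 / 2, cmod \<alpha> / 2, \<eta> * (f \<alpha> / 2) / C}"
  have d: "d \<le> d1" "d \<le> 1 / 2" "d \<le> cmod \<alpha> / 2" "d \<le> \<eta> * (f \<alpha> / 2) / C"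
    unfolding d_def by (rule Min_le; simp)+
  have d0: "d > 0" unfolding d_def using d1(1) \<alpha> \<eta> f\<alpha> C(1) by (subst Min_gr_iff) auto
  have "\<exists>y\<in>fib z. cmod (y - \<alpha>) < r \<and> y \<noteq> z \<and> s z y = 0" if z: "z \<in> Reg" "cmod z < d" for z
  proof -
    obtain y where y: "y \<in> ball \<alpha> r3" "\<phi> y = \<phi> z" using d1(2)[of z] z(2) d(1) by auto
    have y2: "dist \<alpha> y < r2" using y(1) r3(2) by auto
    have yfib: "y \<in> fib z" using y(2) y2 sub by (auto simp: fib_def)
    have "cmod \<alpha> \<le> cmod y + dist \<alpha> y" using norm_triangle_sub[of \<alpha> y] by (simp add: dist_norm)
    then have "cmod y > cmod z" using y2 r2(4) d(3) z(2) by linarith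
    then have ne: "y \<noteq> z" by auto
    have "s z y = 0"
    proof (rule ccontr)
      assume n: "s z y \<noteq> 0"
      obtain y' where y': "y' \<in> fib b2" "s b2 y' = s z y" using s_values[OF z(1) b2 yfib ne] by auto
      then have "\<eta> \<le> cmod (s z y)" unfolding \<eta>_def using n F by (intro Min_le) (auto simp: F_def image_iff)
      then have "\<eta> * (f \<alpha> / 2) \<le> cmod (s z y) * f y"
        using \<eta> f\<alpha> r1(2)[of y] y2 r2(3) by (intro mult_mono) (auto simp: dist_commute)
      also have "\<dots> \<le> C * cmod z"
        using C(2)[OF z(1) _ yfib] z(2) d(2) by (simp add: f_def mult.assoc)
      also have "\<dots> < C * d" using C(1) z(2) by simp
      also have "\<dots> \<le> \<eta> * (f \<alpha> / 2)" using d(4) C(1) by (simp add: pos_le_divide_eq mult_ac)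
      finally show False by simp
    qed
    moreover have "cmod (y - \<alpha>) < r" using y2 r2(2) by (simp add: dist_norm norm_minus_commute)
    ultimately show ?thesis using yfib ne by blast
  qed
  then show ?thesis using that d0 by blast
qed

section \<open>Multiplicities of the zeros and the surviving branches\<close>

lemma nontrivial_obtains:
  assumes "M \<noteq> {\<lambda>z. 0}" "M \<noteq> dirichlet_space"
  obtains b y where "b \<in> Reg" "y \<in> fib b" "y \<noteq> b" "s b y \<noteq> 0"
  using trivial_of_s_eq_0 assms by blast

lemma simple_zero:
  assumes "p = [:\<alpha>, -1:] * k" "poly k \<alpha> \<noteq> 0" "\<alpha> \<in> ball 0 1"
  shows "\<phi> \<alpha> = 0" "deriv \<phi> \<alpha> \<noteq> 0"
proof -
  show "\<phi> \<alpha> = 0" using phi_pq[OF assms(3)] by (simp add: assms(1))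
  have "poly (pderiv p * q - p * pderiv q) \<alpha> = - poly k \<alpha> * poly q \<alpha>"
    unfolding assms(1) pderiv_mult by (simp add: pderiv_pCons)
  then show "deriv \<phi> \<alpha> \<noteq> 0"
    using deriv_phi[OF assms(3)] assms(2,3) q_nonzero[of \<alpha>] by auto
qed

lemma multiple_zero:
  assumes "p = [:0, 0, 1:] * k" shows "deriv \<phi> 0 = 0"
proof -
  have "poly (pderiv p * q - p * pderiv q) 0 = 0"
    unfolding assms pderiv_mult by (simp add: pderiv_pCons)
  then show ?thesis using deriv_phi[of 0] poly_q_0 by simp
qed

text \<open>A branch through a simple zero \<open>\<alpha>\<close> of \<open>\<phi>\<close> must map \<open>\<alpha>\<close> to itself and hence is the identity,
  when all other zeros are multiple.\<close>
lemma no_branch: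
  assumes \<sigma>: "\<sigma> holomorphic_on ball 0 1" "\<And>b. b \<in> ball 0 1 \<Longrightarrow> \<sigma> b \<in> fib b" "\<And>b. b \<in> Reg \<Longrightarrow> \<sigma> b \<noteq> b"
    and \<alpha>: "\<alpha> \<in> ball 0 1" "\<phi> \<alpha> = 0" "deriv \<phi> \<alpha> \<noteq> 0"
    and other: "\<And>w. w \<in> ball 0 1 \<Longrightarrow> \<phi> w = 0 \<Longrightarrow> w \<noteq> \<alpha> \<Longrightarrow> deriv \<phi> w = 0"
  shows False
proof -
  have \<sigma>b: "\<sigma> z \<in> ball 0 1" "\<phi> (\<sigma> z) = \<phi> z" if "z \<in> ball 0 1" for z using \<sigma>(2)[OF that] by (auto simp: fib_def)
  have "(\<sigma> has_field_derivative deriv \<sigma> \<alpha>) (at \<alpha>)" by (rule holomorphic_derivI[OF \<sigma>(1) open_ball \<alpha>(1)])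
  from DERIV_chain2[OF disc_multiplier_deriv[OF multiplier \<sigma>b(1)[OF \<alpha>(1)]] this]
  have "((\<lambda>z. \<phi> (\<sigma> z)) has_field_derivative deriv \<phi> (\<sigma> \<alpha>) * deriv \<sigma> \<alpha>) (at \<alpha>)" .
  moreover have "\<forall>\<^sub>F z in nhds \<alpha>. \<phi> z = \<phi> (\<sigma> z)"
    using \<sigma>b(2) \<alpha>(1) by (auto intro!: eventually_nhds_in_open[of "ball 0 1", THEN eventually_mono])
  ultimately have "(\<phi> has_field_derivative deriv \<phi> (\<sigma> \<alpha>) * deriv \<sigma> \<alpha>) (at \<alpha>)"
    using DERIV_cong_ev[OF refl _ refl, of \<phi> "\<lambda>z. \<phi> (\<sigma> z)"] by blast
  then have "deriv \<phi> \<alpha> = deriv \<phi> (\<sigma> \<alpha>) * deriv \<sigma> \<alpha>" by (rule DERIV_imp_deriv)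
  then have "deriv \<phi> (\<sigma> \<alpha>) \<noteq> 0" using \<alpha>(3) by auto
  then have \<sigma>\<alpha>: "\<sigma> \<alpha> = \<alpha>" using other \<sigma>b[OF \<alpha>(1)] \<alpha>(2) by metis
  obtain e where e: "e > 0" "inj_on \<phi> (ball \<alpha> e)"
    using has_complex_derivative_locally_invertible[OF phi_holomorphic \<alpha>(1) open_ball \<alpha>(3)] by auto
  have "(\<sigma> \<longlongrightarrow> \<alpha>) (at \<alpha>)" using continuous_at_disc[OF \<sigma>(1) \<alpha>(1)] \<sigma>\<alpha> by (simp add: isCont_def)
  then have "\<forall>\<^sub>F z in at \<alpha>. \<sigma> z \<in> ball \<alpha> e" using e(1) by (intro topological_tendstoD) auto
  moreover have "\<forall>\<^sub>F z in at \<alpha>. z \<in> ball \<alpha> e"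
    using eventually_at_ball[OF e(1), of \<alpha> UNIV] by eventually_elim simp
  ultimately have "\<forall>\<^sub>F z in at \<alpha>. False"
    using eventually_Reg[OF \<alpha>(1)]
  proof eventually_elim
    case (elim z)
    then have "\<sigma> z = z" using inj_onD[OF e(2)] \<sigma>b(2)[OF Reg_ball] by blast
    then show False using \<sigma>(3) elim by blast
  qed
  then show False by simp
qed

text \<open>For \<open>z\<close> near \<open>0\<close> the fibre consists of \<open>z\<close>, a
  point \<open>y\<close> near \<gamma> with weight \<open>0\<close>, and two more points. A nonzero
  weight \<open>k\<close> is carried by one or both of these. In the first case \<open>k\<close>, in
  the second the weight \<open>0\<close>, singles out a branch, and \<open>no_branch\<close>
  excludes it.\<close>

lemma trivial_triple_zero:
  assumes ls: "ls = [0, 0, 0, \<gamma>]" and \<gamma>: "\<gamma> \<noteq> 0"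
  shows "M = {\<lambda>z. 0} \<or> M = dirichlet_space"
proof (rule ccontr)
  assume "\<not> ?thesis"
  then obtain b1 y1 where b1: "b1 \<in> Reg" "y1 \<in> fib b1" "y1 \<noteq> b1" "s b1 y1 \<noteq> 0"
    using nontrivial_obtains by blast
  have \<gamma>b: "\<gamma> \<in> ball 0 1" using ls_ball ls by simp
  have p: "p = [:\<gamma>, -1:] * smult (- c) (monom 1 3)" "p = [:0, 0, 1:] * smult (- c) [:0, \<gamma>, -1:]"
    unfolding p_def by (simp_all add: ls monom_altdef numeral_3_eq_3 algebra_simps)
  have \<gamma>0: "\<phi> \<gamma> = 0" "deriv \<phi> \<gamma> \<noteq> 0"
    using simple_zero[OF p(1) _ \<gamma>b] \<gamma> c_nonzero by (auto simp: poly_monom)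
  have other: "deriv \<phi> w = 0" if w: "w \<in> ball 0 1" "\<phi> w = 0" "w \<noteq> \<gamma>" for w
  proof -
    have "poly p w = 0" using phi_q[OF w(1)] w(2) by simp
    then have "w \<in> set ls" unfolding p_def using c_nonzero by (simp add: poly_blaschke_num_eq_0_iff)
    then have "w = 0" using w(3) ls by auto
    then show ?thesis using multiple_zero[OF p(2)] by simp
  qed
  obtain d where d: "d > 0" "\<And>z. z \<in> Reg \<Longrightarrow> cmod z < d \<Longrightarrow> \<exists>y\<in>fib z. cmod (y - \<gamma>) < 1 \<and> y \<noteq> z \<and> s z y = 0"
    using s_eq_0_near_simple_zero[OF \<gamma>b \<gamma> \<gamma>0, of 1] by auto
  obtain z where z: "z \<in> Reg" "cmod z < d" using Reg_near_0[OF d(1)] by blast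
  obtain y where y: "y \<in> fib z" "y \<noteq> z" "s z y = 0" using d(2)[OF z] by blast
  note fin = finite_fib[OF Reg_ball[OF z(1)]]
  define k where "k = s b1 y1"
  have "\<exists>Q. branch_invariant Q \<and> card {x \<in> fib z. Q z x} = 1 \<and> (\<forall>b x. Q b x \<longrightarrow> x \<noteq> b)"
  proof -
    let ?Q = "\<lambda>k b x. \<not> (x = b) \<and> s b x = k"
    have inv: "branch_invariant (?Q k)" for k
      by (intro branch_invariant_conj branch_invariant_not branch_invariant_self branch_invariant_s[of "\<lambda>w. w = k"])
    let ?D = "fib z - {z, y}"
    have D: "card ?D = 2" "finite ?D" using card_fib[OF z(1)] fin y fib_self[OF Reg_ball[OF z(1)]]
      by (auto simp: card_Diff_subset)
    have A: "{x \<in> fib z. ?Q k z x} \<subseteq> ?D" using y(3) b1(4) by (auto simp: k_def)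
    have ne: "{x \<in> fib z. ?Q k z x} \<noteq> {}" using s_values[OF b1(1) z(1) b1(2,3)] by (auto simp: k_def)
    have "card {x \<in> fib z. ?Q k z x} \<le> 2" using card_mono[OF D(2) A] D(1) by simp
    moreover have "card {x \<in> fib z. ?Q k z x} \<noteq> 0" using ne finite_subset[OF A D(2)] by (simp only: card_eq_0_iff simp_thms)
    ultimately consider "card {x \<in> fib z. ?Q k z x} = 1" | "card {x \<in> fib z. ?Q k z x} = 2" by linarith
    then show ?thesis
    proof cases
      case 1
      then show ?thesis using inv[of k] by (intro exI[of _ "?Q k"]  conjI) auto
    next
      case 2
      then have eqD: "{x \<in> fib z. ?Q k z x} = ?D" using card_subset_eq[OF D(2) A] D(1) by simp
      have "x = y" if x: "x \<in> fib z" "?Q 0 z x" for x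
      proof -
        have "x \<notin> {x \<in> fib z. ?Q k z x}" using x b1(4) by (simp add: k_def)
        then show ?thesis using x unfolding eqD by simp
      qed
      then have "{x \<in> fib z. ?Q 0 z x} = {y}" using y by blast
      then have "card {x \<in> fib z. ?Q 0 z x} = 1" by (metis card_1_singleton_iff One_nat_def)
      then show ?thesis using inv[of 0] by (intro exI[of _ "?Q 0"]  conjI) auto
    qed
  qed
  then obtain Q where Q: "branch_invariant Q" "card {x \<in> fib z. Q z x} = 1" "\<And>b x. Q b x \<Longrightarrow> x \<noteq> b" by blast
  obtain \<sigma> where \<sigma>: "\<sigma> holomorphic_on ball 0 1" "\<And>b. b \<in> ball 0 1 \<Longrightarrow> \<sigma> b \<in> fib b"
    "\<And>b. b \<in> Reg \<Longrightarrow> {y \<in> fib b. Q b y} = {\<sigma> b}"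
    using unique_branch[OF Q(1) z(1) Q(2)] by metis
  have "\<sigma> b \<noteq> b" if "b \<in> Reg" for b using \<sigma>(3)[OF that] Q(3) by blast
  then show False using no_branch[OF \<sigma>(1,2) _ \<gamma>b \<gamma>0 other] by blast
qed

text \<open>Differentiating \<open>\<phi> \<circ> \<sigma> = \<phi>\<close> twice at the double zero gives \<open>\<sigma>' 0 = \<plusminus>1\<close>, so the Schwarz
  lemma applies.\<close>
lemma branch_at_double_zero:
  assumes \<sigma>: "\<sigma> holomorphic_on ball 0 1" "\<And>b. b \<in> ball 0 1 \<Longrightarrow> \<sigma> b \<in> fib b" "\<And>b. b \<in> Reg \<Longrightarrow> \<sigma> b \<noteq> b"
    and \<sigma>0: "\<sigma> 0 = 0" and p: "p = [:0, 0, 1:] * k" "poly k 0 \<noteq> 0" and z: "z \<in> ball 0 1"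
  shows "\<sigma> z = - z"
proof -
  have \<sigma>b: "\<sigma> z \<in> ball 0 1" "\<phi> (\<sigma> z) = \<phi> z" if "z \<in> ball 0 1" for z using \<sigma>(2)[OF that] by (auto simp: fib_def)
  define g where "g z = poly k z / poly q z" for z
  have \<phi>g: "\<phi> z = z\<^sup>2 * g z" if "z \<in> ball 0 1" for z
    using phi_pq[OF that] by (simp add: p(1) g_def power2_eq_square algebra_simps)
  have g0: "g 0 \<noteq> 0" using p(2) poly_q_0 by (simp add: g_def)
  have "isCont (\<lambda>z. poly k z / poly q z) 0" using poly_q_0 by (intro continuous_intros) simp
  then have g_cont: "isCont g 0" by (simp add: g_def[abs_def])
  have dl: "((\<lambda>z. \<sigma> z / z) \<longlongrightarrow> deriv \<sigma> 0) (at 0)"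
    using holomorphic_derivI[OF \<sigma>(1) open_ball, of 0] \<sigma>0 by (simp add: has_field_derivative_iff)
  have "((\<lambda>z. (\<sigma> z / z)\<^sup>2 * g (\<sigma> z)) \<longlongrightarrow> (deriv \<sigma> 0)\<^sup>2 * g 0) (at 0)"
  proof (intro tendsto_intros dl)
    have "(\<sigma> \<longlongrightarrow> 0) (at 0)" using continuous_at_disc[OF \<sigma>(1), of 0] \<sigma>0 by (simp add: isCont_def)
    then show "((\<lambda>z. g (\<sigma> z)) \<longlongrightarrow> g 0) (at 0)" by (rule isCont_tendsto_compose[OF g_cont])
  qed
  moreover have "\<forall>\<^sub>F z in at 0. (\<sigma> z / z)\<^sup>2 * g (\<sigma> z) = g z"
  proof -
    have "\<forall>\<^sub>F z in at (0::complex). z \<in> ball 0 1 \<and> z \<noteq> 0"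
      using eventually_at_ball'[of 1 "0::complex" UNIV] by simp
    then show ?thesis
    proof eventually_elim
      case (elim z)
      then have "(\<sigma> z)\<^sup>2 * g (\<sigma> z) = z\<^sup>2 * g z" using \<sigma>b[of z] \<phi>g[of z] \<phi>g[of "\<sigma> z"] by metis
      then show ?case using elim by (simp add: power_divide field_simps)
    qed
  qed
  ultimately have "(g \<longlongrightarrow> (deriv \<sigma> 0)\<^sup>2 * g 0) (at 0)" by (rule Lim_transform_eventually)
  moreover have "(g \<longlongrightarrow> g 0) (at 0)" using g_cont by (simp add: isCont_def)
  ultimately have "(deriv \<sigma> 0)\<^sup>2 * g 0 = g 0" by (rule tendsto_unique[OF at_neq_bot])
  then have d1: "(deriv \<sigma> 0)\<^sup>2 = 1" using g0 by simp
  then have "cmod (deriv \<sigma> 0) = 1" by (metis norm_one norm_power power2_eq_1_iff norm_ge_zero abs_norm_cancel abs_1 abs_minus)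
  then obtain a where a: "\<And>z. cmod z < 1 \<Longrightarrow> \<sigma> z = a * z"
    using Schwarz_Lemma(3)[OF \<sigma>(1) \<sigma>0, of 0] \<sigma>b(1) by auto
  have "((\<lambda>z. \<sigma> z / z) \<longlongrightarrow> a) (at 0)"
  proof (rule tendsto_eventually)
    show "\<forall>\<^sub>F z in at 0. \<sigma> z / z = a"
      using eventually_at_ball'[of 1 "0::complex" UNIV] by (auto elim!: eventually_mono simp: a)
  qed
  then have "a = deriv \<sigma> 0" using dl by (rule tendsto_unique[OF at_neq_bot])
  then have "a = 1 \<or> a = - 1" using d1 by (simp add: power2_eq_1_iff)
  moreover have "a \<noteq> 1"
  proof
    assume "a = 1"
    obtain b where "b \<in> Reg" using Reg_near_0[of 1] by auto
    then show False using \<sigma>(3) a[of b] \<open>a = 1\<close> Reg_ball[of b] by simp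
  qed
  ultimately show ?thesis using a[of z] z by auto
qed

text \<open>The points near \<alpha> and \<beta> have weight \<open>0\<close>, which leaves a single
  off-diagonal point to carry weight. It is a global branch \<sigma>, necessarily
  \<open>- z\<close>, and the formula for the projected monomials becomes diagonal by
  parity.\<close>

theorem double_zero_cases:
  assumes ls: "ls = [0, 0, \<alpha>, \<beta>]" and \<alpha>\<beta>: "\<alpha> \<noteq> 0" "\<beta> \<noteq> 0" "\<alpha> \<noteq> \<beta>"
    and nontriv: "M \<noteq> {\<lambda>z. 0}" "M \<noteq> dirichlet_space"
  shows "\<And>z. z \<in> ball 0 1 \<Longrightarrow> \<phi> (- z) = \<phi> z" "\<exists>b. M = coord_space {n. even n \<longleftrightarrow> b}"
proof -
  obtain b1 y1 where b1: "b1 \<in> Reg" "y1 \<in> fib b1" "y1 \<noteq> b1" "s b1 y1 \<noteq> 0"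
    using nontrivial_obtains[OF nontriv] by blast
  have ball: "\<alpha> \<in> ball 0 1" "\<beta> \<in> ball 0 1" using ls_ball ls by auto
  have p: "p = [:\<alpha>, -1:] * smult c ([:0, 0, 1:] * [:\<beta>, -1:])"
    "p = [:\<beta>, -1:] * smult c ([:0, 0, 1:] * [:\<alpha>, -1:])"
    "p = [:0, 0, 1:] * smult c ([:\<alpha>, -1:] * [:\<beta>, -1:])"
    unfolding p_def by (simp_all add: ls algebra_simps)
  have \<alpha>0: "\<phi> \<alpha> = 0" "deriv \<phi> \<alpha> \<noteq> 0" using simple_zero[OF p(1) _ ball(1)] \<alpha>\<beta> c_nonzero by auto
  have \<beta>0: "\<phi> \<beta> = 0" "deriv \<phi> \<beta> \<noteq> 0" using simple_zero[OF p(2) _ ball(2)] \<alpha>\<beta> c_nonzero by auto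
  \<comment> \<open>Half the distance, so that the points found near the two zeros are
    different.\<close>
  let ?r = "cmod (\<alpha> - \<beta>) / 2"
  have r: "?r > 0" using \<alpha>\<beta> by simp
  obtain d where d: "d > 0" "\<And>z. z \<in> Reg \<Longrightarrow> cmod z < d \<Longrightarrow> \<exists>y\<in>fib z. cmod (y - \<alpha>) < ?r \<and> y \<noteq> z \<and> s z y = 0"
    using s_eq_0_near_simple_zero[OF ball(1) \<alpha>\<beta>(1) \<alpha>0 r] by auto
  obtain d' where d': "d' > 0" "\<And>z. z \<in> Reg \<Longrightarrow> cmod z < d' \<Longrightarrow> \<exists>y\<in>fib z. cmod (y - \<beta>) < ?r \<and> y \<noteq> z \<and> s z y = 0"
    using s_eq_0_near_simple_zero[OF ball(2) \<alpha>\<beta>(2) \<beta>0 r] by auto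
  obtain z where z: "z \<in> Reg" "cmod z < min d d'" using Reg_near_0[of "min d d'"] d(1) d'(1) by auto
  obtain y y' where y: "y \<in> fib z" "cmod (y - \<alpha>) < ?r" "y \<noteq> z" "s z y = 0"
    and y': "y' \<in> fib z" "cmod (y' - \<beta>) < ?r" "y' \<noteq> z" "s z y' = 0"
    using d(2)[OF z(1)] d'(2)[OF z(1)] z(2) by auto
  have yy: "y \<noteq> y'"
    using y(2) y'(2) norm_triangle_ineq4[of "y - \<alpha>" "y - \<beta>"] by (auto simp: norm_minus_commute)
  note fin = finite_fib[OF Reg_ball[OF z(1)]]
  define k where "k = s b1 y1"
  let ?D = "fib z - {z, y, y'}"
  have D: "card ?D = 1" "finite ?D"
    using card_fib[OF z(1)] fin y y' yy fib_self[OF Reg_ball[OF z(1)]] by (auto simp: card_Diff_subset)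
  have inv: "branch_invariant (\<lambda>b x. \<not> (x = b) \<and> R (s b x))" for R
    by (intro branch_invariant_conj branch_invariant_not branch_invariant_self branch_invariant_s[of R])
  have card1: "card {x \<in> fib z. \<not> (x = z) \<and> R (s z x)} = 1" if R: "\<not> R 0" "R k" for R
  proof -
    have A: "{x \<in> fib z. \<not> (x = z) \<and> R (s z x)} \<subseteq> ?D" using y(4) y'(4) R(1) by auto
    have "{x \<in> fib z. \<not> (x = z) \<and> R (s z x)} \<noteq> {}"
      using s_values[OF b1(1) z(1) b1(2,3)] R(2) by (auto simp: k_def)
    then have "card {x \<in> fib z. \<not> (x = z) \<and> R (s z x)} \<noteq> 0"
      using finite_subset[OF A D(2)] by (simp only: card_eq_0_iff simp_thms)
    then show ?thesis using card_mono[OF D(2) A] D(1) by linarith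
  qed
  have k0: "k \<noteq> 0" using b1(4) by (simp add: k_def)
  let ?Q = "\<lambda>b x. \<not> (x = b) \<and> s b x = k"
  obtain \<sigma> where \<sigma>: "\<sigma> holomorphic_on ball 0 1" "\<And>b. b \<in> ball 0 1 \<Longrightarrow> \<sigma> b \<in> fib b"
    "\<And>b. b \<in> Reg \<Longrightarrow> {x \<in> fib b. ?Q b x} = {\<sigma> b}"
    using unique_branch[OF inv[of "\<lambda>w. w = k"] z(1) card1[of "\<lambda>w. w = k"]] k0 by auto
  have \<sigma>Q: "\<sigma> b \<noteq> b" "s b (\<sigma> b) = k" if "b \<in> Reg" for b using \<sigma>(3)[OF that] by blast+
  have only: "x = \<sigma> b" if b: "b \<in> Reg" and x: "x \<in> fib b" "x \<noteq> b" "s b x \<noteq> 0" for b x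
  proof -
    have "card {x \<in> fib b. \<not> (x = b) \<and> s b x \<noteq> 0} = card {x \<in> fib z. \<not> (x = z) \<and> s z x \<noteq> 0}"
      by (rule branch_invariant_card[OF inv[of "\<lambda>w. w \<noteq> 0"] b z(1)])
    also have "\<dots> = 1" using card1[of "\<lambda>w. w \<noteq> 0"] k0 by simp
    finally obtain w where w: "{x \<in> fib b. \<not> (x = b) \<and> s b x \<noteq> 0} = {w}" by (rule card_1_singletonE)
    moreover have "\<sigma> b \<in> {x \<in> fib b. \<not> (x = b) \<and> s b x \<noteq> 0}"
      using \<sigma>(2)[OF Reg_ball[OF b]] \<sigma>Q[OF b] k0 by simp
    moreover have "x \<in> {x \<in> fib b. \<not> (x = b) \<and> s b x \<noteq> 0}" using x by simp
    ultimately show ?thesis by simp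
  qed
  define a where "a = s z z"
  have h: "b * h n b = a * b ^ Suc n + k * \<sigma> b ^ Suc n" if b: "b \<in> Reg" for b n
  proof -
    have "(\<Sum>x\<in>fib b. s b x * x ^ Suc n) = (\<Sum>x\<in>{b, \<sigma> b}. s b x * x ^ Suc n)"
      by (rule sum.mono_neutral_right)
         (use finite_fib[OF Reg_ball[OF b]] fib_self[OF Reg_ball[OF b]] \<sigma>(2)[OF Reg_ball[OF b]] only[OF b] in auto)
    then show ?thesis using h_fibre_sum[OF b] \<sigma>Q[OF b] s_diag[OF b z(1)] by (simp add: a_def)
  qed
  \<comment> \<open>The case \<open>n = 0\<close> of the formula, extended to the point
    \<open>0\<close>, where its left side vanishes; as \<open>k \<noteq> 0\<close>, this fixes the
    value of \<sigma>.\<close>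
  have "0 * h 0 0 = a * 0 + k * \<sigma> 0"
  proof (rule eq_on_disc_of_Reg[of "\<lambda>b. b * h 0 b" "\<lambda>b. a * b + k * \<sigma> b"])
    show "(\<lambda>b. b * h 0 b) holomorphic_on ball 0 1" "(\<lambda>b. a * b + k * \<sigma> b) holomorphic_on ball 0 1"
      by (intro holomorphic_intros h_holomorphic \<sigma>(1))+
  qed (use h[of _ 0] in auto)
  then have \<sigma>0: "\<sigma> 0 = 0" using k0 by simp
  have neg: "\<sigma> b = - b" if "b \<in> ball 0 1" for b
    by (rule branch_at_double_zero[OF \<sigma>(1,2) \<sigma>Q(1) \<sigma>0 p(3) _ that]) (use \<alpha>\<beta> c_nonzero in auto)
  show "\<phi> (- b) = \<phi> b" if "b \<in> ball 0 1" for b using \<sigma>(2)[OF that] neg[OF that] by (simp add: fib_def)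
  \<comment> \<open>The eigenvalue on the monomial of degree \<open>n\<close>; the exponent is
    \<open>Suc n\<close>, so the sign is negative for even \<open>n\<close>.\<close>
  define e where "e w = a + k * (if w then -1 else 1)" for w
  have "h n = (\<lambda>z. e (even n) * dmono n z)" for n
  proof (rule h_eq_cmult_dmono)
    fix b assume b: "b \<in> Reg"
    show "b * h n b = e (even n) * b ^ Suc n"
      unfolding h[OF b] neg[OF Reg_ball[OF b]] e_def by (cases "even n") (simp_all add: algebra_simps)
  qed
  then have M: "M = coord_space {m. e (even m) = 1}"
    using closed_subspace_even_diagonal[OF M_closed, of e] by (simp add: h_def P_def)
  have ne: "(e True = 1) \<noteq> (e False = 1)"
  proof
    assume "(e True = 1) = (e False = 1)"
    then have "e (even m) = 1 \<longleftrightarrow> e True = 1" for m by (cases "even m") simp_all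
    then have "{m. e (even m) = 1} = (if e True = 1 then UNIV else {})" by auto
    then have "M = coord_space (if e True = 1 then UNIV else {})" using M by metis
    then have "M = coord_space UNIV \<or> M = coord_space {}" by (simp split: if_splits)
    then show False using nontriv coord_space_UNIV coord_space_empty by metis
  qed
  have "(e (even m) = 1) = (even m \<longleftrightarrow> e True = 1)" for m :: nat
    using ne by (cases "even m") auto
  then have "M = coord_space {n. even n \<longleftrightarrow> e True = 1}" using M by (simp only:)
  then show "\<exists>b. M = coord_space {n. even n \<longleftrightarrow> b}" by blast
qed

end

section \<open>Squares of products of order two\<close>

text \<open>Inner product of the Hardy space, for which multiplication by an inner function such as
  \<open>B\<close> is isometric.\<close>

definition hardy_inner :: "(complex \<Rightarrow> complex) \<Rightarrow> (complex \<Rightarrow> complex) \<Rightarrow> complex" where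
  "hardy_inner f g = (\<Sum>n. taylor_coeff f n * cnj (taylor_coeff g n))"

lemma hardy_inner_sums:
  assumes f: "f \<in> dirichlet_space" and g: "g \<in> dirichlet_space"
  shows "(\<lambda>n. taylor_coeff f n * cnj (taylor_coeff g n)) sums hardy_inner f g"
proof -
  have "norm (taylor_coeff f n * cnj (taylor_coeff g n))
      \<le> norm (of_nat (n + 1) * taylor_coeff f n * cnj (taylor_coeff g n))" for n
  proof -
    have "1 * norm (taylor_coeff f n * cnj (taylor_coeff g n))
        \<le> norm (of_nat (n + 1) :: complex) * norm (taylor_coeff f n * cnj (taylor_coeff g n))"
      by (rule mult_right_mono) (subst norm_of_nat, simp, rule norm_ge_zero)
    then show ?thesis by (simp add: norm_mult mult.assoc)
  qed
  then have "summable (\<lambda>n. taylor_coeff f n * cnj (taylor_coeff g n))"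
    by (intro summable_comparison_test'[OF dirichlet_inner_summable[OF f g]]) auto
  then show ?thesis unfolding hardy_inner_def by (rule summable_sums)
qed

lemma hardy_inner_linear_left:
  assumes f: "f \<in> dirichlet_space" and g: "g \<in> dirichlet_space" and k: "k \<in> dirichlet_space"
  shows "hardy_inner (\<lambda>z. a * f z + b * g z) k = a * hardy_inner f k + b * hardy_inner g k"
proof -
  have tc: "taylor_coeff (\<lambda>z. a * f z + b * g z) n = a * taylor_coeff f n + b * taylor_coeff g n" for n
    using dirichlet_space_holomorphic[OF f] dirichlet_space_holomorphic[OF g]
    by (simp add: taylor_coeff_add taylor_coeff_cmult holomorphic_on_mult)
  have "(\<lambda>n. a * (taylor_coeff f n * cnj (taylor_coeff k n)) + b * (taylor_coeff g n * cnj (taylor_coeff k n)))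
      sums (a * hardy_inner f k + b * hardy_inner g k)"
    by (intro sums_add sums_mult hardy_inner_sums assms)
  then show ?thesis unfolding hardy_inner_def[of "\<lambda>z. a * f z + b * g z"] tc
    by (simp add: sums_iff algebra_simps)
qed

lemma hardy_inner_cnj:
  assumes "f \<in> dirichlet_space" "g \<in> dirichlet_space"
  shows "cnj (hardy_inner f g) = hardy_inner g f"
proof -
  have "(\<lambda>n. cnj (taylor_coeff f n * cnj (taylor_coeff g n))) sums cnj (hardy_inner f g)"
    unfolding sums_cnj by (rule hardy_inner_sums[OF assms])
  then show ?thesis unfolding hardy_inner_def[of g] by (simp add: sums_iff mult.commute)
qed

lemma hardy_inner_linear_right:
  assumes f: "f \<in> dirichlet_space" and g: "g \<in> dirichlet_space" and k: "k \<in> dirichlet_space"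
  shows "hardy_inner k (\<lambda>z. a * f z + b * g z) = cnj a * hardy_inner k f + cnj b * hardy_inner k g"
proof -
  have "(\<lambda>z. a * f z + b * g z) \<in> dirichlet_space"
    by (intro dirichlet_space_add dirichlet_space_cmult f g)
  from hardy_inner_cnj[OF this k] have "hardy_inner k (\<lambda>z. a * f z + b * g z)
      = cnj (a * hardy_inner f k + b * hardy_inner g k)"
    unfolding hardy_inner_linear_left[OF assms] by simp
  then show ?thesis by (simp add: hardy_inner_cnj[OF f k] hardy_inner_cnj[OF g k])
qed

lemma disc_multiplier_id: "disc_multiplier (\<lambda>z. z)"
  using disc_multiplier_power[of 1] by simp

lemma hardy_inner_shift:
  assumes f: "f \<in> dirichlet_space" and g: "g \<in> dirichlet_space"
  shows "hardy_inner (mult_op (\<lambda>z. z) f) (mult_op (\<lambda>z. z) g) = hardy_inner f g"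
proof -
  have tc: "taylor_coeff (mult_op (\<lambda>z. z) k) n = (if n = 0 then 0 else taylor_coeff k (n - 1))"
    if "k \<in> dirichlet_space" for k n
    unfolding mult_op_def by (rule taylor_coeff_times_id[OF dirichlet_space_holomorphic[OF that]])
  let ?t = "\<lambda>n. taylor_coeff (mult_op (\<lambda>z. z) f) n * cnj (taylor_coeff (mult_op (\<lambda>z. z) g) n)"
  have "?t sums hardy_inner (mult_op (\<lambda>z. z) f) (mult_op (\<lambda>z. z) g)"
    by (intro hardy_inner_sums mult_op_in disc_multiplier_id f g)
  then have "(\<lambda>n. ?t (Suc n)) sums (hardy_inner (mult_op (\<lambda>z. z) f) (mult_op (\<lambda>z. z) g) - ?t 0)"
    using sums_Suc_iff[of ?t "hardy_inner (mult_op (\<lambda>z. z) f) (mult_op (\<lambda>z. z) g) - ?t 0"] by simp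
  moreover have "?t 0 = 0" by (simp add: tc[OF f])
  moreover have "?t (Suc n) = taylor_coeff f n * cnj (taylor_coeff g n)" for n by (simp add: tc f g)
  ultimately have "(\<lambda>n. taylor_coeff f n * cnj (taylor_coeff g n))
      sums hardy_inner (mult_op (\<lambda>z. z) f) (mult_op (\<lambda>z. z) g)" by simp
  then show ?thesis using hardy_inner_sums[OF f g] by (rule sums_unique2)
qed

definition blaschke2 :: "complex \<Rightarrow> complex \<Rightarrow> complex" where
  "blaschke2 \<gamma> z = z * disc_aut \<gamma> z"

lemma blaschke2_0 [simp]: "blaschke2 \<gamma> 0 = 0"
  by (simp add: blaschke2_def)

locale square_blaschke =
  fixes \<gamma> :: complex
  assumes \<gamma>: "\<gamma> \<in> ball 0 1" "\<gamma> \<noteq> 0"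
begin

abbreviation B :: "complex \<Rightarrow> complex" where "B \<equiv> blaschke2 \<gamma>"
abbreviation \<rho> :: "complex \<Rightarrow> complex" where "\<rho> \<equiv> disc_aut \<gamma>"
text \<open>Numerator of the derivative of \<open>B\<close> over
  \<open>(1 - cnj \<gamma> * z) ^ 2\<close>. Its only zero in the disc is the critical point, fixed
  by the involution \<open>\<rho>\<close> that interchanges the two preimages under
  \<open>B\<close>.\<close>

definition N :: "complex \<Rightarrow> complex" where "N z = \<gamma> - 2 * z + cnj \<gamma> * z\<^sup>2"

lemma den: "z \<in> ball 0 1 \<Longrightarrow> 1 - cnj \<gamma> * z \<noteq> 0"
  using disc_aut_denom_nonzero[of \<gamma> z] \<gamma> by auto

lemma rho_in: "z \<in> ball 0 1 \<Longrightarrow> \<rho> z \<in> ball 0 1"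
  using disc_aut_in_ball[of \<gamma> z] \<gamma>(1) by simp

lemma rho_mult: "z \<in> ball 0 1 \<Longrightarrow> \<rho> z * (1 - cnj \<gamma> * z) = \<gamma> - z"
  using den[of z] by (simp add: disc_aut_def)

lemma B_mult: "z \<in> ball 0 1 \<Longrightarrow> B z * (1 - cnj \<gamma> * z) = z * (\<gamma> - z)"
  using rho_mult[of z] by (simp add: blaschke2_def mult.assoc)

text \<open>Vieta for the quadratic equation \<open>B y = B z\<close>: the sum of its two solutions
  is affine in the common value.\<close>

lemma add_rho: assumes "z \<in> ball 0 1" shows "z + \<rho> z = \<gamma> + cnj \<gamma> * B z"
proof -
  have "(z + \<rho> z) * (1 - cnj \<gamma> * z) = (\<gamma> + cnj \<gamma> * B z) * (1 - cnj \<gamma> * z)"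
    unfolding distrib_right mult.assoc rho_mult[OF assms] B_mult[OF assms] by (simp add: algebra_simps)
  then show ?thesis using den[OF assms] by simp
qed

lemma B_eq_iff:
  assumes y: "y \<in> ball 0 1" and z: "z \<in> ball 0 1"
  shows "B y = B z \<longleftrightarrow> y = z \<or> y = \<rho> z"
proof -
  have "B y = B z \<longleftrightarrow> B y * (1 - cnj \<gamma> * y) * (1 - cnj \<gamma> * z) = B z * (1 - cnj \<gamma> * z) * (1 - cnj \<gamma> * y)"
    using den[OF y] den[OF z] by (auto simp: mult_ac)
  also have "\<dots> \<longleftrightarrow> (y - z) * (\<gamma> - z - y * (1 - cnj \<gamma> * z)) = 0"
    unfolding B_mult[OF y] B_mult[OF z] by (auto simp: algebra_simps)
  also have "\<dots> \<longleftrightarrow> y = z \<or> y = \<rho> z"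
    using den[OF z] unfolding rho_mult[OF z, symmetric] by auto
  finally show ?thesis .
qed

lemma B_rho: "z \<in> ball 0 1 \<Longrightarrow> B (\<rho> z) = B z"
  using B_eq_iff[of "\<rho> z" z] rho_in by simp

lemma B_has_derivative:
  assumes z: "z \<in> ball 0 1" shows "(B has_field_derivative N z / (1 - cnj \<gamma> * z)\<^sup>2) (at z)"
proof -
  have "((\<lambda>z. z * \<rho> z) has_field_derivative 1 * \<rho> z + (cnj \<gamma> * \<gamma> - 1) / (1 - cnj \<gamma> * z)\<^sup>2 * z) (at z)"
    by (rule DERIV_mult[OF DERIV_ident disc_aut_has_derivative[OF \<gamma>(1) z]])
  moreover have "1 * \<rho> z + (cnj \<gamma> * \<gamma> - 1) / (1 - cnj \<gamma> * z)\<^sup>2 * z = N z / (1 - cnj \<gamma> * z)\<^sup>2"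
  proof -
    let ?d = "1 - cnj \<gamma> * z"
    have "\<rho> z = (\<gamma> - z) * ?d / ?d\<^sup>2" using den[OF z] by (simp add: disc_aut_def power2_eq_square)
    then have "1 * \<rho> z + (cnj \<gamma> * \<gamma> - 1) / ?d\<^sup>2 * z = ((\<gamma> - z) * ?d + (cnj \<gamma> * \<gamma> - 1) * z) / ?d\<^sup>2"
      by (simp only: add_divide_distrib mult_1 times_divide_eq_left)
    also have "(\<gamma> - z) * ?d + (cnj \<gamma> * \<gamma> - 1) * z = N z"
      by (simp add: N_def power2_eq_square algebra_simps)
    finally show ?thesis .
  qed
  ultimately show ?thesis by (simp add: blaschke2_def[abs_def])
qed

text \<open>The two roots of \<open>N\<close> add up to \<open>2 / cnj \<gamma>\<close>, of modulus
  above \<open>2\<close>, so they cannot both lie in the disc.\<close>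

lemma N_unique_zero:
  assumes "N z = 0" "N w = 0" "z \<in> ball 0 1" "w \<in> ball 0 1" shows "z = w"
proof (rule ccontr)
  assume ne: "z \<noteq> w"
  have "(z - w) * (cnj \<gamma> * (z + w) - 2) = N z - N w" by (simp add: N_def power2_eq_square algebra_simps)
  then have "cnj \<gamma> * (z + w) = 2" using assms ne by simp
  then have "cmod \<gamma> * cmod (z + w) = 2" by (metis complex_mod_cnj norm_mult norm_numeral)
  moreover have "cmod (z + w) < 2" using norm_triangle_ineq[of z w] assms by simp
  then have "cmod \<gamma> * cmod (z + w) \<le> 1 * cmod (z + w)" using \<gamma>(1) by (intro mult_right_mono) auto
  ultimately show False using \<open>cmod (z + w) < 2\<close> by simp
qed

lemma N_zero: obtains \<mu> where "\<mu> \<in> ball 0 1" "\<mu> \<noteq> 0" "N \<mu> = 0" "\<rho> \<mu> = \<mu>"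
proof -
  \<comment> \<open>From the quadratic formula for \<open>N\<close>: the root inside the disc is
    \<open>(1 - t) / cnj \<gamma> = \<gamma> / (1 + t)\<close>.\<close>
  define t where "t = sqrt (1 - (cmod \<gamma>)\<^sup>2)"
  define \<mu> where "\<mu> = \<gamma> / of_real (1 + t)"
  have g1: "(cmod \<gamma>)\<^sup>2 < 1" using \<gamma>(1) by (simp add: abs_square_less_1)
  have t: "t > 0" "t\<^sup>2 = 1 - (cmod \<gamma>)\<^sup>2" using g1 by (simp_all add: t_def)
  have t1: "of_real (1 + t) \<noteq> (0::complex)" using t(1) by (metis add_pos_pos less_numeral_extra(1) less_numeral_extra(3) of_real_eq_0_iff)
  have "cmod \<mu> \<le> cmod \<gamma>" unfolding \<mu>_def norm_divide norm_of_real using t(1) by (simp add: divide_le_eq mult_le_cancel_left1)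
  then have \<mu>: "\<mu> \<in> ball 0 1" using \<gamma>(1) by simp
  have "cnj \<gamma> * \<gamma> = of_real (1 - t\<^sup>2)" using t(2) complex_norm_square[of \<gamma>] by (simp add: mult.commute)
  then have gg: "cnj \<gamma> * \<gamma> = (1 - of_real t) * of_real (1 + t)" by (simp add: power2_eq_square algebra_simps)
  have g: "\<gamma> = \<mu> * of_real (1 + t)" using t1 by (simp add: \<mu>_def)
  then have "cnj \<gamma> * \<mu> * of_real (1 + t) = (1 - of_real t) * of_real (1 + t)" using gg by (simp add: mult.assoc)
  then have "cnj \<gamma> * \<mu> = 1 - of_real t" using t1 by simp
  then have "N \<mu> = \<mu> * of_real (1 + t) - 2 * \<mu> + (1 - of_real t) * \<mu>"
    unfolding N_def power2_eq_square mult.assoc[symmetric] using g by simp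
  also have "\<dots> = 0" by (simp add: algebra_simps)
  finally have N: "N \<mu> = 0" .
  then have "\<mu> * (1 - cnj \<gamma> * \<mu>) = \<gamma> - \<mu>" by (simp add: N_def power2_eq_square algebra_simps)
  then have "\<rho> \<mu> = \<mu>" using rho_mult[OF \<mu>] den[OF \<mu>] by (metis mult_right_cancel)
  then show ?thesis using that \<mu> N \<gamma>(2) t1 by (simp add: \<mu>_def)
qed

text \<open>Such a \<open>\<tau>\<close> would swap the critical value \<open>B \<mu>\<close> with the non-critical value \<open>- B \<mu>\<close>.\<close>
lemma no_negating_map:
  assumes \<tau>: "\<tau> holomorphic_on ball 0 1" "\<And>z. z \<in> ball 0 1 \<Longrightarrow> \<tau> z \<in> ball 0 1"
    and neg: "\<And>z. z \<in> ball 0 1 \<Longrightarrow> B (\<tau> z) = - B z"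
  shows False
proof -
  obtain \<mu> where \<mu>: "\<mu> \<in> ball 0 1" "\<mu> \<noteq> 0" "N \<mu> = 0" "\<rho> \<mu> = \<mu>" using N_zero by blast
  define \<nu> where "\<nu> = \<tau> \<mu>"
  have \<nu>: "\<nu> \<in> ball 0 1" "B \<nu> = - B \<mu>" using \<tau>(2)[OF \<mu>(1)] neg[OF \<mu>(1)] by (simp_all add: \<nu>_def)
  have "B \<mu> \<noteq> 0" using \<mu> by (simp add: blaschke2_def)
  then have ne: "\<nu> \<noteq> \<mu>" using \<nu>(2) by auto
  have "B (\<tau> \<nu>) = B \<mu>" using neg[OF \<nu>(1)] \<nu>(2) by simp
  then have \<tau>\<nu>: "\<tau> \<nu> = \<mu>" using B_eq_iff[OF \<tau>(2)[OF \<nu>(1)] \<mu>(1)] \<mu>(4) by simp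
  have "(\<tau> has_field_derivative deriv \<tau> \<nu>) (at \<nu>)" by (rule holomorphic_derivI[OF \<tau>(1) open_ball \<nu>(1)])
  moreover have "(B has_field_derivative 0) (at (\<tau> \<nu>))" using B_has_derivative[OF \<mu>(1)] \<mu>(3) \<tau>\<nu> by simp
  ultimately have "((\<lambda>z. B (\<tau> z)) has_field_derivative 0 * deriv \<tau> \<nu>) (at \<nu>)" by (rule DERIV_chain2[rotated])
  moreover have "((\<lambda>z. - B z) has_field_derivative - (N \<nu> / (1 - cnj \<gamma> * \<nu>)\<^sup>2)) (at \<nu>)"
    by (rule DERIV_minus[OF B_has_derivative[OF \<nu>(1)]])
  moreover have "\<forall>\<^sub>F z in nhds \<nu>. B (\<tau> z) = - B z"
    by (rule eventually_mono[OF eventually_nhds_in_open[OF open_ball \<nu>(1)] neg])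
  ultimately have "0 * deriv \<tau> \<nu> = - (N \<nu> / (1 - cnj \<gamma> * \<nu>)\<^sup>2)"
    using DERIV_cong_ev[OF refl _ refl, of "\<lambda>z. B (\<tau> z)" "\<lambda>z. - B z" \<nu>] DERIV_unique by blast
  then have "N \<nu> = 0" using den[OF \<nu>(1)] by simp
  then show False using N_unique_zero \<mu> \<nu>(1) ne by blast
qed

text \<open>Multiplication by \<open>B\<close> is \<open>Z\<close> followed by \<open>D\<close> and
  \<open>X\<close>, where \<open>D\<close> inverts \<open>Y\<close>. Up to the shift,
  \<open>X\<close> and \<open>Y\<close> are reflections of each other in the unit circle.\<close>

abbreviation Z :: operator where "Z \<equiv> mult_op (\<lambda>z. z)"
abbreviation X :: operator where "X \<equiv> mult_op (\<lambda>z. \<gamma> - z)"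
abbreviation Y :: operator where "Y \<equiv> mult_op (\<lambda>z. 1 - cnj \<gamma> * z)"
abbreviation D :: operator where "D \<equiv> mult_op (\<lambda>z. inverse (1 - cnj \<gamma> * z))"

lemma multiplier_D: "disc_multiplier (\<lambda>z. inverse (1 - cnj \<gamma> * z))"
proof (rule disc_multiplier_inverse)
  show "disc_multiplier (\<lambda>z. 1 - cnj \<gamma> * z)"
    by (rule disc_multiplier_cong[OF disc_multiplier_poly[of "[:1, - cnj \<gamma>:]"]]) simp
  show "1 - cmod \<gamma> > 0" using \<gamma>(1) by simp
  fix z :: complex assume "z \<in> ball 0 1"
  then have "cmod (cnj \<gamma> * z) \<le> cmod \<gamma>" by (simp add: norm_mult mult_left_le)
  then show "1 - cmod \<gamma> \<le> cmod (1 - cnj \<gamma> * z)" using norm_triangle_ineq2[of 1 "cnj \<gamma> * z"] by simp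
qed

lemma op_in [simp, intro]:
  assumes "f \<in> dirichlet_space"
  shows "Z f \<in> dirichlet_space" "X f \<in> dirichlet_space" "Y f \<in> dirichlet_space" "D f \<in> dirichlet_space"
    "mult_op \<rho> f \<in> dirichlet_space" "mult_op B f \<in> dirichlet_space"
proof -
  show *: "Z f \<in> dirichlet_space" "X f \<in> dirichlet_space" "Y f \<in> dirichlet_space" "D f \<in> dirichlet_space"
    using mult_op_in[OF disc_multiplier_id assms] mult_op_in[OF disc_multiplier_poly[of "[:\<gamma>, -1:]"] assms]
      mult_op_in[OF disc_multiplier_poly[of "[:1, - cnj \<gamma>:]"] assms] mult_op_in[OF multiplier_D assms]
    by (simp_all add: mult_op_def mult.commute)
  have **: "mult_op \<rho> f \<in> dirichlet_space" if "f \<in> dirichlet_space" for f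
    by (rule mult_op_in[OF finite_blaschke_multiplier[OF finite_blaschke_disc_aut[OF \<gamma>(1)]] that])
  have "mult_op B f = mult_op \<rho> (Z f)" by (simp add: mult_op_def blaschke2_def mult_ac)
  then show "mult_op B f \<in> dirichlet_space" using **[OF *(1)] by simp
  show "mult_op \<rho> f \<in> dirichlet_space" by (rule **[OF assms])
qed

lemma YD:
  assumes "f \<in> dirichlet_space" shows "Y (D f) = f"
proof
  fix z
  show "Y (D f) z = f z"
    using den[of z] dirichlet_space_outside[OF assms, of z]
    by (cases "z \<in> ball 0 1") (simp_all add: mult_op_def mult.assoc[symmetric])
qed

lemma X_linear: "X f = (\<lambda>z. \<gamma> * f z + (- 1) * Z f z)" and Y_linear: "Y f = (\<lambda>z. 1 * f z + (- cnj \<gamma>) * Z f z)"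
  by (simp_all add: mult_op_def algebra_simps)

text \<open>On the circle \<open>\<gamma> - z = - z * cnj (1 - cnj \<gamma> * z)\<close>, so the
  factor crosses the inner product as \<open>Y\<close> and leaves \<open>- z\<close> behind. In
  coefficients this rests on the shift being isometric.\<close>

lemma hardy_inner_X:
  assumes f: "f \<in> dirichlet_space" and g: "g \<in> dirichlet_space"
  shows "hardy_inner (X f) g = - hardy_inner (Z f) (Y g)"
  unfolding X_linear Y_linear
    hardy_inner_linear_left[OF f op_in(1)[OF f] g] hardy_inner_linear_right[OF g op_in(1)[OF g] op_in(1)[OF f]]
    hardy_inner_shift[OF f g] by simp

text \<open>Coefficient form of \<open>|\<gamma> - z| = |1 - cnj \<gamma> * z|\<close> on the
  circle.\<close>

lemma hardy_inner_XX:
  assumes f: "f \<in> dirichlet_space" and g: "g \<in> dirichlet_space"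
  shows "hardy_inner (X f) (X g) = hardy_inner (Y f) (Y g)"
proof -
  have "hardy_inner (\<lambda>z. a * f z + b * Z f z) (\<lambda>z. a' * g z + b' * Z g z)
      = (a * cnj a' + b * cnj b') * hardy_inner f g + a * cnj b' * hardy_inner f (Z g) + b * cnj a' * hardy_inner (Z f) g"
    for a b a' b'
  proof -
    have "(\<lambda>z. a' * g z + b' * Z g z) \<in> dirichlet_space"
      by (intro dirichlet_space_add dirichlet_space_cmult op_in g)
    from hardy_inner_linear_left[OF f op_in(1)[OF f] this] show ?thesis
      unfolding hardy_inner_linear_right[OF g op_in(1)[OF g] f] hardy_inner_linear_right[OF g op_in(1)[OF g] op_in(1)[OF f]]
        hardy_inner_shift[OF f g] by (simp add: algebra_simps)
  qed
  then show ?thesis unfolding X_linear Y_linear by (simp only:) (simp add: algebra_simps)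
qed

lemma hardy_inner_B:
  assumes f: "f \<in> dirichlet_space" and g: "g \<in> dirichlet_space"
  shows "hardy_inner (mult_op B f) (mult_op B g) = hardy_inner f g"
proof -
  have B: "mult_op B k = X (D (Z k))" for k
    by (auto simp: mult_op_def blaschke2_def disc_aut_def divide_inverse mult_ac)
  have "hardy_inner (mult_op B f) (mult_op B g) = hardy_inner (Y (D (Z f))) (Y (D (Z g)))"
    unfolding B by (intro hardy_inner_XX op_in f g)
  also have "\<dots> = hardy_inner f g" using f g by (simp add: YD hardy_inner_shift op_in)
  finally show ?thesis .
qed

text \<open>\<open>B ^ (2 k + 1) / z\<close> written without division: one factor \<open>B\<close>
  loses its \<open>z\<close> and leaves \<open>\<rho>\<close>. Then \<open>z * E k z\<close> is an
  odd power of \<open>B\<close>, ready for differentiation.\<close>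

definition E :: "nat \<Rightarrow> complex \<Rightarrow> complex" where
  "E k = (mult_op B ^^ (2 * k)) (mult_op \<rho> (dmono 0))"
text \<open>The derivative of \<open>B\<close> as an element of the space: \<open>N\<close> divided
  twice by \<open>1 - cnj \<gamma> * z\<close>.\<close>

definition B' :: "complex \<Rightarrow> complex" where
  "B' = D (D (disc_ext N))"

lemma pow_in: "f \<in> dirichlet_space \<Longrightarrow> (mult_op B ^^ n) f \<in> dirichlet_space"
  by (induction n) auto

lemma mult_op_funpow: "(mult_op b ^^ n) f z = b z ^ n * f z"
  by (induction n arbitrary: z) (simp_all add: mult_op_def mult.assoc)

lemma E_in: "E k \<in> dirichlet_space"
  unfolding E_def by (intro pow_in op_in dmono_in)

lemma N_poly: "N = poly [:\<gamma>, -2, cnj \<gamma>:]"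
  by (auto simp: N_def power2_eq_square algebra_simps)

lemma B'_in: "B' \<in> dirichlet_space"
  unfolding B'_def N_poly by (intro op_in disc_ext_poly_in)

text \<open>The weight \<open>n + 1\<close> is absorbed by passing from \<open>E k\<close> to the
  derivative of \<open>z * E k z = B ^ (2 k + 1)\<close>. What remains is an inner product of the
  Hardy space, where common powers of \<open>B\<close> cancel.\<close>

lemma dirichlet_inner_E:
  assumes f: "f \<in> dirichlet_space"
  shows "dirichlet_inner f (E k) = of_nat (2 * k + 1) * hardy_inner f ((mult_op B ^^ (2 * k)) B')"
proof -
  let ?g = "(mult_op B ^^ (2 * k)) B'"
  note Eh = dirichlet_space_holomorphic[OF E_in, of k]
  have gh: "?g holomorphic_on ball 0 1" by (intro dirichlet_space_holomorphic pow_in B'_in)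
  have "of_nat (n + 1) * taylor_coeff (E k) n = of_nat (2 * k + 1) * taylor_coeff ?g n" for n
  proof -
    have "of_nat (n + 1) * taylor_coeff (E k) n = taylor_coeff (deriv (\<lambda>z. z * E k z)) n"
      by (rule taylor_coeff_deriv_times_id[OF Eh, symmetric])
    also have "\<dots> = taylor_coeff (\<lambda>z. of_nat (2 * k + 1) * ?g z) n"
    proof (rule taylor_coeff_cong)
      show "(\<lambda>z. of_nat (2 * k + 1) * ?g z) holomorphic_on ball 0 1" by (intro holomorphic_intros gh)
      fix z :: complex assume z: "z \<in> ball 0 1"
      have "((\<lambda>z. B z ^ (2 * k + 1)) has_field_derivative of_nat (2 * k + 1) * ?g z) (at z)"
      proof -
        have "?g z = B z ^ (2 * k) * (N z / (1 - cnj \<gamma> * z)\<^sup>2)"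
          using z by (simp add: mult_op_funpow B'_def mult_op_def disc_ext_def divide_inverse power2_eq_square)
        then show ?thesis using DERIV_power[OF B_has_derivative[OF z], of "2 * k + 1"] by (simp add: mult_ac)
      qed
      moreover have ev: "\<forall>\<^sub>F z in nhds z. z * E k z = B z ^ (2 * k + 1)"
        by (rule eventually_mono[OF eventually_nhds_in_open[OF open_ball z]])
           (simp add: E_def mult_op_funpow, simp add: mult_op_def dmono_def disc_ext_def blaschke2_def mult_ac)
      ultimately have "((\<lambda>z. z * E k z) has_field_derivative of_nat (2 * k + 1) * ?g z) (at z)"
        using DERIV_cong_ev[OF refl ev refl] by simp
      then show "of_nat (2 * k + 1) * ?g z = deriv (\<lambda>z. z * E k z) z" by (rule DERIV_imp_deriv[symmetric])
    qed
    also have "\<dots> = of_nat (2 * k + 1) * taylor_coeff ?g n" by (rule taylor_coeff_cmult[OF gh])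
    finally show ?thesis .
  qed
  then have e: "of_nat (n + 1) * taylor_coeff f n * cnj (taylor_coeff (E k) n)
      = of_nat (2 * k + 1) * (taylor_coeff f n * cnj (taylor_coeff ?g n))" for n
  proof -
    have "of_nat (n + 1) * taylor_coeff f n * cnj (taylor_coeff (E k) n)
        = taylor_coeff f n * cnj (of_nat (n + 1) * taylor_coeff (E k) n)" by simp
    also have "\<dots> = of_nat (2 * k + 1) * (taylor_coeff f n * cnj (taylor_coeff ?g n))"
      unfolding \<open>of_nat (n + 1) * taylor_coeff (E k) n = _\<close> by simp
    finally show ?thesis .
  qed
  have "(\<lambda>n. of_nat (2 * k + 1) * (taylor_coeff f n * cnj (taylor_coeff ?g n)))
      sums (of_nat (2 * k + 1) * hardy_inner f ?g)"
    by (intro sums_mult hardy_inner_sums f pow_in B'_in)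
  then show ?thesis unfolding dirichlet_inner_def e by (rule sums_unique[symmetric])
qed

text \<open>Moving both factors \<open>\<gamma> - z\<close> of \<open>B^2\<close> across the inner
  product cancels the denominator of the derivative and leaves a multiple of \<open>z ^ 4\<close>
  against the quadratic polynomial \<open>N\<close>.\<close>

lemma hardy_inner_B2_B':
  assumes f: "f \<in> dirichlet_space"
  shows "hardy_inner (mult_op B (mult_op B f)) B' = 0"
proof -
  let ?g = "D (D f)"
  have g: "?g \<in> dirichlet_space" by (intro op_in f)
  have 1: "mult_op B (mult_op B f) = X (X (Z (Z ?g)))" and 2: "Z (X (Z (Z ?g))) = X (Z (Z (Z ?g)))"
    by (auto simp: mult_op_def blaschke2_def disc_aut_def divide_inverse mult_ac)
  have "hardy_inner (mult_op B (mult_op B f)) B' = - hardy_inner (X (Z (Z (Z ?g)))) (Y B')"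
    unfolding 1 by (subst hardy_inner_X) (simp_all add: 2 op_in f B'_in)
  also have "\<dots> = hardy_inner (Z (Z (Z (Z ?g)))) (Y (Y B'))"
    by (subst hardy_inner_X) (simp_all add: op_in f B'_in)
  also have "Y (Y B') = disc_ext N"
    unfolding B'_def N_poly by (simp add: YD op_in disc_ext_poly_in)
  also have "Z (Z (Z (Z ?g))) = mult_op (\<lambda>z. z ^ 4) ?g"
    by (auto simp: mult_op_def numeral_eq_Suc mult_ac)
  also have "hardy_inner (mult_op (\<lambda>z. z ^ 4) ?g) (disc_ext N) = 0"
  proof -
    have z: "taylor_coeff (mult_op (\<lambda>z. z ^ 4) ?g) n * cnj (taylor_coeff (disc_ext N) n) = 0" for n
    proof (cases "n < 4")
      case True
      then show ?thesis by (simp add: taylor_coeff_mult_op_power[OF g])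
    next
      case False
      then have "coeff [:\<gamma>, -2, cnj \<gamma>:] n = 0" by (intro coeff_eq_0) auto
      then show ?thesis unfolding N_poly by (simp only: taylor_coeff_disc_ext_poly complex_cnj_zero mult_zero_right)
    qed
    show ?thesis unfolding hardy_inner_def z by simp
  qed
  finally show ?thesis .
qed

text \<open>Multiplication by \<open>B^2\<close> sends \<open>E k\<close> to
  \<open>E (Suc k)\<close>. Conversely the inner product of \<open>B^2 f\<close> with
  \<open>E k\<close> reduces to that of \<open>f\<close> with the preceding generator, because
  \<open>B\<close> acts isometrically on the Hardy space, and vanishes for \<open>k = 0\<close> by
  \<open>hardy_inner_B2_B'\<close>.\<close>

theorem nontrivial_reducing_square:
  "nontrivial_reducing_subspace (mult_op (\<lambda>z. (B z)\<^sup>2)) (dirichlet_perp (range E))"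
proof -
  let ?T = "mult_op (\<lambda>z. (B z)\<^sup>2)"
  have T: "?T f = mult_op B (mult_op B f)" for f by (simp add: mult_op_def power2_eq_square mult.assoc)
  have m: "disc_multiplier (\<lambda>z. (B z)\<^sup>2)"
  proof -
    have "disc_multiplier \<rho>" by (rule finite_blaschke_multiplier[OF finite_blaschke_disc_aut[OF \<gamma>(1)]])
    then have "disc_multiplier (\<lambda>z. (z * \<rho> z) * (z * \<rho> z))" by (intro disc_multiplier_mult disc_multiplier_id)
    then show ?thesis by (simp add: blaschke2_def power2_eq_square)
  qed
  have red: "reducing_subspace ?T (dirichlet_perp (range E))"
  proof (rule reducing_subspace_perp[OF m])
    show "range E \<subseteq> dirichlet_space" using E_in by auto
    show "?T f \<in> dirichlet_perp (range E)" if "f \<in> dirichlet_perp (range E)" for f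
    proof -
      have f: "f \<in> dirichlet_space" and fE: "\<And>k. dirichlet_inner f (E k) = 0"
        using that by (auto simp: dirichlet_perp_def)
      have "dirichlet_inner (?T f) (E k) = 0" for k
      proof (cases k)
        case 0
        then show ?thesis unfolding T using hardy_inner_B2_B'[OF f] by (simp add: dirichlet_inner_E op_in f)
      next
        case (Suc j)
        let ?g = "(mult_op B ^^ (2 * j)) B'"
        have g: "?g \<in> dirichlet_space" by (intro pow_in B'_in)
        have "hardy_inner f ?g = 0" using fE[of j] dirichlet_inner_E[OF f, of j] by (simp only: mult_eq_0_iff of_nat_eq_0_iff) simp
        moreover have "(mult_op B ^^ (2 * k)) B' = mult_op B (mult_op B ?g)" by (simp add: Suc)
        ultimately show ?thesis
          unfolding T by (simp add: dirichlet_inner_E hardy_inner_B op_in f g)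
      qed
      then show ?thesis using mult_op_in[OF m f] by (auto simp: dirichlet_perp_def)
    qed
    show "dirichlet_inner f (?T e) = 0" if f: "f \<in> dirichlet_perp (range E)" and e: "e \<in> range E" for f e
    proof -
      obtain k where "e = E k" using e by blast
      then have "?T e = E (Suc k)" by (simp add: T E_def)
      then show ?thesis using f by (simp add: dirichlet_perp_def)
    qed
  qed
  have E0: "taylor_coeff (E 0) 0 = \<gamma>"
    by (simp add: taylor_coeff_def E_def mult_op_def dmono_def disc_ext_def)
  have "E 0 \<notin> dirichlet_perp (range E)"
  proof
    assume "E 0 \<in> dirichlet_perp (range E)"
    then have "dirichlet_inner (E 0) (E 0) = 0" by (simp add: dirichlet_perp_def)
    then have "E 0 = (\<lambda>z. 0)" by (rule dirichlet_inner_self_eq_0[OF E_in])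
    then show False using E0 \<gamma>(2) by simp
  qed
  then have ne: "dirichlet_perp (range E) \<noteq> dirichlet_space" using E_in by blast
  \<comment> \<open>\<open>a + b z\<close> is chosen orthogonal to \<open>E 0\<close>; all later
    \<open>E k\<close> vanish to order two at \<open>0\<close>. The factor \<open>2\<close> is the
    weight of \<open>z\<close>.\<close>
  define a where "a = 2 * cnj (taylor_coeff (E 0) 1)"
  define b where "b = - cnj (taylor_coeff (E 0) 0)"
  define f where "f = (\<lambda>z. a * dmono 0 z + b * dmono 1 z)"
  have f: "f \<in> dirichlet_space" unfolding f_def by (intro dirichlet_space_add dirichlet_space_cmult dmono_in)
  have fe: "dirichlet_inner f e = a * cnj (taylor_coeff e 0) + b * (2 * cnj (taylor_coeff e 1))"
    if e: "e \<in> dirichlet_space" for e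
  proof -
    have "dirichlet_inner (dmono n) e = cnj (of_nat (n + 1) * taylor_coeff e n)" for n
      unfolding dirichlet_inner_dmono[OF e, symmetric] by (rule dirichlet_inner_cnj[symmetric]) (auto intro: e)
    then show ?thesis
      unfolding f_def using e by (simp add: dirichlet_inner_add_left dirichlet_inner_cmult_left dirichlet_space_cmult)
  qed
  have "dirichlet_inner f (E k) = 0" for k
  proof (cases k)
    case 0
    then show ?thesis unfolding fe[OF E_in] by (simp add: a_def b_def)
  next
    case (Suc j)
    let ?g = "mult_op \<rho> (mult_op \<rho> (E j))"
    have g: "?g \<in> dirichlet_space" by (intro op_in E_in)
    have "E k = mult_op (\<lambda>z. z ^ 2) ?g"
      by (simp add: Suc E_def) (auto simp: mult_op_def blaschke2_def power2_eq_square mult_ac)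
    then have "taylor_coeff (E k) n = 0" if "n < 2" for n using taylor_coeff_mult_op_power[OF g] that by simp
    then show ?thesis unfolding fe[OF E_in] by simp
  qed
  then have "f \<in> dirichlet_perp (range E)" using f by (auto simp: dirichlet_perp_def)
  moreover have "f \<noteq> (\<lambda>z. 0)"
  proof
    assume "f = (\<lambda>z. 0)"
    then have "dirichlet_inner f (dmono 1) = 0" by simp
    then have "2 * b = 0" using fe[OF dmono_in, of 1] by (simp add: taylor_coeff_dmono)
    then show False using E0 \<gamma>(2) by (simp add: b_def)
  qed
  ultimately have "dirichlet_perp (range E) \<noteq> {\<lambda>z. 0}" by blast
  then show ?thesis using red ne by (simp add: nontrivial_reducing_subspace_def)
qed

end

text \<open>The signs of the two factors \<open>disc_aut 0 z = - z\<close> cancel, so with the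
  constant \<open>1\<close> the symbol is exactly \<open>B^2\<close>.\<close>

locale square_reducing = square_blaschke \<gamma> + reducing_blaschke 1 "[0, 0, \<gamma>, \<gamma>]" \<phi> M
  for \<gamma> \<phi> M
begin

lemma phi_B: "z \<in> ball 0 1 \<Longrightarrow> \<phi> z = (B z)\<^sup>2"
  using phi_eq[of z] by (simp add: blaschke2_def power2_eq_square)

lemma mem_fib: "b \<in> ball 0 1 \<Longrightarrow> y \<in> fib b \<longleftrightarrow> y \<in> ball 0 1 \<and> (B y = B b \<or> B y = - B b)"
  using phi_B[of y] phi_B[of b] by (auto simp: fib_def power2_eq_iff)

lemma B_nonzero:
  assumes "b \<in> Reg" shows "B b \<noteq> 0"
proof -
  have "\<phi> b \<noteq> 0" using assms by (simp add: Reg_def)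
  then show ?thesis unfolding phi_B[OF Reg_ball[OF assms]] by simp
qed

lemma rho_fib: "b \<in> ball 0 1 \<Longrightarrow> \<rho> b \<in> fib b"
  using mem_fib[of b "\<rho> b"] rho_in[of b] B_rho[of b] by simp

lemma fib_B_eq: "b \<in> ball 0 1 \<Longrightarrow> {x \<in> fib b. B x = B b} = {b, \<rho> b}"
  using B_eq_iff[OF fib_ball, of _ b b] B_rho[of b] fib_self[of b] rho_fib[of b] by auto

text \<open>The fibre splits by the sign of \<open>B\<close>; each half is an orbit of
  \<open>\<rho>\<close> with at most two points, so four points force two genuine pairs.\<close>

lemma fib_B_neg:
  assumes b: "b \<in> Reg"
  obtains y where "y \<in> ball 0 1" "B y = - B b" "y \<noteq> \<rho> y" "{x \<in> fib b. B x \<noteq> B b} = {y, \<rho> y}" "\<rho> b \<noteq> b"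
proof -
  note bb = Reg_ball[OF b]
  let ?A = "{x \<in> fib b. B x = B b}" and ?N = "{x \<in> fib b. B x \<noteq> B b}"
  have fin: "finite (fib b)" by (rule finite_fib[OF bb])
  have "?A \<union> ?N = fib b" "?A \<inter> ?N = {}" by auto
  then have c4: "card ?A + card ?N = 4"
    using card_Un_disjoint[of ?A ?N] card_fib[OF b] fin by simp
  have A2: "card ?A \<le> 2" unfolding fib_B_eq[OF bb] by (simp add: card_insert_if)
  then have "card ?N \<noteq> 0" using c4 by linarith
  then have "?N \<noteq> {}" by (metis card.empty)
  then obtain y where y: "y \<in> fib b" "B y \<noteq> B b" by blast
  have yb: "y \<in> ball 0 1" by (rule fib_ball[OF y(1)])
  have yn: "B y = - B b" using y mem_fib[OF bb] by auto
  have N: "?N = {y, \<rho> y}"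
  proof (intro equalityI subsetI)
    fix x assume "x \<in> ?N"
    then have "x \<in> ball 0 1" "B x = B y" using mem_fib[OF bb] yn by auto
    then show "x \<in> {y, \<rho> y}" using B_eq_iff[OF _ yb] by auto
  next
    fix x assume "x \<in> {y, \<rho> y}"
    then show "x \<in> ?N" using y rho_fib[OF yb] fib_eq[OF y(1)] B_rho[OF yb] by auto
  qed
  have "card ?N \<le> 2" unfolding N by (simp add: card_insert_if)
  then have "card ?A = 2" "card ?N = 2" using c4 A2 by linarith+
  then have "y \<noteq> \<rho> y" "\<rho> b \<noteq> b" unfolding N fib_B_eq[OF bb] by (auto split: if_splits simp: card_insert_if)
  then show ?thesis using that yb yn N by blast
qed

lemma B_holomorphic: "B holomorphic_on ball 0 1"
  using B_has_derivative by (intro holomorphic_onI) (auto simp: field_differentiable_def intro: has_field_derivative_at_within)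

lemma rho_holomorphic: "\<rho> holomorphic_on ball 0 1"
  by (rule disc_multiplier_holomorphic[OF finite_blaschke_multiplier[OF finite_blaschke_disc_aut[OF \<gamma>(1)]]])

text \<open>Along a branch the quotient of the two values of \<open>B\<close> is continuous with
  values \<open>1\<close> and \<open>-1\<close>, hence constant.\<close>

lemma branch_invariant_B: "branch_invariant (\<lambda>b y. B y = B b)"
  unfolding branch_invariant_def
proof (intro ballI allI impI)
  fix b0 e r assume b0: "b0 \<in> Reg" and br: "branches b0 e r"
  have e: "e > 0" "ball b0 e \<subseteq> Reg" using br by (simp_all add: branches_def)
  have "(B (r y b) = B b) = (B y = B b0)" if b: "b \<in> ball b0 e" and y: "y \<in> fib b0" for b y
  proof -
    let ?t = "\<lambda>b. B (r y b) / B b"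
    have rh: "r y holomorphic_on ball b0 e" "r y b0 = y" using br y by (simp_all add: branches_def)
    have rf: "r y x \<in> fib x" if "x \<in> ball b0 e" for x using br y that by (fastforce simp: branches_def)
    have sub: "ball b0 e \<subseteq> ball 0 1" using e(2) Reg_ball by blast
    have nz: "B x \<noteq> 0" if "x \<in> ball b0 e" for x using B_nonzero e(2) that by blast
    have "?t holomorphic_on ball b0 e"
    proof (intro holomorphic_on_divide)
      have "B \<circ> r y holomorphic_on ball b0 e"
        by (rule holomorphic_on_compose_gen[OF rh(1) B_holomorphic]) (use rf fib_ball in blast)
      then show "(\<lambda>b. B (r y b)) holomorphic_on ball b0 e" by (simp add: o_def)
    qed (use nz holomorphic_on_subset[OF B_holomorphic sub] in auto)
    then have cont: "continuous_on (ball b0 e) ?t" by (rule holomorphic_on_imp_continuous_on)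
    have vals: "?t x = 1 \<or> ?t x = - 1" if "x \<in> ball b0 e" for x
    proof -
      have "x \<in> ball 0 1" using that sub by blast
      then have "B (r y x) = B x \<or> B (r y x) = - B x" using rf[OF that] mem_fib by blast
      then show ?thesis using nz[OF that] by auto
    qed
    have "?t ` ball b0 e \<subseteq> {1, -1}"
    proof (rule image_subsetI)
      fix x assume "x \<in> ball b0 e"
      from vals[OF this] show "?t x \<in> {1, -1}" by blast
    qed
    then have "finite (?t ` ball b0 e)" by (rule finite_subset) simp
    then have "?t constant_on ball b0 e" by (rule continuous_finite_range_constant[OF connected_ball cont])
    then have "?t b = ?t b0" using b e(1) unfolding constant_on_def by (metis centre_in_ball)
    then have "?t b = 1 \<longleftrightarrow> ?t b0 = 1" by simp
    then show ?thesis using nz[OF b] nz[of b0] e(1) rh(2) by simp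
  qed
  then show "\<exists>d>0. d \<le> e \<and> (\<forall>b\<in>ball b0 d. \<forall>y\<in>fib b0. (B (r y b) = B b) = (B y = B b0))"
    using e(1) by blast
qed

text \<open>The point \<open>\<rho> b\<close> is singled out as the off-diagonal one with the same
  value of \<open>B\<close>, so its weight is the same everywhere.\<close>

lemma s_rho:
  assumes b: "b \<in> Reg" and b': "b' \<in> Reg" shows "s b' (\<rho> b') = s b (\<rho> b)"
proof -
  let ?Q = "\<lambda>x y. (\<not> (y = x) \<and> B y = B x) \<and> s x y = s b (\<rho> b)"
  have inv: "branch_invariant ?Q"
    by (intro branch_invariant_conj branch_invariant_not branch_invariant_self branch_invariant_B
        branch_invariant_s[of "\<lambda>w. w = s b (\<rho> b)"])
  have "\<rho> b \<noteq> b" using fib_B_neg[OF b] by blast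
  then have "{y \<in> fib b. ?Q b y} = {\<rho> b}" using fib_B_eq[OF Reg_ball[OF b]] by auto
  then have "card {y \<in> fib b. ?Q b y} = 1" by simp
  then have "card {y \<in> fib b'. ?Q b' y} = 1" using branch_invariant_card[OF inv b b'] by simp
  then obtain y where "{y \<in> fib b'. ?Q b' y} = {y}" by (rule card_1_singletonE)
  then have y: "y \<in> fib b'" "?Q b' y" by auto
  then have "y = \<rho> b'" using fib_B_eq[OF Reg_ball[OF b']] by auto
  then show ?thesis using y by simp
qed

text \<open>If the two points with opposite value of \<open>B\<close> had different weights, one of
  them would be a global branch \<tau> with \<open>B \<circ> \<tau> = - B\<close>, which
  \<open>no_negating_map\<close> rules out.\<close>

lemma s_neg:
  obtains w where "\<And>b x. b \<in> Reg \<Longrightarrow> x \<in> fib b \<Longrightarrow> B x \<noteq> B b \<Longrightarrow> s b x = w"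
proof -
  obtain b1 where b1: "b1 \<in> Reg" using Reg_near_0[of 1] by auto
  obtain y where y: "y \<in> ball 0 1" "B y = - B b1" "y \<noteq> \<rho> y" "{x \<in> fib b1. B x \<noteq> B b1} = {y, \<rho> y}"
    by (rule fib_B_neg[OF b1])
  define w where "w = s b1 y"
  let ?Q = "\<lambda>b x. \<not> (B x = B b) \<and> s b x = w"
  have inv: "branch_invariant ?Q"
    by (intro branch_invariant_conj branch_invariant_not branch_invariant_B branch_invariant_s[of "\<lambda>k. k = w"])
  have mem: "x \<in> fib b1 \<and> B x \<noteq> B b1 \<longleftrightarrow> x = y \<or> x = \<rho> y" for x using y(4) by blast
  have eq: "s b1 (\<rho> y) = w"
  proof (rule ccontr)
    assume "s b1 (\<rho> y) \<noteq> w"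
    then have "x \<in> fib b1 \<and> ?Q b1 x \<longleftrightarrow> x = y" for x using mem[of x] mem[of y] unfolding w_def by metis
    then have "{x \<in> fib b1. ?Q b1 x} = {y}" by blast
    then have c1: "card {x \<in> fib b1. ?Q b1 x} = 1" by simp
    obtain \<tau> where \<tau>: "\<tau> holomorphic_on ball 0 1" "\<And>b. b \<in> ball 0 1 \<Longrightarrow> \<tau> b \<in> fib b"
      "\<And>b. b \<in> Reg \<Longrightarrow> {x \<in> fib b. ?Q b x} = {\<tau> b}"
    proof (rule unique_branch[OF inv b1 c1])
      fix \<sigma> assume "\<sigma> holomorphic_on ball 0 1" "\<And>b. b \<in> ball 0 1 \<Longrightarrow> \<sigma> b \<in> fib b"
        "\<And>b. b \<in> Reg \<Longrightarrow> {x \<in> fib b. ?Q b x} = {\<sigma> b}"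
      then show thesis by (rule that)
    qed
    have neg: "B (\<tau> b) = - B b" if "b \<in> Reg" for b
    proof -
      have "\<tau> b \<in> {x \<in> fib b. ?Q b x}" using \<tau>(3)[OF that] by simp
      then show ?thesis using mem_fib[OF Reg_ball[OF that]] by auto
    qed
    have \<tau>b: "\<tau> z \<in> ball 0 1" if "z \<in> ball 0 1" for z using fib_ball[OF \<tau>(2)[OF that]] .
    have "B \<circ> \<tau> holomorphic_on ball 0 1"
      by (rule holomorphic_on_compose_gen[OF \<tau>(1) B_holomorphic]) (use \<tau>b in blast)
    then have "(\<lambda>z. B (\<tau> z)) holomorphic_on ball 0 1" by (simp add: o_def)
    from eq_on_disc_of_Reg[OF this holomorphic_on_minus[OF B_holomorphic] neg]
    have "B (\<tau> z) = - B z" if "z \<in> ball 0 1" for z using that by blast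
    then show False using no_negating_map[OF \<tau>(1) \<tau>b] by blast
  qed
  have "s b x = w" if b: "b \<in> Reg" and x: "x \<in> fib b" "B x \<noteq> B b" for b x
  proof -
    obtain y' where y': "y' \<noteq> \<rho> y'" "{x \<in> fib b. B x \<noteq> B b} = {y', \<rho> y'}"
      by (rule fib_B_neg[OF b])
    have "x \<in> fib b1 \<and> ?Q b1 x \<longleftrightarrow> x = y \<or> x = \<rho> y" for x using mem[of x] eq unfolding w_def by metis
    then have "{x \<in> fib b1. ?Q b1 x} = {y, \<rho> y}" by blast
    then have "card {x \<in> fib b1. ?Q b1 x} = 2" using y(3) by simp
    then have c2: "card {x \<in> fib b. ?Q b x} = 2" using branch_invariant_card[OF inv b1 b] by simp
    have sub: "{x \<in> fib b. ?Q b x} \<subseteq> {y', \<rho> y'}" unfolding y'(2)[symmetric] by blast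
    have "{x \<in> fib b. ?Q b x} = {y', \<rho> y'}" using card_subset_eq[OF _ sub] c2 y'(1) by simp
    moreover have "x \<in> {y', \<rho> y'}" unfolding y'(2)[symmetric] using x by simp
    ultimately show ?thesis by blast
  qed
  then show ?thesis using that by blast
qed

text \<open>Evaluating the formula for the constant function at \<open>0\<close> shows that the weight of \<open>\<rho>\<close> is the
  negative of the common weight of the two other branches.\<close>
theorem square_fibre_sum:
  obtains a w where "\<And>b n. b \<in> Reg \<Longrightarrow>
    b * h n b = a * b ^ Suc n + w * ((\<Sum>x\<in>{x \<in> fib b. B x \<noteq> B b}. x ^ Suc n) - \<rho> b ^ Suc n)"
proof -
  obtain w where w: "\<And>b x. b \<in> Reg \<Longrightarrow> x \<in> fib b \<Longrightarrow> B x \<noteq> B b \<Longrightarrow> s b x = w" using s_neg by blast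
  obtain b1 where b1: "b1 \<in> Reg" using Reg_near_0[of 1] by auto
  define a k where "a = s b1 b1" and "k = s b1 (\<rho> b1)"
  have sum: "b * h n b = a * b ^ Suc n + k * \<rho> b ^ Suc n + w * (\<Sum>x\<in>{x \<in> fib b. B x \<noteq> B b}. x ^ Suc n)"
    if b: "b \<in> Reg" for b n
  proof -
    note bb = Reg_ball[OF b]
    let ?N = "{x \<in> fib b. B x \<noteq> B b}"
    have fin: "finite ?N" using finite_fib[OF bb] by simp
    have fib: "fib b = insert b (insert (\<rho> b) ?N)" using fib_B_eq[OF bb] by blast
    have ne: "\<rho> b \<noteq> b" using fib_B_neg[OF b] by blast
    have "(\<Sum>x\<in>fib b. s b x * x ^ Suc n) = (\<Sum>x\<in>insert b (insert (\<rho> b) ?N). s b x * x ^ Suc n)"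
      using fib by simp
    also have "\<dots> = s b b * b ^ Suc n + (s b (\<rho> b) * \<rho> b ^ Suc n + (\<Sum>x\<in>?N. s b x * x ^ Suc n))"
      using fin ne B_rho[OF bb] by (subst sum.insert | simp)+
    also have "(\<Sum>x\<in>?N. s b x * x ^ Suc n) = w * (\<Sum>x\<in>?N. x ^ Suc n)"
      unfolding sum_distrib_left by (rule sum.cong) (use w[OF b] in auto)
    finally show ?thesis
      using h_fibre_sum[OF b, of n] s_diag[OF b b1] s_rho[OF b1 b] by (simp add: a_def k_def)
  qed
  \<comment> \<open>For \<open>n = 0\<close> the two points over \<open>- B b\<close> add up to
    \<open>\<gamma> - cnj \<gamma> * B b\<close> by \<open>add_rho\<close>, so the formula extends
    holomorphically to \<open>0\<close>.\<close>
  have "0 * h 0 0 = a * 0 + k * \<rho> 0 + w * (\<gamma> - cnj \<gamma> * B 0)"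
  proof (rule eq_on_disc_of_Reg[of "\<lambda>b. b * h 0 b" "\<lambda>b. a * b + k * \<rho> b + w * (\<gamma> - cnj \<gamma> * B b)"])
    show "(\<lambda>b. b * h 0 b) holomorphic_on ball 0 1" by (intro holomorphic_intros h_holomorphic)
    show "(\<lambda>b. a * b + k * \<rho> b + w * (\<gamma> - cnj \<gamma> * B b)) holomorphic_on ball 0 1"
      by (intro holomorphic_intros rho_holomorphic B_holomorphic)
    fix b assume b: "b \<in> Reg"
    obtain y where y: "y \<in> ball 0 1" "B y = - B b" "y \<noteq> \<rho> y" "{x \<in> fib b. B x \<noteq> B b} = {y, \<rho> y}"
      by (rule fib_B_neg[OF b])
    show "b * h 0 b = a * b + k * \<rho> b + w * (\<gamma> - cnj \<gamma> * B b)"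
      using sum[OF b, of 0] y(3) add_rho[OF y(1)] y(2) unfolding y(4) by simp
  qed simp
  then have "(k + w) * \<gamma> = 0" by (simp add: algebra_simps)
  then have "k = - w" using \<gamma>(2) by (simp add: add_eq_0_iff2)
  then have "b * h n b = a * b ^ Suc n + w * ((\<Sum>x\<in>{x \<in> fib b. B x \<noteq> B b}. x ^ Suc n) - \<rho> b ^ Suc n)"
    if "b \<in> Reg" for b n
    unfolding sum[OF that] by (simp add: algebra_simps)
  then show ?thesis using that by blast
qed

end

section \<open>Complements and affine relations between projections\<close>

lemma dirichlet_proj_perp:
  assumes M: "closed_subspace M" and f: "f \<in> dirichlet_space"
  shows "dirichlet_proj M f = (\<lambda>z. 0) \<longleftrightarrow> f \<in> dirichlet_perp M"
proof
  assume "dirichlet_proj M f = (\<lambda>z. 0)"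
  then show "f \<in> dirichlet_perp M" using dirichlet_proj_orth[OF M f] f by (simp add: dirichlet_perp_def)
next
  assume "f \<in> dirichlet_perp M"
  then show "dirichlet_proj M f = (\<lambda>z. 0)"
    by (intro dirichlet_proj_unique[OF M f closed_subspace_zero[OF M]]) (simp add: dirichlet_perp_def)
qed

lemma perp_Int: "closed_subspace M \<Longrightarrow> M \<inter> dirichlet_perp M = {\<lambda>z. 0}"
  using dirichlet_inner_self_eq_0 closed_subspace_zero
  by (auto simp: dirichlet_perp_def)

lemma nontrivial_reducing_perp:
  assumes m: "disc_multiplier \<phi>" and M: "nontrivial_reducing_subspace (mult_op \<phi>) M"
  shows "nontrivial_reducing_subspace (mult_op \<phi>) (dirichlet_perp M)"
proof -
  have cl: "closed_subspace M" and inv: "\<And>f. f \<in> M \<Longrightarrow> mult_op \<phi> f \<in> M"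
    "\<And>f. f \<in> M \<Longrightarrow> dirichlet_adjoint (mult_op \<phi>) f \<in> M" and nt: "M \<noteq> {\<lambda>z. 0}" "M \<noteq> dirichlet_space"
    using M by (auto simp: nontrivial_reducing_subspace_def reducing_subspace_def)
  have sub: "M \<subseteq> dirichlet_space" using closed_subspace_in_space[OF cl] by blast
  have "reducing_subspace (mult_op \<phi>) (dirichlet_perp M)"
  proof (rule reducing_subspace_perp[OF m sub])
    fix f assume f: "f \<in> dirichlet_perp M"
    then have fD: "f \<in> dirichlet_space" by (simp add: dirichlet_perp_def)
    show "mult_op \<phi> f \<in> dirichlet_perp M"
      using f mult_op_in[OF m fD] mult_op_adjoint[OF m _ fD] inv(2) sub by (auto simp: dirichlet_perp_def)
    show "dirichlet_inner f (mult_op \<phi> e) = 0" if "e \<in> M" for e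
      using f inv(1)[OF that] by (simp add: dirichlet_perp_def)
  qed
  moreover have "dirichlet_perp M \<noteq> {\<lambda>z. 0}"
  proof
    assume p: "dirichlet_perp M = {\<lambda>z. 0}"
    have "f \<in> M" if f: "f \<in> dirichlet_space" for f
    proof -
      have "(\<lambda>z. f z - dirichlet_proj M f z) \<in> dirichlet_perp M"
        using dirichlet_proj_orth[OF cl f] dirichlet_space_diff[OF f dirichlet_proj_space[OF cl f]]
        by (simp add: dirichlet_perp_def)
      then have "f = dirichlet_proj M f" unfolding p by (auto simp: fun_eq_iff)
      then show ?thesis using dirichlet_proj_in[OF cl f] by simp
    qed
    then show False using sub nt by blast
  qed
  moreover have "dirichlet_perp M \<noteq> dirichlet_space"
    using perp_Int[OF cl] sub nt(1) closed_subspace_zero[OF cl] by blast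
  ultimately show ?thesis by (simp add: nontrivial_reducing_subspace_def)
qed

text \<open>The relation makes \<open>M'\<close> and its complement consist of eigenvectors of the
  projection to \<open>M\<close>, with eigenvalues \<open>\<alpha> + \<beta>\<close> and
  \<open>\<alpha>\<close>. Both must be \<open>0\<close> or \<open>1\<close>, and the four
  combinations are the four alternatives.\<close>

lemma affine_projection_cases:
  assumes M: "closed_subspace M" and M': "closed_subspace M'" "M' \<noteq> {\<lambda>z. 0}" "M' \<noteq> dirichlet_space"
    and eq: "\<And>n. dirichlet_proj M (dmono n) = (\<lambda>z. a * dmono n z + b * dirichlet_proj M' (dmono n) z)"
  shows "M = {\<lambda>z. 0} \<or> M = dirichlet_space \<or> M = M' \<or> M = dirichlet_perp M'"
proof -
  let ?P = "dirichlet_proj M" and ?P' = "dirichlet_proj M'"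
  note P' = dirichlet_proj_space[OF M'(1)]
  \<comment> \<open>The relation is assumed on monomials only; symmetry extends it to all
    \<open>f\<close> by moving it to the second argument, which conjugates the coefficients.\<close>
  define \<alpha> \<beta> where "\<alpha> = cnj a" and "\<beta> = cnj b"
  have P: "?P f = (\<lambda>z. \<alpha> * f z + \<beta> * ?P' f z)" if f: "f \<in> dirichlet_space" for f
  proof (rule dirichlet_space_eqI)
    show 1: "?P f \<in> dirichlet_space" by (rule dirichlet_proj_space[OF M f])
    show 2: "(\<lambda>z. \<alpha> * f z + \<beta> * ?P' f z) \<in> dirichlet_space"
      by (intro dirichlet_space_add dirichlet_space_cmult f P')
    fix n
    have "dirichlet_inner (?P f) (dmono n) = dirichlet_inner f (?P (dmono n))"
      by (rule dirichlet_proj_symmetric[OF M f dmono_in])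
    also have "\<dots> = \<alpha> * dirichlet_inner f (dmono n) + \<beta> * dirichlet_inner f (?P' (dmono n))"
      unfolding eq \<alpha>_def \<beta>_def
      by (subst dirichlet_inner_add_right) (simp_all add: dirichlet_space_cmult f P' dirichlet_inner_cmult_right)
    also have "dirichlet_inner f (?P' (dmono n)) = dirichlet_inner (?P' f) (dmono n)"
      by (rule dirichlet_proj_symmetric[OF M'(1) f dmono_in, symmetric])
    also have "\<alpha> * dirichlet_inner f (dmono n) + \<beta> * dirichlet_inner (?P' f) (dmono n)
        = dirichlet_inner (\<lambda>z. \<alpha> * f z + \<beta> * ?P' f z) (dmono n)"
      by (subst dirichlet_inner_add_left) (simp_all add: dirichlet_space_cmult f P' dirichlet_inner_cmult_left)
    finally have "of_nat (n + 1) * taylor_coeff (?P f) n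
        = of_nat (n + 1) * taylor_coeff (\<lambda>z. \<alpha> * f z + \<beta> * ?P' f z) n"
      unfolding dirichlet_inner_dmono[OF 1] dirichlet_inner_dmono[OF 2] .
    then show "taylor_coeff (?P f) n = taylor_coeff (\<lambda>z. \<alpha> * f z + \<beta> * ?P' f z) n"
      by (metis add_is_0 mult_left_cancel of_nat_eq_0_iff one_neq_zero)
  qed
  have eig: "k = 0 \<or> k = 1" if f: "f \<in> dirichlet_space" "f \<noteq> (\<lambda>z. 0)" "?P f = (\<lambda>z. k * f z)" for f k
  proof -
    obtain z where z: "f z \<noteq> 0" using f(2) by auto
    have "?P (?P f) = ?P f" by (rule dirichlet_proj_id[OF M dirichlet_proj_in[OF M f(1)]])
    moreover have "?P (?P f) = (\<lambda>z. k * (k * f z))"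
      unfolding f(3) dirichlet_proj_cmult[OF M f(1)] by (simp add: f(3))
    ultimately have "(\<lambda>z. k * (k * f z)) = (\<lambda>z. k * f z)" using f(3) by simp
    from fun_cong[OF this, of z] z show ?thesis by auto
  qed
  obtain f where f: "f \<in> M'" "f \<noteq> (\<lambda>z. 0)" using M'(2) closed_subspace_zero[OF M'(1)] by blast
  have fD: "f \<in> dirichlet_space" by (rule closed_subspace_in_space[OF M'(1) f(1)])
  have "?P f = (\<lambda>z. (\<alpha> + \<beta>) * f z)"
    unfolding P[OF fD] dirichlet_proj_id[OF M'(1) f(1)] by (simp add: algebra_simps)
  from eig[OF fD f(2) this] have ab: "\<alpha> + \<beta> = 0 \<or> \<alpha> + \<beta> = 1" .
  obtain g where g: "g \<in> dirichlet_space" "g \<notin> M'"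
    using M'(1,3) closed_subspace_in_space[OF M'(1)] by blast
  let ?g = "\<lambda>z. g z - ?P' g z"
  have gD: "?g \<in> dirichlet_space" by (intro dirichlet_space_diff g(1) P')
  have "?g \<in> dirichlet_perp M'" using dirichlet_proj_orth[OF M'(1) g(1)] gD by (simp add: dirichlet_perp_def)
  then have "?P' ?g = (\<lambda>z. 0)" using dirichlet_proj_perp[OF M'(1) gD] by simp
  then have "?P ?g = (\<lambda>z. \<alpha> * ?g z)" unfolding P[OF gD] by simp
  moreover have "?g \<noteq> (\<lambda>z. 0)"
  proof
    assume "?g = (\<lambda>z. 0)"
    then have "g = ?P' g" by (auto simp: fun_eq_iff)
    then show False using g dirichlet_proj_in[OF M'(1) g(1)] by simp
  qed
  ultimately have a01: "\<alpha> = 0 \<or> \<alpha> = 1" using eig[OF gD] by blast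
  have mem: "f \<in> M \<longleftrightarrow> f \<in> dirichlet_space \<and> ?P f = f" for f
    using closed_subspace_in_space[OF M] dirichlet_proj_id[OF M] dirichlet_proj_in[OF M] by metis
  have mem': "f \<in> M' \<longleftrightarrow> f \<in> dirichlet_space \<and> ?P' f = f" for f
    using closed_subspace_in_space[OF M'(1)] dirichlet_proj_id[OF M'(1)] dirichlet_proj_in[OF M'(1)] by metis
  consider "\<alpha> = 0" "\<beta> = 0" | "\<alpha> = 1" "\<beta> = 0" | "\<alpha> = 0" "\<beta> = 1" | "\<alpha> = 1" "\<beta> = - 1"
    using ab a01 by (auto simp: add_eq_0_iff)
  then show ?thesis
  proof cases
    case 1
    then have "f = (\<lambda>z. 0)" if "f \<in> M" for f using that mem P by auto
    then show ?thesis using closed_subspace_zero[OF M] by blast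
  next
    case 2
    then have "f \<in> M" if "f \<in> dirichlet_space" for f using that mem P by auto
    then show ?thesis using mem by blast
  next
    case 3
    then have "f \<in> M \<longleftrightarrow> f \<in> M'" for f using mem mem' P by auto
    then show ?thesis by blast
  next
    case 4
    have "f \<in> M \<longleftrightarrow> f \<in> dirichlet_perp M'" for f
    proof (cases "f \<in> dirichlet_space")
      case True
      have "?P f = f \<longleftrightarrow> ?P' f = (\<lambda>z. 0)" unfolding P[OF True] using 4 by (auto simp: fun_eq_iff)
      then show ?thesis using mem dirichlet_proj_perp[OF M'(1) True] True by simp
    qed (auto simp: mem dirichlet_perp_def)
    then show ?thesis by blast
  qed
qed

text \<open>By \<open>square_fibre_sum\<close> the projections to \<open>M\<close> and to the
  explicit \<open>M'\<close> are, on monomials, a multiple of the identity plus a multiple of one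
  common expression. Eliminating that expression gives an affine relation, which leaves only
  \<open>M'\<close> and its complement.\<close>

theorem card_minimal_reducing_square:
  assumes \<gamma>: "\<gamma> \<in> ball 0 1 - {0}"
  shows "card {M. minimal_reducing_subspace (mult_op (\<lambda>z. (z * disc_aut \<gamma> z)\<^sup>2)) M} = 2"
proof -
  interpret square_blaschke \<gamma> by unfold_locales (use \<gamma> in auto)
  define \<phi> where "\<phi> = (\<lambda>z. (B z)\<^sup>2)"
  define M' where "M' = dirichlet_perp (range E)"
  have M': "nontrivial_reducing_subspace (mult_op \<phi>) M'"
    unfolding M'_def \<phi>_def by (rule nontrivial_reducing_square)
  then have red': "reducing_subspace (mult_op \<phi>) M'" and nt': "M' \<noteq> {\<lambda>z. 0}" "M' \<noteq> dirichlet_space"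
    by (auto simp: nontrivial_reducing_subspace_def)
  then have cl': "closed_subspace M'" by (simp add: reducing_subspace_def)
  have loc: "square_reducing \<gamma> \<phi> M" if "reducing_subspace (mult_op \<phi>) M" for M
    by unfold_locales (use \<gamma> that in \<open>auto simp: \<phi>_def blaschke2_def power2_eq_square\<close>)
  interpret K: square_reducing \<gamma> \<phi> M' by (rule loc[OF red'])
  obtain a' w' where K: "\<And>b n. b \<in> K.Reg \<Longrightarrow> b * K.h n b = a' * b ^ Suc n
      + w' * ((\<Sum>x\<in>{x \<in> K.fib b. B x \<noteq> B b}. x ^ Suc n) - \<rho> b ^ Suc n)"
    using K.square_fibre_sum by blast
  \<comment> \<open>Otherwise the projection to \<open>M'\<close> would be scalar and
    \<open>M'\<close> trivial.\<close>
  have w': "w' \<noteq> 0"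
  proof
    assume "w' = 0"
    then have "K.h n = (\<lambda>z. a' * dmono n z)" for n by (intro K.h_eq_cmult_dmono) (simp add: K)
    then have "M' = coord_space {m. a' = 1}"
      using closed_subspace_even_diagonal[OF cl', of "\<lambda>_. a'"] by (simp add: K.h_def K.P_def)
    then show False using nt' coord_space_UNIV coord_space_empty by (cases "a' = 1") auto
  qed
  have only: "M = M' \<or> M = dirichlet_perp M'" if M: "nontrivial_reducing_subspace (mult_op \<phi>) M" for M
  proof -
    have red: "reducing_subspace (mult_op \<phi>) M" and nt: "M \<noteq> {\<lambda>z. 0}" "M \<noteq> dirichlet_space"
      using M by (auto simp: nontrivial_reducing_subspace_def)
    interpret J: square_reducing \<gamma> \<phi> M by (rule loc[OF red])
    obtain a w where J: "\<And>b n. b \<in> K.Reg \<Longrightarrow> b * J.h n b = a * b ^ Suc n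
        + w * ((\<Sum>x\<in>{x \<in> K.fib b. B x \<noteq> B b}. x ^ Suc n) - \<rho> b ^ Suc n)"
      using J.square_fibre_sum by blast
    let ?a = "a - w * a' / w'" and ?b = "w / w'"
    have "J.h n = (\<lambda>z. ?a * dmono n z + ?b * K.h n z)" for n
    proof
      fix z
      show "J.h n z = ?a * dmono n z + ?b * K.h n z"
      proof (cases "z \<in> ball 0 1")
        case True
        show ?thesis
        proof (rule K.eq_on_disc_of_Reg[OF J.h_holomorphic _ _ True])
          show "(\<lambda>z. ?a * dmono n z + ?b * K.h n z) holomorphic_on ball 0 1"
            by (intro holomorphic_intros K.h_holomorphic dirichlet_space_holomorphic[OF dmono_in])
          fix b assume b: "b \<in> K.Reg"
          note bb = K.Reg_ball[OF b]
          have b0: "b \<noteq> 0" by (rule K.fib_nonzero[OF b K.fib_self[OF bb]])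
          let ?S = "(\<Sum>x\<in>{x \<in> K.fib b. B x \<noteq> B b}. x ^ Suc n) - \<rho> b ^ Suc n"
          have "b * (?a * dmono n b + ?b * K.h n b) = ?a * b ^ Suc n + ?b * (b * K.h n b)"
            using bb by (simp add: dmono_def disc_ext_def algebra_simps)
          also have "\<dots> = a * b ^ Suc n + w * ?S"
            unfolding K[OF b] using w' by (simp add: field_simps)
          also have "\<dots> = b * J.h n b" by (rule J[OF b, symmetric])
          finally show "J.h n b = ?a * dmono n b + ?b * K.h n b" using b0 by simp
        qed
      next
        case False
        then show ?thesis using dirichlet_space_outside[OF J.h_in False] dirichlet_space_outside[OF K.h_in False]
          by (simp add: dmono_def disc_ext_def)
      qed
    qed
    then have "dirichlet_proj M (dmono n) = (\<lambda>z. ?a * dmono n z + ?b * dirichlet_proj M' (dmono n) z)" for n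
      by (simp only: J.h_def J.P_def K.h_def K.P_def)
    from affine_projection_cases[OF J.M_closed cl' nt' this] nt show ?thesis by blast
  qed
  have "card {M. minimal_reducing_subspace (mult_op \<phi>) M} = 2"
    by (rule card_minimal_reducing_two[OF M' nontrivial_reducing_perp[OF K.multiplier M'] perp_Int[OF cl'] only])
  then show ?thesis by (simp add: \<phi>_def blaschke2_def)
qed

section \<open>The classification\<close>

lemma reducing_cong:
  assumes "\<And>M. reducing_subspace T M \<longleftrightarrow> reducing_subspace T' M"
  shows "reducible T \<longleftrightarrow> reducible T'"
    and "card {M. minimal_reducing_subspace T M} = card {M. minimal_reducing_subspace T' M}"
  by (simp_all add: reducible_def minimal_reducing_subspace_def nontrivial_reducing_subspace_def assms)

lemma prod_list_map_cong_mset: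
  fixes f :: "'a \<Rightarrow> complex"
  assumes "mset xs = mset ys" shows "(\<Prod>x\<leftarrow>xs. f x) = (\<Prod>x\<leftarrow>ys. f x)"
  using assms by (metis mset_map prod_mset_prod_list)

text \<open>\<open>square\<close> admits \<open>\<alpha> = 0\<close>, so it includes the multiples
  of \<open>z ^ 4\<close>. Both outcomes record the critical point at \<open>0\<close>, which later
  excludes decompositions of the wrong kind.\<close>

lemma nontrivial_reducing_cases:
  assumes b: "finite_blaschke 4 \<phi>" and zero: "\<phi> 0 = 0"
    and M: "nontrivial_reducing_subspace (mult_op \<phi>) M"
  obtains (even) c \<alpha> where "cmod c = 1" "\<alpha> \<in> ball 0 1 - {0}"
      "\<And>z. z \<in> ball 0 1 \<Longrightarrow> \<phi> z = c * (z\<^sup>2 * disc_aut \<alpha> z * disc_aut (- \<alpha>) z)"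
      "\<exists>b. M = coord_space {n. even n \<longleftrightarrow> b}" "deriv \<phi> 0 = 0"
    | (square) c \<alpha> where "cmod c = 1" "\<alpha> \<in> ball 0 1" "\<And>z. z \<in> ball 0 1 \<Longrightarrow> \<phi> z = c * (z * disc_aut \<alpha> z)\<^sup>2"
      "deriv \<phi> 0 = 0"
proof -
  have red: "reducing_subspace (mult_op \<phi>) M" and nt: "M \<noteq> {\<lambda>z. 0}" "M \<noteq> dirichlet_space"
    using M by (auto simp: nontrivial_reducing_subspace_def)
  obtain c ls' where ls': "cmod c = 1" "length ls' = 4 - 1" "set ls' \<subseteq> ball 0 1"
    "\<And>z. z \<in> ball 0 1 \<Longrightarrow> \<phi> z = c * (disc_aut 0 z * (\<Prod>l\<leftarrow>ls'. disc_aut l z))"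
  proof (rule finite_blaschke_zero_factor[OF b _ zero])
    fix c ls assume "cmod c = 1" "length ls = 4 - 1" "set ls \<subseteq> ball 0 1"
      "\<And>z. z \<in> ball 0 1 \<Longrightarrow> \<phi> z = c * (disc_aut 0 z * (\<Prod>l\<leftarrow>ls. disc_aut l z))"
    then show thesis by (rule that)
  qed simp
  then obtain w x y where "ls' = [w, x, y]" by (auto simp: length_Suc_conv numeral_eq_Suc)
  then have wxy: "w \<in> ball 0 1" "x \<in> ball 0 1" "y \<in> ball 0 1"
    "\<And>z. z \<in> ball 0 1 \<Longrightarrow> \<phi> z = c * (\<Prod>l\<leftarrow>[0, w, x, y]. disc_aut l z)"
    using ls'(3,4) by simp_all
  have loc: "reducing_blaschke c ls \<phi> M" if ls: "mset ls = {#0, w, x, y#}" for ls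
  proof
    have m: "mset ls = mset [0, w, x, y]" using ls by simp
    show "length ls = 4" using arg_cong[OF m, of size] by simp
    have "set ls = {0, w, x, y}" using arg_cong[OF m, of set_mset] by simp
    then show "set ls \<subseteq> ball 0 1" "0 \<in> set ls" using wxy by auto
    show "\<phi> z = c * (\<Prod>l\<leftarrow>ls. disc_aut l z)" if "z \<in> ball 0 1" for z
      using wxy(4)[OF that] prod_list_map_cong_mset[OF m] by metis
  qed (use ls'(1) red in auto)
  \<comment> \<open>Zeros at the origin are listed first, so that the multiplicity at
    \<open>0\<close> is visible from the first nonzero entry.\<close>
  obtain \<alpha> \<beta> \<delta> where ms: "{#w, x, y#} = {#\<alpha>, \<beta>, \<delta>#}"
    and ord: "\<beta> = 0 \<Longrightarrow> \<alpha> = 0" "\<delta> = 0 \<Longrightarrow> \<beta> = 0"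
  proof -
    have "\<exists>\<alpha> \<beta> \<delta>. {#w, x, y#} = {#\<alpha>, \<beta>, \<delta>#} \<and> (\<beta> = 0 \<longrightarrow> \<alpha> = 0) \<and> (\<delta> = 0 \<longrightarrow> \<beta> = 0)"
    proof (cases "w = 0"; cases "x = 0"; cases "y = 0")
    qed (metis add_mset_commute)+
    then show ?thesis using that by blast
  qed
  interpret reducing_blaschke c "[0, \<alpha>, \<beta>, \<delta>]" \<phi> M
    by (rule loc) (use ms in simp)
  have eq: "\<phi> z = c * (disc_aut 0 z * disc_aut \<alpha> z * disc_aut \<beta> z * disc_aut \<delta> z)" if "z \<in> ball 0 1" for z
    using phi_eq[OF that] by (simp add: mult.assoc)
  have ball: "\<alpha> \<in> ball 0 1" "\<beta> \<in> ball 0 1" "\<delta> \<in> ball 0 1" using ls_ball by auto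
  have a0: "\<alpha> = 0"
  proof (rule ccontr)
    assume a: "\<alpha> \<noteq> 0"
    have "p = [:0, -1:] * smult c ([:\<alpha>, -1:] * [:\<beta>, -1:] * [:\<delta>, -1:])"
      unfolding p_def by (simp add: algebra_simps)
    then have "deriv \<phi> 0 \<noteq> 0" by (rule simple_zero(2)) (use a ord c_nonzero in auto)
    then show False using trivial_of_s_eq_0 s_eq_0_of_simple_zero nt by blast
  qed
  have "p = [:0, 0, 1:] * smult c ([:\<beta>, -1:] * [:\<delta>, -1:])"
    unfolding p_def by (simp add: a0 algebra_simps)
  then have d0: "deriv \<phi> 0 = 0" by (rule multiple_zero)
  consider "\<beta> = 0" "\<delta> \<noteq> 0" | "\<beta> = \<delta>" | "\<beta> \<noteq> 0" "\<beta> \<noteq> \<delta>" by blast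
  then show ?thesis
  proof cases
    case 1
    then show ?thesis using trivial_triple_zero[of \<delta>] a0 nt by simp
  next
    case 2
    then have "\<phi> z = c * (z * disc_aut \<beta> z)\<^sup>2" if "z \<in> ball 0 1" for z
      using eq[OF that] by (simp add: a0 power2_eq_square mult_ac)
    then show ?thesis using square[OF norm_c ball(2) _ d0] by blast
  next
    case 3
    then have \<delta>: "\<delta> \<noteq> 0" using ord(2) by blast
    have ls: "[0, \<alpha>, \<beta>, \<delta>] = [0, 0, \<beta>, \<delta>]" by (simp add: a0)
    have ev: "\<phi> (- z) = \<phi> z" if "z \<in> ball 0 1" for z
      by (rule double_zero_cases(1)[OF ls 3(1) \<delta> 3(2) nt that])
    \<comment> \<open>Evenness makes \<open>- \<beta>\<close> a zero; it is neither \<open>0\<close>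
      nor \<beta>, so it is \<delta>.\<close>
    have "\<phi> (- \<beta>) = 0" using ev[OF ball(2)] eq[OF ball(2)] by simp
    then have "\<delta> = - \<beta>"
      using eq[of "- \<beta>"] ball 3 c_nonzero disc_aut_eq_0_iff[of \<beta> "- \<beta>"] disc_aut_eq_0_iff[of \<delta> "- \<beta>"]
      by (auto simp: a0)
    then have "\<phi> z = c * (z\<^sup>2 * disc_aut \<beta> z * disc_aut (- \<beta>) z)" if "z \<in> ball 0 1" for z
      using eq[OF that] by (simp add: a0 power2_eq_square)
    then show ?thesis
      using even[OF norm_c _ _ double_zero_cases(2)[OF ls 3(1) \<delta> 3(2) nt] d0] ball(2) 3(1) by blast
  qed
qed

lemma coord_space_Int: "coord_space S \<inter> coord_space T = coord_space (S \<inter> T)"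
  by (auto simp: coord_space_def)

text \<open>A rotation is pulled through an automorphism of the disc by rotating its
  parameter.\<close>

lemma blaschke_equiv_cmult_left:
  assumes c: "cmod c = 1" and e: "blaschke_equiv (\<lambda>z. c * f z) g"
  shows "blaschke_equiv f g"
proof -
  obtain l a where la: "l \<in> ball 0 1" "cmod a = 1" "\<And>z. z \<in> ball 0 1 \<Longrightarrow> g z = a * disc_aut l (c * f z)"
    using e by (auto simp: blaschke_equiv_def)
  have cc: "c * cnj c = 1" using c complex_norm_square[of c] by simp
  have "disc_aut l (c * w) = c * disc_aut (cnj c * l) w" for w
  proof -
    have "c * (cnj c * l - w) = l - c * w" using cc by (simp add: right_diff_distrib flip: mult.assoc)
    moreover have "1 - cnj (cnj c * l) * w = 1 - cnj l * (c * w)" by (simp add: mult_ac)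
    ultimately show ?thesis by (simp only: disc_aut_def times_divide_eq_right)
  qed
  then have "g z = (a * c) * disc_aut (cnj c * l) (f z)" if "z \<in> ball 0 1" for z
    using la(3)[OF that] by simp
  moreover have "cnj c * l \<in> ball 0 1" "cmod (a * c) = 1" using la c by (simp_all add: norm_mult)
  ultimately show ?thesis unfolding blaschke_equiv_def by blast
qed

text \<open>The even and the odd functions are always reducing for an even symbol. Any other
  subspace would require the shape \<open>(z * disc_aut \<alpha> z) ^ 2\<close> up to a constant,
  whose zeros are symmetric only for \<open>\<alpha> = 0\<close>, that is for a multiple of
  \<open>z ^ 4\<close>.\<close>

lemma card_minimal_reducing_even:
  assumes b: "finite_blaschke 4 \<phi>" and zero: "\<phi> 0 = 0" and ev: "\<And>z. z \<in> ball 0 1 \<Longrightarrow> \<phi> (- z) = \<phi> z"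
    and not4: "\<And>c. cmod c = 1 \<Longrightarrow> \<not> (\<forall>z\<in>ball 0 1. \<phi> z = c * z ^ 4)"
  shows "card {M. minimal_reducing_subspace (mult_op \<phi>) M} = 2"
proof (rule card_minimal_reducing_two)
  note m = finite_blaschke_multiplier[OF b]
  have nt: "nontrivial_reducing_subspace (mult_op \<phi>) (coord_space {n. even n \<longleftrightarrow> b})" for b
  proof -
    have "(if b then 1 else 0) \<notin> {n::nat. even n \<longleftrightarrow> b}" "(if b then 0 else 1) \<in> {n::nat. even n \<longleftrightarrow> b}" by auto
    then have "{n. even n \<longleftrightarrow> b} \<noteq> (UNIV :: nat set)" "{n. even n \<longleftrightarrow> b} \<noteq> ({} :: nat set)" by blast+
    then have "coord_space {n. even n \<longleftrightarrow> b} \<noteq> {\<lambda>z. 0}" "coord_space {n. even n \<longleftrightarrow> b} \<noteq> dirichlet_space"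
      unfolding coord_space_empty[symmetric] coord_space_UNIV[symmetric] coord_space_eq_iff by blast+
    then show ?thesis
      using reducing_subspace_even_coord_space[OF m ev] by (simp add: nontrivial_reducing_subspace_def)
  qed
  show "nontrivial_reducing_subspace (mult_op \<phi>) (coord_space {n. even n \<longleftrightarrow> True})"
    "nontrivial_reducing_subspace (mult_op \<phi>) (coord_space {n. even n \<longleftrightarrow> False})" by (rule nt)+
  have "{n. even n \<longleftrightarrow> True} \<inter> {n. even n \<longleftrightarrow> False} = ({} :: nat set)" by auto
  then show "coord_space {n. even n \<longleftrightarrow> True} \<inter> coord_space {n. even n \<longleftrightarrow> False} = {\<lambda>z. 0}"
    unfolding coord_space_Int by (simp only: coord_space_empty)
  fix M assume "nontrivial_reducing_subspace (mult_op \<phi>) M"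
  then show "M = coord_space {n. even n \<longleftrightarrow> True} \<or> M = coord_space {n. even n \<longleftrightarrow> False}"
  proof (cases rule: nontrivial_reducing_cases[OF b zero, consumes 1, case_names even square])
    case (even c \<alpha>)
    then obtain b where "M = coord_space {n. even n \<longleftrightarrow> b}" by blast
    then show ?thesis by (cases b) simp_all
  next
    case (square c \<alpha>)
    have c0: "c \<noteq> 0" using square(1) by auto
    have "\<alpha> = 0"
    proof (rule ccontr)
      assume a: "\<alpha> \<noteq> 0"
      have "\<phi> (- \<alpha>) = 0" using ev[OF square(2)] square(3)[OF square(2)] by simp
      then have "disc_aut \<alpha> (- \<alpha>) = 0" using square(3)[of "- \<alpha>"] square(2) c0 a by simp
      then show False using disc_aut_eq_0_iff[OF square(2), of "- \<alpha>"] square(2) a by simp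
    qed
    then have "\<forall>z\<in>ball 0 1. \<phi> z = c * z ^ 4" using square(3) by (simp add: numeral_eq_Suc mult_ac)
    then show ?thesis using not4[OF square(1)] by blast
  qed
qed

lemma blaschke_equiv_square_even:
  assumes "blaschke_equiv (\<lambda>z. z\<^sup>2) \<psi>" "z \<in> ball 0 1" shows "\<psi> (- z) = \<psi> z"
  using assms by (auto simp: blaschke_equiv_def)

theorem theorem1p3:
  fixes \<phi> :: "complex \<Rightarrow> complex"
  assumes "finite_blaschke 4 \<phi>"
  shows
    "(blaschke_equiv (\<lambda>z. z ^ 4) \<phi>
      \<or> (\<exists>\<psi>\<^sub>1 \<psi>\<^sub>2. blaschke_decomposition \<phi> \<psi>\<^sub>1 \<psi>\<^sub>2 \<and> blaschke_equiv (\<lambda>z. z ^ 2) \<psi>\<^sub>2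
            \<and> \<not> blaschke_equiv (\<lambda>z. z ^ 4) \<phi>)
      \<or> (\<exists>\<psi>\<^sub>1 \<psi>\<^sub>2. blaschke_decomposition \<phi> \<psi>\<^sub>1 \<psi>\<^sub>2
            \<and> (\<exists>\<gamma>\<in>ball 0 1 - {0}. blaschke_equiv (\<lambda>z. (z * disc_aut \<gamma> z) ^ 2) \<phi>))
      \<or> (\<exists>\<psi>\<^sub>1 \<psi>\<^sub>2. blaschke_decomposition \<phi> \<psi>\<^sub>1 \<psi>\<^sub>2 \<and> \<not> blaschke_equiv (\<lambda>z. z ^ 2) \<psi>\<^sub>2
            \<and> \<not> (\<exists>\<gamma>\<in>ball 0 1 - {0}. blaschke_equiv (\<lambda>z. (z * disc_aut \<gamma> z) ^ 2) \<phi>))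
      \<or> \<not> decomposable \<phi>)
     \<and> (blaschke_equiv (\<lambda>z. z ^ 4) \<phi>
          \<longrightarrow> card {M. minimal_reducing_subspace (mult_op \<phi>) M} = 4)
     \<and> (\<forall>\<psi>\<^sub>1 \<psi>\<^sub>2. blaschke_decomposition \<phi> \<psi>\<^sub>1 \<psi>\<^sub>2 \<and> blaschke_equiv (\<lambda>z. z ^ 2) \<psi>\<^sub>2
            \<and> \<not> blaschke_equiv (\<lambda>z. z ^ 4) \<phi>
          \<longrightarrow> card {M. minimal_reducing_subspace (mult_op \<phi>) M} = 2)
     \<and> (\<forall>\<psi>\<^sub>1 \<psi>\<^sub>2. blaschke_decomposition \<phi> \<psi>\<^sub>1 \<psi>\<^sub>2
            \<and> (\<exists>\<gamma>\<in>ball 0 1 - {0}. blaschke_equiv (\<lambda>z. (z * disc_aut \<gamma> z) ^ 2) \<phi>)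
          \<longrightarrow> card {M. minimal_reducing_subspace (mult_op \<phi>) M} = 2)
     \<and> (\<forall>\<psi>\<^sub>1 \<psi>\<^sub>2. blaschke_decomposition \<phi> \<psi>\<^sub>1 \<psi>\<^sub>2 \<and> \<not> blaschke_equiv (\<lambda>z. z ^ 2) \<psi>\<^sub>2
            \<and> \<not> (\<exists>\<gamma>\<in>ball 0 1 - {0}. blaschke_equiv (\<lambda>z. (z * disc_aut \<gamma> z) ^ 2) \<phi>)
          \<longrightarrow> \<not> reducible (mult_op \<phi>))
     \<and> (\<not> decomposable \<phi> \<longrightarrow> \<not> reducible (mult_op \<phi>))"
proof -
  note m = finite_blaschke_multiplier[OF assms]
  note le = finite_blaschke_norm_le[OF assms]
  obtain \<phi>\<^sub>0 where equiv: "blaschke_equiv \<phi> \<phi>\<^sub>0" and \<phi>\<^sub>0: "finite_blaschke 4 \<phi>\<^sub>0" "\<phi>\<^sub>0 0 = 0"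
    using blaschke_equiv_normalize[OF assms] by metis
  have equiv': "blaschke_equiv \<phi>\<^sub>0 \<phi>" by (rule blaschke_equiv_sym[OF equiv le])
  note red = reducing_subspace_blaschke_equiv[OF m equiv le]
  note cong = reducing_cong[OF red]
  have i: "card {M. minimal_reducing_subspace (mult_op \<phi>) M} = 4" if "blaschke_equiv (\<lambda>z. z ^ 4) \<phi>"
  proof -
    have "cmod (z ^ 4) \<le> 1" if "z \<in> ball 0 1" for z :: complex
      using that by (simp add: norm_power power_le_one)
    from reducing_cong(2)[OF reducing_subspace_blaschke_equiv[OF disc_multiplier_power that this]]
    show ?thesis using card_minimal_reducing_power[of 4] by simp
  qed
  \<comment> \<open>Evenness passes from \<open>\<psi>\<^sub>2\<close> to \<phi> and on to the
    normalised symbol, to which the count applies; a multiple of \<open>z ^ 4\<close> there would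
    make \<phi> itself equivalent to \<open>z ^ 4\<close>.\<close>
  have ii: "card {M. minimal_reducing_subspace (mult_op \<phi>) M} = 2"
    if dec: "blaschke_decomposition \<phi> \<psi>\<^sub>1 \<psi>\<^sub>2" and \<psi>\<^sub>2: "blaschke_equiv (\<lambda>z. z ^ 2) \<psi>\<^sub>2"
      and not4: "\<not> blaschke_equiv (\<lambda>z. z ^ 4) \<phi>" for \<psi>\<^sub>1 \<psi>\<^sub>2
  proof (rule trans[OF cong(2) card_minimal_reducing_even[OF \<phi>\<^sub>0]])
    fix z :: complex assume z: "z \<in> ball 0 1"
    then have "\<phi> (- z) = \<phi> z"
      using dec blaschke_equiv_square_even[OF \<psi>\<^sub>2 z] by (simp add: blaschke_decomposition_def)
    then show "\<phi>\<^sub>0 (- z) = \<phi>\<^sub>0 z" using equiv z by (auto simp: blaschke_equiv_def)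
  next
    fix c :: complex assume c: "cmod c = 1"
    show "\<not> (\<forall>z\<in>ball 0 1. \<phi>\<^sub>0 z = c * z ^ 4)"
    proof
      assume "\<forall>z\<in>ball 0 1. \<phi>\<^sub>0 z = c * z ^ 4"
      then have "blaschke_equiv (\<lambda>z. c * z ^ 4) \<phi>" using equiv' by (simp add: blaschke_equiv_def)
      then have "blaschke_equiv (\<lambda>z. z ^ 4) \<phi>" by (rule blaschke_equiv_cmult_left[OF c])
      then show False using not4 by blast
    qed
  qed
  have iii: "card {M. minimal_reducing_subspace (mult_op \<phi>) M} = 2"
    if \<gamma>: "\<gamma> \<in> ball 0 1 - {0}" and e: "blaschke_equiv (\<lambda>z. (z * disc_aut \<gamma> z) ^ 2) \<phi>" for \<gamma>
  proof -
    have "finite_blaschke 4 (\<lambda>z. (z * disc_aut \<gamma> z)\<^sup>2)"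
      by (rule finite_blaschkeI[of 4 1 "[0, 0, \<gamma>, \<gamma>]"]) (use \<gamma> in \<open>auto simp: power2_eq_square\<close>)
    from reducing_cong(2)[OF reducing_subspace_blaschke_equiv[OF finite_blaschke_multiplier[OF this] e
          finite_blaschke_norm_le[OF this]]]
    show ?thesis using card_minimal_reducing_square[OF \<gamma>] by simp
  qed
  have iv: "\<not> reducible (mult_op \<phi>)"
    if dec: "blaschke_decomposition \<phi> \<psi>\<^sub>1 \<psi>\<^sub>2" and \<psi>\<^sub>2: "\<not> blaschke_equiv (\<lambda>z. z ^ 2) \<psi>\<^sub>2"
      and sq: "\<not> (\<exists>\<gamma>\<in>ball 0 1 - {0}. blaschke_equiv (\<lambda>z. (z * disc_aut \<gamma> z) ^ 2) \<phi>)" for \<psi>\<^sub>1 \<psi>\<^sub>2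
  proof
    assume "reducible (mult_op \<phi>)"
    then have "reducible (mult_op \<phi>\<^sub>0)" using cong(1) by simp
    then obtain M where "nontrivial_reducing_subspace (mult_op \<phi>\<^sub>0) M" unfolding reducible_def by blast
    \<comment> \<open>Reducibility makes \<open>0\<close> a critical point, and a decomposition of a
      symbol critical at \<open>0\<close> has one of the two excluded shapes.\<close>
    then have "deriv \<phi>\<^sub>0 0 = 0" by (cases rule: nontrivial_reducing_cases[OF \<phi>\<^sub>0, consumes 1, case_names even square]) auto
    then have "deriv \<phi> 0 = 0"
      by (intro blaschke_equiv_deriv[OF m equiv]) (use finite_blaschke_in_ball[OF assms, of 0] in auto)
    then show False using decomposition_critical_at_0[OF assms dec] \<psi>\<^sub>2 sq by blast
  qed
  have v: "decomposable \<phi>" if "reducible (mult_op \<phi>)"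
  proof -
    have "reducible (mult_op \<phi>\<^sub>0)" using that cong(1) by simp
    then obtain M where "nontrivial_reducing_subspace (mult_op \<phi>\<^sub>0) M" unfolding reducible_def by blast
    then have "decomposable \<phi>\<^sub>0"
    proof (cases rule: nontrivial_reducing_cases[OF \<phi>\<^sub>0, consumes 1, case_names even square])
      case (even c \<alpha>)
      then show ?thesis by (intro decomposable_even[of c \<alpha>]) auto
    next
      case (square c \<alpha>)
      then show ?thesis by (intro decomposable_square[of c \<alpha>]) auto
    qed
    then show ?thesis by (rule decomposable_blaschke_equiv[OF equiv'])
  qed
  show ?thesis
  proof (intro conjI allI impI)
    show "blaschke_equiv (\<lambda>z. z ^ 4) \<phi>
      \<or> (\<exists>\<psi>\<^sub>1 \<psi>\<^sub>2. blaschke_decomposition \<phi> \<psi>\<^sub>1 \<psi>\<^sub>2 \<and> blaschke_equiv (\<lambda>z. z ^ 2) \<psi>\<^sub>2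
            \<and> \<not> blaschke_equiv (\<lambda>z. z ^ 4) \<phi>)
      \<or> (\<exists>\<psi>\<^sub>1 \<psi>\<^sub>2. blaschke_decomposition \<phi> \<psi>\<^sub>1 \<psi>\<^sub>2
            \<and> (\<exists>\<gamma>\<in>ball 0 1 - {0}. blaschke_equiv (\<lambda>z. (z * disc_aut \<gamma> z) ^ 2) \<phi>))
      \<or> (\<exists>\<psi>\<^sub>1 \<psi>\<^sub>2. blaschke_decomposition \<phi> \<psi>\<^sub>1 \<psi>\<^sub>2 \<and> \<not> blaschke_equiv (\<lambda>z. z ^ 2) \<psi>\<^sub>2
            \<and> \<not> (\<exists>\<gamma>\<in>ball 0 1 - {0}. blaschke_equiv (\<lambda>z. (z * disc_aut \<gamma> z) ^ 2) \<phi>))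
      \<or> \<not> decomposable \<phi>"
      \<comment> \<open>For any decomposition: if \<phi> is equivalent to one of the squares, the
        third case applies; otherwise \<open>\<psi>\<^sub>2\<close> decides between the first two
        cases and the fourth.\<close>
      unfolding decomposable_def by metis
  qed (use i ii iii iv v in blast)+
qed

end
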